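(* Let $\Omega\subset\mathbb{R}^n$ be a nonempty open set and suppose that $u$ is $(s,p)$-superharmonic in $\Omega$. Then $u$ has the following properties. (i) (Pointwise behavior) $u(x)=\liminf_{y\to x}u(y)=\operatorname{ess\,lim\,inf}_{y\to x}u(y)$ for every $x\in\Omega$. (ii) (Summability) Let $\bar t:=\frac{(p-1)n}{n-sp}$ if $1<p<\frac ns$ and $\bar t:=+\infty$ if $p\ge\frac ns$, and let $\bar q:=\min\left\{\frac{n(p-1)}{n-s},p\right\}$. Then for every $h\in(0,s)$, $t\in(0,\bar t)$ and $q\in(0,\bar q)$ one has $u\in W^{h,q}_{\rm loc}(\Omega)\cap L^t_{\rm loc}(\Omega)\cap L^{p-1}_{sp}(\mathbb{R}^n)$. (iii) (Unbounded comparison) If $D\Subset\Omega$ is an open set and $v\in C(\overline D)$ is a weak solution in $D$ such that $u\ge v$ on $\partial D$ and almost everywhere on $\mathbb{R}^n\setminus D$, then $u\ge v$ in $D$. (iv) (Connection to weak supersolutions) If $u$ is locally bounded in $\Omega$ or $u\in W^{s,p}_{\rm loc}(\Omega)$, then $u$ is a weak supersolution in $\Omega$.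
   Context: Standing assumptions: $n\ge1$ is an integer, $s\in(0,1)$, $p\in(1,\infty)$, $\Lambda\ge1$, and $K:\mathbb{R}^n\times\mathbb{R}^n\to[0,\infty)$ is a measurable symmetric kernel ($K(x,y)=K(y,x)$) with $\Lambda^{-1}\le K(x,y)|x-y|^{n+sp}\le\Lambda$ for a.e. $x,y\in\mathbb{R}^n$. Functions are measurable; $D\Subset\Omega$ means that $\overline D$ is a compact subset of $\Omega$; $u_\pm:=\max\{\pm u,0\}$. For $h\in(0,1)$ and $q>0$, $W^{h,q}(U)$ consists of $v\in L^q(U)$ with $\int_U\int_U\frac{|v(x)-v(y)|^q}{|x-y|^{n+hq}}\,dx\,dy<\infty$; $v\in W^{h,q}_{\rm loc}(\Omega)$ means $v\in W^{h,q}(D)$ for every open $D\Subset\Omega$. The tail space is $L^{p-1}_{sp}(\mathbb{R}^n):=\{f\in L^{p-1}_{\rm loc}(\mathbb{R}^n):\int_{\mathbb{R}^n}|f(x)|^{p-1}(1+|x|)^{-n-sp}\,dx<\infty\}$. Also $\operatorname{ess\,lim\,inf}_{y\to x}u(y)=\lim_{r\to0}\operatorname{ess\,inf}_{B_r(x)}u$. A weak supersolution in an open set $\Omega$ is a function $u$ on $\mathbb{R}^n$ with $u\in W^{s,p}_{\rm loc}(\Omega)$, $u_-\in L^{p-1}_{sp}(\mathbb{R}^n)$, and $$\int_{\mathbb{R}^n}\int_{\mathbb{R}^n}|u(x)-u(y)|^{p-2}(u(x)-u(y))(\eta(x)-\eta(y))K(x,y)\,dx\,dy\ge0$$ for every nonnegative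 $\eta\in C_0^\infty(\Omega)$. $u$ is a weak subsolution if $-u$ is a weak supersolution, and a weak solution if it is both. "$v\in C(\overline D)$ is a weak solution in $D$" means that $v$, defined on $\mathbb{R}^n$, is a weak solution in $D$ whose restriction to $\overline D$ is continuous (and finite). A function $u:\mathbb{R}^n\to[-\infty,\infty]$ is $(s,p)$-superharmonic in an open set $\Omega$ if: (a) $u<+\infty$ almost everywhere in $\Omega$ and $u>-\infty$ everywhere in $\Omega$; (b) $u$ is lower semicontinuous in $\Omega$; (c) if $D\Subset\Omega$ is open and $v\in C(\overline D)$ is a weak solution in $D$ such that $v_+\in L^\infty(\mathbb{R}^n)$ and $u\ge v$ on $\partial D$ and almost everywhere on $\mathbb{R}^n\setminus D$, then $u\ge v$ in $D$; (d) $u_-\in L^{p-1}_{sp}(\mathbb{R}^n)$. *)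

theory Defs
  imports "HOL-Analysis.Analysis"
begin

text \<open>
  The space \<open>\<real>\<^sup>n\<close> is a type \<open>'a\<close> of class \<open>euclidean_space\<close>, with \<open>n = DIM('a)\<close>.  ``Measurable'' and
  ``almost everywhere'' refer to Lebesgue measure; double integrals are integrals with respect to
  Lebesgue measure on \<open>'a \<times> 'a\<close>.  All functions \<open>u\<close>, \<open>v\<close> are extended-real valued.
\<close>

definition compactly_contained :: "'a::topological_space set \<Rightarrow> 'a set \<Rightarrow> bool" (infix \<open>\<Subset>\<close> 50)
  where "D \<Subset> \<Omega> \<longleftrightarrow> compact (closure D) \<and> closure D \<subseteq> \<Omega>"

definition pos_part :: "('a \<Rightarrow> ereal) \<Rightarrow> 'a \<Rightarrow> ereal"
  where "pos_part u x = max (u x) 0"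

definition neg_part :: "('a \<Rightarrow> ereal) \<Rightarrow> 'a \<Rightarrow> ereal"
  where "neg_part u x = max (- u x) 0"

text \<open>\<open>|a|\<^sup>q\<close> for \<open>q > 0\<close>, with value \<open>\<infinity>\<close> at \<open>a = \<plusminus>\<infinity>\<close>; so finite integrals force finiteness a.e.\<close>

definition abs_powr :: "ereal \<Rightarrow> real \<Rightarrow> ennreal"
  where "abs_powr a q = (if \<bar>a\<bar> = \<infinity> then \<infinity> else ennreal (\<bar>real_of_ereal a\<bar> powr q))"

definition Lq :: "real \<Rightarrow> 'a::euclidean_space set \<Rightarrow> ('a \<Rightarrow> ereal) set"
  where "Lq q U = {v. v \<in> borel_measurable (lebesgue_on U) \<and>
                      (\<integral>\<^sup>+x\<in>U. abs_powr (v x) q \<partial>lebesgue) < \<infinity>}"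

definition Lq_loc :: "real \<Rightarrow> 'a::euclidean_space set \<Rightarrow> ('a \<Rightarrow> ereal) set"
  where "Lq_loc q \<Omega> = {v. \<forall>D. open D \<and> D \<Subset> \<Omega> \<longrightarrow> v \<in> Lq q D}"

definition W :: "real \<Rightarrow> real \<Rightarrow> 'a::euclidean_space set \<Rightarrow> ('a \<Rightarrow> ereal) set"
  where "W h q U = {v. v \<in> Lq q U \<and>
     (\<integral>\<^sup>+z\<in>U \<times> U. (case z of (x, y) \<Rightarrow>
         abs_powr (v x - v y) q / ennreal (norm (x - y) powr (real DIM('a) + h * q)))
       \<partial>(lebesgue :: ('a \<times> 'a) measure)) < \<infinity>}"

definition W_loc :: "real \<Rightarrow> real \<Rightarrow> 'a::euclidean_space set \<Rightarrow> ('a \<Rightarrow> ereal) set"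
  where "W_loc h q \<Omega> = {v. \<forall>D. open D \<and> D \<Subset> \<Omega> \<longrightarrow> v \<in> W h q D}"

definition tail_space :: "real \<Rightarrow> real \<Rightarrow> ('a::euclidean_space \<Rightarrow> ereal) set"
  where "tail_space s p = {f. f \<in> Lq_loc (p - 1) UNIV \<and>
     (\<integral>\<^sup>+x. abs_powr (f x) (p - 1) * ennreal ((1 + norm x) powr (- real DIM('a) - s * p))
       \<partial>lebesgue) < \<infinity>}"

definition Linf :: "('a::euclidean_space \<Rightarrow> ereal) set"
  where "Linf = {f. f \<in> borel_measurable lebesgue \<and> (\<exists>M::real. AE x in lebesgue. \<bar>f x\<bar> \<le> ereal M)}"

definition locally_bounded :: "'a::euclidean_space set \<Rightarrow> ('a \<Rightarrow> ereal) \<Rightarrow> bool"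
  where "locally_bounded \<Omega> u \<longleftrightarrow>
     (\<forall>D. open D \<and> D \<Subset> \<Omega> \<longrightarrow> (\<exists>M::real. \<forall>x\<in>D. \<bar>u x\<bar> \<le> ereal M))"

text \<open>\<open>C\<^sup>k\<close> via iterated partial derivatives.\<close>

primrec Ck :: "nat \<Rightarrow> ('a::euclidean_space \<Rightarrow> real) \<Rightarrow> bool"
  where
    "Ck 0 f \<longleftrightarrow> continuous_on UNIV f"
  | "Ck (Suc k) f \<longleftrightarrow> f differentiable_on UNIV \<and>
       (\<forall>b\<in>Basis. Ck k (\<lambda>x. frechet_derivative f (at x) b))"

definition test_functions :: "'a::euclidean_space set \<Rightarrow> ('a \<Rightarrow> real) set"
  where "test_functions \<Omega> = {\<eta>. (\<forall>k. Ck k \<eta>) \<and> {x. \<eta> x \<noteq> 0} \<Subset> \<Omega>}"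

definition elliptic_kernel :: "real \<Rightarrow> real \<Rightarrow> real \<Rightarrow> ('a::euclidean_space \<Rightarrow> 'a \<Rightarrow> real) \<Rightarrow> bool"
  where "elliptic_kernel s p \<Lambda> K \<longleftrightarrow>
     (\<lambda>(x, y). K x y) \<in> borel_measurable (lebesgue :: ('a \<times> 'a) measure) \<and>
     (\<forall>x y. 0 \<le> K x y) \<and> (\<forall>x y. K x y = K y x) \<and>
     (AE (x, y) in (lebesgue :: ('a \<times> 'a) measure).
        inverse \<Lambda> \<le> K x y * norm (x - y) powr (real DIM('a) + s * p) \<and>
        K x y * norm (x - y) powr (real DIM('a) + s * p) \<le> \<Lambda>)"

text \<open>At \<open>u x = u y\<close> the value is \<open>0\<close> also for \<open>p < 2\<close>.\<close>

definition weak_integrand ::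
  "real \<Rightarrow> ('a::euclidean_space \<Rightarrow> 'a \<Rightarrow> real) \<Rightarrow> ('a \<Rightarrow> real) \<Rightarrow> ('a \<Rightarrow> real) \<Rightarrow> 'a \<times> 'a \<Rightarrow> real"
  where "weak_integrand p K u \<eta> = (\<lambda>(x, y).
     \<bar>u x - u y\<bar> powr (p - 2) * (u x - u y) * (\<eta> x - \<eta> y) * K x y)"

text \<open>
  The differences in the integral are meaningful only if \<open>u\<close> is finite a.e.; on the remaining null
  set the value of \<open>real_of_ereal\<close> is irrelevant.  Integrability has to be required because the Bochner integral
  of a nonintegrable function is \<open>0\<close>.  It loses nothing: by \<open>u \<in> W_loc s p \<Omega>\<close> and
  \<open>neg_part u \<in> tail_space s p\<close> the positive part of the integrand always has a finite integral, so
  the integral exists in \<open>[-\<infinity>, \<infinity>)\<close>, and being \<open>\<ge> 0\<close> forces it to be finite.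
\<close>

definition weak_supersolution ::
  "real \<Rightarrow> real \<Rightarrow> ('a::euclidean_space \<Rightarrow> 'a \<Rightarrow> real) \<Rightarrow> 'a set \<Rightarrow> ('a \<Rightarrow> ereal) \<Rightarrow> bool"
  where "weak_supersolution s p K \<Omega> u \<longleftrightarrow>
     u \<in> borel_measurable lebesgue \<and> (AE x in lebesgue. \<bar>u x\<bar> \<noteq> \<infinity>) \<and>
     u \<in> W_loc s p \<Omega> \<and> neg_part u \<in> tail_space s p \<and>
     (\<forall>\<eta>\<in>test_functions \<Omega>. (\<forall>x. 0 \<le> \<eta> x) \<longrightarrow>
        integrable lebesgue (weak_integrand p K (\<lambda>x. real_of_ereal (u x)) \<eta>) \<and>
        0 \<le> integral\<^sup>L lebesgue (weak_integrand p K (\<lambda>x. real_of_ereal (u x)) \<eta>))"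

definition weak_subsolution ::
  "real \<Rightarrow> real \<Rightarrow> ('a::euclidean_space \<Rightarrow> 'a \<Rightarrow> real) \<Rightarrow> 'a set \<Rightarrow> ('a \<Rightarrow> ereal) \<Rightarrow> bool"
  where "weak_subsolution s p K \<Omega> u \<longleftrightarrow> weak_supersolution s p K \<Omega> (\<lambda>x. - u x)"

definition weak_solution ::
  "real \<Rightarrow> real \<Rightarrow> ('a::euclidean_space \<Rightarrow> 'a \<Rightarrow> real) \<Rightarrow> 'a set \<Rightarrow> ('a \<Rightarrow> ereal) \<Rightarrow> bool"
  where "weak_solution s p K \<Omega> u \<longleftrightarrow>
     weak_supersolution s p K \<Omega> u \<and> weak_subsolution s p K \<Omega> u"

definition continuous_weak_solution ::
  "real \<Rightarrow> real \<Rightarrow> ('a::euclidean_space \<Rightarrow> 'a \<Rightarrow> real) \<Rightarrow> 'a set \<Rightarrow> ('a \<Rightarrow> ereal) \<Rightarrow> bool"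
  where "continuous_weak_solution s p K D v \<longleftrightarrow>
     weak_solution s p K D v \<and> continuous_on (closure D) v \<and> (\<forall>x\<in>closure D. \<bar>v x\<bar> \<noteq> \<infinity>)"

definition lower_semicontinuous_on :: "'a::topological_space set \<Rightarrow> ('a \<Rightarrow> ereal) \<Rightarrow> bool"
  where "lower_semicontinuous_on S u \<longleftrightarrow> (\<forall>c. openin (top_of_set S) {x\<in>S. c < u x})"

definition superharmonic ::
  "real \<Rightarrow> real \<Rightarrow> ('a::euclidean_space \<Rightarrow> 'a \<Rightarrow> real) \<Rightarrow> 'a set \<Rightarrow> ('a \<Rightarrow> ereal) \<Rightarrow> bool"
  where "superharmonic s p K \<Omega> u \<longleftrightarrow>
     u \<in> borel_measurable lebesgue \<and>
     (AE x in lebesgue. x \<in> \<Omega> \<longrightarrow> u x < \<infinity>) \<and> (\<forall>x\<in>\<Omega>. - \<infinity> < u x) \<and>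
     lower_semicontinuous_on \<Omega> u \<and>
     (\<forall>D v. open D \<and> D \<Subset> \<Omega> \<and> continuous_weak_solution s p K D v \<and> pos_part v \<in> Linf \<and>
        (\<forall>x\<in>frontier D. v x \<le> u x) \<and> (AE x in lebesgue. x \<notin> D \<longrightarrow> v x \<le> u x) \<longrightarrow>
        (\<forall>x\<in>D. v x \<le> u x)) \<and>
     neg_part u \<in> tail_space s p"

definition ess_inf_on :: "'a::euclidean_space set \<Rightarrow> ('a \<Rightarrow> ereal) \<Rightarrow> ereal"
  where "ess_inf_on A u = Liminf (ae_filter (lebesgue_on A)) u"

text \<open>The limit exists, since the essential infimum over \<open>ball x r\<close> is antimonotone in \<open>r\<close>.\<close>

definition ess_lim_inf :: "('a::euclidean_space \<Rightarrow> ereal) \<Rightarrow> 'a \<Rightarrow> ereal"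
  where "ess_lim_inf u x = Lim (at_right 0) (\<lambda>r. ess_inf_on (ball x r) u)"

end

theory Submission
 imports Defs
begin

text \<open>A superharmonic function is given by comparison alone: it comes with no energy and no
  equation. Both are obtained from an approximation of \<open>u\<close> from below by solutions of
  obstacle problems.

  Fix a compact \<open>C\<close> in \<open>Om\<close> and open sets \<open>D\<close>,
  \<open>D0\<close> around it, with the closure of \<open>D\<close> in \<open>D0\<close> and the
  closure of \<open>D0\<close> in \<open>Om\<close>, such that \<open>D\<close> satisfies an
  exterior density condition (\<open>exterior_ball_neighbourhood\<close>). Let the obstacle
  \<open>g\<close> be a j-Lipschitz minorant of min(u, ka) on \<open>D0\<close>, obtained by
  inf-convolution, and min(u, ka) elsewhere. Among the functions above \<open>g\<close> that equal
  \<open>g\<close> off \<open>D\<close> there is an energy minimiser \<open>w\<close>. The energy is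
  submodular under maximum and minimum, so an upper limit of a minimising sequence minimises and
  weak compactness is avoided (\<open>minimiser_exists\<close>). The minimiser satisfies a
  variational inequality (\<open>obstacle_solution\<close>): it is a supersolution in
  \<open>D\<close>, and a solution where it lies above \<open>g\<close>. De Giorgi estimates
  (\<open>energy_estimate\<close>, \<open>de_giorgi_small_measure\<close>,
  \<open>de_giorgi_growth\<close>) give it a continuous version in \<open>D\<close> whose upper
  limits at the frontier of \<open>D\<close> are at most \<open>g\<close> (\<open>esup_eq\<close>,
  \<open>wc_boundary\<close>). Hence, for e > 0, the set E where w > g + e has its closure in
  \<open>D\<close>; there w - e is a continuous weak solution that is bounded above, and off E one
  has w - e <= g <= u. Comparison gives w - e <= u, and so g <= w <= u
  (\<open>superharmonic_comparison\<close>). By lower semicontinuity \<open>g\<close>, and with it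
  \<open>w\<close>, tends to min(u, ka) as j grows (\<open>approximants\<close>).

  The De Giorgi argument uses neither a Sobolev nor an isoperimetric inequality. A set that fills at
  most half of a ball sees, from the centre, a definite kernel mass outside itself
  (\<open>kernel_integral_off_set\<close>); and the energy estimate keeps the interaction of the
  points above the barrier with those below it, which bounds the upper level set directly.

  The assertions then follow from the approximants. Tail: the far part of the energy estimate for (2
  m - w)_+, on a set of positive measure where u < m, bounds the tail of w_+ uniformly, and Fatou's
  lemma passes to \<open>u\<close> (\<open>positive_tail_finite\<close>,
  \<open>u_finite_AE\<close>). Truncations: for fixed ka the energies are bounded uniformly in j, so
  min(u, ka) is a supersolution of locally finite energy (\<open>trunc_supersolution\<close>).

  (i) If u >= c almost everywhere near x0, the approximants are almost c except on a set of small
  measure, and De Giorgi's lemma lifts them at x0; as they lie below \<open>u\<close>, also u x0 >=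
  c (\<open>lower_bound_AE_imp_pointwise\<close>).

  (ii) Testing the truncations with a negative power of u + c bounds the energy of \<open>u\<close>
  with the weight (u + c)^(-1-e) (\<open>weighted_energy\<close>). Truncating between L and 2 L
  turns this into a recursion for the exponent in the decay of the measure of {u >= L}; it is
  iterated up to any exponent below the critical one (\<open>decay_step\<close>,
  \<open>decay_below\<close>). Interpolation between the weighted energy and an integrable power of
  \<open>u\<close> gives the fractional seminorm (\<open>fractional_seminorm_finite\<close>).

  (iii) A solution \<open>v\<close> is compared with the approximants instead of with
  \<open>u\<close>: the positive part of v - e - w has compact support in \<open>D\<close> and is a
  test function for both equations. Fatou's lemma and strict monotonicity give v - e <= u almost
  everywhere (\<open>unbounded_comparison_AE\<close>), and (i) makes this hold everywhere.

  (iv) If \<open>u\<close> is locally bounded it agrees locally with a truncation; if its energy is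
  locally finite, the truncation level tends to infinity (\<open>u_supersolution\<close>).

  Internally all functions and the kernel are Borel representatives; the last parts translate from
  and to the Lebesgue measurable data of the definitions.\<close>

abbreviation (input) NLint :: "('a::euclidean_space => ennreal) => ennreal" (binder "NL " 10)
  where "NLint f == nn_integral lborel f"

abbreviation (input) AEL :: "('a::euclidean_space => bool) => bool" (binder "AL " 10)
  where "AEL P == eventually P (ae_filter lborel)"

abbreviation (input) lims :: "(nat => 'a::topological_space) => 'a => bool" (infixr "~>" 60)
  where "f ~> l == (f \<longlongrightarrow> l) sequentially"

abbreviation "Bor == borel_measurable borel"
abbreviation "em == emeasure lborel"
abbreviation "en == ennreal"
abbreviation "ind == indicator"

abbreviation (input) apow :: "real => real => real" (infixr "|^" 80)
 where "x |^ y == \<bar>x\<bar> powr y"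

abbreviation "ms == measure lborel"
abbreviation "infy == \<infinity>"

section \<open>The nonlinearity |t|^(p-2) t and elementary inequalities for powers\<close>

definition jp :: "real => real => real"
 where "jp p t = sgn t*t |^ (p-1)"

lemma jp_eq: "t |^ (p-2)*t = jp p t"
proof(cases "t = 0")
 case False
 have "t |^ (p-1) = t |^ (p-2)*t |^ 1"
  by(subst powr_add[symmetric]) simp
 hence "t |^ (p-1) = t |^ (p-2)*abs t"
  using False by simp
 thus ?thesis
  by(simp add:jp_def sgn_mult_abs mult.commute mult.left_commute abs_sgn_eq sgn_if)
qed (simp add:jp_def)

lemma jp_0 [simp]: "jp p 0 = 0"
 by(simp add:jp_def)

lemma jp_minus [simp]: "jp p (- t) = - jp p t"
 by(simp add:jp_def sgn_if)

lemma jp_minus_commute: "jp p (a-b) = - jp p (b-a)"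
 using jp_minus[of p "b-a"] by simp

lemma abs_jp: "abs (jp p t) = t |^ (p-1)"
 by(simp add:jp_def abs_mult abs_sgn_eq)

lemma jp_nonneg: "0 <= t ==> jp p t = t powr (p-1)"
 by(simp add:jp_def sgn_if)

lemma jp_nonpos: "t <= 0 ==> jp p t = - ((- t) powr (p-1))"
 using jp_nonneg[of "- t" p] by simp

lemma jp_mult_self: "jp p t*t = t |^ p"
proof(cases "t = 0")
 case False
 have "t |^ p = t |^ (p-1)*t |^ 1"
  by(subst powr_add[symmetric]) simp
 thus ?thesis
  using False by(auto simp:jp_def sgn_if)
qed simp

lemma jp_mono:
 assumes "1 < p" and "a <= b"
 shows "jp p a <= jp p b"
proof -
 consider "0 <= a" | "a < 0" "0 <= b" | "b < 0" using assms by linarith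
 thus ?thesis
 proof cases
  case 1
  thus ?thesis
   using assms by(simp add:jp_nonneg powr_mono2)
 next
  case 2
  have "jp p a <= 0" "0 <= jp p b"
   using 2 by(auto simp:jp_nonneg jp_nonpos)
  thus ?thesis by linarith
 next
  case 3
  thus ?thesis
   using assms by(simp add:jp_nonpos powr_mono2)
 qed
qed

lemma jp_strict_mono:
 assumes "1 < p" and "a < b"
 shows "jp p a < jp p b"
proof -
 consider "0 <= a" | "a < 0" "0 <= b" | "b < 0" using assms by linarith
 thus ?thesis
 proof cases
  case 1
  thus ?thesis
   using assms by(simp add:jp_nonneg powr_less_mono2)
 next
  case 2
  have "jp p a < 0" "0 <= jp p b"
   using 2 by(auto simp:jp_nonneg jp_nonpos)
  thus ?thesis by linarith
 next
  case 3
  thus ?thesis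
   using assms by(simp add:jp_nonpos powr_less_mono2)
 qed
qed

lemma isCont_jp:
 assumes "1 < p"
 shows "isCont (jp p) t"
proof(cases "t = 0")
 case True
 have "((%t. (abs t) powr (p-1)) \<longlongrightarrow> (0::real) |^ (p-1)) (at 0)"
  using assms by(intro tendsto_intros) auto
 hence "((%t. (abs t) powr (p-1)) \<longlongrightarrow> 0) (at 0)"
  by simp
 hence "(jp p \<longlongrightarrow> 0) (at 0)"
  by(rule Lim_null_comparison[rotated]) (simp add:abs_jp)
 thus ?thesis
  using True by(simp add:isCont_def)
next
 case False
 have "isCont (%t. sgn t*t |^ (p-1)) t"
  using False by(intro continuous_intros) auto
 thus ?thesis
  by(simp add:jp_def[abs_def])
qed

lemma tendsto_jp:
 assumes "1 < p" and "(f \<longlongrightarrow> l) F"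
 shows "((%x. jp p (f x)) \<longlongrightarrow> jp p l) F"
 using isCont_tendsto_compose[OF isCont_jp] assms by blast

lemma borel_measurable_jp [measurable (raw)]:
 assumes [measurable]: "f : borel_measurable M"
 shows "(%x. jp p (f x)) : borel_measurable M"
 unfolding jp_def by measurable

lemma powr_add_le:
 fixes a b q :: real
 assumes "0 <= q" "0 <= a" "0 <= b"
 shows "(a+b) powr q <= 2 powr q*(a powr q+b powr q)"
proof -
 have "(a+b) powr q <= (2 * max a b) powr q"
  using assms by(intro powr_mono2) auto
 also have "... = 2 powr q*(max a b powr q)"
  using assms by(simp add:powr_mult)
 also have "... <= 2 powr q*(a powr q+b powr q)"
  by(intro mult_left_mono) (auto simp:max_def)
 finally show ?thesis .
qed

lemma abs_powr_add_le:
 fixes a b q :: real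
 assumes "0 <= q"
 shows "(a+b) |^ q <= 2 powr q*(a |^ q+b |^ q)"
  and "(a-b) |^ q <= 2 powr q*(a |^ q+b |^ q)"
proof -
 have "(a+b) |^ q <= (abs a+abs b) powr q" "(a-b) |^ q <= (abs a+abs b) powr q"
  using assms by(auto intro!: powr_mono2)
 thus "(a+b) |^ q <= 2 powr q*(a |^ q+b |^ q)"
  "(a-b) |^ q <= 2 powr q*(a |^ q+b |^ q)"
  using powr_add_le[OF assms, of "abs a" "abs b"] by linarith+
qed

lemma Young_powr:
 fixes p :: real
 assumes "1 < p" "0 <= a" "0 <= b"
 shows "a powr (p-1)*b <= (p-1)/p*a powr p+b powr p/p"
proof -
 define q where "q = p/(p-1)"
 have q: "1 < q" "1/q+1/p = 1"
  using assms by(auto simp:q_def field_simps)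
 have "a powr (p-1)*b <= (a powr (p-1)) powr q/q+b powr p/p"
  using q assms by(intro Youngs_inequality) auto
 also have "(a powr (p-1)) powr q = a powr p"
  using assms by(simp add:powr_powr q_def)
 finally show ?thesis
  by(simp add:mult.commute q_def)
qed

lemma Young_powr':
 fixes p :: real
 assumes "1 < p" "0 <= a" "0 <= b"
 shows "a powr (p-1)*b <= a powr p+b powr p"
proof -
 have "(p-1)/p*a powr p <= 1*a powr p"
  using assms by(intro mult_right_mono) auto
 moreover have "b powr p/p <= b powr p/1"
  using assms by(intro divide_left_mono) auto
 ultimately show ?thesis
  using Young_powr[OF assms] by linarith
qed

text \<open>Convexity of |.|^p in the form used throughout: the graph lies above its tangents.
  Young's inequality gives it without calculus. The first variation of the energy and Jensen's
  inequality rest on it as well.\<close>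

lemma powr_tangent:
 assumes "1 < p"
 shows "a |^ p+p*jp p a*(b-a) <= b |^ p"
proof -
 have "jp p a*b <= a |^ (p-1)*abs b"
  by(metis abs_jp abs_ge_self abs_mult)
 also have "... <= (p-1)/p*a |^ p+b |^ p/p"
  using Young_powr[OF assms, of "abs a" "abs b"] by simp
 finally have "p*(jp p a*b) <= p*((p-1)/p*a |^ p+b |^ p/p)"
  using assms by(intro mult_left_mono) auto
 also have "... = (p-1)*a |^ p+b |^ p"
  using assms by(simp add:field_simps)
 finally have "p*(jp p a*b) <= (p-1)*a |^ p+b |^ p" .
 moreover have "p*jp p a*(b-a) = p*(jp p a*b)-p*(jp p a*a)"
  by(simp add:algebra_simps)
 ultimately show ?thesis
  unfolding jp_mult_self by argo
qed

lemma powr_diff_le: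
 fixes p :: real
 assumes "1 < p"
 shows "abs (a |^ p-b |^ p) <= p*(a |^ (p-1)+b |^ (p-1))*abs (a-b)"
proof -
 have *: "a |^ p-b |^ p <= p*(a |^ (p-1)+b |^ (p-1))*abs (a-b)" for a b
 proof -
  have "a |^ p-b |^ p <= p*(jp p a*(a-b))"
   using powr_tangent[OF assms, of a b] by(simp add:algebra_simps)
  also have "jp p a*(a-b) <= a |^ (p-1)*abs (a-b)"
   by(metis abs_jp abs_ge_self abs_mult)
  also have "... <= (a |^ (p-1)+b |^ (p-1))*abs (a-b)"
   by(intro mult_right_mono) auto
  finally show ?thesis
   using assms by(simp add:mult.assoc)
 qed
 show ?thesis
  using *[of a b] *[of b a] by(simp add:abs_minus_commute add.commute abs_le_iff)
qed

lemma powr_convex: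
 fixes p :: real
 assumes "1 < p" "0 <= t" "t <= 1"
 shows "((1-t)*a+t*b) |^ p <= (1-t)*a |^ p+t*b |^ p"
proof -
 let ?F = "%m. (1-t)*(m |^ p+p*jp p m*(a-m))+t*(m |^ p+p*jp p m*(b-m))"
 define m where "m = (1-t)*a+t*b"
 have "?F m <= (1-t)*a |^ p+t*b |^ p"
  using assms by(intro add_mono mult_left_mono powr_tangent) auto
 moreover have "?F m = m |^ p+p*jp p m*((1-t)*a+t*b-m)"
  by(simp add:algebra_simps)
 ultimately show ?thesis
  by(simp add:m_def)
qed

text \<open>Both \<open>c\<close> and \<open>d\<close> are convex combinations of \<open>a\<close>
  and \<open>b\<close>, with the weights exchanged, so the two convexity inequalities add up to the
  claim.\<close>

lemma powr_majorization:
 fixes p :: real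
 assumes "1 < p" "a <= c" "c <= b" "a+b = c+d"
 shows "c |^ p+d |^ p <= a |^ p+b |^ p"
proof(cases "a = b")
 case True
 hence "c = b" "d = b" using assms by auto
 thus ?thesis using True by simp
next
 case False
 define t where "t = (c-a)/(b-a)"
 have t: "0 <= t" "t <= 1"
  using assms False by(auto simp:t_def field_simps)
 have "t*(b-a) = c-a"
  using False by(simp add:t_def)
 hence c: "c = (1-t)*a+t*b" and d: "d = (1-(1-t))*a+(1-t)*b"
  using assms(4) by(simp_all add:algebra_simps)
 show ?thesis
  using powr_convex[OF assms(1) t, of a b] powr_convex[OF assms(1), of "1-t" a b] t
  unfolding c[symmetric] d[symmetric] by(simp add:algebra_simps)
qed

text \<open>Pointwise source of the submodularity of the energy. If both pairs are ordered the same
  way there is equality. Otherwise the differences of the maxima and of the minima lie between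
  \<open>a - b\<close> and \<open>c - d\<close> and have the same sum, so
  \<open>powr_majorization\<close> applies.\<close>

lemma powr_max_min:
 assumes "1 < p"
 shows "(max a c-max b d) |^ p+(min a c-min b d) |^ p <= (a-b) |^ p+(c-d) |^ (p::real)"
proof -
 consider "c <= a" "d <= b" | "a <= c" "b <= d" | "c <= a" "b <= d" | "a <= c" "d <= b" by linarith
 thus ?thesis
 proof cases
  case 3
  thus ?thesis
   using powr_majorization[OF assms, of "c-d" "a-d" "a-b" "c-b"]
   by(simp add:max_def min_def)
 next
  case 4
  thus ?thesis
   using powr_majorization[OF assms, of "a-b" "a-d" "c-d" "c-b"]
   by(simp add:max_def min_def)
 qed (auto simp:max_def min_def)
qed

text \<open>Here \<open>d\<close> is the increment of a barrier. If |d| <= (a - b)/2, then a - b + d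
  keeps half of a - b. Otherwise a - b < 2 |d|, and every term is at most a multiple of |d|^p. The
  error is charged only where the truncated function is positive, so that it can later be bounded by
  the measure of a level set.\<close>

lemma jp_energy_aux:
 assumes p: "1 < p" and "b <= a"
 defines "B == max a 0-max b 0"
 shows "(1/2) powr (p-1)*(a-b) powr (p-1)*B-(if 0 < a then 4*d |^ p else 0) <= jp p (a-b+d)*B"
proof(cases "0 < a")
 case False
 hence "B = 0" using assms(2) by(auto simp:B_def)
 thus ?thesis using False by simp
next
 let ?F = "(1/2) powr (p-1)*(a-b) powr (p-1) = ((a-b)/2) powr (p-1)"
 case True
 have B: "0 <= B" "B <= a-b"
  using assms(2) by(auto simp:B_def)
 show ?thesis
 proof(cases "abs d <= (a-b)/2")
  case d: True
  have "?F"
   using assms(2) by(simp add:powr_divide powr_mult)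
  also have "... <= (a-b+d) powr (p-1)"
   using d p B by(intro powr_mono2) auto
  also have "... = jp p (a-b+d)"
   using d B by(intro jp_nonneg[symmetric]) auto
  finally show ?thesis
   using B by(smt (verit) mult_right_mono powr_ge_zero)
 next
  case d: False
  have d1: "B <= 2*abs d" using d B by auto
  have e: "d |^ (p-1)*abs d = d |^ p"
   using jp_mult_self[of p "abs d"] by(simp add:jp_nonneg)
  have "?F"
   using assms(2) by(simp add:powr_divide powr_mult)
  also have "... <= d |^ (p-1)"
   using d p B by(intro powr_mono2) auto
  finally have 1: "(1/2) powr (p-1)*(a-b) powr (p-1)*B <= d |^ (p-1)*(2*abs d)"
   using B d1 by(intro mult_mono) auto
  have "jp p (- abs d) <= jp p (a-b+d)"
   using p B by(intro jp_mono) auto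
  hence "- (d |^ (p-1)) <= jp p (a-b+d)"
   by(simp add:jp_nonneg)
  hence "- (d |^ (p-1))*B <= jp p (a-b+d)*B"
   using B by(intro mult_right_mono) auto
  moreover have "d |^ (p-1)*B <= d |^ (p-1)*(2*abs d)"
   using d1 by(intro mult_left_mono) auto
  ultimately show ?thesis
   using 1 True e by simp
 qed
qed

lemma jp_energy:
 assumes p: "1 < p"
 shows "(1/2) powr (p-1)*((a-b) |^ (p-1)*abs (max a 0-max b 0))-(if 0 < a | 0 < b then 4*d |^ p else 0) <= jp p (a-b+d)*(max a 0-max b 0)"
proof(cases "b <= a")
 case True
 have "abs (a-b) = a-b" "abs (max a 0-max b 0) = max a 0-max b 0" "0 < a | 0 < b \<longleftrightarrow> 0 < a"
  using True by auto
 thus ?thesis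
  using jp_energy_aux[OF p True, of d] by(simp add:mult.assoc)
next
 case False
 have "abs (a-b) = b-a" "abs (max a 0-max b 0) = max b 0-max a 0" "0 < a | 0 < b \<longleftrightarrow> 0 < b"
  using False by auto
 moreover have e: "jp p (a-b+d) = - jp p (b-a+(- d))"
  by(metis add.commute diff_minus_eq_add jp_minus minus_add_distrib minus_diff_eq uminus_add_conv_diff)
 ultimately show ?thesis
  using jp_energy_aux[OF p, of a b "- d"] False
  unfolding e by(cases "0 < b") (simp_all add:mult.assoc minus_mult_right max_def del:minus_mult_left)
qed

section \<open>Null sets, Tonelli and exchange of variables for Lebesgue measure on pairs\<close>

lemma fst_borel [measurable]: "fst : (borel :: ('a::euclidean_space \<times> 'b::euclidean_space) measure) \<rightarrow>\<^sub>M borel"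
 by(intro borel_measurable_continuous_onI continuous_intros)

lemma snd_borel [measurable]: "snd : (borel :: ('a::euclidean_space \<times> 'b::euclidean_space) measure) \<rightarrow>\<^sub>M borel"
 by(intro borel_measurable_continuous_onI continuous_intros)

lemma AE_prod_lborelI:
 assumes "AE x in (lborel :: 'a::euclidean_space measure). P x"
 shows "AE z in (lborel :: ('a \<times> 'a) measure). P (fst z)" "AE z in (lborel :: ('a \<times> 'a) measure). P (snd z)"
proof -
 obtain N where N: "N : null_sets lborel" "{x. ~ P x} <= N"
  using assms by(auto simp:eventually_ae_filter)
 have [measurable]: "N : sets borel" using N by auto
 have "emeasure (lborel \<Otimes>\<^sub>M lborel) (N \<times> (UNIV :: 'a set)) = 0" "emeasure (lborel \<Otimes>\<^sub>M lborel) ((UNIV :: 'a set) \<times> N) = 0"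
  using N by(simp_all add:lborel.emeasure_pair_measure_Times null_setsD1)
 hence "N \<times> UNIV : null_sets (lborel :: ('a \<times> 'a) measure)" "UNIV \<times> N : null_sets (lborel :: ('a \<times> 'a) measure)"
  unfolding lborel_prod by(auto simp:null_sets_def borel_prod[symmetric])
 hence a: "AL z. z ~: N \<times> (UNIV :: 'a set)" "AL z. z ~: (UNIV :: 'a set) \<times> N"
  by(auto intro:AE_not_in)
 show "AE z in (lborel :: ('a \<times> 'a) measure). P (fst z)"
  using a(1) by(rule eventually_mono) (use N(2) in auto)
 show "AE z in (lborel :: ('a \<times> 'a) measure). P (snd z)"
  using a(2) by(rule eventually_mono) (use N(2) in auto)
qed

lemma nn_integral_lborel_prod:
 fixes f :: "'a::euclidean_space \<times> 'a => ennreal"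
 assumes [measurable]: "f : Bor"
 shows "(NL z. f z) = (NL x. NL y. f (x, y))"
proof -
 have "(NL z. f z) = (\<integral>\<^sup>+z. f z \<partial>(lborel \<Otimes>\<^sub>M lborel))" unfolding lborel_prod ..
 also have "... = (NL x. NL y. f (x, y))"
  by(subst lborel.nn_integral_fst[symmetric]) (auto simp:lborel_prod)
 finally show ?thesis .
qed

lemma nn_integral_lborel_swap:
 fixes f :: "'a::euclidean_space \<times> 'a => ennreal"
 assumes [measurable]: "f : Bor"
 shows "(NL z. f (snd z, fst z)) = (NL z. f z)"
proof -
 have [measurable]: "(%z. f (snd z, fst z)) : Bor"
  by(rule measurable_compose[OF _ assms]) (intro borel_measurable_continuous_onI continuous_intros)
 have m: "(%(x, y). f (x, y)) : borel_measurable (lborel \<Otimes>\<^sub>M lborel)"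
  unfolding lborel_prod by simp
 have "(NL z. f (snd z, fst z)) = (NL x. NL y. f (y, x))"
  by(subst nn_integral_lborel_prod) simp_all
 also have "... = (NL x. NL y. f (x, y))"
  by(rule lborel_pair.Fubini'[OF m])
 finally show ?thesis
  by(subst nn_integral_lborel_prod) simp_all
qed

section \<open>Integrals of powers of the distance, by dyadic shells\<close>

lemma dyadic_between:
 fixes t :: real
 assumes "1 <= t"
 obtains j :: nat where "2^j <= t" "t < 2^Suc j"
proof -
 obtain m :: nat where m: "t < 2^m"
  using real_arch_pow[of 2 t] by auto
 define i where "i = (LEAST m. t < 2^m)"
 have i: "t < 2^i"
  unfolding i_def by(rule LeastI[of _ m]) (rule m)
 have "i ~= 0"
  using i assms by(intro notI) simp
 then obtain j where j: "i = Suc j"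
  by(meson old.nat.exhaust)
 have "~ t < 2^j"
  using not_less_Least[of j "%m. t < 2^m"] j unfolding i_def by simp
 thus ?thesis
  using that[of j] i j by auto
qed

definition ball_const :: "'a::euclidean_space itself => real => real"
 where "ball_const _ al = unit_ball_vol (real DIM('a))*2^DIM('a)/(1-2 powr-al)"

lemma ball_const_nonneg:
 assumes "0 < al"
 shows "0 <= ball_const TYPE('a::euclidean_space) al"
proof -
 have "2 powr-al < (1::real)"
  using assms powr_less_mono[of "- al" 0 2] by simp
 thus ?thesis by(simp add:ball_const_def)
qed

text \<open>Powers far from \<open>x\<close> and powers near \<open>x\<close> are both majorised by
  constants on balls whose radii double or halve. The last hypothesis bounds the terms by a
  geometric series of ratio 2^(-al), and \<open>ball_const\<close> is its sum for r = 1.\<close>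

lemma nn_integral_dyadic_balls:
 fixes x :: "'a::euclidean_space"
 assumes r: "0 < r" and al: "0 < al"
  and f: "!!y. f y <= (\<Sum>j. en (c j)*ind (cball x (rh j)) y)"
  and c: "!!j. 0 <= c j" "!!j. 0 <= rh j" "!!j. c j*rh j^DIM('a) <= 2^DIM('a)*r*(2 powr-al)^j"
 shows "(NL y. f y) <= en (ball_const TYPE('a) al*r)"
proof -
 let ?u = "unit_ball_vol (real DIM('a))" and ?q = "2 powr-al :: real"
 have [measurable]: "cball x (rh j) : sets borel" for j
  by(rule borel_closed) (rule closed_cball)
 have q: "0 < ?q" "?q < 1"
  using al powr_less_mono[of "- al" 0 2] by simp_all
 have "(NL y. f y) <= (NL y. (\<Sum>j. en (c j)*ind (cball x (rh j)) y))"
  by(intro nn_integral_mono f)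
 also have "... = (\<Sum>j. NL y. en (c j)*ind (cball x (rh j)) y)"
  by(intro nn_integral_suminf) measurable
 also have "... = (\<Sum>j. en (c j)*em (cball x (rh j)))"
  by(simp add:nn_integral_cmult_indicator)
 also have "... <= (\<Sum>j. en (?u*2^DIM('a)*r*?q^j))"
 proof(intro suminf_le allI)
  fix j
  have "en (c j)*em (cball x (rh j)) = en (?u*(c j*rh j^DIM('a)))"
   using c by(simp add:emeasure_cball ennreal_mult[symmetric] mult_ac)
  also have "... <= en (?u*(2^DIM('a)*r*?q^j))"
   using c(3)[of j] by(intro ennreal_leI mult_left_mono) auto
  finally show "en (c j)*em (cball x (rh j)) <= en (?u*2^DIM('a)*r*?q^j)"
   by(simp add:mult_ac)
 qed auto
 also have "... = en (?u*2^DIM('a)*r*(1/(1-?q)))"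
  using r q by(intro suminf_ennreal_eq sums_mult geometric_sums) auto
 finally show ?thesis
  by(simp add:ball_const_def mult_ac)
qed

lemma indicator_le_suminf:
 fixes c :: "nat => real"
 assumes "y : A j" "a <= c j"
 shows "en a <= (\<Sum>j. en (c j)*ind (A j) y)"
proof -
 define f where "f i = en (c i)*ind (A i) y" for i
 have "en a <= f j"
  using assms by(simp add:f_def ennreal_leI)
 also have "f j <= (\<Sum>j. f j)"
  using sum_le_suminf[of f "{j}"] by simp
 finally show ?thesis
  by(simp add:f_def)
qed

lemma nn_integral_far_power:
 fixes x :: "'a::euclidean_space"
 assumes r: "0 < r" and al: "0 < al"
 shows "(NL y. en (norm (x-y) powr-(real DIM('a)+al))*ind {y. r <= norm (x-y)} y) <= en (ball_const TYPE('a) al*r powr-al)"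
proof(rule nn_integral_dyadic_balls[where c = "%j. (2^j*r) powr-(real DIM('a)+al)"
   and rh = "%j. 2*(2^j*r)"])
 let ?F = "real DIM('a)+al"
 fix y
 show "en (norm (x-y) powr-(?F))*ind {y. r <= norm (x-y)} y <= (\<Sum>j. en ((2^j*r) powr-(?F))*ind (cball x (2*(2^j*r))) y)"
 proof(cases "r <= norm (x-y)")
  case True
  hence "1 <= norm (x-y)/r" using r by simp
  then obtain j where j: "2^j <= norm (x-y)/r" "norm (x-y)/r < 2^Suc j"
   by(rule dyadic_between)
  have 1: "2^j*r <= norm (x-y)" "norm (x-y) <= 2*(2^j*r)"
   using j r by(simp_all add:field_simps)
  have "y : cball x (2*(2^j*r))"
   using 1 by(simp add:dist_norm)
  moreover have "norm (x-y) powr-(?F) <= (2^j*r) powr-(?F)"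
   using 1 r al by(intro powr_mono2') auto
  ultimately show ?thesis
   using True by(simp add:indicator_le_suminf)
 qed simp
next
 let ?F = "%j r. (2^j*r) powr-(real DIM('a)+al)*(2*(2^j*r))^DIM('a)"
 fix j
 have "?F j r = 2^DIM('a)*((2^j*r) powr-(real DIM('a)+al)*(2^j*r) powr real DIM('a))"
  using r by(simp add:powr_realpow power_mult_distrib)
 also have "... = 2^DIM('a)*(2^j*r) powr-al"
  by(simp flip:powr_add)
 also have "(2^j*r) powr-al = r powr-al*(2 powr-al)^j"
  using r by(simp add:powr_mult powr_power powr_powr mult.commute flip:powr_realpow)
 finally show "?F j r <= 2^DIM('a)*r powr-al*(2 powr-al)^j"
  by(simp add:mult_ac)
qed (use r al in auto)

lemma nn_integral_near_power:
 fixes x :: "'a::euclidean_space"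
 assumes r: "0 < r" and al: "0 < bt"
 shows "(NL y. en (norm (x-y) powr-(real DIM('a)-bt))*ind {y. norm (x-y) <= r} y) <= en (ball_const TYPE('a) bt*r powr bt)"
proof(rule nn_integral_dyadic_balls[where c = "%j. (r/2^Suc j) powr-real DIM('a)*(r/2^j) powr bt"
   and rh = "%j. r/2^j"])
 let ?G = "%y. norm (x-y) powr-(real DIM('a)-bt)"
 let ?F = "%j. (r/2^Suc j) powr-real DIM('a)*(r/2^j) powr bt"
 fix y
 show "en (?G y)*ind {y. norm (x-y) <= r} y <= (\<Sum>j. en (?F j)*ind (cball x (r/2^j)) y)"
 proof(cases "norm (x-y) <= r & x ~= y")
  case True
  hence "1 <= r/norm (x-y)" using r by(simp add:field_simps)
  then obtain j where j: "2^j <= r/norm (x-y)" "r/norm (x-y) < 2^Suc j"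
   by(rule dyadic_between)
  have 1: "r/2^Suc j <= norm (x-y)" "norm (x-y) <= r/2^j"
   using j True by(simp_all add:field_simps)
  have "?G y = norm (x-y) powr-real DIM('a)*norm (x-y) powr bt"
   by(simp flip:powr_add)
  also have "... <= ?F j"
   using 1 r al by(intro mult_mono powr_mono2' powr_mono2) auto
  finally have "?G y <= ?F j" .
  moreover have "y : cball x (r/2^j)"
   using 1 by(simp add:dist_norm)
  ultimately show ?thesis
   using True by(simp add:indicator_le_suminf)
 qed auto
next
 let ?F = "%r j. (r/2^Suc j) powr-real DIM('a)*(r/2^j) powr bt*(r/2^j)^DIM('a)"
 fix j
 have "(r/2^Suc j) powr-real DIM('a) = 2^DIM('a)*(r/2^j) powr-real DIM('a)"
  using r by(simp add:powr_divide powr_mult powr_minus powr_realpow field_simps)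
 hence "?F r j = 2^DIM('a)*(r/2^j) powr bt*((r/2^j) powr-real DIM('a)*(r/2^j) powr real DIM('a))"
  using r by(simp add:powr_realpow)
 also have "... = 2^DIM('a)*(r/2^j) powr bt"
  using r by(simp flip:powr_add)
 also have "(r/2^j) powr bt = r powr bt*(2 powr-bt)^j"
  using r by(simp add:powr_divide powr_minus powr_power powr_powr field_simps flip:powr_realpow)
 finally show "?F r j <= 2^DIM('a)*r powr bt*(2 powr-bt)^j"
  by(smt (verit) \<open>(r / 2 ^ j) powr bt = r powr bt * (2 powr - bt) ^ j\<close> vector_space_over_itself.scale_scale)
qed (use r al in auto)

section \<open>The kernel: the measure on pairs, cutoffs, and the tail weight\<close>

locale frac_kernel =
 fixes s p La :: real and k :: "'a::euclidean_space => 'a => real"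
 assumes s0: "0 < s" and s1: "s < 1" and p1: "1 < p" and La1: "1 <= La"
  and k_meas [measurable]: "(%z. k (fst z) (snd z)) : Bor"
  and k_sym: "k x y = k y x"
  and k_lower: "norm (x-y) powr-(real DIM('a)+s*p) <= La * k x y"
  and k_upper: "k x y <= La*norm (x-y) powr-(real DIM('a)+s*p)"
begin

lemma La0: "0 < La" and p0: "0 < p" and sp0: "0 < s*p" and spp: "0 < p-s*p"
 using La1 s0 s1 p1 by(auto simp:algebra_simps)

lemma k_nonneg: "0 <= k x y"
proof -
 have "0 <= La * k x y"
  using k_lower[of x y] powr_ge_zero order_trans by blast
 thus ?thesis using La0 by(simp add:zero_le_mult_iff)
qed

text \<open>With the kernel as a density, the energy is an L^p norm of increments and the weak form
  an integral of products of increments, so Fatou's lemma, dominated convergence and Hoelder-type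
  arguments apply directly.\<close>

definition mu :: "('a \<times> 'a) measure"
 where "mu = density lborel (%z. en (k (fst z) (snd z)))"

abbreviation (input) NMint (binder "NM " 10)
  where "NMint f == nn_integral mu f"

abbreviation (input) BMint :: "('a \<times> 'a => real) => real" (binder "BM " 10)
  where "BMint f == integral\<^sup>L mu f"

lemma sets_mu [measurable_cong, simp]: "sets mu = sets borel"
 by(simp add:mu_def)

lemma space_mu [simp]: "space mu = UNIV"
 by(simp add:mu_def)

lemma nn_integral_mu_density:
 assumes [measurable]: "f : Bor"
 shows "(NM z. f z) = (NL z. f z*en (k (fst z) (snd z)))"
 unfolding mu_def by(subst nn_integral_density) (auto simp:mult.commute)

lemma nn_integral_mu:
 assumes [measurable]: "f : Bor"
 shows "(NM z. f z) = (NL x. NL y. f (x, y)*en (k x y))"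
 by(simp add:nn_integral_mu_density nn_integral_lborel_prod)

lemma nn_integral_mu_swap:
 assumes [measurable]: "f : Bor"
 shows "(NM z. f (snd z, fst z)) = (NM z. f z)"
proof -
 have [measurable]: "(%z. f (snd z, fst z)) : Bor"
  by(rule measurable_compose[OF _ assms]) (intro borel_measurable_continuous_onI continuous_intros)
 show ?thesis
  using nn_integral_lborel_swap[of "%z. f z*en (k (fst z) (snd z))"] by(simp add:nn_integral_mu_density k_sym)
qed

lemma AE_muI:
 assumes "AL x. P x"
 shows "AE z in mu. P (fst z)" and "AE z in mu. P (snd z)"
 using AE_prod_lborelI[OF assms] unfolding mu_def
 by(simp_all add:AE_density eventually_mono)

definition lip_const :: real
 where "lip_const = La*(ball_const TYPE('a) (p-s*p)+ball_const TYPE('a) (s*p))"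

lemma lip_const_nonneg: "0 <= lip_const"
 using ball_const_nonneg[OF spp, where 'a = 'a] ball_const_nonneg[OF sp0, where 'a = 'a] La0
 by(simp add:lip_const_def)

text \<open>Split at distance \<open>l\<close>. Nearer than \<open>l\<close> the Lipschitz bound
  raises the power of the distance by p, to the locally integrable p - s p - n; farther away the
  bound by 1 leaves -n - s p, which is integrable at infinity. Both pieces scale like l^(-s
  p).\<close>

lemma nn_integral_lip_kernel:
 assumes l: "0 < l" and g: "!!y. (abs (g y)) <= 1" "!!y. (abs (g y)) <= norm (x-y)/l"
 shows "(NL y. en (g y |^ p)*en (k x y)) <= en (lip_const*l powr-(s*p))"
proof -
 let ?N = "real DIM('a)"
 let ?E = "ball_const TYPE('a) (s*p)*l powr-(s*p)"
 let ?D = "%y. norm (x-y) powr p*norm (x-y) powr-(?N+s*p)"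
 let ?C = "%y. norm (x-y) <= l"
 let ?B = "%y. en (g y |^ p)*en (k x y)"
 let ?A = "ball_const TYPE('a) (p-s*p)*l powr (p-s*p)"
 let ?G = "%y. norm (x-y) powr-(?N+s*p)"
 let ?F = "%y. norm (x-y) powr-(?N-(p-s*p))"
 have "(NL y. ?B y) <= (NL y. en (La*l powr-p)*(en (?F y)*ind {y. ?C y} y)+en La*(en (?G y)*ind {y. l <= norm (x-y)} y))"
 proof(rule nn_integral_mono)
  fix y
  show "?B y <= en (La*l powr-p)*(en (?F y)*ind {y. ?C y} y)+en La*(en (?G y)*ind {y. l <= norm (x-y)} y)"
  proof(cases "?C y")
   case True
   have "g y |^ p * k x y <= (norm (x-y)/l) powr p*(La*norm (x-y) powr-(?N+s*p))"
    using g p0 k_upper k_nonneg by(intro mult_mono powr_mono2) auto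
   also have "... = La*l powr-p*(?D y)"
    using l by(simp add:powr_divide powr_minus field_simps)
   also have "?D y = ?F y"
    by(simp add:algebra_simps flip:powr_add)
   finally have "?B y <= en (La*l powr-p)*en (?F y)"
    using La0 k_nonneg by(simp add:ennreal_leI flip:ennreal_mult)
   also have "... <= en (La*l powr-p)*(en (?F y)*ind {y. ?C y} y)+en La*(en (?G y)*ind {y. l <= norm (x-y)} y)"
    using True by simp
   finally show ?thesis .
  next
   case False
   have "g y |^ p * k x y <= 1 powr p*(La*norm (x-y) powr-(?N+s*p))"
    using g p0 k_upper k_nonneg by(intro mult_mono powr_mono2) auto
   hence "?B y <= en La*en (?G y)"
    using La0 k_nonneg by(simp add:ennreal_leI flip:ennreal_mult)
   thus ?thesis using False by simp
  qed
 qed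
 also have "... = en (La*l powr-p)*(NL y. en (?F y)*ind {y. ?C y} y)+en La*(NL y. en (?G y)*ind {y. l <= norm (x-y)} y)"
  by(subst nn_integral_add) (auto simp:nn_integral_cmult)
 also have "... <= en (La*l powr-p)*en (?A)+en La*en (?E)"
  by(intro add_mono mult_left_mono nn_integral_near_power nn_integral_far_power l spp sp0) auto
 also have "... = en (La*l powr-p*(?A)+La*(?E))"
  using La0 ball_const_nonneg[OF spp, where 'a = 'a] ball_const_nonneg[OF sp0, where 'a = 'a]
  by(simp add:ennreal_mult[symmetric] ennreal_plus[symmetric] del:ennreal_plus)
 also have "La*l powr-p*(?A) = La*ball_const TYPE('a) (p-s*p)*(l powr-p*l powr (p-s*p))"
  by simp
 also have "l powr-p*l powr (p-s*p) = l powr-(s*p)"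
  by(simp flip:powr_add)
 finally show ?thesis
  by(simp add:lip_const_def algebra_simps)
qed

definition wt :: "'a => real"
 where "wt y = (1+norm y) powr-(real DIM('a)+s*p)"

lemma wt_measurable [measurable]: "wt : Bor"
 unfolding wt_def by measurable

lemma wt_pos: "0 < wt y"
proof -
 have "0 < 1+norm y" by(simp add:add_pos_nonneg)
 thus ?thesis by(simp add:wt_def)
qed

lemma wt_nonneg [simp]: "0 <= wt y"
 using wt_pos[of y] by simp

text \<open>For bounded \<open>x\<close> and |x - y| >= d, the quantity 1 + |y| is at most a
  multiple of |x - y|, so away from the diagonal the tail weight controls the kernel.\<close>

lemma k_le_wt:
 assumes "0 < d" "0 <= R"
 obtains C where "0 < C" "!!x y. norm x <= R ==> d <= norm (x-y) ==> k x y <= C*wt y"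
proof -
 let ?N = "real DIM('a)+s*p"
 define a where "a = (1+R)/d+1"
 have a: "0 < a" using assms by(simp add:a_def add_pos_pos)
 have e: "a powr ?N*a powr-?N = 1"
  using a by(simp flip:powr_add)
 have "k x y <= La*a powr ?N*wt y" if "norm x <= R" "d <= norm (x-y)" for x y
 proof -
  have "1+norm y <= 1+R+norm (x-y)"
   using that norm_triangle_ineq2[of y x] by(simp add:norm_minus_commute)
  also have "... <= (1+R)*(norm (x-y)/d)+norm (x-y)"
   using assms that by(intro add_right_mono) (simp add:pos_le_divide_eq mult_left_mono)
  also have "... = a*norm (x-y)" by(simp add:a_def algebra_simps)
  finally have "(a*norm (x-y)) powr-?N <= (1+norm y) powr-?N"
   using sp0 by(intro powr_mono2') (auto simp:add_pos_nonneg)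
  hence "a powr-?N*norm (x-y) powr-?N <= wt y"
   using a assms that by(simp add:powr_mult wt_def)
  hence "a powr ?N*(a powr-?N*norm (x-y) powr-?N) <= a powr ?N*wt y"
   by(intro mult_left_mono) auto
  hence "norm (x-y) powr-?N <= a powr ?N*wt y"
   by(simp only: mult.assoc[symmetric] e mult_1)
  hence "La*norm (x-y) powr-?N <= La*(a powr ?N*wt y)"
   using La0 by(intro mult_left_mono) auto
  thus ?thesis using k_upper[of x y] by(simp add:mult.assoc)
 qed
 thus ?thesis
  using that[of "La*a powr ?N"] La0 a by simp
qed

text \<open>The converse control, valid up to the diagonal because |x - y| is at most a multiple of
  1 + |y|. It turns a bound for a kernel integral into a bound for a tail.\<close>

lemma wt_le_k:
 assumes "0 <= R"
 obtains C where "0 < C" "!!x y. norm x <= R ==> x ~= y ==> wt y <= C * k x y"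
proof -
 let ?N = "real DIM('a)+s*p"
 have "wt y <= ((1+R) powr ?N*La) * k x y" if "norm x <= R" "x ~= y" for x y
 proof -
  have "norm (x-y) <= R+norm y"
   using that norm_triangle_ineq4[of x y] by simp
  also have "... <= (1+R)*(1+norm y)"
   using assms by(simp add:algebra_simps)
  finally have "((1+R)*(1+norm y)) powr-?N <= norm (x-y) powr-?N"
   using sp0 that by(intro powr_mono2') auto
  hence "(1+R) powr-?N*wt y <= La * k x y"
   using k_lower[of x y] assms by(simp add:powr_mult wt_def)
  hence "(1+R) powr ?N*((1+R) powr-?N*wt y) <= (1+R) powr ?N*(La * k x y)"
   by(intro mult_left_mono) auto
  moreover have "(1+R) powr ?N*(1+R) powr-?N = 1"
   using assms by(simp flip:powr_add)
  ultimately show ?thesis by(simp only: mult.assoc[symmetric] mult_1)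
 qed
 thus ?thesis
  using that[of "(1+R) powr ?N*La"] La0 assms by simp
qed

lemma nn_integral_wt: "(NL y. en (wt y)) < infy"
proof -
 let ?N = "real DIM('a)+s*p"
 have [measurable]: "cball (0::'a) 1 : sets borel"
  by(rule borel_closed) (rule closed_cball)
 have "(NL y. en (wt y)) <= (NL y. ind (cball (0::'a) 1) y+en (norm ((0::'a)-y) powr-?N)*ind {y. 1 <= norm ((0::'a)-y)} y)"
 proof(rule nn_integral_mono)
  fix y
  show "en (wt y) <= ind (cball 0 1) y+en (norm ((0::'a)-y) powr-?N)*ind {y. 1 <= norm ((0::'a)-y)} y"
  proof(cases "norm y < 1")
   case True
   have "wt y <= 1 powr-?N"
    unfolding wt_def using sp0 by(intro powr_mono2') auto
   thus ?thesis using True by(simp add:ennreal_le_1)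
  next
   case False
   hence "y ~= 0" by auto
   hence "wt y <= norm ((0::'a)-y) powr-?N"
    unfolding wt_def using sp0 by(intro powr_mono2') auto
   thus ?thesis using False by(simp add:ennreal_leI add_increasing)
  qed
 qed
 also have "... = em (cball (0::'a) 1)+(NL y. en (norm ((0::'a)-y) powr-?N)*ind {y. 1 <= norm ((0::'a)-y)} y)"
  by(subst nn_integral_add) auto
 also have "... <= em (cball (0::'a) 1)+en (ball_const TYPE('a) (s*p)*1 powr-(s*p))"
  by(intro add_left_mono nn_integral_far_power sp0) simp
 also have "... < infy"
  using emeasure_lborel_cball_finite[of "0::'a" 1] by(simp add:less_top)
 finally show ?thesis .
qed

text \<open>Takes the place of a Sobolev inequality. At least half of the ball lies off
  \<open>A\<close>, and there the kernel is at least rh^(-n-s p)/La. With \<open>rh\<close> chosen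
  so that \<open>A\<close> has half the volume of such a ball, the lower bound is a multiple of
  |A|^(-s p/n): the smaller a set, the more kernel mass it sees outside itself.\<close>

lemma kernel_integral_off_set:
 assumes A [measurable]: "A : sets borel" and rh: "0 < rh"
  and le: "em (A Int ball x rh) <= en (unit_ball_vol (real DIM('a))*rh^DIM('a)/2)"
 shows "en (unit_ball_vol (real DIM('a))/(2*La)*rh powr-(s*p)) <= (NL y. ind (ball x rh-A) y*en (k x y))"
proof -
 let ?N = "real DIM('a)+s*p"
 let ?G = "rh powr-?N/La"
 let ?F = "unit_ball_vol (real DIM('a))*rh^DIM('a)/2"
 have e: "rh powr-(s*p) = rh powr-?N*rh^DIM('a)"
  using rh by(simp flip:powr_realpow powr_add)
 have fin: "em (A Int ball x rh) < infy"
  using le by(simp add:order_le_less_trans)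
 have "en (?F) = en (unit_ball_vol (real DIM('a))*rh^DIM('a))-en (?F)"
  using rh by(subst ennreal_minus) auto
 also have "... <= em (ball x rh)-em (A Int ball x rh)"
  using rh le by(intro ennreal_minus_mono) (auto simp:emeasure_ball)
 also have "... = em (ball x rh-A Int ball x rh)"
  using fin by(subst emeasure_Diff) auto
 also have "ball x rh-A Int ball x rh = ball x rh-A" by auto
 finally have m: "en (?F) <= em (ball x rh-A)" .
 have "en (unit_ball_vol (real DIM('a))/(2*La)*rh powr-(s*p)) = en (?G)*en (?F)"
  using rh La0 unfolding e by(subst ennreal_mult[symmetric]) (auto simp:mult_ac)
 also have "... <= en (?G)*em (ball x rh-A)"
  by(intro mult_left_mono m) simp
 also have "... = (NL y. en (?G)*ind (ball x rh-A) y)"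
  by(simp add:nn_integral_cmult_indicator)
 also have "... = (NL y. en (?G)*ind (ball x rh-A) y*ind (- {x}) y)"
  by(rule nn_integral_cong_AE, rule eventually_mono[OF AE_lborel_singleton[of x]]) (simp add:indicator_def)
 also have "... <= (NL y. ind (ball x rh-A) y*en (k x y))"
 proof(rule nn_integral_mono)
  fix y
  show "en (?G)*ind (ball x rh-A) y*ind (- {x}) y <= ind (ball x rh-A) y*en (k x y)"
  proof(cases "y : ball x rh & y ~= x")
   case True
   hence "rh powr-?N <= norm (x-y) powr-?N"
    using sp0 by(intro powr_mono2') (auto simp:dist_norm)
   hence "?G <= k x y"
    using k_lower[of x y] La0 by(simp add:field_simps)
   thus ?thesis by(auto simp:indicator_def intro!: ennreal_leI)
  qed (auto simp:indicator_def)
 qed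
 finally show ?thesis .
qed

end

section \<open>Passage to the limit in the weak form: local energy and far tail\<close>

lemma Young_eps:
 fixes P Q :: real
 assumes P: "1 < P" "1 < Q" "1/P+1/Q = 1" and "0 < e"
 obtains C where "0 <= C" "!!u v. 0 <= u ==> 0 <= v ==> u * v <= e*u powr P+C * v powr Q"
proof -
 define t where "t = e powr (1/P)"
 have t: "0 < t" "t powr P = e"
  using assms by(simp_all add:t_def powr_powr)
 have "u * v <= e*u powr P+(1/t) powr Q * v powr Q" if "0 <= u" "0 <= v" for u v
 proof -
  have "u * v = (t*u)*(v/t)"
   using t by simp
  also have "... <= (t*u) powr P/P+(v/t) powr Q/Q"
   using P t that by(intro Youngs_inequality) auto
  also have "... <= (t*u) powr P/1+(v/t) powr Q/1"
   using P by(intro add_mono divide_left_mono) auto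
  also have "... = e*u powr P+(1/t) powr Q * v powr Q"
   using t that by(simp add:powr_mult powr_divide)
  finally show ?thesis .
 qed
 thus ?thesis
  using that[of "(1/t) powr Q"] by simp
qed

text \<open>A weak convergence statement without functional analysis. By Young's inequality the
  positive part of u v - e u^P is dominated by a multiple of v^Q, so dominated convergence removes
  it in the limit; what remains is at most e C, with e arbitrary.\<close>

lemma nn_integral_product_tendsto_0:
 fixes u :: "nat => 'b => real" and v :: "'b => real"
 assumes P: "1 < P" "1 < Q" "1/P+1/Q = 1"
  and [measurable]: "!!j. u j : borel_measurable M" "v : borel_measurable M"
  and nn: "!!j x. 0 <= u j x" "!!x. 0 <= v x"
  and lim: "!!x. (%j. u j x) ~> 0"
  and bnd: "!!j. (\<integral>\<^sup>+x. en (u j x powr P) \<partial>M) <= en C" "0 <= C"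
  and fin: "(\<integral>\<^sup>+x. en (v x powr Q) \<partial>M) < infy"
 shows "(%j. \<integral>\<^sup>+x. en (u j x * v x) \<partial>M) ~> 0"
proof(rule tendsto_0_if_Limsup_eq_0_ennreal)
 let ?F = "%u v M. Limsup sequentially (%j. \<integral>\<^sup>+x. en (u j x * v x) \<partial>M)"
 have *: "?F u v M <= en (e*C)" if e: "0 < e" for e
 proof -
  obtain D where D: "0 <= D" "!!u v. 0 <= u ==> 0 <= v ==> u * v <= e*u powr P+D * v powr Q"
   using Young_eps[OF P e] by blast
  have "(%j. \<integral>\<^sup>+x. en (u j x * v x-e*u j x powr P) \<partial>M) ~> (\<integral>\<^sup>+x. 0 \<partial>M)"
  proof(rule nn_integral_dominated_convergence[where w = "%x. en (D * v x powr Q)"])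
   show "(\<integral>\<^sup>+x. en (D * v x powr Q) \<partial>M) < infy"
    using fin D(1) by(simp add:ennreal_mult nn_integral_cmult ennreal_mult_less_top)
   show "AE x in M. en (u j x * v x-e*u j x powr P) <= en (D * v x powr Q)" for j
    using D(2)[OF nn(1)[of j] nn(2)] by(intro AE_I2 ennreal_leI) (simp add:algebra_simps)
   show "AE x in M. (%j. en (u j x * v x-e*u j x powr P)) ~> 0"
   proof(rule AE_I2)
    fix x
    have "(%j. u j x * v x-e*u j x powr P) ~> 0 * v x-e*0 powr P"
     using P nn by(intro tendsto_intros lim tendsto_powr') auto
    thus "(%j. en (u j x * v x-e*u j x powr P)) ~> 0"
     using tendsto_ennrealI by fastforce
   qed
  qed auto
  hence 1: "(%j. (\<integral>\<^sup>+x. en (u j x * v x-e*u j x powr P) \<partial>M)+en (e*C)) ~> 0+en (e*C)"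
   by(intro tendsto_intros) auto
  have 2: "(\<integral>\<^sup>+x. en (u j x * v x) \<partial>M) <= (\<integral>\<^sup>+x. en (u j x * v x-e*u j x powr P) \<partial>M)+en (e*C)" for j
  proof -
   have "(\<integral>\<^sup>+x. en (u j x * v x) \<partial>M) <= (\<integral>\<^sup>+x. en (u j x * v x-e*u j x powr P)+en e*en (u j x powr P) \<partial>M)"
   proof(rule nn_integral_mono)
    fix x
    have "en (u j x * v x) = en ((u j x * v x-e*u j x powr P)+e*u j x powr P)" by simp
    also have "... <= en (u j x * v x-e*u j x powr P)+en (e*u j x powr P)"
     using e by(cases "0 <= u j x * v x-e*u j x powr P")
      (auto simp:ennreal_plus[symmetric] ennreal_neg intro!: ennreal_leI simp del:ennreal_plus)
    finally show "en (u j x * v x) <= en (u j x * v x-e*u j x powr P)+en e*en (u j x powr P)"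
     using e by(simp add:ennreal_mult)
   qed
   also have "... = (\<integral>\<^sup>+x. en (u j x * v x-e*u j x powr P) \<partial>M)+en e*(\<integral>\<^sup>+x. en (u j x powr P) \<partial>M)"
    by(simp add:nn_integral_add nn_integral_cmult)
   also have "... <= (\<integral>\<^sup>+x. en (u j x * v x-e*u j x powr P) \<partial>M)+en e*en C"
    by(intro add_left_mono mult_left_mono bnd) auto
   finally show ?thesis
    using e bnd(2) by(simp add:ennreal_mult)
  qed
  have "?F u v M <= Limsup sequentially (%j. (\<integral>\<^sup>+x. en (u j x * v x-e*u j x powr P) \<partial>M)+en (e*C))"
   using 2 by(intro Limsup_mono always_eventually) auto
  also have "... = en (e*C)"
   using lim_imp_Limsup[OF _ 1] by simp
  finally show ?thesis .
 qed
 show "?F u v M = 0"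
 proof(rule antisym)
  show "?F u v M <= 0"
  proof(rule ennreal_le_epsilon)
   fix e :: real assume e: "0 < e"
   have "en (e/(C+1)*C) <= en e"
    using e bnd(2) by(intro ennreal_leI) (simp add:field_simps)
   thus "?F u v M <= 0+en e"
    using *[of "e/(C+1)"] e bnd(2) by(auto intro:order_trans)
  qed
 qed simp
qed

lemma times_borel [measurable]:
 "A : sets borel ==> B : sets borel ==> A \<times> B : sets (borel :: ('a::euclidean_space \<times> 'b::euclidean_space) measure)"
 unfolding borel_prod[symmetric] by(rule pair_measureI)

lemma indicator_times_measurable [measurable (raw)]:
 fixes A :: "'a::euclidean_space set" and B :: "'b::euclidean_space set"
 assumes "A : sets borel" "B : sets borel"
 shows "ind (A \<times> B) : Bor"
 by(intro borel_measurable_indicator times_borel assms)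

definition dl :: "('a => real) => 'a \<times> 'a => real"
 where "dl w z = w (fst z)-w (snd z)"

lemma dl_measurable [measurable (raw)]:
 fixes w :: "'a::euclidean_space => real"
 assumes [measurable]: "w : Bor"
 shows "dl w : Bor"
 unfolding dl_def[abs_def] by measurable

text \<open>The separation under which the kernel between \<open>U\<close> and the complement of
  \<open>V\<close> is bounded by the tail weight (\<open>inside_kernel\<close>). It asks neither
  that \<open>U\<close> be closed nor that \<open>V\<close> be open, so it covers pairs of balls,
  compact sets and collars alike.\<close>

definition inside :: "'a::real_normed_vector set => 'a set => bool"
 where "inside U V \<longleftrightarrow> U : sets borel & V : sets borel & bounded U & (EX d>0. ALL x:U. ALL y. y ~: V --> d <= norm (x-y))"

lemma insideD: "inside U V ==> U <= V"
 by(force simp:inside_def)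

lemma inside_mono: "inside U V ==> A <= U ==> V <= B ==> A : sets borel ==> B : sets borel ==> inside A B"
 unfolding inside_def by(meson bounded_subset subset_iff)

lemma inside_compact_open:
 fixes C :: "'a::euclidean_space set"
 assumes "compact C" "open V" "C <= V"
 shows "inside C V"
proof -
 obtain d where "0 < d" "!!x y. x : C ==> y : - V ==> d <= dist x y"
 proof(cases "C = {} | - V = {}")
  case True thus ?thesis using that[of 1] by auto
 next
  case False
  have "C Int-V = {}" "closed (- V)" using assms by auto
  thus ?thesis
   using separate_compact_closed[of C "- V"] assms that by metis
 qed
 thus ?thesis
  using assms by(auto simp:inside_def dist_norm borel_compact compact_imp_bounded intro!: exI[of _ d])
qed

context frac_kernel
begin

definition tail :: "('a => real) => bool"
 where "tail w \<longleftrightarrow> w : Bor & (NL y. en (w y |^ (p-1)*wt y)) < infy"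

definition energy :: "'a set => ('a => real) => ennreal"
 where "energy V w = (NM z. en (dl w z |^ p)*ind (V \<times> V) z)"

text \<open>Up to the factor 2^(p-1), a symmetric majorant of the (p-1)-th power of the increment of
  \<open>h\<close> on the pairs with one point in \<open>U\<close> and the other off
  \<open>V\<close>. If U <= V, these are the only pairs off V x V at which a test function supported
  in \<open>U\<close> has a nonzero increment.\<close>

definition farfun :: "'a set => 'a set => ('a => real) => 'a \<times> 'a => real"
 where "farfun U V h z = (h (fst z) |^ (p-1)+h (snd z) |^ (p-1))*(ind U (fst z)*ind (- V) (snd z)+ind U (snd z)*ind (- V) (fst z))"

lemma tail_measurable: "tail w ==> w : Bor"
 by(simp add:tail_def)

lemma tail_mono:
 assumes "tail h" "w : Bor" "!!x. (abs (w x)) <= abs (h x)"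
 shows "tail w"
proof -
 have "(NL y. en (w y |^ (p-1)*wt y)) <= (NL y. en (h y |^ (p-1)*wt y))"
  using assms p1 by(intro nn_integral_mono ennreal_leI mult_right_mono powr_mono2) auto
 thus ?thesis
  using assms by(auto simp:tail_def)
qed

lemma tail_const: "tail (%_. c)"
proof -
 have "(NL y. en (c |^ (p-1)*wt y)) = en (c |^ (p-1))*(NL y. en (wt y))"
  by(simp add:ennreal_mult nn_integral_cmult)
 also have "... < infy"
  using nn_integral_wt by(simp add:ennreal_mult_less_top)
 finally show ?thesis by(simp add:tail_def)
qed

lemma tail_add:
 assumes "tail f" "tail g"
 shows "tail (%x. f x+g x)"
proof -
 let ?G = "%y. (f y+g y) |^ (p-1)*wt y"
 let ?F = "%y. en (2 powr (p-1))*(en (f y |^ (p-1)*wt y)+en (g y |^ (p-1)*wt y))"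
 have [measurable]: "f : Bor" "g : Bor"
  using assms by(auto simp:tail_def)
 have "(NL y. en (?G y)) <= (NL y. ?F y)"
 proof(rule nn_integral_mono)
  fix y
  have "?G y <= 2 powr (p-1)*(f y |^ (p-1)+g y |^ (p-1))*wt y"
   using p1 by(intro mult_right_mono abs_powr_add_le) auto
  thus "en (?G y) <= ?F y"
   by(simp add:ennreal_plus[symmetric] ennreal_mult[symmetric] ennreal_leI algebra_simps del:ennreal_plus)
 qed
 also have "... = en (2 powr (p-1))*((NL y. en (f y |^ (p-1)*wt y))+(NL y. en (g y |^ (p-1)*wt y)))"
  by(simp add:nn_integral_cmult nn_integral_add)
 also have "... < infy"
  using assms by(simp add:tail_def ennreal_mult_less_top)
 finally show ?thesis by(simp add:tail_def)
qed

lemma tail_bounded_integral: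
 assumes "tail w" "bounded U" and [measurable]: "U : sets borel"
 shows "(NL y. en (w y |^ (p-1))*ind U y) < infy"
proof -
 have [measurable]: "w : Bor"
  using assms by(auto simp:tail_def)
 obtain R where R: "0 < R" "!!x. x : U ==> norm x <= R"
  using assms(2) by(auto simp:bounded_pos)
 let ?N = "real DIM('a)+s*p"
 have "(NL y. en (w y |^ (p-1))*ind U y) <= (NL y. en ((1+R) powr ?N)*en (w y |^ (p-1)*wt y))"
 proof(rule nn_integral_mono)
  fix y
  show "en (w y |^ (p-1))*ind U y <= en ((1+R) powr ?N)*en (w y |^ (p-1)*wt y)"
  proof(cases "y : U")
   case True
   have "(1+R) powr-?N <= wt y"
    unfolding wt_def using R(2)[OF True] sp0 by(intro powr_mono2') (auto simp:add_pos_nonneg)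
   hence "(1+R) powr ?N*(1+R) powr-?N <= (1+R) powr ?N*wt y"
    by(intro mult_left_mono) auto
   moreover have "(1+R) powr ?N*(1+R) powr-?N = 1"
    using R by(simp flip:powr_add)
   ultimately have "w y |^ (p-1)*1 <= w y |^ (p-1)*((1+R) powr ?N*wt y)"
    by(intro mult_left_mono) auto
   thus ?thesis
    using True by(simp add:ennreal_mult[symmetric] ennreal_leI mult_ac)
  qed simp
 qed
 also have "... = en ((1+R) powr ?N)*(NL y. en (w y |^ (p-1)*wt y))"
  by(simp add:nn_integral_cmult)
 also have "... < infy"
  using assms by(simp add:tail_def ennreal_mult_less_top)
 finally show ?thesis .
qed

lemma inside_kernel:
 assumes "inside U V"
 obtains C where "0 < C" "!!x y. x : U ==> y ~: V ==> k x y <= C*wt y"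
proof -
 obtain d where d: "0 < d" "!!x y. x : U ==> y ~: V ==> d <= norm (x-y)"
  using assms unfolding inside_def by blast
 obtain R where R: "0 < R" "!!x. x : U ==> norm x <= R"
  using assms by(auto simp:bounded_pos inside_def)
 obtain C where "0 < C" "!!x y. norm x <= R ==> d <= norm (x-y) ==> k x y <= C*wt y"
  using k_le_wt[of d R] d R by(metis less_imp_le)
 thus ?thesis using that[of C] d R by blast
qed

lemma farfun_nonneg: "0 <= farfun U V h z"
 by(simp add:farfun_def)

lemma farfun_measurable [measurable]:
 assumes [measurable]: "h : Bor" "U : sets borel" "V : sets borel"
 shows "farfun U V h : Bor"
 unfolding farfun_def[abs_def] by measurable

lemma inside_emeasure_finite: "inside U V ==> em U < infy"
 unfolding inside_def by(meson emeasure_bounded_finite)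

text \<open>For x in \<open>U\<close> and y off \<open>V\<close> the kernel is at most C *
  \<open>wt y\<close>, so the double integral splits: the local L^(p-1) integral times the total
  mass of \<open>wt\<close>, plus the measure of \<open>U\<close> times the tail. The other half is
  the image under exchange of variables.\<close>

lemma farfun_finite:
 assumes "tail h" "inside U V"
 shows "(NM z. en (farfun U V h z)) < infy"
proof -
 let ?F = "%C x y. en C*(en (h x |^ (p-1))*ind U x*en (wt y)+ind U x*en (h y |^ (p-1)*wt y))"
 have [measurable]: "h : Bor" "U : sets borel" "V : sets borel"
  using assms by(auto simp:tail_def inside_def)
 have bU: "bounded U" using assms by(simp add:inside_def)
 obtain C where C: "0 < C" "!!x y. x : U ==> y ~: V ==> k x y <= C*wt y"
  using inside_kernel[OF assms(2)] by blast
 define F where "F z = (h (fst z) |^ (p-1)+h (snd z) |^ (p-1))*(ind U (fst z)*ind (- V) (snd z))"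
  for z :: "'a \<times> 'a"
 have [measurable]: "F : Bor"
  unfolding F_def[abs_def] by measurable
 let ?T = "NL y. en (h y |^ (p-1)*wt y)"
 have "(NM z. en (F z)) = (NL x. NL y. en (F (x, y))*en (k x y))"
  by(rule nn_integral_mu) measurable
 also have "... <= (NL x. NL y. ?F C x y)"
 proof(intro nn_integral_mono)
  fix x y
  show "en (F (x, y))*en (k x y) <= ?F C x y"
  proof(cases "x : U & y ~: V")
   case True
   have "(h x |^ (p-1)+h y |^ (p-1)) * k x y <= (h x |^ (p-1)+h y |^ (p-1))*(C*wt y)"
    using C True by(intro mult_left_mono) auto
   also have "... = C*(h x |^ (p-1)*wt y+h y |^ (p-1)*wt y)"
    by(simp add:algebra_simps)
   finally show ?thesis
    using True C(1) k_nonneg[of x y]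
    by(simp add:F_def ennreal_plus[symmetric] ennreal_mult[symmetric] ennreal_leI del:ennreal_plus)
  qed (auto simp:F_def)
 qed
 also have "... = en C*((NL x. en (h x |^ (p-1))*ind U x)*(NL y. en (wt y))+em U*?T)"
  by(simp add:nn_integral_cmult nn_integral_add nn_integral_multc)
 also have "... < infy"
  using tail_bounded_integral[OF assms(1) bU] nn_integral_wt assms(1) inside_emeasure_finite[OF assms(2)]
  by(simp add:ennreal_mult_less_top tail_def)
 finally have 1: "(NM z. en (F z)) < infy" .
 have 2: "(NM z. en (F (snd z, fst z))) = (NM z. en (F z))"
  by(rule nn_integral_mu_swap[where f = "%z. en (F z)"]) measurable
 have [measurable]: "(%z. F (snd z, fst z)) : Bor"
  unfolding F_def by measurable
 have "(NM z. en (farfun U V h z)) = (NM z. en (F z)+en (F (snd z, fst z)))"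
  by(intro nn_integral_cong, subst ennreal_plus[symmetric]) (auto simp:F_def farfun_def algebra_simps)
 also have "... = (NM z. en (F z))+(NM z. en (F (snd z, fst z)))"
  by(rule nn_integral_add) measurable
 also have "... < infy" using 1 2 by simp
 finally show ?thesis .
qed

lemma jp_dl_far_le:
 assumes sub: "U <= V" and h: "!!x. (abs (w x)) <= abs (h x)"
  and eh: "!!x. (abs (eh x)) <= B" "!!x. x ~: U ==> eh x = 0"
  and z: "z ~: V \<times> V"
 shows "abs (jp p (dl w z)*dl eh z) <= 2 powr (p-1)*B*farfun U V h z"
proof -
 let ?F = "%x y. h x |^ (p-1)+h y |^ (p-1)"
 obtain x y where z': "z = (x, y)" by(cases z)
 have B: "0 <= B" using eh(1)[of x] by linarith
 have far: "abs (jp p (w x-w y)) <= 2 powr (p-1)*(?F x y)"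
 proof -
  have "(w x-w y) |^ (p-1) <= 2 powr (p-1)*(w x |^ (p-1)+w y |^ (p-1))"
   using p1 by(intro abs_powr_add_le) auto
  also have "... <= 2 powr (p-1)*(?F x y)"
   using h p1 by(intro mult_left_mono add_mono powr_mono2) auto
  finally show ?thesis by(simp add:abs_jp)
 qed
 have *: "abs (jp p (w x-w y))*B <= 2 powr (p-1)*(?F x y)*B"
  by(rule mult_right_mono[OF far B])
 consider "x : U" "y ~: V" | "y : U" "x ~: V" | "x ~: U" "y ~: U"
  using z sub by(auto simp:z')
 thus ?thesis
 proof cases
  case 1
  hence "dl eh z = eh x" "farfun U V h z = ?F x y"
   using sub eh(2)[of y] by(auto simp:dl_def farfun_def z')
  thus ?thesis
   using * mult_left_mono[OF eh(1)[of x], of "abs (jp p (w x-w y))"]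
   by(simp add:z' dl_def abs_mult mult_ac)
 next
  case 2
  hence "dl eh z = - eh y" "farfun U V h z = ?F x y"
   using sub eh(2)[of x] by(auto simp:dl_def farfun_def z')
  thus ?thesis
   using * mult_left_mono[OF eh(1)[of y], of "abs (jp p (w x-w y))"]
   by(simp add:z' dl_def abs_mult mult_ac)
 next
  case 3
  thus ?thesis using eh(2) B farfun_nonneg[of U V h z] by(simp add:z' dl_def)
 qed
qed

text \<open>On V x V Young's inequality bounds the integrand by the two energy densities, and off V
  x V \<open>farfun\<close> does. The weak form thus makes sense for functions with a tail and a
  local energy only.\<close>

lemma integrable_jp_dl:
 assumes w: "tail w" "energy V w < infy" and UV: "inside U V"
  and [measurable]: "eh : Bor"
  and eh: "!!x. (abs (eh x)) <= B" "!!x. x ~: U ==> eh x = 0" "energy V eh < infy"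
 shows "integrable mu (%z. jp p (dl w z)*dl eh z)"
proof -
 let ?F = "%z. en (norm (jp p (dl w z)*dl eh z))"
 have [measurable]: "w : Bor" "U : sets borel" "V : sets borel"
  using w UV by(auto simp:tail_def inside_def)
 have "0 <= B" using eh(1) abs_ge_zero order_trans by blast
 let ?G = "%z. (en (dl w z |^ p)*ind (V \<times> V) z+en (dl eh z |^ p)*ind (V \<times> V) z)+en (2 powr (p-1)*B)*en (farfun U V w z)"
 have "(NM z. ?F z) <= (NM z. ?G z)"
 proof(rule nn_integral_mono)
  fix z
  show "?F z <= ?G z"
  proof(cases "z : V \<times> V")
   case True
   have "abs (jp p (dl w z)*dl eh z) <= dl w z |^ p+dl eh z |^ p"
    using Young_powr'[OF p1, of "abs (dl w z)" "abs (dl eh z)"] by(simp add:abs_mult abs_jp)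
   hence "?F z <= en (dl w z |^ p)+en (dl eh z |^ p)"
    by(simp add:ennreal_leI flip:ennreal_plus)
   thus ?thesis using True by(simp add:add_increasing2)
  next
   case False
   have "?F z <= en (2 powr (p-1)*B)*en (farfun U V w z)"
    using jp_dl_far_le[OF insideD[OF UV] _ eh(1,2) False, of w w] \<open>0 <= B\<close> farfun_nonneg
    by(simp add:ennreal_leI flip:ennreal_mult)
   thus ?thesis using False by simp
  qed
 qed
 also have "... = energy V w+energy V eh+en (2 powr (p-1)*B)*(NM z. en (farfun U V w z))"
  unfolding energy_def by(simp add:nn_integral_add nn_integral_cmult)
 also have "... < infy"
  using w eh farfun_finite[OF w(1) UV] by(simp add:ennreal_mult_less_top)
 finally have "(NM z. ?F z) < infy" .
 thus ?thesis
  by(intro integrableI_bounded) measurable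
qed

lemma energy_lsc:
 assumes [measurable]: "!!j. f j : Bor" "V : sets borel"
  and lim: "!!x. x : V ==> (%j. f j x) ~> g x" and bnd: "!!j. energy V (f j) <= M"
 shows "energy V g <= M"
proof -
 let ?F = "%z. liminf (%j. en (dl (f j) z |^ p)*ind (V \<times> V) z)"
 have "energy V g = (NM z. ?F z)"
  unfolding energy_def
 proof(rule nn_integral_cong)
  fix z
  show "en (dl g z |^ p)*ind (V \<times> V) z = ?F z"
  proof(cases "z : V \<times> V")
   case True
   hence "(%j. (abs (dl (f j) z)) powr p) ~> dl g z |^ p"
    using p0 unfolding dl_def by(intro tendsto_intros tendsto_powr' lim) auto
   hence "(%j. en (dl (f j) z |^ p)) ~> en (dl g z |^ p)"
    by(rule tendsto_ennrealI)
   from lim_imp_Liminf[OF _ this] show ?thesis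
    using True by simp
  qed (simp add:Liminf_const)
 qed
 also have "... <= liminf (%j. energy V (f j))"
  unfolding energy_def by(rule nn_integral_liminf) measurable
 also have "... <= M"
  by(rule Liminf_le) (use bnd in auto)
 finally show ?thesis .
qed

lemma jp_conj_powr:
 "jp p a |^ (p/(p-1)) = a |^ p"
 using p1 by(simp add:abs_jp powr_powr)

lemma conj_exponents: "1 < p/(p-1)" "1/(p/(p-1))+1/p = 1" "1/p+1/(p/(p-1)) = 1"
proof -
 have "(p-1)/p+1/p = 1"
  using p0 by(simp add:add_divide_distrib[symmetric])
 thus "1 < p/(p-1)" "1/(p/(p-1))+1/p = 1" "1/p+1/(p/(p-1)) = 1"
  using p1 by(simp_all add:add.commute)
qed

lemma energy_le_sum:
 assumes [measurable]: "f : Bor" "g : Bor" "V : sets borel"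
  and le: "!!x y. x : V ==> y : V ==> abs (eh x-eh y) <= abs (f x-f y)+abs (g x-g y)"
 shows "energy V eh <= en (2 powr p)*(energy V f+energy V g)"
proof -
 let ?F = "%z. en (2 powr p)*(en (dl f z |^ p)*ind (V \<times> V) z+en (dl g z |^ p)*ind (V \<times> V) z)"
 have "energy V eh <= (NM z. ?F z)"
  unfolding energy_def
 proof(rule nn_integral_mono)
  fix z
  show "en (dl eh z |^ p)*ind (V \<times> V) z <= ?F z"
  proof(cases "z : V \<times> V")
   case True
   have "dl eh z |^ p <= (abs (dl f z)+abs (dl g z)) powr p"
    using True p0 le by(intro powr_mono2) (auto simp:dl_def)
   also have "... <= 2 powr p*(dl f z |^ p+dl g z |^ p)"
    using p0 by(intro powr_add_le) auto
   finally have "en (dl eh z |^ p) <= en (2 powr p*(dl f z |^ p+dl g z |^ p))"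
    by(rule ennreal_leI)
   thus ?thesis using True by(simp add:ennreal_mult ennreal_plus)
  qed simp
 qed
 also have "... = en (2 powr p)*(energy V f+energy V g)"
  unfolding energy_def by(subst nn_integral_cmult, measurable, subst nn_integral_add, measurable)
 finally show ?thesis .
qed

lemma integral_tendsto_split:
 fixes f :: "nat => 'a \<times> 'a => real"
 assumes int: "!!j. integrable mu (f j)" "integrable mu g"
  and [measurable]: "V : sets borel" "H : Bor"
  and near: "(%j. NM z. en (abs (f j z-g z))*ind (V \<times> V) z) ~> 0"
  and lim: "!!z. (%j. f j z) ~> g z"
  and H: "!!j z. z ~: V \<times> V ==> abs (f j z) <= H z" "(NM z. en (H z)) < infy"
 shows "(%j. BM z. f j z) ~> (BM z. g z)"
proof(rule tendsto_L1_int[OF int])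
 let ?G = "%j. (NM z. en (abs (f j z-g z))*ind (V \<times> V) z)"
 let ?F = "%j z. en (abs (f j z-g z))*ind (- (V \<times> V)) z"
 have [measurable]: "f j : Bor" "g : Bor" for j
  using int by(auto dest:borel_measurable_integrable)
 have g: "abs (g z) <= H z" if "z ~: V \<times> V" for z
  by(rule tendsto_upperbound[OF tendsto_rabs[OF lim[of z]]]) (use H(1)[OF that] in auto)
 have far: "(%j. NM z. ?F j z) ~> (NM z. 0)"
 proof(rule nn_integral_dominated_convergence[where w = "%z. en (2*H z)"])
  show "(NM z. en (2*H z)) < infy"
   using H(2) by(simp add:ennreal_mult' nn_integral_cmult ennreal_mult_less_top)
  show "AE z in mu. ?F j z <= en (2*H z)" for j
  proof(rule AE_I2)
   fix z
   show "?F j z <= en (2*H z)"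
   proof(cases "z : V \<times> V")
    case False
    have "abs (f j z-g z) <= 2*H z"
     using H(1)[OF False, of j] g[OF False] by linarith
    thus ?thesis
     using False by(simp add:ennreal_leI)
   qed simp
  qed
  show "AE z in mu. (%j. ?F j z) ~> 0"
  proof(rule AE_I2)
   fix z
   have "(%j. (abs (f j z-g z))) ~> abs (g z-g z)"
    by(intro tendsto_intros lim)
   hence "(%j. en (abs (f j z-g z))) ~> en 0"
    by(intro tendsto_ennrealI) simp
   thus "(%j. ?F j z) ~> 0"
    by(cases "z : V \<times> V") simp_all
  qed
 qed measurable
 have "(%j. ?G j+(NM z. ?F j z)) ~> 0+(NM z. 0)"
  by(intro tendsto_add near far)
 moreover have "?G j+(NM z. ?F j z) = (NM z. en (norm (f j z-g z)))" for j
  by(subst nn_integral_add[symmetric]) (auto intro!: nn_integral_cong split:split_indicator)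
 ultimately show "(%j. NM z. en (norm (f j z-g z))) ~> 0"
  by simp
qed

text \<open>Stands in for weak compactness. On V x V the functions \<open>jp p (dl (w j))\<close>
  are bounded in L^(p/(p-1)) and converge pointwise, which suffices against the fixed increment of
  \<open>eh\<close> in L^p (\<open>nn_integral_product_tendsto_0\<close>). Off V x V the far
  majorant of \<open>h\<close> dominates.\<close>

lemma jp_dl_tendsto:
 assumes UV: "inside U V" and h: "tail h"
  and w [measurable]: "!!j. w j : Bor" "!!j x. (abs (w j x)) <= abs (h x)" "!!x. (%j. w j x) ~> g x"
   "!!j. energy V (w j) <= en M" "0 <= M"
  and eh [measurable]: "eh : Bor" "!!x. (abs (eh x)) <= B" "!!x. x ~: U ==> eh x = 0" "energy V eh < infy"
 shows "(%j. BM z. jp p (dl (w j) z)*dl eh z) ~> (BM z. jp p (dl g z)*dl eh z)"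
proof -
 let ?E = "%z. jp p (dl g z)*dl eh z"
 let ?D = "%z. 2 powr (p-1)*B*farfun U V h z"
 let ?C = "%z. (%j. (abs (jp p (dl (w j) z)-jp p (dl g z)))*ind (V \<times> V) z)"
 let ?B = "%j z. en (dl (w j) z |^ p)*ind (V \<times> V) z+en (dl g z |^ p)*ind (V \<times> V) z"
 let ?A = "%j z. jp p (dl (w j) z)*dl eh z"
 let ?G = "%z. abs (dl eh z)*ind (V \<times> V) z"
 let ?F = "%j z. abs (jp p (dl (w j) z)-jp p (dl g z))*ind (V \<times> V) z"
 have [measurable]: "h : Bor" "U : sets borel" "V : sets borel"
  using UV h by(auto simp:tail_def inside_def)
 have B: "0 <= B" using eh(2) abs_ge_zero order_trans by blast
 have [measurable]: "g : Bor"
  using w(1,3) by(rule borel_measurable_LIMSEQ_real[rotated])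
 have gh: "abs (g x) <= abs (h x)" for x
  by(rule tendsto_upperbound[OF tendsto_rabs[OF w(3)[of x]]]) (use w(2) in auto)
 have eg: "energy V g <= en M"
  by(rule energy_lsc[OF _ _ w(3,4)]) measurable
 have tl: "tail (w j)" "tail g" for j
  by(rule tail_mono[OF h]; use w gh in simp)+
 have fin: "energy V (w j) < infy" "energy V g < infy" for j
  using w(4)[of j] eg by(auto simp:order_le_less_trans)
 show ?thesis
 proof(rule integral_tendsto_split[where V = V and H = "%z. ?D z"])
  show "integrable mu (%z. ?A j z)" "integrable mu (%z. ?E z)" for j
   using integrable_jp_dl[OF tl(1) fin(1) UV eh] integrable_jp_dl[OF tl(2) fin(2) UV eh] by blast+
  show "abs (?A j z) <= ?D z" if "z ~: V \<times> V" for j z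
   by(rule jp_dl_far_le[OF insideD[OF UV] w(2) eh(2,3) that])
  show "(NM z. en (?D z)) < infy"
   using farfun_finite[OF h UV] B
   by(simp add:ennreal_mult farfun_nonneg nn_integral_cmult ennreal_mult_less_top)
  show "(%j. ?A j z) ~> ?E z" for z
   unfolding dl_def by(intro tendsto_intros tendsto_jp p1 w)
  let ?P = "p/(p-1)"
  have "(%j. NM z. en ((?F j z)*(?G z))) ~> 0"
  proof(rule nn_integral_product_tendsto_0[where P = ?P and Q = p and C = "2 powr ?P*(M+M)"])
   show "?C z ~> 0" for z
   proof -
    have "?C z ~> abs (jp p (dl g z)-jp p (dl g z))*ind (V \<times> V) z"
     unfolding dl_def by(intro tendsto_intros tendsto_jp p1 w)
    thus ?thesis by simp
   qed
   show "0 <= 2 powr ?P*(M+M)"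
    using w(5) by simp
   show "(NM z. en ((?F j z) powr ?P)) <= en (2 powr ?P*(M+M))" for j
   proof -
    have "(NM z. en ((?F j z) powr ?P)) <= (NM z. en (2 powr ?P)*(?B j z))"
    proof(rule nn_integral_mono)
     fix z
     have "(jp p (dl (w j) z)-jp p (dl g z)) |^ ?P <= 2 powr ?P*(dl (w j) z |^ p+dl g z |^ p)"
      using abs_powr_add_le(2)[of ?P "jp p (dl (w j) z)" "jp p (dl g z)"] conj_exponents
      unfolding jp_conj_powr by simp
     thus "en ((?F j z) powr ?P) <= en (2 powr ?P)*(?B j z)"
      by(cases "z : V \<times> V") (simp_all add:ennreal_leI flip:ennreal_mult ennreal_plus)
    qed
    also have "... = en (2 powr ?P)*(energy V (w j)+energy V g)"
     unfolding energy_def by(simp add:nn_integral_cmult nn_integral_add)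
    also have "... <= en (2 powr ?P)*(en M+en M)"
     by(intro mult_left_mono add_mono w(4) eg) auto
    also have "... = en (2 powr ?P*(M+M))"
     using w(5) by(subst ennreal_mult) (auto simp del:mult_2 simp flip:ennreal_plus)
    finally show ?thesis .
   qed
   show "(NM z. en ((?G z) powr p)) < infy"
   proof -
    have "(NM z. en ((?G z) powr p)) = energy V eh"
     unfolding energy_def by(intro nn_integral_cong) (simp split:split_indicator)
    thus ?thesis using eh(4) by simp
   qed
  qed (use conj_exponents p1 in auto)
  moreover have "en ((?F j z)*(?G z)) = en (abs (?A j z-?E z))*ind (V \<times> V) z" for j z
   by(simp add:abs_mult[symmetric] left_diff_distrib split:split_indicator)
  ultimately show "(%j. NM z. en (abs (?A j z-?E z))*ind (V \<times> V) z) ~> 0"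
   by simp
 qed measurable
qed

text \<open>The roles are exchanged: the increments of the tests are bounded in L^p and
  \<open>jp p (dl w)\<close> is fixed in L^(p/(p-1)). This is what passes from smooth tests to
  rougher ones.\<close>

lemma jp_dl_tendsto_right:
 assumes UV: "inside U V" and w: "tail w" "energy V w < infy"
  and eh [measurable]: "!!j. eh j : Bor" "!!j x. (abs (eh j x)) <= B" "!!j x. x ~: U ==> eh j x = 0"
  and e: "!!x. (%j. eh j x) ~> ze x" "!!j. energy V (eh j) <= en M" "0 <= M"
 shows "(%j. BM z. jp p (dl w z)*dl (eh j) z) ~> (BM z. jp p (dl w z)*dl ze z)"
proof -
 let ?E = "%z. (%j. (abs (dl (eh j) z-dl ze z))*ind (V \<times> V) z)"
 let ?D = "2 powr p*(M+M)"
 let ?C = "%z. jp p (dl w z)*dl ze z"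
 let ?B = "%z. 2 powr (p-1)*B*farfun U V w z"
 let ?A = "%z j. jp p (dl w z)*dl (eh j) z"
 let ?G = "%z. abs (jp p (dl w z))*ind (V \<times> V) z"
 let ?F = "%j z. abs (dl (eh j) z-dl ze z)*ind (V \<times> V) z"
 have [measurable]: "w : Bor" "U : sets borel" "V : sets borel"
  using UV w by(auto simp:tail_def inside_def)
 have B: "0 <= B" using eh(2) abs_ge_zero order_trans by blast
 have ze[measurable]: "ze : Bor"
  using eh(1) e(1) by(rule borel_measurable_LIMSEQ_real[rotated])
 have zeB: "abs (ze x) <= B" for x
  by(rule tendsto_upperbound[OF tendsto_rabs[OF e(1)[of x]]]) (use eh(2) in auto)
 have ze0: "ze x = 0" if "x ~: U" for x
  using e(1)[of x] eh(3)[OF that] by(simp add:LIMSEQ_const_iff)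
 have eg: "energy V ze <= en M"
  by(rule energy_lsc[OF _ _ e(1,2)]) measurable
 have fin: "energy V (eh j) < infy" "energy V ze < infy" for j
  using e(2)[of j] eg by(auto simp:order_le_less_trans)
 show ?thesis
 proof(rule integral_tendsto_split[where V = V and H = "%z. ?B z"])
  show "integrable mu (%z. ?A z j)" "integrable mu (%z. ?C z)" for j
   using integrable_jp_dl[OF w UV eh fin(1)] integrable_jp_dl[OF w UV ze zeB ze0 fin(2)] by blast+
  show "abs (?A z j) <= ?B z" if "z ~: V \<times> V" for j z
   by(rule jp_dl_far_le[OF insideD[OF UV] order_refl eh(2,3) that])
  show "(NM z. en (?B z)) < infy"
   using farfun_finite[OF w(1) UV] B
   by(simp add:ennreal_mult farfun_nonneg nn_integral_cmult ennreal_mult_less_top)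
  show "(%j. ?A z j) ~> ?C z" for z
   unfolding dl_def by(intro tendsto_intros e)
  let ?Q = "p/(p-1)"
  have "(%j. NM z. en ((?F j z)*(?G z))) ~> 0"
  proof(rule nn_integral_product_tendsto_0[where P = p and Q = ?Q and C = "?D"])
   show "?E z ~> 0" for z
   proof -
    have "?E z ~> abs (dl ze z-dl ze z)*ind (V \<times> V) z"
     unfolding dl_def by(intro tendsto_intros e)
    thus ?thesis by simp
   qed
   show "0 <= ?D"
    using e(3) by simp
   show "(NM z. en ((?F j z) powr p)) <= en (?D)" for j
   proof -
    have "(NM z. en ((?F j z) powr p)) = energy V (%x. eh j x-ze x)"
     unfolding energy_def by(intro nn_integral_cong) (simp add:dl_def algebra_simps split:split_indicator)
    also have "... <= en (2 powr p)*(energy V (eh j)+energy V ze)"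
     by(rule energy_le_sum) auto
    also have "... <= en (2 powr p)*(en M+en M)"
     by(intro mult_left_mono add_mono e(2) eg) auto
    also have "... = en (?D)"
     using e(3) by(subst ennreal_mult) (auto simp del:mult_2 simp flip:ennreal_plus)
    finally show ?thesis .
   qed
   show "(NM z. en ((?G z) powr ?Q)) < infy"
   proof -
    have "(NM z. en ((?G z) powr ?Q)) = energy V w"
     unfolding energy_def by(intro nn_integral_cong) (simp add:jp_conj_powr split:split_indicator)
    thus ?thesis using w(2) by simp
   qed
  qed (use conj_exponents p1 in auto)
  moreover have "en ((?F j z)*(?G z)) = en (abs (?A z j-?C z))*ind (V \<times> V) z" for j z
   by(simp add:abs_mult[symmetric] algebra_simps split:split_indicator)
  ultimately show "(%j. NM z. en (abs (?A z j-?C z))*ind (V \<times> V) z) ~> 0"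
   by simp
 qed measurable
qed

end

context frac_kernel
begin

lemma k_measurable_right [measurable]: "k x : Bor"
proof -
 have "(%y. (x, y)) : borel \<rightarrow>\<^sub>M borel"
  by(intro borel_measurable_continuous_onI continuous_intros)
 from measurable_compose[OF this k_meas] show ?thesis by simp
qed

lemma energy_lipschitz:
 assumes [measurable]: "V : sets borel" "f : Bor" and "0 < l" "0 < H"
  and f: "!!x y. x : V ==> y : V ==> abs (f x-f y) <= H"
   "!!x y. x : V ==> y : V ==> abs (f x-f y) <= H*(norm (x-y)/l)"
 shows "energy V f <= en (H powr p*(lip_const*l powr-(s*p)))*em V"
proof -
 let ?G = "H powr p*(lip_const*l powr-(s*p))"
 let ?F = "%x y. en ((f x-f y) |^ p)*ind (V \<times> V) (x, y)*en (k x y)"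
 have "energy V f = (NL x. NL y. ?F x y)"
  unfolding energy_def by(subst nn_integral_mu) (auto simp:dl_def)
 also have "... <= (NL x. en (?G)*ind V x)"
 proof(rule nn_integral_mono)
  fix x
  show "(NL y. ?F x y) <= en (?G)*ind V x"
  proof(cases "x : V")
   case True
   define r where "r y = (f x-f y)/H*ind V y" for y
   have [measurable]: "r : Bor"
    unfolding r_def by measurable
   have "(NL y. ?F x y) = (NL y. en (H powr p)*(en (r y |^ p)*en (k x y)))"
   proof(rule nn_integral_cong)
    fix y
    show "?F x y = en (H powr p)*(en (r y |^ p)*en (k x y))"
    proof(cases "y : V")
     case y: True
     have "(f x-f y) |^ p = H powr p*r y |^ p"
      using y \<open>0 < H\<close> by(simp add:r_def powr_mult[symmetric])
     thus ?thesis
      using y True by(simp add:ennreal_mult mult.assoc)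
    qed (simp add:r_def)
   qed
   also have "... = en (H powr p)*(NL y. en (r y |^ p)*en (k x y))"
    by(rule nn_integral_cmult) measurable
   also have "... <= en (H powr p)*en (lip_const*l powr-(s*p))"
   proof(intro mult_left_mono nn_integral_lip_kernel)
    show "abs (r y) <= 1" for y
     using f(1)[OF True, of y] \<open>0 < H\<close> by(simp add:r_def split:split_indicator)
    show "abs (r y) <= norm (x-y)/l" for y
     using f(2)[OF True, of y] \<open>0 < H\<close> \<open>0 < l\<close>
     by(simp add:r_def field_simps split:split_indicator)
   qed (use \<open>0 < l\<close> in auto)
   also have "... = en (?G)"
    using lip_const_nonneg by(simp add:ennreal_mult)
   finally show ?thesis using True by simp
  qed simp
 qed
 also have "... = en (?G)*em V"
  by(simp add:nn_integral_cmult_indicator)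
 finally show ?thesis .
qed

lemma energy_mono: "V <= V' ==> energy V f <= energy V' f"
 unfolding energy_def by(intro nn_integral_mono) (auto split:split_indicator)

lemma energy_contraction:
 assumes "!!x y. x : V ==> y : V ==> abs (f x-f y) <= abs (g x-g y)"
 shows "energy V f <= energy V g"
 unfolding energy_def dl_def using assms p0
 by(intro nn_integral_mono) (auto intro!: ennreal_leI powr_mono2 split:split_indicator)

end

section \<open>The obstacle problem: existence of a minimiser and the variational inequality\<close>

locale obstacle = frac_kernel s p La k for s p La and k :: "'a::euclidean_space => 'a => real" +
 fixes D D0 :: "'a set" and g :: "'a => real" and lo hi A :: real
 assumes open_D: "open D" and open_D0: "open D0" and D_D0: "inside D D0" and bounded_D0: "bounded D0"
  and tail_g: "tail g" and g_hi: "!!x. g x <= hi" and g_lo: "!!x. x : D0 ==> lo <= g x"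
  and g_lip: "!!x y. x : D0 ==> y : D0 ==> abs (g x-g y) <= A*norm (x-y)" and A_pos: "0 < A"
  and lo_hi: "lo < hi"
begin

lemma D_sub: "D <= D0"
 using insideD[OF D_D0] .

lemma D_sets [measurable]: "D : sets borel" "D0 : sets borel"
 using open_D open_D0 by auto

lemma g_meas [measurable]: "g : Bor"
 using tail_g by(rule tail_measurable)

lemma energy_g: "energy D0 g < infy"
proof -
 have "energy D0 g <= en ((hi-lo) powr p*(lip_const*((hi-lo)/A) powr-(s*p)))*em D0"
 proof(rule energy_lipschitz)
  fix x y assume "x : D0" "y : D0"
  thus "abs (g x-g y) <= hi-lo" "abs (g x-g y) <= (hi-lo)*(norm (x-y)/((hi-lo)/A))"
   using g_hi[of x] g_hi[of y] g_lo[of x] g_lo[of y] g_lip[of x y] lo_hi by(auto simp:mult.commute)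
 qed (use lo_hi A_pos in auto)
 also have "... < infy"
  using emeasure_bounded_finite[OF bounded_D0] by(simp add:ennreal_mult_less_top)
 finally show ?thesis .
qed

text \<open>The upper constraint \<open>hi + 1\<close> leaves room above \<open>hi\<close>: the
  minimiser is truncated at \<open>hi\<close> afterwards, and then small upward variations are still
  admissible.\<close>

definition adm :: "('a => real) => bool"
 where "adm z \<longleftrightarrow> z : Bor & (ALL x. x ~: D --> z x = g x) & (ALL x:D. g x <= z x & z x <= hi+1)"

definition dom :: "'a => real"
 where "dom x = abs (g x)+(abs hi+abs lo+1)"

lemma tail_dom: "tail dom"
proof -
 have "tail (%x. (abs (g x)))"
  by(rule tail_mono[OF tail_g]) auto
 hence "tail (%x. (abs (g x))+(abs hi+abs lo+1))"
  by(rule tail_add) (rule tail_const)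
 thus ?thesis by(simp add:dom_def[abs_def])
qed

lemma dom_meas [measurable]: "dom : Bor"
 using tail_dom by(rule tail_measurable)

lemma adm_g: "adm g"
proof -
 have "g x <= hi+1" for x using g_hi[of x] by linarith
 thus ?thesis by(simp add:adm_def)
qed

lemma adm_meas: "adm z ==> z : Bor"
 by(simp add:adm_def)

lemma adm_le_dom:
 assumes "adm z" shows "abs (z x) <= abs (dom x)"
proof(cases "x : D")
 case True
 hence "g x <= z x" "z x <= hi+1" using assms by(auto simp:adm_def)
 thus ?thesis by(auto simp:dom_def)
next
 case False
 hence "z x = g x" using assms by(auto simp:adm_def)
 thus ?thesis by(auto simp:dom_def)
qed

lemma adm_diff:
 assumes "adm z" "adm z'"
 shows "abs (z x-z' x) <= hi+1-lo" and "x ~: D ==> z x-z' x = 0"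
proof -
 show "abs (z x-z' x) <= hi+1-lo"
 proof(cases "x : D")
  case True
  hence "lo <= g x" using D_sub g_lo by auto
  thus ?thesis using assms True unfolding adm_def by(auto dest!: bspec)
 next
  case False
  thus ?thesis using assms lo_hi unfolding adm_def by auto
 qed
qed (use assms in \<open>auto simp:adm_def\<close>)

lemma adm_tail: "adm z ==> tail z"
 by(rule tail_mono[OF tail_dom]) (auto intro:adm_meas simp:adm_le_dom)

definition far_const :: real
 where "far_const = p*(2*(2 powr (p-1)*(hi+1-lo)))"

lemma far_const_nonneg: "0 <= far_const"
 using lo_hi p0 by(auto simp:far_const_def intro!: mult_nonneg_nonneg)

text \<open>An integrable bound, common to all admissible \<open>w\<close>, for the negative part of
  |dl w|^p - |dl g|^p: on D0 x D0 that part is at most |dl g|^p, and elsewhere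
  \<open>far_diff_le\<close> applies.\<close>

definition low :: "'a \<times> 'a => real"
 where "low z = dl g z |^ p*ind (D0 \<times> D0) z+far_const*farfun D D0 dom z"

text \<open>Since the exterior data only have a tail of order p - 1, |dl w|^p need not be integrable
  over all pairs. Subtracting the density of \<open>g\<close> makes the functional finite for
  competitors of finite energy on \<open>D0\<close>, and adding the fixed integrable
  \<open>low\<close> makes it nonnegative, so that Fatou's lemma applies. Up to these fixed terms,
  the energy is minimised.\<close>

definition rel_energy :: "('a => real) => 'a \<times> 'a => real"
 where "rel_energy w z = dl w z |^ p-dl g z |^ p+low z"

definition Ph :: "('a => real) => ennreal"
 where "Ph w = (NM z. en (rel_energy w z))"

lemma low_nonneg: "0 <= low z"
 using far_const_nonneg by(auto simp:low_def farfun_nonneg)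

lemma low_meas [measurable]: "low : Bor"
 unfolding low_def[abs_def] by measurable

lemma rel_energy_meas [measurable (raw)]:
 assumes [measurable]: "w : Bor"
 shows "rel_energy w : Bor"
 unfolding rel_energy_def[abs_def] by measurable

lemma nn_integral_low: "(NM z. en (low z)) < infy"
proof -
 have "(NM z. en (low z)) = (NM z. en (dl g z |^ p)*ind (D0 \<times> D0) z+en far_const*en (farfun D D0 dom z))"
  using far_const_nonneg
  by(intro nn_integral_cong) (auto simp:low_def ennreal_plus ennreal_mult farfun_nonneg split:split_indicator)
 also have "... = energy D0 g+en far_const*(NM z. en (farfun D D0 dom z))"
  unfolding energy_def by(simp add:nn_integral_add nn_integral_cmult)
 also have "... < infy"
  using energy_g farfun_finite[OF tail_dom D_D0] by(simp add:ennreal_mult_less_top)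
 finally show ?thesis .
qed

text \<open>The function w - g is bounded and vanishes off \<open>D\<close>. The bound of
  \<open>powr_diff_le\<close> for the difference of p-th powers is therefore a sum of two products
  of the kind estimated in \<open>jp_dl_far_le\<close>, which also explains
  \<open>far_const\<close>.\<close>

lemma far_diff_le:
 assumes "adm w" "z ~: D0 \<times> D0"
 shows "abs (dl w z |^ p-dl g z |^ p) <= far_const*farfun D D0 dom z"
proof -
 let ?eh = "%x. w x-g x"
 let ?F = "2 powr (p-1)*(hi+1-lo)*farfun D D0 dom z"
 have "abs (dl w z |^ p-dl g z |^ p) <= p*(dl w z |^ (p-1)+dl g z |^ (p-1))*abs (dl w z-dl g z)"
  by(rule powr_diff_le[OF p1])
 also have "... = p*(abs (jp p (dl w z)*dl ?eh z)+abs (jp p (dl g z)*dl ?eh z))"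
 proof -
  have "dl ?eh z = dl w z-dl g z" by(simp add:dl_def)
  thus ?thesis by(simp only: abs_mult abs_jp distrib_right mult.assoc)
 qed
 also have "... <= p*(?F+?F)"
  using p0 by(intro mult_left_mono add_mono jp_dl_far_le[OF D_sub] adm_diff adm_le_dom assms adm_g) auto
 finally show ?thesis by(simp add:far_const_def algebra_simps)
qed

lemma rel_energy_nonneg:
 assumes "adm w" shows "0 <= rel_energy w z"
proof(cases "z : D0 \<times> D0")
 case True
 thus ?thesis using far_const_nonneg farfun_nonneg by(simp add:rel_energy_def low_def)
next
 case False
 thus ?thesis using far_diff_le[OF assms False] by(simp add:rel_energy_def low_def)
qed

lemma energy_le_Ph:
 assumes "adm w" shows "energy D0 w <= Ph w"
 unfolding energy_def Ph_def
 using far_const_nonneg farfun_nonneg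
 by(intro nn_integral_mono) (auto simp:rel_energy_def low_def intro!: ennreal_leI split:split_indicator)

lemma integrable_rel_energy:
 assumes "adm w" "energy D0 w < infy"
 shows "integrable mu (rel_energy w)"
proof -
 let ?F = "%z. en (dl w z |^ p)*ind (D0 \<times> D0) z+en 2*en (low z)"
 have [measurable]: "w : Bor" using assms by(simp add:adm_def)
 have "(NM z. en (norm (rel_energy w z))) <= (NM z. ?F z)"
 proof(rule nn_integral_mono)
  fix z
  have l: "en 2*en (low z) = en (2*low z)"
   using low_nonneg by(simp only: ennreal_mult)
  show "en (norm (rel_energy w z)) <= ?F z"
  proof(cases "z : D0 \<times> D0")
   case True
   have "rel_energy w z <= dl w z |^ p+2*low z"
    using low_nonneg[of z] powr_ge_zero[of "abs (dl g z)" p] unfolding rel_energy_def by linarith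
   thus ?thesis
    unfolding l using True low_nonneg[of z] rel_energy_nonneg[OF assms(1), of z]
    by(simp add:ennreal_plus[symmetric] ennreal_leI del:ennreal_plus)
  next
   case False
   have "rel_energy w z <= 2*low z"
    using far_diff_le[OF assms(1) False] False by(simp add:rel_energy_def low_def)
   thus ?thesis
    unfolding l using False rel_energy_nonneg[OF assms(1), of z] by(simp add:ennreal_leI)
  qed
 qed
 also have "... = energy D0 w+en 2*(NM z. en (low z))"
  unfolding energy_def by(subst nn_integral_add) (simp_all add:nn_integral_cmult)
 also have "... < infy"
  using assms nn_integral_low by(simp add:ennreal_mult_less_top)
 finally show ?thesis
  by(intro integrableI_bounded) measurable
qed

lemma Ph_eq_integral:
 assumes "adm w" "energy D0 w < infy"
 shows "Ph w = en (BM z. rel_energy w z)"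
 unfolding Ph_def using integrable_rel_energy[OF assms] rel_energy_nonneg[OF assms(1)]
 by(intro nn_integral_eq_integral) auto

lemma Ph_g: "Ph g < infy"
 using Ph_eq_integral[OF adm_g energy_g] by simp

lemma Ph_max_min:
 assumes "adm w" "adm z"
 shows "Ph (%x. max (w x) (z x))+Ph (%x. min (w x) (z x)) <= Ph w+Ph z"
proof -
 let ?G = "%x. min (w x) (z x)"
 let ?F = "%x. max (w x) (z x)"
 have a: "adm (?F)" "adm (?G)"
  using assms by(auto simp:adm_def)
 note [measurable] = assms[THEN adm_meas] a[THEN adm_meas]
 have "Ph (?F)+Ph (?G) = (NM v. en (rel_energy (?F) v+rel_energy (?G) v))"
  unfolding Ph_def by(subst nn_integral_add[symmetric]) (auto simp:rel_energy_nonneg a)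
 also have "... <= (NM v. en (rel_energy w v+rel_energy z v))"
 proof(intro nn_integral_mono ennreal_leI)
  fix v
  show "rel_energy (?F) v+rel_energy (?G) v <= rel_energy w v+rel_energy z v"
   using powr_max_min[OF p1, of "w (fst v)" "z (fst v)" "w (snd v)" "z (snd v)"]
   unfolding rel_energy_def dl_def by linarith
 qed
 also have "... = Ph w+Ph z"
  unfolding Ph_def by(subst nn_integral_add[symmetric]) (auto simp:rel_energy_nonneg assms)
 finally show ?thesis .
qed

lemma Ph_lsc:
 assumes "!!j. adm (w j)" and lim: "!!x. (%j. w j x) ~> z x"
 shows "adm z" and "Ph z <= liminf (%j. Ph (w j))"
proof -
 have [measurable]: "w j : Bor" for j using assms by(simp add:adm_def)
 have [measurable]: "z : Bor"
  by(rule borel_measurable_LIMSEQ_real[OF lim]) simp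
 have "z x = g x" if "x ~: D" for x
  using lim[of x] assms(1) that by(simp add:adm_def LIMSEQ_const_iff)
 moreover have "g x <= z x & z x <= hi+1" if "x : D" for x
  using assms(1) that by(intro conjI LIMSEQ_le_const[OF lim] LIMSEQ_le_const2[OF lim]) (auto simp:adm_def)
 ultimately show "adm z" by(simp add:adm_def)
 have "Ph z = (NM v. liminf (%j. en (rel_energy (w j) v)))"
  unfolding Ph_def
 proof(rule nn_integral_cong)
  fix v
  have "(%j. rel_energy (w j) v) ~> rel_energy z v"
   unfolding rel_energy_def dl_def using p0 by(intro tendsto_intros tendsto_powr' lim) auto
  hence "(%j. en (rel_energy (w j) v)) ~> en (rel_energy z v)"
   by(rule tendsto_ennrealI)
  from lim_imp_Liminf[OF _ this] show "en (rel_energy z v) = liminf (%j. en (rel_energy (w j) v))"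
   by simp
 qed
 also have "... <= liminf (%j. Ph (w j))"
  unfolding Ph_def by(rule nn_integral_liminf) measurable
 finally show "Ph z <= liminf (%j. Ph (w j))" .
qed

text \<open>Existence of a minimiser needs no compactness: by submodularity of \<open>Ph\<close> the maxima of tails of a
 minimising sequence are again almost minimising, so its upper limit is a minimiser by Fatou's lemma.\<close>

primrec tail_max :: "(nat => 'a => real) => nat => nat => 'a => real"
 where "tail_max z i 0 = z i"
 | "tail_max z i (Suc m) = (%x. max (tail_max z i m x) (z (i+Suc m) x))"

lemma minimiser_exists:
 obtains wm where "adm wm" "!!z. adm z ==> Ph wm <= Ph z"
proof -
 let ?G = "%I i. I+en (2*(1/2)^i)"
 let ?F = "%i m. en (2*(1/2)^i-(1/2)^(i+m))"
 define I where "I = (INF z\<in>Collect adm. Ph z)"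
 have I_le: "I <= Ph z" if "adm z" for z
  unfolding I_def using that by(intro INF_lower) simp
 have I_fin: "I < infy"
  using I_le[OF adm_g] Ph_g by(rule order_le_less_trans)
 have "EX z. adm z & Ph z < I+en ((1/2)^i)" for i :: nat
 proof -
  have "I < I+en ((1/2)^i)"
   using I_fin ennreal_add_left_cancel_less[of I 0 "en ((1/2)^i)"] by simp
  thus ?thesis
   unfolding I_def by(subst (asm) INF_less_iff) auto
 qed
 then obtain z where z: "!!i. adm (z i)" "!!i. Ph (z i) < I+en ((1/2)^i)"
  by metis
 let ?M = "tail_max z"
 have adm_M: "adm (?M i m)" for i m
 proof(induction m)
  case 0 thus ?case using z by simp
 next
  case (Suc m)
  thus ?case using z(1)[of "i+Suc m"] by(auto simp:adm_def)
 qed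
 \<comment> \<open>The minimum of two admissible functions is admissible, so its value is at least
   \<open>I\<close>. By submodularity the maximum with one more function costs at most the excess of
   that function, 2^-(i+m+1). The bound is the partial sum of these excesses.\<close>
 have Ph_M: "Ph (?M i m) <= I+?F i m" for i m
 proof(induction m)
  case 0
  show ?case using z(2)[of i] by simp
 next
  case (Suc m)
  have "I+Ph (?M i (Suc m)) <= Ph (%x. min (?M i m x) (z (i+Suc m) x))+Ph (?M i (Suc m))"
   using adm_M[of i m] z(1)[of "i+Suc m"] by(intro add_right_mono I_le) (auto simp:adm_def)
  also have "... <= Ph (?M i m)+Ph (z (i+Suc m))"
   using Ph_max_min[OF adm_M[of i m] z(1)[of "i+Suc m"]] by(simp add:add.commute)
  also have "... <= (I+?F i m)+(I+en ((1/2)^(i+Suc m)))"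
   using z(2)[of "i+Suc m"] by(intro add_mono Suc.IH) auto
  also have "... = I+(I+(?F i m+en ((1/2)^(i+Suc m))))"
   by(simp add:ac_simps)
  also have "?F i m+en ((1/2)^(i+Suc m)) = en (2*(1/2)^i-(1/2)^(i+Suc m))"
  proof -
   have "(1/2::real)^(i+m) <= (1/2)^i"
    by(rule power_decreasing) auto
   hence "0 <= 2*(1/2::real)^i-(1/2)^(i+m)"
    by(smt (verit) zero_le_power divide_nonneg_nonneg)
   thus ?thesis
    by(subst ennreal_plus[symmetric]) auto
  qed
  finally show ?case
   using I_fin by(subst (asm) ennreal_add_left_cancel_le) auto
 qed
 have M_inc: "incseq (%m. ?M i m x)" for i x
  by(rule incseq_SucI) simp
 have M_bd: "?M i m x <= max (g x) (hi+1)" for i m x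
  using adm_M[of i m] by(cases "x : D") (auto simp:adm_def)
 have "EX l. (%m. ?M i m x) ~> l" for i x
  by(rule incseq_convergent[OF M_inc[of i x], of "max (g x) (hi+1)"]) (use M_bd in blast)+
 then obtain Z where Z: "!!i x. (%m. ?M i m x) ~> Z i x"
  by metis
 have adm_Z: "adm (Z i)" for i
  by(rule Ph_lsc(1)[OF adm_M Z])
 have Ph_Z: "Ph (Z i) <= ?G I i" for i
 proof -
  have "Ph (Z i) <= liminf (%m. Ph (?M i m))"
   by(rule Ph_lsc(2)[OF adm_M Z])
  also have "... <= ?G I i"
  proof(rule Liminf_le)
   show "\<forall>\<^sub>F m in sequentially. Ph (?M i m) <= ?G I i"
    by(intro always_eventually allI order_trans[OF Ph_M] add_left_mono ennreal_leI) simp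
  qed simp
  finally show ?thesis .
 qed
 \<comment> \<open>Starting later takes the maximum over fewer functions, so the limits
   \<open>Z i\<close> decrease in i. Their limit \<open>wm\<close> is the upper limit of the
   minimising sequence.\<close>
 have M_Suc: "?M (Suc i) m x <= ?M i (Suc m) x" for i m x
  by(induction m) (auto simp:max_def)
 have Z_dec: "decseq (%i. Z i x)" for x
 proof(rule decseq_SucI)
  fix i
  have "(%m. ?M i (Suc m) x) ~> Z i x"
   using Z[of i x] by(rule LIMSEQ_Suc)
  thus "Z (Suc i) x <= Z i x"
   by(rule LIMSEQ_le[OF Z]) (use M_Suc in auto)
 qed
 have Z_bd: "min (g x) lo <= Z i x" for i x
  using adm_Z[of i] by(cases "x : D") (auto simp:adm_def min_def)
 have "EX l. (%i. Z i x) ~> l" for x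
  by(rule decseq_convergent[OF Z_dec[of x], of "min (g x) lo"]) (use Z_bd in blast)+
 then obtain wm where wm: "!!x. (%i. Z i x) ~> wm x"
  by metis
 have "Ph wm <= liminf (%i. Ph (Z i))"
  by(rule Ph_lsc(2)[OF adm_Z wm])
 also have "... <= liminf (%i. ?G I i)"
  by(intro Liminf_mono always_eventually allI Ph_Z)
 also have "... = I"
 proof -
  have "(%i. 2*(1/2::real)^i) ~> 2*0"
   by(intro tendsto_intros LIMSEQ_power_zero) simp
  hence "(%i. ?G I i) ~> I+en 0"
   by(intro tendsto_add tendsto_const tendsto_ennrealI) simp
  from lim_imp_Liminf[OF _ this] show ?thesis by simp
 qed
 finally have "Ph wm <= I" .
 moreover have "adm wm" by(rule Ph_lsc(1)[OF adm_Z wm])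
 ultimately show ?thesis
  using that I_le order_trans by blast
qed

text \<open>The first variation without differentiating an integral. The tangent inequality taken at
  w_t = wm + t (z - wm), not at \<open>wm\<close>, combined with minimality gives a nonnegative weak
  form for \<open>w t\<close> for every t in (0,1]. Then t tends to 0 by
  \<open>jp_dl_tendsto\<close>, with energies bounded by convexity.\<close>

lemma minimiser_variation:
 assumes wm: "adm wm" "!!z. adm z ==> Ph wm <= Ph z" and eW: "energy D0 wm < infy"
  and z: "adm z" "energy D0 z < infy"
 shows "0 <= (BM v. jp p (dl wm v)*dl (%x. z x-wm x) v)"
proof -
 let ?G = "%wm z. energy D0 wm+energy D0 z"
 let ?F = "%j. 1/real (Suc j)"
 note [measurable] = wm(1)[THEN adm_meas] z(1)[THEN adm_meas]
 let ?eh = "%x. z x-wm x"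
 define w where "w t x = wm x+t*(z x-wm x)" for t x
 have [measurable]: "w t : Bor" for t
  unfolding w_def[abs_def] by measurable
 have w_conv: "w t x = (1-t)*wm x+t*z x" for t x
  by(simp add:w_def algebra_simps)
 have w_adm: "adm (w t)" if "0 <= t" "t <= 1" for t
  unfolding adm_def
 proof(intro conjI allI impI ballI)
  fix x
  show "w t x = g x" if "x ~: D" using wm z that by(simp add:w_def adm_def)
  assume x: "x : D"
  have 1: "g x <= wm x" "wm x <= hi+1" "g x <= z x" "z x <= hi+1"
   using wm z x by(auto simp:adm_def)
  have "(1-t)*g x+t*g x <= w t x" "w t x <= (1-t)*(hi+1)+t*(hi+1)"
   unfolding w_conv using 1 that by(intro add_mono mult_left_mono; simp)+
  thus "g x <= w t x" "w t x <= hi+1" by(simp_all add:algebra_simps)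
 qed simp
 have w_en: "energy D0 (w t) <= ?G wm z" if "0 <= t" "t <= 1" for t
 proof -
  have "dl (w t) v |^ p <= dl wm v |^ p+dl z v |^ p" for v
  proof -
   have "dl (w t) v |^ p <= (1-t)*dl wm v |^ p+t*dl z v |^ p"
    using powr_convex[OF p1 that, of "dl wm v" "dl z v"] by(simp add:dl_def w_conv algebra_simps)
   also have "... <= 1*dl wm v |^ p+1*dl z v |^ p"
    using that by(intro add_mono mult_right_mono) auto
   finally show ?thesis by simp
  qed
  hence "energy D0 (w t) <= (NM v. en (dl wm v |^ p)*ind (D0 \<times> D0) v+en (dl z v |^ p)*ind (D0 \<times> D0) v)"
   unfolding energy_def by(intro nn_integral_mono) (auto simp:ennreal_leI simp flip:ennreal_plus split:split_indicator)
  also have "... = ?G wm z"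
   unfolding energy_def by(rule nn_integral_add) measurable
  finally show ?thesis .
 qed
 have w_fin: "energy D0 (w t) < infy" if "0 <= t" "t <= 1" for t
  using w_en[OF that] eW z by(auto simp:order_le_less_trans)
 have eeh: "energy D0 ?eh < infy"
 proof -
  have "energy D0 ?eh <= en (2 powr p)*(energy D0 z+energy D0 wm)"
   by(rule energy_le_sum) auto
  also have "... < infy" using eW z by(simp add:ennreal_mult_less_top)
  finally show ?thesis .
 qed
 have pos: "0 <= (BM v. jp p (dl (w t) v)*dl ?eh v)" if t: "0 < t" "t <= 1" for t
 proof -
  have i: "integrable mu (%v. jp p (dl (w t) v)*dl ?eh v)"
   by(rule integrable_jp_dl[OF adm_tail[OF w_adm] w_fin D_D0 _ adm_diff[OF z(1) wm(1)] eeh]) (use t in auto)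
  have "en (BM v. rel_energy wm v) <= en (BM v. rel_energy (w t) v)"
   using wm(2)[OF w_adm[of t]] t unfolding Ph_eq_integral[OF wm(1) eW]
   by(simp add:Ph_eq_integral[OF w_adm[of t] w_fin[of t]])
  hence "(BM v. rel_energy wm v) <= (BM v. rel_energy (w t) v)"
   by(subst (asm) ennreal_le_iff) (auto intro!: integral_nonneg_AE simp:rel_energy_nonneg w_adm t less_imp_le)
  also have "... <= (BM v. rel_energy wm v+p*t*(jp p (dl (w t) v)*dl ?eh v))"
  proof(rule integral_mono)
   fix v
   have "dl wm v-dl (w t) v = - (t*dl ?eh v)"
    by(simp add:dl_def w_def algebra_simps)
   hence "dl (w t) v |^ p-p*jp p (dl (w t) v)*(t*dl ?eh v) <= dl wm v |^ p"
    using powr_tangent[OF p1, of "dl (w t) v" "dl wm v"] by simp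
   thus "rel_energy (w t) v <= rel_energy wm v+p*t*(jp p (dl (w t) v)*dl ?eh v)"
    by(simp add:rel_energy_def algebra_simps)
  qed (use i t in \<open>auto intro!: integrable_rel_energy w_adm w_fin wm eW\<close>)
  also have "... = (BM v. rel_energy wm v)+p*t*(BM v. jp p (dl (w t) v)*dl ?eh v)"
   using i integrable_rel_energy[OF wm(1) eW] by simp
  finally have "0 <= (p*t)*(BM v. jp p (dl (w t) v)*dl ?eh v)" by simp
  moreover have "0 < p*t" using t p0 by simp
  ultimately show ?thesis
   by(metis mult_le_cancel_left_pos mult_zero_right)
 qed
 obtain M where M: "0 <= M" "?G wm z = en M"
  using eW z by(cases "?G wm z") auto
 have "(%j. BM v. jp p (dl (w (?F j)) v)*dl ?eh v) ~> (BM v. jp p (dl wm v)*dl ?eh v)"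
 proof(rule jp_dl_tendsto[OF D_D0 tail_dom _ _ _ _ M(1) _ adm_diff[OF z(1) wm(1)] eeh])
  fix j
  have t: "0 <= ?F j" "?F j <= 1" by auto
  show "w (?F j) : Bor" by measurable
  show "abs (w (?F j) x) <= abs (dom x)" for x
   by(rule adm_le_dom[OF w_adm[OF t]])
  show "energy D0 (w (?F j)) <= en M"
   using w_en[OF t] M by simp
 next
  fix x
  have "(%j. wm x+1/real (Suc j)*(z x-wm x)) ~> wm x+0*(z x-wm x)"
   by(intro tendsto_intros LIMSEQ_Suc[OF lim_1_over_n])
  thus "(%j. w (?F j) x) ~> wm x"
   by(simp add:w_def)
 qed measurable
 thus ?thesis
  by(rule LIMSEQ_le_const) (use pos in auto)
qed

text \<open>Truncation at \<open>hi\<close> contracts increments and so keeps minimality. A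
  direction \<open>eh\<close> is allowed as soon as some positive multiple of it stays above the
  obstacle: nonnegative directions always, and both signs where \<open>wm\<close> exceeds
  \<open>g\<close> by a fixed amount.\<close>

theorem obstacle_solution:
 obtains wm where "wm : Bor" "!!x. x ~: D ==> wm x = g x" "!!x. g x <= wm x" "!!x. wm x <= hi"
  "energy D0 wm < infy"
  "!!eh B t. eh : Bor ==> (!!x. (abs (eh x)) <= B) ==> (!!x. x ~: D ==> eh x = 0) ==> energy D0 eh < infy ==> 0 < t ==> (!!x. x : D ==> g x <= wm x+t*eh x) ==> 0 <= (BM v. jp p (dl wm v)*dl eh v)"
proof -
 obtain wm0 where wm0: "adm wm0" "!!z. adm z ==> Ph wm0 <= Ph z"
  by(rule minimiser_exists) blast
 define wm where "wm x = min (wm0 x) hi" for x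
 have [measurable]: "wm0 : Bor" using wm0(1) by(rule adm_meas)
 have "wm : Bor" unfolding wm_def[abs_def] by measurable
 hence aW: "adm wm"
  using wm0(1) g_hi by(auto simp:adm_def wm_def min_def)
 have "Ph wm <= Ph wm0"
  unfolding Ph_def rel_energy_def dl_def wm_def using p0
  by(intro nn_integral_mono ennreal_leI add_right_mono diff_right_mono powr_mono2) auto
 hence wm: "Ph wm <= Ph z" if "adm z" for z
  using wm0(2)[OF that] by(rule order_trans)
 have eW: "energy D0 wm < infy"
  using energy_le_Ph[OF aW] wm[OF adm_g] Ph_g by(meson order_le_less_trans)
 have [measurable]: "wm : Bor" using aW by(rule adm_meas)
 have var: "0 <= (BM v. jp p (dl wm v)*dl eh v)"
  if [measurable]: "eh : Bor" and eh: "!!x. (abs (eh x)) <= B" "!!x. x ~: D ==> eh x = 0" "energy D0 eh < infy"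
   and t: "0 < t" "!!x. x : D ==> g x <= wm x+t*eh x" for eh B t
 proof -
  have B: "0 <= B" using eh(1) abs_ge_zero order_trans by blast
  \<comment> \<open>Besides r <= t, the bound r B <= 1 keeps wm + r eh below hi + 1.\<close>
  define r where "r = min t (1/(B+1))"
  have r: "0 < r" "r <= t" "r*B <= 1"
  proof -
   show "0 < r" "r <= t" using t B by(auto simp:r_def)
   have "r*B <= 1/(B+1)*B" using B by(intro mult_right_mono) (auto simp:r_def)
   also have "... <= 1" using B by(simp add:field_simps)
   finally show "r*B <= 1" .
  qed
  define z where "z x = wm x+r*eh x" for x
  have [measurable]: "z : Bor" unfolding z_def[abs_def] by measurable
  have az: "adm z"
   unfolding adm_def
  proof(intro conjI allI impI ballI)
   fix x
   show "z x = g x" if "x ~: D" using aW eh(2) that by(simp add:z_def adm_def)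
   assume x: "x : D"
   show "g x <= z x"
   proof(cases "0 <= eh x")
    case True
    have "g x <= wm x" using aW x by(simp add:adm_def)
    thus ?thesis using True r by(simp add:z_def add_increasing2)
   next
    case False
    hence "t*eh x <= r*eh x" using r by(intro mult_right_mono_neg) auto
    thus ?thesis using t(2)[OF x] by(simp add:z_def)
   qed
   have "r*eh x <= r*B" using eh(1)[of x] r by(intro mult_left_mono) auto
   thus "z x <= hi+1" using r(3) by(simp add:z_def wm_def)
  qed simp
  have "energy D0 (%x. r*eh x) < infy"
  proof -
   have "energy D0 (%x. r*eh x) = (NM v. en (r powr p)*(en (dl eh v |^ p)*ind (D0 \<times> D0) v))"
    unfolding energy_def using r
    by(intro nn_integral_cong) (auto simp:dl_def abs_mult powr_mult ennreal_mult mult.assoc right_diff_distrib[symmetric] split:split_indicator)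
   also have "... = en (r powr p)*energy D0 eh"
    unfolding energy_def by(rule nn_integral_cmult) measurable
   also have "... < infy" using eh(3) by(simp add:ennreal_mult_less_top)
   finally show ?thesis .
  qed
  hence ez: "energy D0 z < infy"
   using eW by(intro order_le_less_trans[OF energy_le_sum[of wm "%x. r*eh x" D0]])
    (auto simp:z_def ennreal_mult_less_top)
  have "0 <= (BM v. jp p (dl wm v)*dl (%x. z x-wm x) v)"
   by(rule minimiser_variation[OF aW wm eW az ez])
  also have "... = (BM v. r*(jp p (dl wm v)*dl eh v))"
   by(intro Bochner_Integration.integral_cong) (auto simp:dl_def z_def algebra_simps)
  finally show ?thesis
   using r(1) by(simp add:zero_le_mult_iff)
 qed
 show ?thesis
 proof(rule that[of wm])
  show "g x <= wm x" "x ~: D ==> wm x = g x" for x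
   using aW by(cases "x : D", auto simp:adm_def)
  show "wm x <= hi" for x by(simp add:wm_def)
  show "wm : Bor" by measurable
  show "energy D0 wm < infy" by(fact eW)
  show "0 <= (BM v. jp p (dl wm v)*dl eh v)"
   if "eh : Bor" "!!x. (abs (eh x)) <= B" "!!x. x ~: D ==> eh x = 0" "energy D0 eh < infy"
    "0 < t" "!!x. x : D ==> g x <= wm x+t*eh x" for eh B t
   by(rule var[OF that])
 qed
qed

end

section \<open>The energy estimate for truncations above a barrier\<close>

lemma nn_integral_le_of_integral_nonpos:
 fixes e P Q :: "'b => real"
 assumes e: "integrable M e" "(\<integral>x. e x \<partial>M) <= 0"
  and [measurable]: "P : borel_measurable M" "Q : borel_measurable M"
  and le: "AE x in M. P x-Q x <= e x" and nn: "!!x. 0 <= P x" "!!x. 0 <= Q x"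
 shows "(\<integral>\<^sup>+x. en (P x) \<partial>M) <= (\<integral>\<^sup>+x. en (Q x) \<partial>M)"
proof -
 let ?G = "%M. \<integral>\<^sup>+x. en (e x) \<partial>M"
 let ?F = "%M. \<integral>\<^sup>+x. en (- e x) \<partial>M"
 have [measurable]: "e : borel_measurable M" using e(1) by(rule borel_measurable_integrable)
 have fin: "(?G M) < infy" "(?F M) < infy"
  using e(1) by(auto simp:real_integrable_def less_top)
 \<comment> \<open>Only \<open>e\<close> is known to be integrable. Comparing its positive and
   negative parts makes it possible to add the integral of the negative part to both sides and to
   cancel it at the end, with no finiteness of the integrals of \<open>P\<close> and
   \<open>Q\<close>.\<close>
 have "enn2real (?G M) <= enn2real (?F M)"
  using e(2) real_lebesgue_integral_def[OF e(1)] by simp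
 hence en: "(?G M) <= (?F M)"
  using fin by(metis ennreal_enn2real ennreal_leI infinity_ennreal_def)
 have "(?F M)+(\<integral>\<^sup>+x. en (P x) \<partial>M) = (\<integral>\<^sup>+x. en (- e x)+en (P x) \<partial>M)"
  by(rule nn_integral_add[symmetric]) measurable
 also have "... <= (\<integral>\<^sup>+x. en (e x)+en (Q x) \<partial>M)"
 proof(rule nn_integral_mono_AE)
  show "AE x in M. en (- e x)+en (P x) <= en (e x)+en (Q x)"
   using le
  proof(rule eventually_mono)
   fix x assume x: "P x-Q x <= e x"
   show "en (- e x)+en (P x) <= en (e x)+en (Q x)"
    using x nn[of x] by(cases "0 <= e x") (auto simp:ennreal_neg ennreal_leI simp flip:ennreal_plus)
  qed
 qed
 also have "... = (?G M)+(\<integral>\<^sup>+x. en (Q x) \<partial>M)"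
  by(rule nn_integral_add) measurable
 also have "... <= (?F M)+(\<integral>\<^sup>+x. en (Q x) \<partial>M)"
  by(intro add_right_mono en)
 finally show ?thesis
  using fin(2) by(subst (asm) ennreal_add_left_cancel_le) auto
qed

text \<open>The complement of a usual cutoff: it equals 1 off \<open>U\<close> and may vanish well
  inside. Then ka + H ze is a barrier that rises to ka + H towards the outside, and a function
  bounded by ka + H on \<open>V\<close> can exceed it within \<open>V\<close> only at points of
  \<open>U\<close>.\<close>

definition cutoff_fun :: "'a::euclidean_space set => real => ('a => real) => bool"
 where "cutoff_fun U l ze \<longleftrightarrow> 0 < l & ze : Bor & (ALL x. 0 <= ze x & ze x <= 1) & (ALL x y. (abs (ze x-ze y)) <= norm (x-y)/l) & (ALL x. x ~: U --> ze x = 1)"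

definition trunc_test :: "'a set => ('a => real) => ('a => real) => 'a => real"
 where "trunc_test U f ph x = (if x : U then max (f x-ph x) 0 else 0)"

lemma trunc_test_nonneg: "0 <= trunc_test U f ph x"
 by(simp add:trunc_test_def)

lemma trunc_test_measurable [measurable (raw)]:
 assumes [measurable]: "U : sets borel" "f : Bor" "ph : Bor"
 shows "trunc_test U f ph : Bor"
 unfolding trunc_test_def[abs_def] by measurable

context frac_kernel
begin

definition est_const :: real
 where "est_const = 2 powr (p-1)*(8*lip_const+2)"

lemma est_const_pos: "0 < est_const"
 using lip_const_nonneg by(simp add:est_const_def)

text \<open>A Caccioppoli inequality: \<open>f\<close> behaves like a subsolution against the
  truncation (f - ph)_+. On V x V \<open>jp_energy\<close> is applied with the increment of the
  barrier as perturbation. The first conclusion keeps the full increment of f - ph to the power p -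
  1, hence also the interaction between points above and below the barrier. The second keeps the far
  values of \<open>f\<close> below \<open>ka\<close>.\<close>

lemma energy_estimate:
 assumes UV: "inside U V" and [measurable]: "f : Bor"
  and ze: "cutoff_fun U l ze" and H: "0 < H"
  and le: "AL x. x : V --> f x <= ka+H"
  and T: "0 <= T" "!!x. x : U ==> (NL y. en (max (f y-ka) 0 powr (p-1))*ind (- V) y*en (k x y)) <= en T"
 defines "ph == %x. ka+H*ze x"
 defines "eh == trunc_test U f ph"
 assumes int: "integrable mu (%z. jp p (dl f z)*dl eh z)" "(BM z. jp p (dl f z)*dl eh z) <= 0"
 shows "(NM z. en (dl (%x. f x-ph x) z |^ (p-1)*abs (dl eh z))*ind (V \<times> V) z) <= en (est_const*(H powr p*l powr-(s*p)+T*H))*em {x:U. ph x < f x}" (is "?I1 <= _")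
  and "(NM z. en (eh (fst z) * max (ka-f (snd z)) 0 powr (p-1))*ind (- V) (snd z)) <= en (est_const*(H powr p*l powr-(s*p)+T*H))*em {x:U. ph x < f x}" (is "?I2 <= _")
proof -
 have [measurable]: "U : sets borel" "V : sets borel" using UV by(auto simp:inside_def)
 have [measurable]: "ze : Bor" using ze by(simp add:cutoff_fun_def)
 have l: "0 < l" and ze01: "!!x. 0 <= ze x" "!!x. ze x <= 1" and zel: "!!x y. (abs (ze x-ze y)) <= norm (x-y)/l"
  and zeU: "!!x. x ~: U ==> ze x = 1"
  using ze by(auto simp:cutoff_fun_def)
 have [measurable]: "ph : Bor" unfolding ph_def by measurable
 have [measurable]: "eh : Bor" unfolding eh_def by measurable
 have UsubV: "U <= V" using UV by(rule insideD)
 define S where "S = {x:U. ph x < f x}"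
 have [measurable]: "S : sets borel" unfolding S_def by measurable
 have ehS: "x ~: S ==> eh x = 0" for x by(auto simp:eh_def trunc_test_def S_def)
 have eh0: "0 <= eh x" for x by(simp add:eh_def trunc_test_nonneg)
 define c where "c = (1/2::real) powr (p-1)"
 have c: "0 < c" "c <= 1" "2 powr (p-1)*c = 1"
  using p1 by(auto simp:c_def powr_le_one_le powr_mult[symmetric] intro:powr_le1)
 \<comment> \<open>\<open>P\<close> and \<open>R\<close> are the terms to be kept; \<open>Q\<close>
   is the cost of the slope of the barrier, and \<open>X\<close> the cost of far values above
   \<open>ka\<close>.\<close>
 define P where "P z = dl (%x. f x-ph x) z |^ (p-1)*abs (dl eh z)*ind (V \<times> V) z" for z
 define R where "R z = eh (fst z) * max (ka-f (snd z)) 0 powr (p-1)*ind (- V) (snd z)" for z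
 define Q where "Q z = 4*H powr p*((ze (fst z)-ze (snd z)) |^ p*ind S (fst z))" for z
 define X where "X z = H*(max (f (snd z)-ka) 0 powr (p-1)*ind (- V) (snd z)*ind S (fst z))" for z
 define sw :: "'a \<times> 'a => 'a \<times> 'a" where "sw z = (snd z, fst z)" for z
 have [measurable]: "P : Bor" "R : Bor" "Q : Bor" "X : Bor"
  unfolding P_def[abs_def] R_def[abs_def] Q_def[abs_def] X_def[abs_def] by measurable
 have [measurable]: "(%z. R (sw z)) : Bor" "(%z. Q (sw z)) : Bor" "(%z. X (sw z)) : Bor"
  unfolding R_def Q_def X_def sw_def by(simp_all only: fst_conv snd_conv) measurable
 have nn: "0 <= P z" "0 <= R z" "0 <= Q z" "0 <= X z" for z
  using H eh0 by(auto simp:P_def R_def Q_def X_def)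
 \<comment> \<open>On the support of \<open>eh\<close> one has f x >= ka, so f x - f y may be
   replaced by ka - f y. Far values below \<open>ka\<close> give the term \<open>R\<close>; those
   above cost at most \<open>X\<close>, because eh x <= H.\<close>
 have far: "R (x, y)-X (x, y) <= jp p (f x-f y)*eh x" if "f x <= ka+H" "x : U" "y ~: V" for x y
 proof(cases "x : S")
  case False
  thus ?thesis using ehS[OF False] by(simp add:R_def X_def)
 next
  case True
  have "0 <= H*ze x" using H ze01(1)[of x] by simp
  hence fx: "ka <= f x" using True by(simp add:S_def ph_def)
  have "eh x = f x-ph x" using True by(auto simp:eh_def trunc_test_def S_def)
  moreover have "ka <= ph x" using H ze01(1)[of x] by(simp add:ph_def)
  ultimately have ehH: "eh x <= H" using that(1) by linarith
  have m: "jp p (ka-f y) <= jp p (f x-f y)" using fx by(intro jp_mono p1) auto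
  show ?thesis
  proof(cases "f y <= ka")
   case fy: True
   hence "(ka-f y) powr (p-1)*eh x <= jp p (f x-f y)*eh x"
    using m eh0 by(intro mult_right_mono) (auto simp:jp_nonneg)
   thus ?thesis using fy that True by(simp add:R_def X_def mult.commute)
  next
   case fy: False
   have "- (H*(f y-ka) powr (p-1)) <= - ((f y-ka) powr (p-1)*eh x)"
    using mult_right_mono[OF ehH, of "(f y-ka) powr (p-1)"] by(simp add:mult.commute)
   also have "... = jp p (ka-f y)*eh x" using fy by(simp add:jp_nonpos)
   also have "... <= jp p (f x-f y)*eh x" using m eh0 by(intro mult_right_mono) auto
   finally show ?thesis using fy that True by(simp add:R_def X_def)
  qed
 qed
 have ae: "AE z in mu. (c*P z+R z+R (sw z))-(Q z+Q (sw z)+X z+X (sw z)) <= jp p (dl f z)*dl eh z"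
  using AE_muI(1)[OF le] AE_muI(2)[OF le]
 proof eventually_elim
  fix z :: "'a \<times> 'a" assume as: "fst z : V --> f (fst z) <= ka+H" "snd z : V --> f (snd z) <= ka+H"
  obtain x y where z: "z = (x, y)" by(cases z)
  have as: "x : V ==> f x <= ka+H" "y : V ==> f y <= ka+H" using as by(auto simp:z)
  consider "x : V" "y : V" | "x : U" "y ~: V" | "y : U" "x ~: V" | "x ~: U" "y ~: U" "x ~: V | y ~: V"
   using UsubV by blast
  thus "(c*P z+R z+R (sw z))-(Q z+Q (sw z)+X z+X (sw z)) <= jp p (dl f z)*dl eh z"
  proof cases
   case 1
   have e: "eh x = max (f x-ph x) 0" if "x : V" "f x <= ka+H" for x
    using that zeU[of x] by(auto simp:eh_def trunc_test_def ph_def)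
   have ex: "eh x = max (f x-ph x) 0" "eh y = max (f y-ph y) 0"
    using e 1 as by auto
   have S_iff: "0 < f x-ph x \<longleftrightarrow> x : S" "0 < f y-ph y \<longleftrightarrow> y : S"
    using 1 as zeU[of x] zeU[of y] by(cases "x : U"; cases "y : U"; force simp:S_def ph_def)+
   have d: "(ph x-ph y) |^ p = H powr p*(ze x-ze y) |^ p"
    using H by(simp add:ph_def right_diff_distrib[symmetric] abs_mult powr_mult)
   have "c*(((f x-ph x)-(f y-ph y)) |^ (p-1)*abs (eh x-eh y))-(if x : S | y : S then 4*(ph x-ph y) |^ p else 0) <= jp p ((f x-ph x)-(f y-ph y)+(ph x-ph y))*(eh x-eh y)"
    using jp_energy[OF p1, of "f x-ph x" "f y-ph y" "ph x-ph y"] unfolding ex c_def S_iff .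
   moreover have "(if x : S | y : S then 4*(ph x-ph y) |^ p else 0) <= Q z+Q (sw z)"
    using nn(3)[of z] by(auto simp:Q_def sw_def z d abs_minus_commute split:split_indicator)
   moreover have "R z = 0" "R (sw z) = 0" "X z = 0" "X (sw z) = 0"
    using 1 by(auto simp:R_def X_def sw_def z)
   moreover have "P z = ((f x-ph x)-(f y-ph y)) |^ (p-1)*abs (eh x-eh y)"
    using 1 by(simp add:P_def z dl_def)
   moreover have "(f x-ph x)-(f y-ph y)+(ph x-ph y) = dl f z" "dl eh z = eh x-eh y"
    by(simp_all add:dl_def z)
   ultimately show ?thesis by simp
  next
   case 2
   hence xV: "x : V" using UsubV by auto
   have "dl eh z = eh x" "dl f z = f x-f y" "P z = 0" "R (sw z) = 0"
    using 2 UsubV ehS[of y] by(auto simp:dl_def z P_def R_def sw_def S_def)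
   thus ?thesis
    using far[OF as(1)[OF xV] 2] nn(3)[of z] nn(3)[of "sw z"] nn(4)[of "sw z"] by(simp add:z)
  next
   case 3
   hence yV: "y : V" using UsubV by auto
   have "dl eh z = - eh y" "dl f z = - (f y-f x)" "P z = 0" "R z = 0"
    using 3 UsubV ehS[of x] by(auto simp:dl_def z P_def R_def sw_def S_def)
   thus ?thesis
    using far[OF as(2)[OF yV] 3] nn(3)[of z] nn(3)[of "sw z"] nn(4)[of z] by(simp add:z sw_def jp_minus_commute[of p "f x"])
  next
   case 4
   have "eh x = 0" "eh y = 0" using 4 ehS by(auto simp:S_def)
   hence "dl eh z = 0" "P z = 0" "R z = 0" "R (sw z) = 0"
    by(auto simp:dl_def z P_def R_def sw_def)
   thus ?thesis
    using nn(3)[of z] nn(3)[of "sw z"] nn(4)[of z] nn(4)[of "sw z"] by simp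
  qed
 qed
 have "(NM z. en (c*P z+R z+R (sw z))) <= (NM z. en (Q z+Q (sw z)+X z+X (sw z)))"
  using c(1) nn by(intro nn_integral_le_of_integral_nonpos[OF int _ _ ae]) (auto intro!: add_nonneg_nonneg mult_nonneg_nonneg)
 also have "... = (NM z. en (Q z)+en (Q (sw z))+en (X z)+en (X (sw z)))"
  by(simp add:nn)
 also have "... = (NM z. en (Q z))+(NM z. en (Q (sw z)))+(NM z. en (X z))+(NM z. en (X (sw z)))"
  by(simp add:nn_integral_add)
 also have "(NM z. en (Q (sw z))) = (NM z. en (Q z))"
  unfolding sw_def by(rule nn_integral_mu_swap[where f = "%z. en (Q z)"]) measurable
 also have "(NM z. en (X (sw z))) = (NM z. en (X z))"
  unfolding sw_def by(rule nn_integral_mu_swap[where f = "%z. en (X z)"]) measurable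
 finally have main: "(NM z. en (c*P z+R z+R (sw z))) <= (NM z. en (Q z))+(NM z. en (Q z))+(NM z. en (X z))+(NM z. en (X z))" .
 have Qb: "(NM z. en (Q z)) <= en (4*H powr p*(lip_const*l powr-(s*p)))*em S"
 proof -
  have "(NM z. en (Q z)) = (NL x. NL y. en (Q (x, y))*en (k x y))"
   by(rule nn_integral_mu) measurable
  also have "... = (NL x. NL y. en (4*H powr p)*ind S x*(en ((ze x-ze y) |^ p)*en (k x y)))"
   by(intro nn_integral_cong) (auto simp:Q_def ennreal_mult mult_ac split:split_indicator)
  also have "... = (NL x. en (4*H powr p)*ind S x*(NL y. en ((ze x-ze y) |^ p)*en (k x y)))"
   by(intro nn_integral_cong nn_integral_cmult) measurable
  also have "... <= (NL x. en (4*H powr p)*ind S x*en (lip_const*l powr-(s*p)))"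
  proof(intro nn_integral_mono mult_left_mono nn_integral_lip_kernel l)
   show "abs (ze x-ze y) <= 1" for x y
    using ze01[of x] ze01[of y] by linarith
  qed (auto intro:zel)
  also have "... = (NL x. en (4*H powr p*(lip_const*l powr-(s*p)))*ind S x)"
   using lip_const_nonneg by(intro nn_integral_cong) (auto simp:ennreal_mult split:split_indicator)
  also have "... = en (4*H powr p*(lip_const*l powr-(s*p)))*em S"
   by(rule nn_integral_cmult_indicator) simp
  finally show ?thesis .
 qed
 have Xb: "(NM z. en (X z)) <= en (H*T)*em S"
 proof -
  have "(NM z. en (X z)) = (NL x. NL y. en (X (x, y))*en (k x y))"
   by(rule nn_integral_mu) measurable
  also have "... = (NL x. NL y. en H*ind S x*(en (max (f y-ka) 0 powr (p-1))*ind (- V) y*en (k x y)))"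
   using H by(intro nn_integral_cong) (auto simp:X_def ennreal_mult mult_ac split:split_indicator)
  also have "... = (NL x. en H*ind S x*(NL y. en (max (f y-ka) 0 powr (p-1))*ind (- V) y*en (k x y)))"
   by(intro nn_integral_cong nn_integral_cmult) measurable
  also have "... <= (NL x. en H*ind S x*en T)"
  proof(rule nn_integral_mono)
   fix x
   show "en H*ind S x*(NL y. en (max (f y-ka) 0 powr (p-1))*ind (- V) y*en (k x y)) <= en H*ind S x*en T"
   proof(cases "x : S")
    case True
    hence "x : U" by(auto simp:S_def)
    thus ?thesis by(intro mult_left_mono T(2)) auto
   qed simp
  qed
  also have "... = (NL x. en (H*T)*ind S x)"
   using H T by(intro nn_integral_cong) (auto simp:ennreal_mult split:split_indicator)
  also have "... = en (H*T)*em S"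
   by(rule nn_integral_cmult_indicator) simp
  finally show ?thesis .
 qed
 define b where "b = 8*H powr p*(lip_const*l powr-(s*p))+2*(H*T)"
 have b0: "0 <= b" using H T lip_const_nonneg by(simp add:b_def)
 have main2: "(NM z. en (c*P z+R z+R (sw z))) <= en b*em S"
 proof -
  let ?q = "4*H powr p*(lip_const*l powr-(s*p))"
  have q0: "0 <= ?q" "0 <= H*T" using lip_const_nonneg H T by auto
  have "b = ?q+?q+H*T+H*T" by(simp add:b_def)
  hence "en b = en ?q+en ?q+en (H*T)+en (H*T)"
   using q0 by(simp only: ennreal_plus add_nonneg_nonneg)
  hence "en b*em S = en ?q*em S+en ?q*em S+en (H*T)*em S+en (H*T)*em S"
   by(simp add:distrib_right)
  thus ?thesis
   using main Qb Xb by(auto intro!: order_trans[OF main] add_mono)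
 qed
 have fin: "2 powr (p-1)*b <= est_const*(H powr p*l powr-(s*p)+T*H)"
 proof -
  let ?h = "H powr p*l powr-(s*p)"
  have "b = 8*lip_const*?h+2*(T*H)" by(simp add:b_def)
  also have "... <= (8*lip_const+2)*?h+(8*lip_const+2)*(T*H)"
   using lip_const_nonneg H T by(intro add_mono mult_right_mono) auto
  finally have "2 powr (p-1)*b <= 2 powr (p-1)*((8*lip_const+2)*(?h+T*H))"
   by(intro mult_left_mono) (auto simp:distrib_left)
  thus ?thesis by(simp add:est_const_def mult.assoc)
 qed
 have fin1: "en (2 powr (p-1))*(en b*em S) <= en (est_const*(H powr p*l powr-(s*p)+T*H))*em S"
  unfolding mult.assoc[symmetric] using b0 fin
  by(intro mult_right_mono) (auto simp:ennreal_mult[symmetric] intro!: ennreal_leI)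
 have "?I1 = (NM z. en (P z))"
  by(intro nn_integral_cong) (auto simp:P_def split:split_indicator)
 also have "... <= (NM z. en (2 powr (p-1))*en (c*P z+R z+R (sw z)))"
 proof(rule nn_integral_mono)
  fix z
  have "P z = 2 powr (p-1)*(c*P z)" using c(3) by(simp add:mult.assoc[symmetric])
  also have "... <= 2 powr (p-1)*(c*P z+R z+R (sw z))"
   using nn[of z] nn(2)[of "sw z"] by(intro mult_left_mono) auto
  finally show "en (P z) <= en (2 powr (p-1))*en (c*P z+R z+R (sw z))"
   by(simp add:ennreal_leI flip:ennreal_mult')
 qed
 also have "... = en (2 powr (p-1))*(NM z. en (c*P z+R z+R (sw z)))"
  by(rule nn_integral_cmult) measurable
 also have "... <= en (2 powr (p-1))*(en b*em S)"
  by(intro mult_left_mono main2) simp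
 also note fin1
 finally show "?I1 <= en (est_const*(H powr p*l powr-(s*p)+T*H))*em {x:U. ph x < f x}"
  by(simp add:S_def)
 have "?I2 = (NM z. en (R z))"
  by(intro nn_integral_cong) (auto simp:R_def split:split_indicator)
 also have "... <= (NM z. en (2 powr (p-1))*en (c*P z+R z+R (sw z)))"
 proof(rule nn_integral_mono)
  fix z
  have "R z <= c*P z+R z+R (sw z)" using nn[of z] nn(2)[of "sw z"] c by simp
  also have "... = 1*(c*P z+R z+R (sw z))" by simp
  also have "... <= 2 powr (p-1)*(c*P z+R z+R (sw z))"
   using nn[of z] nn(2)[of "sw z"] c p1 by(intro mult_right_mono ge_one_powr_ge_zero) auto
  finally show "en (R z) <= en (2 powr (p-1))*en (c*P z+R z+R (sw z))"
   by(simp add:ennreal_leI flip:ennreal_mult')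
 qed
 also have "... = en (2 powr (p-1))*(NM z. en (c*P z+R z+R (sw z)))"
  by(rule nn_integral_cmult) measurable
 also have "... <= en (2 powr (p-1))*(en b*em S)"
  by(intro mult_left_mono main2) simp
 also note fin1
 finally show "?I2 <= en (est_const*(H powr p*l powr-(s*p)+T*H))*em {x:U. ph x < f x}"
  by(simp add:S_def)
qed

text \<open>The class of functions for which \<open>energy_estimate\<close> holds at all levels \<open>ka >= ka0\<close>.\<close>

definition dg :: "('a => real) => 'a set => 'a set => real => real => bool"
 where "dg f U V ka0 T \<longleftrightarrow> f : Bor & 0 <= T & (ALL ka H l ze. ka0 <= ka --> 0 < H --> cutoff_fun U l ze --> (AL x. x : V --> f x <= ka+H) --> (NM z. en (dl (%x. f x-(ka+H*ze x)) z |^ (p-1)*abs (dl (trunc_test U f (%x. ka+H*ze x)) z))*ind (V \<times> V) z) <= en (est_const*(H powr p*l powr-(s*p)+T*H))*em {x:U. ka+H*ze x < f x})"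

end

section \<open>De Giorgi iteration: the small density lemma and the growth lemma\<close>

lemma unit_ball_vol_DIM [simp]:
 "0 < unit_ball_vol (real DIM('b::euclidean_space))" "unit_ball_vol (real DIM('b::euclidean_space)) ~= 0"
 using unit_ball_vol_pos[of "real DIM('b)"] by linarith+

definition radial :: "'a::euclidean_space => real => real => 'a => real"
 where "radial x0 rh1 rh2 x = min 1 (max 0 ((dist x0 x-rh1)/(rh2-rh1)))"

lemma abs_min_max_diff_le: "abs (min 1 (max 0 a)-min 1 (max 0 b)) <= abs (a-b :: real)"
 by(auto simp:min_def max_def)

lemma cutoff_radial:
 assumes "rh1 < rh2" "ball x0 rh2 <= U"
 shows "cutoff_fun U (rh2-rh1) (radial x0 rh1 rh2)"
 unfolding cutoff_fun_def
proof(intro conjI allI impI)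
 show "radial x0 rh1 rh2 : Bor"
  unfolding radial_def[abs_def] by measurable
 show "abs (radial x0 rh1 rh2 x-radial x0 rh1 rh2 y) <= norm (x-y)/(rh2-rh1)" for x y
 proof -
  have "abs (radial x0 rh1 rh2 x-radial x0 rh1 rh2 y) <= abs ((dist x0 x-rh1)/(rh2-rh1)-(dist x0 y-rh1)/(rh2-rh1))"
   unfolding radial_def by(rule abs_min_max_diff_le)
  also have "... = abs (dist x0 x-dist x0 y)/(rh2-rh1)"
   using assms(1) by(simp add:diff_divide_distrib[symmetric])
  also have "abs (dist x0 x-dist x0 y) <= norm (x-y)"
   using abs_dist_diff_le[of x0 x y] by(metis abs_dist_diff_le dist_commute dist_norm)
  finally show ?thesis using assms(1) by(simp add:divide_right_mono)
 qed
 show "radial x0 rh1 rh2 x = 1" if "x ~: U" for x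
 proof -
  have "rh2 <= dist x0 x" using that assms(2) by(auto simp:subset_eq not_less[symmetric])
  thus ?thesis using assms(1) by(simp add:radial_def)
 qed
qed (use assms in \<open>auto simp:radial_def\<close>)

lemma radial_0:
 assumes "rh1 < rh2" "dist x0 x <= rh1"
 shows "radial x0 rh1 rh2 x = 0"
proof -
 have "(dist x0 x-rh1)/(rh2-rh1) <= 0"
  using assms by(intro divide_nonpos_pos) auto
 thus ?thesis by(simp add:radial_def)
qed

lemma radial_1: "rh1 < rh2 ==> rh2 <= dist x0 x ==> radial x0 rh1 rh2 x = 1"
 by(simp add:radial_def)

text \<open>Induction on b j <= b 0 * t^j with t = q^(-1/ga): the factor t^(ga j) cancels q^j, and
  the smallness of \<open>b 0\<close> gives C * (b 0)^ga <= t. The bound keeps b j <= b 0, so the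
  recursion is asked for only in that case.\<close>

lemma fast_geometric_decay:
 fixes b :: "nat => real"
 assumes C: "0 < C" "1 < q" "0 < ga" and nn: "!!j. 0 <= b j"
  and step: "!!j. b j <= b 0 ==> b (Suc j) <= C*q^j*b j powr (1+ga)"
  and init: "b 0 <= C powr (- (1/ga))*q powr (- (1/ga\<^sup>2))"
 shows "b ~> 0"
proof(cases "b 0 = 0")
 case True
 have "b j = 0" for j
 proof(induction j)
  case (Suc j)
  thus ?case using step[of j] nn[of "Suc j"] True by simp
 qed (fact True)
 hence "b = (%_. 0)" by auto
 thus ?thesis by simp
next
 case False
 hence b0: "0 < b 0" using nn[of 0] by simp
 define t where "t = q powr (- (1/ga))"
 have t: "0 < t" "t < 1" using C by(auto simp:t_def powr_less_one)
 have "t powr ga = q powr-1" using C by(simp add:t_def powr_powr)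
 hence tg: "t powr ga = 1/q" using C by(simp add:powr_minus_divide)
 have bnd: "b j <= b 0*t^j" for j
 proof(induction j)
  case (Suc j)
  have "b j <= b 0*1" using Suc t b0 by(intro order_trans[OF Suc.IH] mult_left_mono power_le_one) auto
  hence "b (Suc j) <= C*q^j*b j powr (1+ga)" by(intro step) simp
  also have "... <= C*q^j*(b 0*t^j) powr (1+ga)"
   using C Suc.IH nn by(intro mult_left_mono powr_mono2) auto
  also have "(b 0*t^j) powr (1+ga) = (b 0*t^j)*(b 0 powr ga*(t powr ga)^j)"
   using b0 t by(simp add:powr_add powr_mult powr_power mult.commute powr_powr flip:powr_realpow)
  also have "C*q^j*((b 0*t^j)*(b 0 powr ga*(t powr ga)^j)) = (b 0*t^j)*(C*b 0 powr ga)"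
   using C by(simp add:tg power_divide)
  also have "... <= (b 0*t^j)*t"
  proof(intro mult_left_mono)
   have "b 0 powr ga <= (C powr (- (1/ga))*q powr (- (1/ga\<^sup>2))) powr ga"
    using C nn init by(intro powr_mono2) auto
   also have "... = C powr-1*q powr-(1/ga\<^sup>2*ga)"
    using C by(simp add:powr_mult powr_powr)
   also have "1/ga\<^sup>2*ga = 1/ga" by(simp add:power2_eq_square)
   also have "C powr-1*q powr-(1/ga) = 1/C*t"
    using C by(simp add:t_def powr_minus_divide)
   finally show "C*b 0 powr ga <= t" using C by(simp add:field_simps)
  qed (use b0 t in auto)
  finally show ?case by(simp add:mult_ac)
 qed simp
 have "(%j. b 0*t^j) ~> b 0*0"
  using t by(intro tendsto_intros LIMSEQ_power_zero) auto
 hence "(%j. b 0*t^j) ~> 0" by simp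
 from tendsto_sandwich[OF _ _ tendsto_const this] show ?thesis
  using nn bnd by(simp add:always_eventually)
qed

context frac_kernel
begin

lemma nn_integral_mu_lower:
 assumes [measurable]: "F : Bor" "A : sets borel"
  and F: "!!x. x : A ==> en c <= (NL y. en (F (x, y))*en (k x y))"
 shows "en c*em A <= (NM z. en (F z))"
proof -
 have "en c*em A = (NL x. en c*ind A x)"
  by(rule nn_integral_cmult_indicator[symmetric]) simp
 also have "... <= (NL x. NL y. en (F (x, y))*en (k x y))"
  using F by(intro nn_integral_mono) (auto split:split_indicator)
 also have "... = (NM z. en (F z))"
  by(rule nn_integral_mu[symmetric]) measurable
 finally show ?thesis .
qed

lemma dgD:
 assumes "dg f U V ka0 T" "ka0 <= ka" "0 < H" "cutoff_fun U l ze" "AL x. x : V --> f x <= ka+H"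
 shows "(NM z. en (dl (%x. f x-(ka+H*ze x)) z |^ (p-1)*abs (dl (trunc_test U f (%x. ka+H*ze x)) z))*ind (V \<times> V) z) <= en (est_const*(H powr p*l powr-(s*p)+T*H))*em {x:U. ka+H*ze x < f x}"
 using assms unfolding dg_def by blast

lemma dg_measurable: "dg f U V ka0 T ==> f : Bor"
 by(simp add:dg_def)

lemma AE_lborel_imp_emeasure_le:
 assumes "AL x. x : A --> x : B" "A : sets borel" "B : sets (borel :: 'a measure)"
 shows "em A <= em B"
 using assms by(intro emeasure_mono_AE) auto

text \<open>A point where f > ka' + h and a point off \<open>S\<close>, where \<open>f\<close> is
  below the barrier, contribute at least h^p. The kernel mass off \<open>S\<close> seen from the
  first is at least a multiple of a^(-s p/n) by \<open>kernel_integral_off_set\<close>, while the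
  energy estimate bounds the total by a multiple of H^p (rh2 - rh1)^(-s p) a. This produces the
  superlinear power of \<open>a\<close>.\<close>

lemma de_giorgi_step:
 assumes dg: "dg f (ball x0 (R/2)) (ball x0 R) ka0 T" and r: "0 < r" "4*r <= R"
  and ka: "ka0 <= ka'" "ka'+h <= ka+H" "ka <= ka'" and h: "0 < h" "0 < H" and T: "T <= H powr (p-1)*r powr-(s*p)"
  and le: "AL x. x : ball x0 R --> f x <= ka+H"
  and rh: "0 < rh1" "rh1 < rh2" "rh2 <= r"
  and small: "ms {x:ball x0 rh2. ka' < f x} <= unit_ball_vol (real DIM('a))/2*r^DIM('a)"
 defines "a == ms {x:ball x0 rh2. ka' < f x}"
 shows "h powr p * ms {x:ball x0 rh1. ka'+h < f x} <= (4*La*est_const/unit_ball_vol (real DIM('a))*(2/unit_ball_vol (real DIM('a))) powr (s*p/real DIM('a)))*H powr p*(rh2-rh1) powr-(s*p)*a powr (1+s*p/real DIM('a))"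
proof -
 let ?om = "unit_ball_vol (real DIM('a))" and ?n = "real DIM('a)"
 let ?U = "ball x0 (R/2)" and ?V = "ball x0 R"
 let ?B = "%ze. trunc_test ?U f (%x. ka'+H*ze x)"
 let ?A = "%rh. rh powr-(s*p)*(2/?om) powr (s*p/?n)*a powr (s*p/?n)"
 let ?G = "(2/?om) powr (s*p/?n)*a powr (s*p/?n)"
 let ?F = "H powr p*(rh2-rh1) powr-(s*p)"
 let ?C = "est_const*(2*(?F))*a"
 have [measurable]: "f : Bor" using dg by(rule dg_measurable)
 have [measurable]: "ball x t : sets borel" for t and x :: 'a by simp
 define ze where "ze = radial x0 rh1 rh2"
 have cut: "cutoff_fun ?U (rh2-rh1) ze"
  unfolding ze_def using r rh by(intro cutoff_radial) auto
 hence [measurable]: "ze : Bor" by(simp add:cutoff_fun_def)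
 define S where "S = {x:?U. ka'+H*ze x < f x}"
 define A2 where "A2 = {x:ball x0 rh2. ka' < f x}"
 define A1 where "A1 = {x:ball x0 rh1. ka'+h < f x}"
 have [measurable]: "S : sets borel" "A1 : sets borel" "A2 : sets borel"
  unfolding S_def A1_def A2_def by measurable
 have fin: "em A1 < infy" "em A2 < infy"
  by(rule emeasure_bounded_finite, rule bounded_subset[OF bounded_ball], force simp:A1_def A2_def)+
 have em: "em A1 = en (ms A1)" "em A2 = en a"
  using fin by(auto simp:emeasure_eq_ennreal_measure a_def A2_def)
 have le': "AL x. x : ?V --> f x <= ka'+H"
  using le by(rule eventually_mono) (use ka in auto)
 have SA: "AL x. x : S --> x : A2"
  using le
 proof(rule eventually_mono)
  fix x assume x: "x : ?V --> f x <= ka+H"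
  show "x : S --> x : A2"
  proof
   assume xS: "x : S"
   hence xU: "x : ?U" "ka'+H*ze x < f x" by(auto simp:S_def)
   hence "x : ?V" using r by auto
   hence fx: "f x <= ka'+H" using x ka by auto
   have "dist x0 x < rh2"
   proof(rule ccontr)
    assume "~ dist x0 x < rh2"
    hence "ze x = 1" unfolding ze_def using rh by(intro radial_1) auto
    thus False using xU fx by simp
   qed
   moreover have "0 <= H*ze x" using h cut by(simp add:cutoff_fun_def)
   ultimately show "x : A2" using xU by(auto simp:A2_def)
  qed
 qed
 have S_le: "em S <= en a"
  using AE_lborel_imp_emeasure_le[OF SA] em by simp
 have a0: "0 <= a" by(simp add:a_def)
 show ?thesis
 proof(cases "a = 0")
  case True
  have "em A1 <= em A2"
   using rh h by(intro emeasure_mono) (auto simp:A1_def A2_def)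
  hence "ms A1 = 0" using em True by(simp add:ennreal_eq_0_iff measure_le_0_iff)
  thus ?thesis using True by(simp add:A1_def)
 next
  case False
  hence a: "0 < a" using a0 by simp
  \<comment> \<open>A ball of radius \<open>rh\<close> has measure 2 a. The set \<open>S\<close>, of
    measure at most a, therefore fills at most half of it, and \<open>small\<close> ensures rh <=
    r.\<close>
  define rh where "rh = (2*a/?om) powr (1/?n)"
  have rh0: "0 < rh" using a by(simp add:rh_def)
  have rhn: "rh^DIM('a) = 2*a/?om"
  proof -
   have "rh^DIM('a) = rh powr ?n" using rh0 by(simp add:powr_realpow)
   also have "... = 2*a/?om" using a by(simp add:rh_def powr_powr)
   finally show ?thesis .
  qed
  have rhr: "rh <= r"
  proof(rule power_le_imp_le_base[of _ "DIM('a)-1"])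
   have "2*a/?om <= r^DIM('a)"
    using small unfolding a_def[symmetric] by(simp add:field_simps)
   thus "rh^Suc (DIM('a)-1) <= r^Suc (DIM('a)-1)" using rhn by simp
  qed (use r in auto)
  define F where "F z = dl (%x. f x-(ka'+H*ze x)) z |^ (p-1)*abs (dl (?B ze) z)*ind (?V \<times> ?V) z" for z
  have [measurable]: "F : Bor"
   unfolding F_def[abs_def] by measurable
  let ?c = "h powr p*(?om/(2*La)*rh powr-(s*p))"
  have "en ?c*em A1 <= (NM z. en (F z))"
  proof(rule nn_integral_mu_lower)
   fix x assume x: "x : A1"
   hence xr: "dist x0 x < rh1" "ka'+h < f x" by(auto simp:A1_def)
   have zex: "ze x = 0" unfolding ze_def using rh xr by(intro radial_0) auto
   have xU: "x : ?U" "x : ?V" using xr rh r by auto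
   have sm: "em (S Int ball x rh) <= en (?om*rh^DIM('a)/2)"
   proof -
    have "em (S Int ball x rh) <= em S" by(intro emeasure_mono) auto
    also note S_le
    also have "en a = en (?om*rh^DIM('a)/2)" by(simp add:rhn)
    finally show ?thesis .
   qed
   have "en ?c = en (h powr p)*en (?om/(2*La)*rh powr-(s*p))"
    using La0 by(subst ennreal_mult) auto
   also have "... <= en (h powr p)*(NL y. ind (ball x rh-S) y*en (k x y))"
    by(intro mult_left_mono kernel_integral_off_set rh0 sm) auto
   also have "... = (NL y. en (h powr p)*(ind (ball x rh-S) y*en (k x y)))"
    by(rule nn_integral_cmult[symmetric]) measurable
   also have "... <= (NL y. en (F (x, y))*en (k x y))"
   proof(rule nn_integral_mono)
    fix y
    show "en (h powr p)*(ind (ball x rh-S) y*en (k x y)) <= en (F (x, y))*en (k x y)"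
    proof(cases "y : ball x rh-S")
     case True
     have "dist x0 y <= dist x0 x+dist x y" by(rule dist_triangle)
     also have "... < 2*r" using xr rh rhr True by auto
     finally have y: "y : ?U" "y : ?V" using r by auto
     have ty: "trunc_test ?U f (%x. ka'+H*ze x) y = 0" "f y <= ka'+H*ze y"
      using True y by(auto simp:trunc_test_def S_def)
     have tx: "trunc_test ?U f (%x. ka'+H*ze x) x = f x-ka'"
      using xU xr h by(simp add:trunc_test_def zex)
     have "h powr p = h powr (p-1)*h" using h by(simp add:powr_diff field_simps)
     also have "... <= dl (%x. f x-(ka'+H*ze x)) (x, y) |^ (p-1)*abs (dl (?B ze) (x, y))"
      using h p1 xr ty tx by(intro mult_mono powr_mono2) (auto simp:dl_def zex)
     also have "... = F (x, y)" using xU y by(simp add:F_def)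
     finally show ?thesis using True by(simp add:mult_right_mono ennreal_leI)
    qed simp
   qed
   finally show "en ?c <= (NL y. en (F (x, y))*en (k x y))" .
  qed measurable
  also have "(NM z. en (F z)) = (NM z. en (dl (%x. f x-(ka'+H*ze x)) z |^ (p-1)*abs (dl (?B ze) z))*ind (?V \<times> ?V) z)"
   by(intro nn_integral_cong) (auto simp:F_def split:split_indicator)
  also have "... <= en (est_const*(?F+T*H))*em S"
   unfolding S_def by(rule dgD[OF dg ka(1) h(2) cut le'])
  also have "... <= en (est_const*(2*(?F)))*en a"
  proof(rule mult_mono[OF ennreal_leI S_le])
   have "T*H <= H powr (p-1)*r powr-(s*p)*H"
    using T h by(intro mult_right_mono) auto
   also have "... = H powr p*r powr-(s*p)"
    using h by(simp add:powr_diff)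
   also have "... <= ?F"
    using rh sp0 by(intro mult_left_mono powr_mono2') auto
   finally show "est_const*(?F+T*H) <= est_const*(2*(?F))"
    using est_const_pos by(intro mult_left_mono) auto
  qed auto
  finally have "en (?c * ms A1) <= en (?C)"
   using La0 est_const_pos a by(simp add:em ennreal_mult[symmetric])
  hence fin: "?c * ms A1 <= ?C"
   using est_const_pos a by(subst (asm) ennreal_le_iff) auto
  have "rh powr-(s*p) = (2*a/?om) powr-(s*p/?n)"
   using a by(simp add:rh_def powr_powr)
  hence inv: "?A rh = 1"
   using a by(simp add:powr_minus powr_mult[symmetric] field_simps)
  have "h powr p * ms A1 = (2*La/?om)*(?G)*(?c * ms A1)"
  proof -
   have "(2*La/?om)*(?G)*(?c * ms A1) = (2*La/?om*(?om/(2*La)))*(?A rh)*(h powr p * ms A1)"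
    by(simp only: mult_ac)
   also have "... = h powr p * ms A1"
    unfolding inv using La0 unit_ball_vol_DIM by simp
   finally show ?thesis by simp
  qed
  also have "... <= (2*La/?om)*(?G)*(?C)"
   using fin La0 by(intro mult_left_mono) auto
  also have "... = (4*La*est_const/?om*(2/?om) powr (s*p/?n))*H powr p*(rh2-rh1) powr-(s*p)*(a*a powr (s*p/?n))"
   by simp
  also have "a*a powr (s*p/?n) = a powr (1+s*p/?n)"
   using a by(simp add:powr_add)
  finally show ?thesis by(simp add:A1_def)
 qed
qed

text \<open>\<open>de_giorgi_step\<close> is iterated with levels rising to ka + H/2 and radii
  shrinking to r/2. The threshold \<open>vu\<close> is what \<open>fast_geometric_decay\<close>
  needs, capped by half of the unit ball volume for the sake of the step.\<close>

lemma de_giorgi_small_measure: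
 obtains vu where "0 < vu" "!!f x0 R r ka0 ka H T. dg f (ball x0 (R/2)) (ball x0 R) ka0 T ==> 0 < r ==> 4*r <= R ==> ka0 <= ka ==> 0 < H ==> T <= H powr (p-1)*r powr-(s*p) ==> AL x. x : ball x0 R --> f x <= ka+H ==> ms {x:ball x0 r. ka < f x} <= vu*r^DIM('a) ==> AL x. x : ball x0 (r/2) --> f x <= ka+H/2"
proof -
 let ?om = "unit_ball_vol (real DIM('a))" and ?n = "real DIM('a)"
 let ?A = "%r. r^DIM('a)*r powr (s*p)"
 let ?G = "%C ga q. C powr (- (1/ga))*q powr (- (1/ga\<^sup>2))"
 let ?F = "%r j. r powr-(s*p)*(2 powr (s*p))^(j+2)"
 define ga where "ga = s*p/?n"
 have ga: "0 < ga" using sp0 by(simp add:ga_def)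
 define C0 where "C0 = 4*La*est_const/?om*(2/?om) powr ga"
 have C0: "0 < C0" using La0 est_const_pos by(simp add:C0_def)
 define q where "q = 2 powr (p+s*p)"
 have q: "1 < q" using p0 sp0 by(simp add:q_def)
 \<comment> \<open>Level and radius change by multiples of 2^-(j+2) in step j; the factor q^2
   absorbs the shift by two.\<close>
 define C where "C = C0*q\<^sup>2"
 have C: "0 < C" using C0 q by(simp add:C_def)
 define vu where "vu = min (?om/2) (?G C ga q)"
 have vu: "0 < vu" "vu <= ?om/2" "vu <= ?G C ga q"
  using C q by(auto simp:vu_def)
 show ?thesis
 proof(rule that[OF vu(1)])
  fix f x0 R r ka0 ka H T
  assume dg: "dg f (ball x0 (R/2)) (ball x0 R) ka0 T" and r: "0 < r" "4*r <= R"
   and ka: "ka0 <= ka" and H: "0 < H" and T: "T <= H powr (p-1)*r powr-(s*p)"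
   and le: "AL x. x : ball x0 R --> f x <= ka+H"
   and m: "ms {x:ball x0 r. ka < f x} <= vu*r^DIM('a)"
  have [measurable]: "f : Bor" using dg by(rule dg_measurable)
  have [measurable]: "ball x0 t : sets borel" for t by simp
  define kaj where "kaj j = ka+H/2*(1-(1/2)^j)" for j :: nat
  define rhj where "rhj j = r/2*(1+(1/2)^j)" for j :: nat
  define A where "A j = {x:ball x0 (rhj j). kaj j < f x}" for j
  define b where "b j = ms (A j)/r^DIM('a)" for j
  have [measurable]: "A j : sets borel" for j unfolding A_def by measurable
  have Afin: "em (A j) < infy" for j
   by(rule emeasure_bounded_finite, rule bounded_subset[OF bounded_ball]) (force simp:A_def)
  have rn: "0 < r^DIM('a)" using r by simp
  have half: "(1/2::real)^j <= 1" "0 < (1/2::real)^j" for j by(auto simp:power_le_one)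
  have b0: "b 0 <= vu" using m rn by(simp add:b_def A_def rhj_def kaj_def field_simps)
  have "b ~> 0"
  proof(rule fast_geometric_decay[OF C q ga])
   show "0 <= b j" for j using rn by(simp add:b_def)
   show "b 0 <= ?G C ga q" using b0 vu(3) by simp
   fix j assume bj: "b j <= b 0"
   define h where "h = H*(1/2)^(j+2)"
   have h: "0 < h" using H by(simp add:h_def)
   have kaS: "kaj (Suc j) = kaj j+h" by(simp add:kaj_def h_def algebra_simps)
   have rhS: "rhj j-rhj (Suc j) = r*(1/2)^(j+2)" by(simp add:rhj_def algebra_simps)
   have st: "h powr p * ms {x:ball x0 (rhj (Suc j)). kaj j+h < f x} <= C0*H powr p*(rhj j-rhj (Suc j)) powr-(s*p) * ms {x:ball x0 (rhj j). kaj j < f x} powr (1+ga)"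
    unfolding C0_def ga_def
   proof(rule de_giorgi_step[OF dg r _ _ _ h H T le])
    have "0 <= H/2*(1-(1/2)^j)" using H half(1)[of j] by simp
    thus "ka0 <= kaj j" "ka <= kaj j" using ka unfolding kaj_def by linarith+
    show "kaj j+h <= ka+H"
    proof -
     have "H/2*(1-(1/2)^Suc j) <= H/2*2" using H half(2)[of "Suc j"]
      by(intro mult_left_mono) linarith+
     hence "kaj (Suc j) <= ka+H" unfolding kaj_def by linarith
     thus ?thesis using kaS by simp
    qed
    show "0 < rhj (Suc j)" "rhj (Suc j) < rhj j" "rhj j <= r"
     using r half[of j] by(auto simp:rhj_def add_pos_pos)
    have "ms {x:ball x0 (rhj j). kaj j < f x} = b j*r^DIM('a)"
     using r by(simp add:b_def A_def)
    also have "... <= vu*r^DIM('a)"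
     using bj b0 rn by(intro mult_right_mono) auto
    also have "... <= ?om/2*r^DIM('a)" using vu(2) rn by(intro mult_right_mono) auto
    finally show "ms {x:ball x0 (rhj j). kaj j < f x} <= ?om/2*r^DIM('a)" .
   qed
   have aux: "((1/2::real)^m) powr a = (2 powr-a)^m" for m a
    by(induction m) (simp_all add:powr_mult powr_divide powr_minus field_simps)
   define m where "m = j+2"
   have e1: "(rhj j-rhj (Suc j)) powr-(s*p) = ?F r j"
    unfolding rhS m_def[symmetric] using r by(simp add:powr_mult aux)
   have e2: "h powr p*(2 powr p)^(j+2) = H powr p"
    unfolding h_def m_def[symmetric] using H
    by(simp add:powr_mult aux mult.assoc flip:power_mult_distrib powr_add)
   have mA: "ms (A i) = b i*r^DIM('a)" for i using r by(simp add:b_def)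
   have "H powr p*(b (Suc j)*r^DIM('a)) = (2 powr p)^(j+2)*(h powr p * ms (A (Suc j)))"
    using e2 by(simp add:mA mult_ac)
   also have "... <= (2 powr p)^(j+2)*(C0*H powr p*(?F r j) * ms (A j) powr (1+ga))"
    using st unfolding e1 A_def kaS by(intro mult_left_mono) auto
   also have "ms (A j) powr (1+ga) = b j powr (1+ga)*(?A r)"
   proof -
    have "(r^DIM('a)) powr (1+ga) = ?A r"
     using r by(simp add:powr_add ga_def powr_powr flip:powr_realpow)
    moreover have "0 <= b j" using rn by(simp add:b_def)
    ultimately show ?thesis using rn by(simp add:mA powr_mult)
   qed
   also have "(2 powr p)^(j+2)*(C0*H powr p*(?F r j)*(b j powr (1+ga)*(?A r))) = (H powr p*r^DIM('a))*(C0*((2 powr p)^(j+2)*(2 powr (s*p))^(j+2))*b j powr (1+ga))*(r powr-(s*p)*r powr (s*p))"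
    by(simp only: mult_ac)
   also have "r powr-(s*p)*r powr (s*p) = 1" using r by(simp flip:powr_add)
   also have "(2 powr p)^(j+2)*(2 powr (s*p))^(j+2) = q^(j+2)"
    by(simp only: power_mult_distrib[symmetric] q_def powr_add)
   finally have "H powr p*(b (Suc j)*r^DIM('a)) <= (H powr p*r^DIM('a))*(C0*q^(j+2)*b j powr (1+ga))"
    by(simp only: mult_1_right)
   hence "(H powr p*r^DIM('a))*b (Suc j) <= (H powr p*r^DIM('a))*(C0*q^(j+2)*b j powr (1+ga))"
    by(simp only: mult_ac)
   hence "b (Suc j) <= C0*q^(j+2)*b j powr (1+ga)"
    using rn H by(subst (asm) mult_le_cancel_left_pos) auto
   thus "b (Suc j) <= C*q^j*b j powr (1+ga)"
    by(simp add:C_def power_add mult_ac power2_eq_square)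
  qed
  hence lim: "(%j. b j*r^DIM('a)) ~> 0*r^DIM('a)" by(intro tendsto_intros)
  define B where "B = {x:ball x0 (r/2). ka+H/2 < f x}"
  have [measurable]: "B : sets borel" unfolding B_def by measurable
  have "ms B <= b j*r^DIM('a)" for j
  proof -
   have "r/2 <= rhj j" using r half(2)[of j] by(simp add:rhj_def)
   moreover have "kaj j <= ka+H/2" using H half(2)[of j] by(simp add:kaj_def)
   ultimately have "B <= A j" by(auto simp:A_def B_def)
   hence "ms B <= ms (A j)"
    using Afin by(intro measure_mono_fmeasurable) (auto simp:fmeasurable_def)
   thus ?thesis using r by(simp add:b_def)
  qed
  hence "ms B <= 0"
   using LIMSEQ_le_const[OF lim] by simp
  moreover have "em B < infy"
   by(rule emeasure_bounded_finite, rule bounded_subset[OF bounded_ball[of x0 "r/2"]]) (auto simp:B_def)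
  ultimately have "em B = 0"
   by(simp add:emeasure_eq_ennreal_measure measure_le_0_iff)
  hence "AL x. x ~: B" by(intro AE_not_in) (auto simp:null_sets_def)
  thus "AL x. x : ball x0 (r/2) --> f x <= ka+H/2"
   by(rule eventually_mono) (auto simp:B_def)
 qed
qed

end

context frac_kernel
begin

text \<open>Nonlocality replaces the isoperimetric lemma. Let h = t H and let the level ka1 lie h
  below the upper bound. A point where f > ka1 + h/2 and a point where f <= ka contribute at least
  (H/2)^(p-1) (h/2), and the kernel between them is at least of order r^(-n-s p). The energy
  estimate bounds the total by a multiple of h^p r^(n-s p). So the first set has density of order
  t^(p-1), and \<open>de_giorgi_small_measure\<close> applies once t is small.\<close>

lemma de_giorgi_growth:
 assumes c0: "0 < c0"
 obtains th where "0 < th" "th < 1" "!!f x0 R r ka0 ka H T. dg f (ball x0 (R/2)) (ball x0 R) ka0 T ==> 0 < r ==> 4*r <= R ==> ka0 <= ka ==> 0 < H ==> T <= (th*H) powr (p-1)*r powr-(s*p) ==> AL x. x : ball x0 R --> f x <= ka+H ==> c0*r^DIM('a) <= ms {x:ball x0 r. f x <= ka} ==> AL x. x : ball x0 (r/2) --> f x <= ka+(1-th)*H"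
proof -
 let ?om = "unit_ball_vol (real DIM('a))" and ?N = "real DIM('a)+s*p"
 let ?C = "%h r. h powr p*r powr-(s*p)"
 let ?B = "%H h. (H/2) powr (p-1)*(h/2)"
 let ?A = "2 powr p*La*2 powr ?N"
 let ?G = "%t r. 2*est_const*?om*2^DIM('a)*(t powr (p-1)*r^DIM('a))"
 let ?F = "%h r. est_const*(2*(?C h r))*(?om*2^DIM('a)*r^DIM('a))"
 obtain vu where vu: "0 < vu" "!!f x0 R r ka0 ka H T. dg f (ball x0 (R/2)) (ball x0 R) ka0 T ==> 0 < r ==> 4*r <= R ==> ka0 <= ka ==> 0 < H ==> T <= H powr (p-1)*r powr-(s*p) ==> AL x. x : ball x0 R --> f x <= ka+H ==> ms {x:ball x0 r. ka < f x} <= vu*r^DIM('a) ==> AL x. x : ball x0 (r/2) --> f x <= ka+H/2"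
  using de_giorgi_small_measure by blast
 define E where "E = 2*est_const*?om*2^DIM('a)*(2 powr p*La*2 powr ?N/c0)"
 have E: "0 < E" using est_const_pos La0 c0 by(simp add:E_def)
 define t where "t = min (1/2) ((vu/E) powr (1/(p-1)))"
 have t: "0 < t" "t <= 1/2" using vu(1) E by(auto simp:t_def)
 have tE: "E*t powr (p-1) <= vu"
 proof -
  have "t powr (p-1) <= ((vu/E) powr (1/(p-1))) powr (p-1)"
   using t p1 by(intro powr_mono2) (auto simp:t_def)
  also have "... = vu/E" using p1 vu(1) E by(simp add:powr_powr)
  finally show ?thesis using E by(simp add:field_simps)
 qed
 show ?thesis
 \<comment> \<open>The small density lemma is applied at level ka1 + h/2 with height h/2 and ends at
   ka1 + 3h/4 = ka + H - h/4; hence the gain t/4.\<close>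
 proof(rule that[of "t/4"])
  fix f x0 R r ka0 ka H T
  assume dg: "dg f (ball x0 (R/2)) (ball x0 R) ka0 T" and r: "0 < r" "4*r <= R"
   and ka: "ka0 <= ka" and H: "0 < H" and T: "T <= (t/4*H) powr (p-1)*r powr-(s*p)"
   and le: "AL x. x : ball x0 R --> f x <= ka+H"
   and m: "c0*r^DIM('a) <= ms {x:ball x0 r. f x <= ka}"
  have [measurable]: "f : Bor" using dg by(rule dg_measurable)
  have [measurable]: "ball x d : sets borel" for d and x :: 'a by simp
  let ?U = "ball x0 (R/2)" and ?V = "ball x0 R"
  define ka1 where "ka1 = ka+(1-t)*H"
  define h where "h = t*H"
  have h: "0 < h" "h <= H/2" using t H by(simp_all add:h_def)
  have ka1: "ka1+h = ka+H" "ka+H/2 <= ka1"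
  proof -
   have "t*H <= 1/2*H" using H t by(intro mult_right_mono) auto
   thus "ka1+h = ka+H" "ka+H/2 <= ka1" by(simp_all add:ka1_def h_def left_diff_distrib)
  qed
  have Tm: "T <= d powr (p-1)*r powr-(s*p)" if "t/4*H <= d" for d
  proof -
   have "(t/4*H) powr (p-1) <= d powr (p-1)"
    using that p1 t H by(intro powr_mono2) auto
   thus ?thesis using T by(meson mult_right_mono order_trans powr_ge_zero)
  qed
  have rn: "0 < r^DIM('a)" using r by simp
  define ze where "ze = radial x0 r (2*r)"
  have cut: "cutoff_fun ?U r ze"
   using cutoff_radial[of r "2*r" x0 ?U] r by(simp add:ze_def subset_ball)
  hence [measurable]: "ze : Bor" by(simp add:cutoff_fun_def)
  have ze0: "ze x = 0" if "dist x0 x < r" for x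
   unfolding ze_def using that r by(intro radial_0) auto
  define S where "S = {x:?U. ka1+h*ze x < f x}"
  define P where "P = {x:ball x0 r. ka1+h/2 < f x}"
  define Y where "Y = {x:ball x0 r. f x <= ka}"
  have [measurable]: "S : sets borel" "P : sets borel" "Y : sets borel"
   unfolding S_def P_def Y_def by measurable
  have fin: "em P < infy" "em Y < infy"
   by(rule emeasure_bounded_finite, rule bounded_subset[OF bounded_ball[of x0 r]], force simp:P_def Y_def)+
  have em: "em P = en (ms P)" "em Y = en (ms Y)"
   using fin by(auto simp:emeasure_eq_ennreal_measure)
  have SA: "AL x. x : S --> x : ball x0 (2*r)"
   using le
  proof(rule eventually_mono)
   fix x assume x: "x : ?V --> f x <= ka+H"
   show "x : S --> x : ball x0 (2*r)"
   proof(rule impI, rule ccontr)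
    assume xS: "x : S" and n: "x ~: ball x0 (2*r)"
    hence "ze x = 1" unfolding ze_def using r by(intro radial_1) auto
    thus False using xS x ka1 r by(auto simp:S_def)
   qed
  qed
  have S_le: "em S <= en (?om*2^DIM('a)*r^DIM('a))"
   using AE_lborel_imp_emeasure_le[OF SA] r by(simp add:emeasure_ball power_mult_distrib mult.assoc)
  define kl where "kl = (2*r) powr-?N/La"
  define cc where "cc = (H/2) powr (p-1)*(h/2) * kl"
  let ?c = "cc * ms Y"
  define F where "F z = dl (%x. f x-(ka1+h*ze x)) z |^ (p-1)*abs (dl (trunc_test ?U f (%x. ka1+h*ze x)) z)*ind (?V \<times> ?V) z" for z
  have [measurable]: "F : Bor"
   unfolding F_def[abs_def] by measurable
  have kl0: "0 <= kl" using La0 by(simp add:kl_def)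
  hence cc0: "0 <= cc" using h by(simp add:cc_def)
  have "en ?c*em P <= (NM z. en (F z))"
  proof(rule nn_integral_mu_lower)
   fix x assume x: "x : P"
   hence xr: "dist x0 x < r" "ka1+h/2 < f x" by(auto simp:P_def)
   have xU: "x : ?U" "x : ?V" using xr r by auto
   have "en ?c = (NL y. en cc*ind Y y)"
    using cc0 by(subst nn_integral_cmult_indicator) (auto simp:em ennreal_mult)
   also have "... <= (NL y. en (F (x, y))*en (k x y))"
   proof(rule nn_integral_mono)
    fix y
    show "en cc*ind Y y <= en (F (x, y))*en (k x y)"
    proof(cases "y : Y")
     case True
     hence yr: "dist x0 y < r" "f y <= ka" by(auto simp:Y_def)
     have yU: "y : ?U" "y : ?V" using yr r by auto
     have ty: "trunc_test ?U f (%x. ka1+h*ze x) y = 0"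
      using yU yr ka1 H ze0[OF yr(1)] by(simp add:trunc_test_def)
     have tx: "trunc_test ?U f (%x. ka1+h*ze x) x = f x-ka1"
      using xU xr h ze0[OF xr(1)] by(simp add:trunc_test_def)
     have "?B H h <= dl (%x. f x-(ka1+h*ze x)) (x, y) |^ (p-1)*abs (dl (trunc_test ?U f (%x. ka1+h*ze x)) (x, y))"
      using h p1 xr yr tx ty H ka1 ze0 by(intro mult_mono powr_mono2) (auto simp:dl_def)
     also have "... = F (x, y)" using xU yU by(simp add:F_def)
     finally have 1: "?B H h <= F (x, y)" .
     have "norm (x-y) <= 2*r"
      using dist_triangle[of x y x0] xr yr dist_commute[of x x0] by(simp add:dist_norm[symmetric])
     moreover have "x ~= y" using xr yr ka1 h H by auto
     ultimately have "(2*r) powr-?N <= norm (x-y) powr-?N"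
      using sp0 by(intro powr_mono2') auto
     hence "(2*r) powr-?N <= La * k x y" using k_lower[of x y] by(rule order_trans)
     hence kk: "kl <= k x y" using La0 by(simp add:kl_def divide_le_eq mult.commute)
     have F0: "0 <= F (x, y)" by(simp add:F_def)
     have "cc <= F (x, y) * k x y"
      unfolding cc_def using 1 kl0 kk F0 by(intro mult_mono) auto
     thus ?thesis
      using True F0 k_nonneg by(simp add:ennreal_leI flip:ennreal_mult)
    qed simp
   qed
   finally show "en ?c <= (NL y. en (F (x, y))*en (k x y))" .
  qed measurable
  also have "(NM z. en (F z)) = (NM z. en (dl (%x. f x-(ka1+h*ze x)) z |^ (p-1)*abs (dl (trunc_test ?U f (%x. ka1+h*ze x)) z))*ind (?V \<times> ?V) z)"
   by(intro nn_integral_cong) (auto simp:F_def split:split_indicator)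
  also have "... <= en (est_const*(?C h r+T*h))*em S"
   unfolding S_def using ka ka1 h H le by(intro dgD[OF dg _ h(1) cut]) auto
  also have "... <= en (est_const*(2*(?C h r)))*en (?om*2^DIM('a)*r^DIM('a))"
  proof(rule mult_mono[OF ennreal_leI S_le])
   have "T*h <= h powr (p-1)*r powr-(s*p)*h"
    using h t H by(intro mult_right_mono Tm) (auto simp:h_def)
   also have "... = ?C h r" using h by(simp add:powr_diff)
   finally show "est_const*(?C h r+T*h) <= est_const*(2*(?C h r))"
    using est_const_pos by(intro mult_left_mono) auto
  qed auto
  finally have "en (?c * ms P) <= en (?F h r)"
   using cc0 est_const_pos r by(simp add:em ennreal_mult[symmetric])
  hence fin: "?c * ms P <= ?F h r"
   using est_const_pos r by(subst (asm) ennreal_le_iff) auto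
  define X where "X = H powr p*(t*r powr-(s*p))"
  have X: "0 < X" using H t r by(simp add:X_def)
  have e1: "cc*(c0*r^DIM('a)) = X*(c0/(?A))"
  proof -
   have "?B H h = t*(H/2) powr p"
    using H by(simp add:h_def powr_diff)
   also have "... = t*H powr p/2 powr p" using H by(simp add:powr_divide)
   finally have a: "?B H h = t*H powr p/2 powr p" .
   have "kl*r^DIM('a) = 2 powr-?N/La*(r powr-?N*r powr real DIM('a))"
    using r by(simp add:kl_def powr_mult powr_realpow)
   also have "r powr-?N*r powr real DIM('a) = r powr-(s*p)"
    by(simp flip:powr_add)
   finally have b: "kl*r^DIM('a) = r powr-(s*p)*(1/(La*2 powr ?N))"
    unfolding powr_minus_divide[of 2 ?N] by simp
   have "cc*(c0*r^DIM('a)) = (?B H h)*(kl*r^DIM('a))*c0"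
    by(simp only: cc_def mult_ac)
   also have "... = X*(c0/(?A))"
    unfolding a b X_def by(simp add:mult_ac)
   finally show ?thesis .
  qed
  have "X*(c0/(?A)) * ms P <= ?c * ms P"
   unfolding e1[symmetric] Y_def using m cc0
   by(intro mult_right_mono mult_left_mono) auto
  also note fin
  also have "?F h r = X*(?G t r)"
  proof -
   have "h powr p = H powr p*(t*t powr (p-1))"
    using t H by(simp add:h_def powr_mult powr_diff)
   thus ?thesis by(simp add:X_def)
  qed
  finally have "X*(c0/(?A) * ms P) <= X*(?G t r)"
   by(simp only: mult.assoc)
  hence "c0/(?A) * ms P <= ?G t r"
   using X by(subst (asm) mult_le_cancel_left_pos) auto
  hence "ms P <= E*t powr (p-1)*r^DIM('a)"
   using c0 La0 by(simp add:E_def field_simps)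
  also have "... <= vu*r^DIM('a)" using tE rn by(intro mult_right_mono) auto
  finally have mP: "ms {x:ball x0 r. ka1+h/2 < f x} <= vu*r^DIM('a)"
   by(simp add:P_def)
  have "AL x. x : ball x0 (r/2) --> f x <= (ka1+h/2)+(h/2)/2"
  proof(rule vu(2)[OF dg r _ _ _ _ mP])
   show "ka0 <= ka1+h/2" using ka ka1 h H by linarith
   show "T <= (h/2) powr (p-1)*r powr-(s*p)" using t H by(intro Tm) (simp add:h_def)
   show "AL x. x : ball x0 R --> f x <= ka1+h/2+h/2"
    using le by(rule eventually_mono) (use ka1 in auto)
  qed (use h in auto)
  moreover have "(ka1+h/2)+(h/2)/2 = ka+(1-t/4)*H"
   by(simp add:ka1_def h_def algebra_simps)
  ultimately show "AL x. x : ball x0 (r/2) --> f x <= ka+(1-t/4)*H" by simp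
 qed (use t in auto)
qed

lemma tail_diff_const: "tail f ==> tail (%x. f x-c)"
 using tail_add[of f "%_. - c"] tail_const[of "- c"] by simp

lemma tail_minus: "tail f ==> tail (%x. - f x)"
 by(simp add:tail_def)

lemma far_integral_bound:
 assumes "tail f" "inside U V"
 obtains T where "0 <= T" "!!x ka. x : U ==> ka0 <= ka ==> (NL y. en (max (f y-ka) 0 powr (p-1))*ind (- V) y*en (k x y)) <= en T"
proof -
 let ?G = "%y. (f y-ka0) |^ (p-1)*wt y"
 let ?F = "%y ka x. en (max (f y-ka) 0 powr (p-1))*ind (- V) y*en (k x y)"
 obtain C where C: "0 < C" "!!x y. x : U ==> y ~: V ==> k x y <= C*wt y"
  using inside_kernel[OF assms(2)] by blast
 have [measurable]: "f : Bor" using assms(1) by(rule tail_measurable)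
 let ?I = "NL y. en (?G y)"
 have I: "?I < infy" using tail_diff_const[OF assms(1), of ka0] by(simp add:tail_def)
 show ?thesis
 proof(rule that[of "enn2real (en C*?I)"])
  fix x ka assume x: "x : U" and ka: "ka0 <= ka"
  have "(NL y. ?F y ka x) <= (NL y. en C*en (?G y))"
  proof(rule nn_integral_mono)
   fix y
   show "?F y ka x <= en C*en (?G y)"
   proof(cases "y : V")
    case False
    have "max (f y-ka) 0 powr (p-1) * k x y <= (f y-ka0) |^ (p-1)*(C*wt y)"
     using C(2)[OF x False] ka p1 k_nonneg by(intro mult_mono powr_mono2) auto
    thus ?thesis
     using False C(1) k_nonneg by(simp add:ennreal_leI mult_ac flip:ennreal_mult')
   qed simp
  qed
  also have "... = en C*?I" by(rule nn_integral_cmult) measurable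
  also have "... = en (enn2real (en C*?I))"
   using I by(simp add:ennreal_mult_less_top)
  finally show "(NL y. ?F y ka x) <= en (enn2real (en C*?I))" .
 qed simp
qed

lemma energy_extend:
 assumes UV: "inside U V" and [measurable]: "eh : Bor"
  and eh: "!!x. (abs (eh x)) <= B" "!!x. x ~: U ==> eh x = 0" "energy V eh < infy"
 shows "energy X eh < infy"
proof -
 let ?F = "%z. en (dl eh z |^ p)*ind (V \<times> V) z+en (B powr p)*en (farfun U V (%_. 1) z)"
 have [measurable]: "U : sets borel" "V : sets borel" using UV by(auto simp:inside_def)
 have sub: "U <= V" using UV by(rule insideD)
 have "energy X eh <= (NM z. ?F z)"
  unfolding energy_def
 proof(rule nn_integral_mono)
  fix z :: "'a \<times> 'a"
  obtain x y where z: "z = (x, y)" by(cases z)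
  show "en (dl eh z |^ p)*ind (X \<times> X) z <= ?F z"
  proof(cases "z : V \<times> V | dl eh z = 0")
   case True
   thus ?thesis by(auto split:split_indicator simp:add_increasing2)
  next
   case False
   then consider "x : U" "y ~: V" | "y : U" "x ~: V"
    using False sub eh(2)[of x] eh(2)[of y] unfolding z dl_def by fastforce
   hence "abs (dl eh z) <= B & 1 <= farfun U V (%_. 1) z"
   proof cases
    case 1
    hence "eh y = 0" "y ~: U" using sub eh(2)[of y] by auto
    thus ?thesis using 1 eh(1)[of x] by(simp add:dl_def z farfun_def)
   next
    case 2
    hence "eh x = 0" "x ~: U" using sub eh(2)[of x] by auto
    thus ?thesis using 2 eh(1)[of y] by(simp add:dl_def z farfun_def)
   qed
   hence "dl eh z |^ p*1 <= B powr p*farfun U V (%_. 1) z"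
    using p0 by(intro mult_mono powr_mono2) auto
   hence "en (dl eh z |^ p) <= en (B powr p)*en (farfun U V (%_. 1) z)"
    by(simp add:ennreal_leI flip:ennreal_mult')
   thus ?thesis using False by(auto split:split_indicator)
  qed
 qed
 also have "... = energy V eh+en (B powr p)*(NM z. en (farfun U V (%_. 1) z))"
  unfolding energy_def by(subst nn_integral_add) (simp_all add:nn_integral_cmult)
 also have "... < infy"
  using eh(3) farfun_finite[OF tail_const UV] by(simp add:ennreal_mult_less_top)
 finally show ?thesis .
qed

lemma energy_cong_AE:
 assumes "AL x. x : V --> f x = h x"
 shows "energy V f = energy V h"
 unfolding energy_def
proof(rule nn_integral_cong_AE)
 show "AE z in mu. en (dl f z |^ p)*ind (V \<times> V) z = en (dl h z |^ p)*ind (V \<times> V) z"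
  using AE_muI[OF assms] by eventually_elim (auto simp:dl_def split:split_indicator)
qed

lemma trunc_test_energy:
 assumes UV: "inside U V" and V: "bounded V" and [measurable]: "f : Bor" and e: "energy V f < infy"
  and ze: "cutoff_fun U l ze" and H: "0 < H" and le: "AL x. x : V --> f x <= ka+H"
  and B: "!!x. x : U ==> f x-ka <= B" "0 <= B"
 defines "eh == trunc_test U f (%x. ka+H*ze x)"
 shows "energy X eh < infy" and "!!x. (abs (eh x)) <= B"
proof -
 have [measurable]: "U : sets borel" "V : sets borel" using UV by(auto simp:inside_def)
 have [measurable]: "ze : Bor" using ze by(simp add:cutoff_fun_def)
 have [measurable]: "eh : Bor" unfolding eh_def by measurable
 have ze0: "0 <= H*ze x" for x using ze H by(simp add:cutoff_fun_def)
 show bd: "abs (eh x) <= B" for x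
  using B(1)[of x] B(2) ze0[of x] by(auto simp:eh_def trunc_test_def)
 have "energy V (%x. ka+H*ze x) <= en (H powr p*(lip_const*l powr-(s*p)))*em V"
 proof(rule energy_lipschitz)
  fix x y
  have "0 <= ze x" "ze x <= 1" "0 <= ze y" "ze y <= 1" "abs (ze x-ze y) <= norm (x-y)/l"
   using ze by(simp_all add:cutoff_fun_def)
  hence "abs (ze x-ze y) <= 1" "abs (ze x-ze y) <= norm (x-y)/l" by linarith+
  hence "H*abs (ze x-ze y) <= H*1" "H*abs (ze x-ze y) <= H*(norm (x-y)/l)"
   using H by(intro mult_left_mono; simp)+
  moreover have "ka+H*ze x-(ka+H*ze y) = H*(ze x-ze y)"
   by(simp add:right_diff_distrib)
  hence "abs (ka+H*ze x-(ka+H*ze y)) = H*abs (ze x-ze y)"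
   using H by(simp add:abs_mult)
  ultimately show "abs (ka+H*ze x-(ka+H*ze y)) <= H" "abs (ka+H*ze x-(ka+H*ze y)) <= H*(norm (x-y)/l)"
   by simp_all
 qed (use H ze in \<open>auto simp:cutoff_fun_def\<close>)
 also have "... < infy"
  using emeasure_bounded_finite[OF V] by(simp add:ennreal_mult_less_top)
 finally have eph: "energy V (%x. ka+H*ze x) < infy" .
 have "energy V eh = energy V (%x. max (f x-(ka+H*ze x)) 0)"
 proof(rule energy_cong_AE)
  show "AL x. x : V --> eh x = max (f x-(ka+H*ze x)) 0"
   using le by(rule eventually_mono) (use ze in \<open>auto simp:eh_def trunc_test_def cutoff_fun_def\<close>)
 qed
 also have "... <= energy V (%x. f x-(ka+H*ze x))"
  by(rule energy_contraction) (auto simp:max_def)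
 also have "... <= en (2 powr p)*(energy V f+energy V (%x. ka+H*ze x))"
  by(rule energy_le_sum) auto
 also have "... < infy" using e eph by(simp add:ennreal_mult_less_top)
 finally have eV: "energy V eh < infy" .
 have off: "eh x = 0" if "x ~: U" for x using that by(simp add:eh_def trunc_test_def)
 show "energy X eh < infy"
  by(rule energy_extend[OF UV _ bd off eV]) measurable
qed

end

section \<open>Continuity and boundary behaviour of solutions of the obstacle problem\<close>

locale obstacle_sol = obstacle s p La k D D0 g lo hi A
 for s p La and k :: "'a::euclidean_space => 'a => real" and D D0 g lo hi A +
 fixes w :: "'a => real"
 assumes w_meas [measurable]: "w : Bor"
  and w_off: "!!x. x ~: D ==> w x = g x" and w_ge: "!!x. g x <= w x" and w_hi: "!!x. w x <= hi"
  and w_energy: "energy D0 w < infy"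
  and w_var: "!!eh B t. eh : Bor ==> (!!x. (abs (eh x)) <= B) ==> (!!x. x ~: D ==> eh x = 0) ==> energy D0 eh < infy ==> 0 < t ==> (!!x. x : D ==> g x <= w x+t*eh x) ==> 0 <= (BM v. jp p (dl w v)*dl eh v)"
begin

lemma w_le_dom: "abs (w x) <= abs (dom x)"
 using w_ge[of x] w_hi[of x] by(auto simp:dom_def)

lemma w_tail: "tail w"
 by(rule tail_mono[OF tail_dom w_meas w_le_dom])

lemma w_integrable:
 assumes "eh : Bor" "!!x. (abs (eh x)) <= B" "!!x. x ~: D ==> eh x = 0" "energy D0 eh < infy"
 shows "integrable mu (%v. jp p (dl w v)*dl eh v)"
 by(rule integrable_jp_dl[OF w_tail w_energy D_D0 assms])

lemma bounded_sub: "V <= D0 ==> bounded V"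
 using bounded_D0 bounded_subset by blast

lemma energy_sub: "V <= D0 ==> energy V w < infy"
 using energy_mono[of V D0 w] w_energy by(rule order_le_less_trans)

text \<open>Where \<open>eh\<close> is positive, lowering \<open>w\<close> by it leaves the barrier,
  which is at least ka >= g. So -eh is an admissible direction at levels above the obstacle.\<close>

lemma upper_test:
 assumes UV: "inside U V" and V: "V <= D0" and ka: "!!x. x : V ==> g x <= ka" and H: "0 < H"
  and ze: "cutoff_fun U l ze" and le: "AL x. x : V --> w x <= ka+H"
 defines "eh == trunc_test U w (%x. ka+H*ze x)"
 shows "integrable mu (%v. jp p (dl w v)*dl eh v)" and "(BM v. jp p (dl w v)*dl eh v) <= 0"
proof -
 have [measurable]: "U : sets borel" using UV by(auto simp:inside_def)
 have [measurable]: "ze : Bor" using ze by(simp add:cutoff_fun_def)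
 have m [measurable]: "eh : Bor" unfolding eh_def by measurable
 have ze0: "0 <= H*ze x" for x using ze H by(simp add:cutoff_fun_def)
 have b: "w x-ka <= abs (hi-ka)" for x using w_hi[of x] by linarith
 have eh: "energy D0 eh < infy" "!!x. (abs (eh x)) <= abs (hi-ka)"
  using trunc_test_energy[OF UV bounded_sub[OF V] w_meas energy_sub[OF V] ze H le b abs_ge_zero]
  unfolding eh_def by blast+
 have off: "eh x = 0" if "x ~: D" for x
  using that w_off[OF that] ka[of x] ze0[of x] insideD[OF UV] by(auto simp:eh_def trunc_test_def)
 show "integrable mu (%v. jp p (dl w v)*dl eh v)"
  by(rule w_integrable[OF m eh(2) off eh(1)])
 have "energy D0 (%x. - eh x) < infy" using eh(1) by(simp add:energy_def dl_def abs_minus_commute)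
 moreover have "g x <= w x+1 * - eh x" for x
  using w_ge[of x] ka[of x] ze0[of x] insideD[OF UV] by(auto simp:eh_def trunc_test_def max_def)
 ultimately have "0 <= (BM v. jp p (dl w v)*dl (%x. - eh x) v)"
  using eh(2) off by(intro w_var[of _ "abs (hi-ka)" 1]) auto
 also have "... = (BM v. - (jp p (dl w v)*dl eh v))"
  by(intro Bochner_Integration.integral_cong) (auto simp:dl_def algebra_simps)
 finally show "(BM v. jp p (dl w v)*dl eh v) <= 0" by simp
qed

text \<open>Raising \<open>w\<close> is always admissible, so -w satisfies the estimate at every
  level; in exchange \<open>V\<close> has to lie in \<open>D\<close>.\<close>

lemma lower_test:
 assumes UV: "inside U V" and V: "V <= D" and H: "0 < H"
  and ze: "cutoff_fun U l ze" and le: "AL x. x : V --> - w x <= ka+H"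
 defines "eh == trunc_test U (%x. - w x) (%x. ka+H*ze x)"
 shows "integrable mu (%v. jp p (dl (%x. - w x) v)*dl eh v)" and "(BM v. jp p (dl (%x. - w x) v)*dl eh v) <= 0"
proof -
 let ?F = "%v. jp p (dl (%x. - w x) v)*dl eh v"
 have [measurable]: "U : sets borel" using UV by(auto simp:inside_def)
 have [measurable]: "ze : Bor" using ze by(simp add:cutoff_fun_def)
 have m [measurable]: "eh : Bor" unfolding eh_def by measurable
 have VD0: "V <= D0" using V D_sub by auto
 have b: "- w x-ka <= abs lo+abs ka" if "x : U" for x
 proof -
  have "x : D0" using that insideD[OF UV] VD0 by auto
  thus ?thesis using w_ge[of x] g_lo[of x] by linarith
 qed
 have en: "energy V (%x. - w x) < infy"
  using energy_sub[OF VD0] by(simp add:energy_def dl_def abs_minus_commute)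
 have m': "(%x. - w x) : Bor" by measurable
 have "0 <= abs lo+abs ka" by simp
 hence eh: "energy D0 eh < infy" "!!x. (abs (eh x)) <= abs lo+abs ka"
  using trunc_test_energy[OF UV bounded_sub[OF VD0] m' en ze H le b]
  unfolding eh_def by blast+
 have off: "eh x = 0" if "x ~: D" for x
  using that V insideD[OF UV] by(auto simp:eh_def trunc_test_def)
 have neg: "?F v = - (jp p (dl w v)*dl eh v)" for v
  by(simp add:dl_def jp_minus_commute[of p "w (snd v)"])
 show "integrable mu (%v. ?F v)"
  unfolding neg using w_integrable[OF m eh(2) off eh(1)] by simp
 have "g x <= w x+1*eh x" for x
  using w_ge[of x] by(simp add:eh_def trunc_test_nonneg add_increasing2)
 hence "0 <= (BM v. jp p (dl w v)*dl eh v)"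
  using eh off by(intro w_var[of _ "abs lo+abs ka" 1]) auto
 thus "(BM v. ?F v) <= 0"
  unfolding neg by simp
qed

lemma dg_upper:
 assumes UV: "inside U V" and V: "V <= D0" and ka0: "!!x. x : V ==> g x <= ka0"
 obtains T where "dg w U V ka0 T"
proof -
 obtain T where T: "0 <= T" "!!x ka. x : U ==> ka0 <= ka ==> (NL y. en (max (w y-ka) 0 powr (p-1))*ind (- V) y*en (k x y)) <= en T"
  using far_integral_bound[OF w_tail UV] by blast
 show ?thesis
 proof(rule that, unfold dg_def, intro conjI allI impI)
  fix ka H l ze
  assume a: "ka0 <= ka" "0 < H" "cutoff_fun U l ze" "AL x. x : V --> w x <= ka+H"
  have "!!x. x : V ==> g x <= ka" using ka0 a(1) by force
  from upper_test[OF UV V this a(2,3,4)]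
  show "(NM z. en (dl (%x. w x-(ka+H*ze x)) z |^ (p-1)*abs (dl (trunc_test U w (%x. ka+H*ze x)) z))*ind (V \<times> V) z) <= en (est_const*(H powr p*l powr-(s*p)+T*H))*em {x:U. ka+H*ze x < w x}"
   using T a by(intro energy_estimate(1)[OF UV w_meas a(3,2,4)]) auto
 qed (use T in auto)
qed

lemma dg_lower:
 assumes UV: "inside U V" and V: "V <= D"
 obtains T where "dg (%x. - w x) U V ka0 T"
proof -
 obtain T where T: "0 <= T" "!!x ka. x : U ==> ka0 <= ka ==> (NL y. en (max (- w y-ka) 0 powr (p-1))*ind (- V) y*en (k x y)) <= en T"
  using far_integral_bound[OF tail_minus[OF w_tail] UV] by blast
 show ?thesis
 proof(rule that, unfold dg_def, intro conjI allI impI)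
  fix ka H l ze
  assume a: "ka0 <= ka" "0 < H" "cutoff_fun U l ze" "AL x. x : V --> - w x <= ka+H"
  from lower_test[OF UV V a(2,3,4)]
  show "(NM z. en (dl (%x. - w x-(ka+H*ze x)) z |^ (p-1)*abs (dl (trunc_test U (%x. - w x) (%x. ka+H*ze x)) z))*ind (V \<times> V) z) <= en (est_const*(H powr p*l powr-(s*p)+T*H))*em {x:U. ka+H*ze x < - w x}"
   using T a by(intro energy_estimate(1)[OF UV _ a(3,2,4)]) auto
 qed (use T in auto)
qed

end

lemma AE_open_ex:
 fixes S :: "'a::euclidean_space set"
 assumes "open S" "S ~= {}" "AL x. x : S --> P x"
 obtains x where "x : S" "P x"
proof -
 obtain y r where y: "0 < r" "ball y r <= S"
  using assms(1,2) by(meson ex_in_conv open_contains_ball)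
 have "EX x:S. P x"
 proof(rule ccontr)
  assume "~ (EX x:S. P x)"
  hence "AL x. x ~: ball y r"
   using assms(3) y(2) by(auto elim!: eventually_mono)
  hence "em (ball y r) = 0"
   by(subst (asm) AE_iff_measurable[of "ball y r"]) auto
  moreover have "0 < unit_ball_vol (real DIM('a))*r^DIM('a)" using y by simp
  ultimately show False using y by(simp add:emeasure_ball ennreal_eq_0_iff)
 qed
 thus ?thesis using that by blast
qed

lemma AE_open_continuous_le:
 fixes f :: "'a::euclidean_space => real"
 assumes "open S" "continuous_on S f" "AL x. x : S --> f x <= c" "x : S"
 shows "f x <= c"
proof(rule ccontr)
 let ?F = "f -` {c<..} Int S"
 assume "~ f x <= c"
 have 1: "open (?F)"
  using assms(1,2) by(intro continuous_on_open_vimage[THEN iffD1, rule_format]) auto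
 have "x : ?F" using \<open>~ f x <= c\<close> assms(4) by auto
 hence 2: "?F ~= {}" by blast
 have 3: "AL y. y : ?F --> False"
  using assms(3) by(rule eventually_mono) auto
 show False by(rule AE_open_ex[OF 1 2 3])
qed

text \<open>The essential limit superior at \<open>x\<close>. The infimum is taken in the reals and
  is meaningful under the local essential bounds of \<open>esup_bounded\<close>.\<close>

definition esup :: "('a::euclidean_space => real) => 'a => real"
 where "esup f x = Inf {M. EX r>0. AL y. y : ball x r --> f y <= M}"

lemma esup_bounded:
 assumes r0: "0 < r0" and f: "AL y. y : ball x r0 --> a <= f y & f y <= b"
 shows "esup f x < M ==> EX r>0. AL y. y : ball x r --> f y <= M"
  and "0 < r ==> AL y. y : ball x r --> f y <= m ==> esup f x <= m"
  and "a <= esup f x" and "esup f x <= b"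
proof -
 let ?S = "{M. EX r>0. AL y. y : ball x r --> f y <= M}"
 have b: "b : ?S" using r0 f by(auto intro!: exI[of _ r0] elim!: eventually_mono)
 have lb: "a <= M" if M: "M : ?S" for M
 proof -
  obtain r where r: "0 < r" "AL y. y : ball x r --> f y <= M" using M by auto
  have "AL y. y : ball x (min r r0) --> a <= f y & f y <= M"
   using f r(2) by eventually_elim auto
  then obtain y where "a <= f y & f y <= M"
   by(rule AE_open_ex[rotated 2]) (use r r0 in auto)
  thus ?thesis by linarith
 qed
 have bdd: "bdd_below ?S" using lb by(rule bdd_belowI)
 show "esup f x < M ==> EX r>0. AL y. y : ball x r --> f y <= M"
 proof -
  assume "esup f x < M"
  then obtain M' where "M' : ?S" "M' < M"
   using cInf_lessD[of ?S M] b unfolding esup_def by blast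
  thus ?thesis by(auto elim!: eventually_mono)
 qed
 show "0 < r ==> AL y. y : ball x r --> f y <= m ==> esup f x <= m"
  unfolding esup_def using bdd by(intro cInf_lower) auto
 show "esup f x <= b" unfolding esup_def using bdd b by(intro cInf_lower)
 show "a <= esup f x" unfolding esup_def using b lb by(intro cInf_greatest) auto
qed

lemma inside_balls:
 assumes "0 < R" shows "inside (ball x (R/2)) (ball (x::'a::euclidean_space) R)"
 unfolding inside_def
proof(intro conjI exI[of _ "R/2"] ballI allI impI)
 fix y z assume "y : ball x (R/2)" "z ~: ball x R"
 thus "R/2 <= norm (y-z)"
  using dist_triangle[of x z y] by(auto simp:dist_norm[symmetric])
qed (use assms in auto)

context frac_kernel
begin

text \<open>The growth lemma prepared for contradictions, with M0 an essential upper limit of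
  \<open>f\<close>: if \<open>f\<close> exceeds M0 by at most \<open>de\<close> near the point and
  one small ball has a fixed proportion of {f <= ka}, then f <= m < M0 on a smaller ball. The
  overshoot \<open>de\<close> is chosen below the gain th * H. A single small scale suffices, and no
  modulus of continuity is produced.\<close>

lemma one_shot:
 assumes "0 < c0" "ka < M0"
 obtains m de where "m < M0" "0 < de" "!!f x0 R ka0 T. dg f (ball x0 (R/2)) (ball x0 R) ka0 T ==> ka0 <= ka ==> 0 < R ==> AL x. x : ball x0 R --> f x <= M0+de ==> EX rh>0. ALL r. 0 < r & r <= rh & c0*r^DIM('a) <= ms {x:ball x0 r. f x <= ka} --> (AL x. x : ball x0 (r/2) --> f x <= m)"
proof -
 obtain th where th: "0 < th" "th < 1" "!!f x0 R r ka0 ka H T. dg f (ball x0 (R/2)) (ball x0 R) ka0 T ==> 0 < r ==> 4*r <= R ==> ka0 <= ka ==> 0 < H ==> T <= (th*H) powr (p-1)*r powr-(s*p) ==> AL x. x : ball x0 R --> f x <= ka+H ==> c0*r^DIM('a) <= ms {x:ball x0 r. f x <= ka} ==> AL x. x : ball x0 (r/2) --> f x <= ka+(1-th)*H"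
  by(rule de_giorgi_growth[OF assms(1)]) blast
 define de where "de = th*(M0-ka)/2"
 define H where "H = M0+de-ka"
 have de: "0 < de" using th assms by(simp add:de_def)
 have H: "0 < H" using de assms by(simp add:H_def)
 show ?thesis
 proof(rule that[of "ka+(1-th)*H" de])
  have "th*(M0-ka) = 2*de" by(simp add:de_def)
  moreover have "th*H = th*(M0-ka)+th*de" by(simp add:H_def algebra_simps)
  ultimately have "th*H = 2*de+th*de" by simp
  moreover have "0 < th*de" using th de by simp
  ultimately have "de < th*H" using de by linarith
  moreover have "ka+(1-th)*H = M0+de-th*H" by(simp add:H_def algebra_simps)
  ultimately show "ka+(1-th)*H < M0" by linarith
  fix f x0 R ka0 T
  assume dg: "dg f (ball x0 (R/2)) (ball x0 R) ka0 T" and ka0: "ka0 <= ka" and R: "0 < R"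
   and le: "AL x. x : ball x0 R --> f x <= M0+de"
  have T0: "0 <= T" using dg by(simp add:dg_def)
  define a where "a = (th*H) powr (p-1)"
  have a: "0 < a" using th H by(simp add:a_def)
  \<comment> \<open>For r <= rh the admissible tail a r^(-s p) exceeds the fixed bound
    \<open>T\<close>, since r^(-s p) grows as r shrinks.\<close>
  define rh where "rh = min (R/4) ((a/(T+1)) powr (1/(s*p)))"
  have rh0: "0 < rh" using R a T0 by(simp add:rh_def)
  show "EX rh>0. ALL r. 0 < r & r <= rh & c0*r^DIM('a) <= ms {x:ball x0 r. f x <= ka} --> (AL x. x : ball x0 (r/2) --> f x <= ka+(1-th)*H)"
  proof(intro exI[of _ rh] conjI rh0 allI impI, elim conjE)
   fix r assume r: "0 < r" "r <= rh" and m: "c0*r^DIM('a) <= ms {x:ball x0 r. f x <= ka}"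
   have "r powr (s*p) <= ((a/(T+1)) powr (1/(s*p))) powr (s*p)"
    using r sp0 by(intro powr_mono2) (auto simp:rh_def)
   also have "... = a/(T+1)"
   proof -
    have "1/(s*p)*(s*p) = 1" using sp0 by(metis less_irrefl nonzero_divide_eq_eq)
    thus ?thesis unfolding powr_powr using a T0 by simp
   qed
   finally have "(T+1)*r powr (s*p) <= a" using T0 by(simp add:field_simps)
   hence "T*r powr (s*p) <= a"
    by(smt (verit) mult_right_mono powr_ge_zero)
   hence "T <= a*r powr-(s*p)"
    using r by(simp add:powr_minus_divide field_simps)
   thus "AL x. x : ball x0 (r/2) --> f x <= ka+(1-th)*H"
    using r ka0 H le m by(intro th(3)[OF dg]) (auto simp:a_def rh_def H_def)
  qed
 qed (fact de)
qed

lemma measure_ball: "0 <= r ==> ms (ball (x::'a) r) = unit_ball_vol (real DIM('a))*r^DIM('a)"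
 by(simp add:measure_def emeasure_ball)

end

context obstacle_sol
begin

lemma w_lower: "x : D0 ==> lo <= w x"
 using g_lo w_ge order_trans by blast

lemma esup_w:
 assumes "x : D0"
 shows "esup w x < M ==> EX r>0. AL y. y : ball x r --> w y <= M"
  and "0 < r ==> AL y. y : ball x r --> w y <= M ==> esup w x <= M"
  and "esup (%x. - w x) x < M ==> EX r>0. AL y. y : ball x r --> - w y <= M"
  and "0 < r ==> AL y. y : ball x r --> - w y <= M ==> esup (%x. - w x) x <= M"
proof -
 obtain r0 where r0: "0 < r0" "ball x r0 <= D0" using assms open_D0 open_contains_ball by blast
 have "AL y. y : ball x r0 --> lo <= w y & w y <= hi"
  using r0 w_lower w_hi by(intro AE_I2) auto
 note 1 = esup_bounded[OF r0(1) this]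
 have "AL y. y : ball x r0 --> - hi <= - w y & - w y <= - lo"
  using r0 w_lower w_hi by(intro AE_I2) auto
 note 2 = esup_bounded[OF r0(1) this]
 show "esup w x < M ==> EX r>0. AL y. y : ball x r --> w y <= M" by(rule 1(1))
 show "0 < r ==> AL y. y : ball x r --> w y <= M ==> esup w x <= M" by(rule 1(2))
 show "esup (%x. - w x) x < M ==> EX r>0. AL y. y : ball x r --> - w y <= M" by(rule 2(1))
 show "0 < r ==> AL y. y : ball x r --> - w y <= M ==> esup (%x. - w x) x <= M" by(rule 2(2))
qed

lemma ball_shrink: "AL y. y : ball x r --> P y ==> r' <= r ==> AL y. y : ball x r' --> P y"
 by(auto elim!: eventually_mono)

text \<open>If the essential upper limit M0 exceeded the lower limit m0, then, with ka midway, one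
  of {w <= ka} and {w >= ka} would fill half of a small ball. Then \<open>one_shot\<close>, for
  \<open>w\<close> or for -w, contradicts the choice of M0 or m0.\<close>

lemma esup_eq:
 assumes x0: "x0 : D"
 shows "esup w x0 <= - esup (%x. - w x) x0"
proof(rule ccontr)
 let ?F = "%c0 r. c0*r^DIM('a)"
 define M0 m0 where "M0 = esup w x0" and "m0 = - esup (%x. - w x) x0"
 assume "~ esup w x0 <= - esup (%x. - w x) x0"
 hence lt: "m0 < M0" by(simp add:M0_def m0_def)
 have x0': "x0 : D0" using x0 D_sub by auto
 define ka where "ka = (M0+m0)/2"
 have ka: "ka < M0" "- ka < - m0" using lt by(auto simp:ka_def)
 define c0 where "c0 = unit_ball_vol (real DIM('a))/2"
 have c0: "0 < c0" by(simp add:c0_def)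
 obtain m1 de1 where 1: "m1 < M0" "0 < de1" "!!f x0 R ka0 T. dg f (ball x0 (R/2)) (ball x0 R) ka0 T ==> ka0 <= ka ==> 0 < R ==> AL x. x : ball x0 R --> f x <= M0+de1 ==> EX rh>0. ALL r. 0 < r & r <= rh & ?F c0 r <= ms {x:ball x0 r. f x <= ka} --> (AL x. x : ball x0 (r/2) --> f x <= m1)"
  by(rule one_shot[OF c0 ka(1)]) blast
 obtain m2 de2 where 2: "m2 < - m0" "0 < de2" "!!f x0 R ka0 T. dg f (ball x0 (R/2)) (ball x0 R) ka0 T ==> ka0 <= - ka ==> 0 < R ==> AL x. x : ball x0 R --> f x <= - m0+de2 ==> EX rh>0. ALL r. 0 < r & r <= rh & ?F c0 r <= ms {x:ball x0 r. f x <= - ka} --> (AL x. x : ball x0 (r/2) --> f x <= m2)"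
  by(rule one_shot[OF c0 ka(2)]) blast
 obtain r1 where r1: "0 < r1" "AL y. y : ball x0 r1 --> w y <= M0+de1"
  using esup_w(1)[OF x0', of "M0+de1"] 1 by(auto simp:M0_def)
 obtain r2 where r2: "0 < r2" "AL y. y : ball x0 r2 --> - w y <= - m0+de2"
  using esup_w(3)[OF x0', of "- m0+de2"] 2 by(auto simp:m0_def)
 obtain r3 where r3: "0 < r3" "ball x0 r3 <= D" using x0 open_D open_contains_ball by blast
 define R where "R = min (min r1 r2) (min r3 ((M0-m0)/(8*A)))"
 have R: "0 < R" "R <= r1" "R <= r2" "R <= r3" "R <= (M0-m0)/(8*A)"
  using r1 r2 r3 lt A_pos by(auto simp:R_def)
 have RD: "ball x0 R <= D" using r3 R by auto
 hence RD0: "ball x0 R <= D0" using D_sub by auto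
 have AR: "A*(2*R) <= (M0-m0)/4"
  using R(5) A_pos by(simp add:field_simps)
 \<comment> \<open>The estimate for \<open>w\<close> needs a level above the obstacle. Arbitrarily
   near x0 the function \<open>w\<close>, and with it \<open>g\<close>, takes values close to m0,
   and the Lipschitz bound spreads this over the ball.\<close>
 have g_le: "g x <= ka" if x: "x : ball x0 R" for x
 proof -
  have "~ (AL y. y : ball x0 R --> - w y <= - m0-(M0-m0)/8)"
  proof
   assume "AL y. y : ball x0 R --> - w y <= - m0-(M0-m0)/8"
   hence "esup (%x. - w x) x0 <= - m0-(M0-m0)/8" by(rule esup_w(4)[OF x0' R(1)])
   thus False using lt by(simp add:m0_def)
  qed
  then obtain y where y: "y : ball x0 R" "~ - w y <= - m0-(M0-m0)/8"
   using AE_I2[of lborel "%y. y : ball x0 R --> - w y <= - m0-(M0-m0)/8"] by auto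
  have "x : D0" "y : D0" using x y(1) RD0 by blast+
  hence "g x <= g y+A*norm (x-y)" using g_lip[of x y] by linarith
  also have "norm (x-y) <= 2*R"
   using dist_triangle[of x y x0] x y(1) dist_commute[of x x0] by(simp add:dist_norm[symmetric])
  finally have "g x <= g y+A*(2*R)" using A_pos by simp
  also have "g y <= w y" by(rule w_ge)
  finally show ?thesis using y(2) AR lt by(simp add:ka_def field_simps)
 qed
 obtain T1 where T1: "dg w (ball x0 (R/2)) (ball x0 R) ka T1"
  using dg_upper[OF inside_balls[OF R(1)] RD0 g_le] by blast
 obtain T2 where T2: "dg (%x. - w x) (ball x0 (R/2)) (ball x0 R) (- ka) T2"
  using dg_lower[OF inside_balls[OF R(1)] RD] by blast
 obtain rh1 where rh1: "0 < rh1" "!!r. 0 < r ==> r <= rh1 ==> ?F c0 r <= ms {x:ball x0 r. w x <= ka} ==> (AL x. x : ball x0 (r/2) --> w x <= m1)"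
  using 1(3)[OF T1 order_refl R(1) ball_shrink[OF r1(2) R(2)]] by blast
 obtain rh2 where rh2: "0 < rh2" "!!r. 0 < r ==> r <= rh2 ==> ?F c0 r <= ms {x:ball x0 r. - w x <= - ka} ==> (AL x. x : ball x0 (r/2) --> - w x <= m2)"
  using 2(3)[OF T2 order_refl R(1) ball_shrink[OF r2(2) R(3)]] by blast
 define r where "r = min rh1 rh2"
 have r: "0 < r" "r <= rh1" "r <= rh2" using rh1 rh2 by(auto simp:r_def)
 have [measurable]: "ball x0 r : sets borel" by simp
 define P Q where "P = {x:ball x0 r. w x <= ka}" and "Q = {x:ball x0 r. - w x <= - ka}"
 have [measurable]: "P : sets borel" "Q : sets borel" unfolding P_def Q_def by measurable
 have "ball x0 r = P Un Q" by(auto simp:P_def Q_def)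
 hence "ms (ball x0 r) <= ms P+ms Q"
  using measure_Un_le[of P lborel Q] by simp
 hence "?F c0 r+?F c0 r <= ms P+ms Q"
  using r by(simp add:measure_ball c0_def)
 then consider "?F c0 r <= ms P" | "?F c0 r <= ms Q"
  by linarith
 thus False
 proof cases
  case 1
  hence "AL x. x : ball x0 (r/2) --> w x <= m1"
   using rh1(2)[OF r(1,2)] by(simp add:P_def)
  hence "M0 <= m1" unfolding M0_def using r by(intro esup_w(2)[OF x0', of "r/2"]) auto
  thus False using \<open>m1 < M0\<close> by simp
 next
  case 2
  hence "AL x. x : ball x0 (r/2) --> - w x <= m2"
   using rh2(2)[OF r(1,3)] by(simp add:Q_def)
  hence "esup (%x. - w x) x0 <= m2" using r by(intro esup_w(4)[OF x0', of "r/2"]) auto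
  thus False using \<open>m2 < - m0\<close> by(simp add:m0_def)
 qed
qed

lemma w_near_esup:
 assumes x0: "x0 : D" and e: "0 < e"
 obtains r where "0 < r" "AL y. y : ball x0 r --> abs (w y-esup w x0) <= e"
proof -
 have x0': "x0 : D0" using x0 D_sub by auto
 obtain r1 where r1: "0 < r1" "AL y. y : ball x0 r1 --> w y <= esup w x0+e"
  using esup_w(1)[OF x0', of "esup w x0+e"] e by auto
 obtain r2 where r2: "0 < r2" "AL y. y : ball x0 r2 --> - w y <= esup (%x. - w x) x0+e"
  using esup_w(3)[OF x0', of "esup (%x. - w x) x0+e"] e by auto
 have "AL y. y : ball x0 (min r1 r2) --> abs (w y-esup w x0) <= e"
  using r1(2) r2(2) by eventually_elim (use esup_eq[OF x0] in auto)
 thus ?thesis using that[of "min r1 r2"] r1 r2 by auto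
qed

text \<open>Off \<open>D\<close> one has w = g <= g z + e/2 near z, and by the exterior condition
  this covers a fixed proportion of every small ball, so \<open>one_shot\<close> applies at the
  level g z + e/2.\<close>

lemma esup_boundary:
 assumes z: "z : D0" and c0: "0 < c0" "0 < r0"
  and ext: "!!r. 0 < r ==> r <= r0 ==> c0*r^DIM('a) <= ms (ball z r-D)" and e: "0 < e"
 obtains r where "0 < r" "AL y. y : ball z r --> w y <= g z+e"
proof -
 define ka where "ka = g z+e/2"
 have "esup w z <= ka"
 proof(rule ccontr)
  assume "~ esup w z <= ka"
  hence lt: "ka < esup w z" by simp
  obtain m de where 1: "m < esup w z" "0 < de" "!!f x0 R ka0 T. dg f (ball x0 (R/2)) (ball x0 R) ka0 T ==> ka0 <= ka ==> 0 < R ==> AL x. x : ball x0 R --> f x <= esup w z+de ==> EX rh>0. ALL r. 0 < r & r <= rh & c0*r^DIM('a) <= ms {x:ball x0 r. f x <= ka} --> (AL x. x : ball x0 (r/2) --> f x <= m)"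
   by(rule one_shot[OF c0(1) lt]) blast
  obtain r1 where r1: "0 < r1" "AL y. y : ball z r1 --> w y <= esup w z+de"
   using esup_w(1)[OF z, of "esup w z+de"] 1 by auto
  obtain r3 where r3: "0 < r3" "ball z r3 <= D0" using z open_D0 open_contains_ball by blast
  define R where "R = min r1 (min r3 (e/(2*A)))"
  have R: "0 < R" "R <= r1" "R <= r3" "R <= e/(2*A)"
   using r1 r3 e A_pos by(auto simp:R_def)
  have RD0: "ball z R <= D0" using r3 R by auto
  have g_le: "g x <= ka" if x: "x : ball z R" for x
  proof -
   have "g x <= g z+A*norm (x-z)" using g_lip[of x z] x z RD0 by auto
   also have "norm (x-z) <= R"
    using x by(simp add:dist_norm norm_minus_commute)
   finally have "g x <= g z+A*R" using A_pos by simp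
   moreover have "A*R <= e/2" using R(4) A_pos by(simp add:field_simps)
   ultimately show ?thesis by(simp add:ka_def)
  qed
  obtain T where T: "dg w (ball z (R/2)) (ball z R) ka T"
   using dg_upper[OF inside_balls[OF R(1)] RD0 g_le] by blast
  obtain rh where rh: "0 < rh" "!!r. 0 < r ==> r <= rh ==> c0*r^DIM('a) <= ms {x:ball z r. w x <= ka} ==> (AL x. x : ball z (r/2) --> w x <= m)"
   using 1(3)[OF T order_refl R(1) ball_shrink[OF r1(2) R(2)]] by blast
  define r where "r = min (min rh r0) R"
  have r: "0 < r" "r <= rh" "r <= r0" "r <= R" using rh c0 R by(auto simp:r_def)
  have [measurable]: "ball z r : sets borel" by simp
  have m1: "{x:ball z r. w x <= ka} : sets borel" by measurable
  have "c0*r^DIM('a) <= ms (ball z r-D)" by(rule ext[OF r(1,3)])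
  also have "... <= ms {x:ball z r. w x <= ka}"
  proof(rule measure_mono_fmeasurable)
   show "ball z r-D <= {x:ball z r. w x <= ka}" using g_le r w_off by auto
   have "em {x:ball z r. w x <= ka} < infy"
    by(rule emeasure_bounded_finite, rule bounded_subset[OF bounded_ball[of z r]]) auto
   thus "{x:ball z r. w x <= ka} : fmeasurable lborel"
    using m1 by(intro fmeasurableI) auto
  qed measurable
  finally have "AL x. x : ball z (r/2) --> w x <= m" by(rule rh(2)[OF r(1,2)])
  hence "esup w z <= m" using r by(intro esup_w(2)[OF z, of "r/2"]) auto
  thus False using 1(1) by simp
 qed
 thus ?thesis
  using esup_w(1)[OF z, of "g z+e"] e that by(auto simp:ka_def)
qed

definition wc :: "'a => real"
 where "wc x = (if x : D then esup w x else w x)"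

text \<open>The ball around x0 and the small ball around y meet in a nonempty open set, so some
  point satisfies both almost everywhere bounds.\<close>

lemma wc_near:
 assumes x0: "x0 : D" and r: "0 < r" and ae: "AL y. y : ball x0 r --> abs (w y-wc x0) <= e" and y: "y : ball x0 r" "y : D"
 shows "abs (wc y-wc x0) <= e"
proof(rule field_le_epsilon)
 fix e' :: real assume e': "0 < e'"
 obtain rh where rh: "0 < rh" "AL v. v : ball y rh --> abs (w v-wc y) <= e'"
  using w_near_esup[OF y(2) e'] y(2) by(auto simp:wc_def)
 have aev: "AL v. v : ball y rh Int ball x0 r --> abs (w v-wc y) <= e' & abs (w v-wc x0) <= e"
  using rh(2) ae by eventually_elim auto
 have "y : ball y rh Int ball x0 r" using rh y by auto
 hence ne: "ball y rh Int ball x0 r ~= {}" by blast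
 obtain v where "abs (w v-wc y) <= e' & abs (w v-wc x0) <= e"
  by(rule AE_open_ex[OF _ ne aev]) auto
 thus "abs (wc y-wc x0) <= e+e'" by linarith
qed

lemma continuous_wc: "continuous_on D wc"
 unfolding continuous_on_iff
proof(intro ballI allI impI)
 fix x0 and e :: real assume x0: "x0 : D" and e: "0 < e"
 obtain r where r: "0 < r" "AL y. y : ball x0 r --> abs (w y-esup w x0) <= e/2"
  using w_near_esup[OF x0, of "e/2"] e by auto
 have "dist (wc y) (wc x0) < e" if "y : D" "dist y x0 < r" for y
 proof -
  have "abs (wc y-wc x0) <= e/2"
   using r x0 that by(intro wc_near[OF x0 r(1)]) (auto simp:wc_def dist_commute)
  thus ?thesis using e by(simp add:dist_real_def)
 qed
 thus "EX d>0. ALL y:D. dist y x0 < d --> dist (wc y) (wc x0) < e" using r(1) by auto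
qed

text \<open>Around each point of \<open>D\<close> the difference is small almost everywhere on some
  ball. Lindelof's theorem extracts countably many of these balls, so the exceptional set is null
  for each i, and then for all i at once.\<close>

lemma wc_eq_AE: "AL x. w x = wc x"
proof -
 let ?F = "%i. 2/real (Suc i)"
 let ?G = "%y B i. y : B --> y : D --> abs (w y-wc y) <= ?F i"
 let ?A = "%x i. x : D --> abs (w x-wc x) <= ?F i"
 have "AL x. ?A x i" for i
 proof -
  let ?e = "1/real (Suc i)"
  have "EX r>0. AL y. y : ball x r --> abs (w y-wc x) <= ?e" if x: "x : D" for x
  proof -
   obtain r where "0 < r" "AL y. y : ball x r --> abs (w y-esup w x) <= ?e"
    by(rule w_near_esup[OF x, of ?e]) auto
   thus ?thesis using x by(auto simp:wc_def)
  qed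
  then obtain rh where rh: "!!x. x : D ==> 0 < rh x" "!!x. x : D ==> AL y. y : ball x (rh x) --> abs (w y-wc x) <= ?e"
   by metis
  obtain \<F> where F: "\<F> <= (%x. ball x (rh x)) ` D" "countable \<F>" "\<Union>\<F> = \<Union>((%x. ball x (rh x)) ` D)"
   by(rule Lindelof[of "(%x. ball x (rh x)) ` D"]) auto
  have cov: "D <= \<Union>\<F>" unfolding F(3) using rh(1) by force
  have "AL y. ALL B:\<F>. ?G y B i"
  proof(subst AE_ball_countable[OF F(2)], intro ballI)
   fix B assume "B : \<F>"
   then obtain x where x: "x : D" "B = ball x (rh x)" using F(1) by auto
   show "AL y. ?G y B i"
    using rh(2)[OF x(1)]
   proof(rule eventually_mono)
    fix y assume y: "y : ball x (rh x) --> abs (w y-wc x) <= ?e"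
    show "?G y B i"
    proof(intro impI)
     assume "y : B" "y : D"
     hence "abs (wc y-wc x) <= ?e" "abs (w y-wc x) <= ?e"
      using wc_near[OF x(1) rh(1)[OF x(1)] rh(2)[OF x(1)]] x y by auto
     moreover have "?F i = ?e+?e" by simp
     ultimately show "abs (w y-wc y) <= ?F i" by linarith
    qed
   qed
  qed
  thus ?thesis by(rule eventually_mono) (use cov in blast)
 qed
 hence "AL x. ALL i. ?A x i"
  by(subst AE_all_countable) blast
 thus ?thesis
 proof(rule eventually_mono)
  fix x assume a: "ALL i. ?A x i"
  show "w x = wc x"
  proof(cases "x : D")
   case True
   have "(%i. 2*(1/real (Suc i))) ~> 2*0"
    by(intro tendsto_intros LIMSEQ_Suc[OF lim_1_over_n])
   hence "(%i. ?F i) ~> 0" by simp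
   hence "abs (w x-wc x) <= 0"
    by(rule LIMSEQ_le_const) (use a True in auto)
   thus ?thesis by simp
  qed (simp add:wc_def)
 qed
qed

lemma continuous_g: "continuous_on D0 g"
proof -
 have "A-lipschitz_on D0 g"
  by(rule lipschitz_onI) (use g_lip A_pos in \<open>auto simp:dist_norm\<close>)
 thus ?thesis by(rule lipschitz_on_continuous_on)
qed

lemma wc_bounds: "x : D ==> g x <= wc x" "x : D ==> wc x <= hi"
proof -
 have "AL x. x : D --> g x-wc x <= 0" "AL x. x : D --> wc x <= hi"
  using wc_eq_AE w_ge w_hi by(auto elim!: eventually_mono) (metis w_ge, metis w_hi)
 moreover have "continuous_on D (%x. g x-wc x)"
  by(intro continuous_intros continuous_wc continuous_on_subset[OF continuous_g D_sub])
 ultimately have "x : D ==> g x-wc x <= 0" "x : D ==> wc x <= hi"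
  using AE_open_continuous_le[OF open_D] continuous_wc by blast+
 thus "x : D ==> g x <= wc x" "x : D ==> wc x <= hi" by simp_all
qed

lemma wc_sol: "obstacle_sol s p La k D D0 g lo hi A wc"
proof
 have 1: "(%x. ind D x *\<^sub>R wc x) : Bor"
  by(rule borel_measurable_continuous_on_indicator[OF _ continuous_wc]) simp
 have "wc = (%x. if x : D then ind D x *\<^sub>R wc x else w x)"
  by(auto simp:wc_def)
 also have "... : Bor" using 1 by measurable
 finally show "wc : Bor" .
 show "wc x = g x" if "x ~: D" for x using that w_off by(simp add:wc_def)
 show "g x <= wc x" "wc x <= hi" for x
  using wc_bounds[of x] w_ge[of x] w_hi[of x] by(cases "x : D"; simp add:wc_def)+
 have "energy D0 wc = energy D0 w"
  by(rule energy_cong_AE) (use wc_eq_AE in \<open>auto elim!: eventually_mono\<close>)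
 thus "energy D0 wc < infy" using w_energy by simp
 show "0 <= (BM v. jp p (dl wc v)*dl eh v)"
  if eh: "eh : Bor" "!!x. (abs (eh x)) <= B" "!!x. x ~: D ==> eh x = 0" "energy D0 eh < infy"
   "0 < t" "!!x. x : D ==> g x <= wc x+t*eh x" for eh B t
 proof -
  \<comment> \<open>The constraint on directions is pointwise, whereas \<open>w\<close> and
    \<open>wc\<close> agree only almost everywhere. Putting the direction to 0 where they differ
    makes it admissible for \<open>w\<close> without changing any integral.\<close>
  define eh' where "eh' x = (if w x = wc x then eh x else 0)" for x
  have [measurable]: "wc : Bor" by fact
  have [measurable]: "eh : Bor" by fact
  have B: "0 <= B" using eh(2) abs_ge_zero order_trans by blast
  have eq: "AL x. eh' x = eh x" using wc_eq_AE by(auto elim!: eventually_mono simp:eh'_def)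
  have e': "energy D0 eh' = energy D0 eh"
   by(rule energy_cong_AE) (use eq in \<open>auto elim!: eventually_mono\<close>)
  have "0 <= (BM v. jp p (dl w v)*dl eh' v)"
  proof(rule w_var[OF _ _ _ _ eh(5)])
   show "eh' : Bor" unfolding eh'_def[abs_def] by measurable
   show "abs (eh' x) <= B" for x using eh(2) B by(simp add:eh'_def)
   show "g x <= w x+t*eh' x" if "x : D" for x
    using eh(6)[OF that] w_ge[of x] by(simp add:eh'_def)
  qed (use eh e' in \<open>auto simp:eh'_def\<close>)
  also have "(BM v. jp p (dl w v)*dl eh' v) = (BM v. jp p (dl wc v)*dl eh v)"
  proof(rule integral_cong_AE)
   show "AE v in mu. jp p (dl w v)*dl eh' v = jp p (dl wc v)*dl eh v"
    using AE_muI[OF wc_eq_AE] AE_muI[OF eq] by eventually_elim (simp add:dl_def)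
   have [measurable]: "eh' : Bor" unfolding eh'_def[abs_def] by measurable
   show "(%v. jp p (dl w v)*dl eh' v) : borel_measurable mu" by measurable
  qed measurable
  finally show ?thesis .
 qed
qed

lemma wc_boundary:
 assumes z: "z : D0" and c0: "0 < c0" "0 < r0"
  and ext: "!!r. 0 < r ==> r <= r0 ==> c0*r^DIM('a) <= ms (ball z r-D)" and e: "0 < e"
 obtains r where "0 < r" "!!x. x : ball z r ==> x : D ==> wc x <= g z+e"
proof -
 obtain r where r: "0 < r" "AL y. y : ball z r --> w y <= g z+e"
  using esup_boundary[OF z c0 ext e] by blast
 have "AL y. y : ball z r Int D --> wc y <= g z+e"
  using r(2) wc_eq_AE by eventually_elim auto
 hence "wc x <= g z+e" if "x : ball z r Int D" for x
  by(rule AE_open_continuous_le[rotated 2])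
   (use that open_D continuous_on_subset[OF continuous_wc] in auto)
 thus ?thesis using that r(1) by blast
qed

end

section \<open>Neighbourhoods with exterior balls, Lipschitz minorants, approximation from
  below\<close>

lemma exterior_ball_neighbourhood:
 fixes C :: "'a::euclidean_space set"
 assumes C: "compact C" "C ~= {}" and Om: "open Om" "C <= Om"
 obtains D D0 and r0 :: real where "open D" "open D0" "bounded D0" "C <= D" "closure D0 <= Om" "compact (closure D0)"
  "inside D D0" "closure D <= D0" "0 < r0"
  "!!z r. z : frontier D ==> 0 < r ==> r <= r0 ==> unit_ball_vol (real DIM('a))/2^DIM('a)*r^DIM('a) <= ms (ball z r-D)"
proof -
 let ?A = "%r. unit_ball_vol (real DIM('a))/2^DIM('a)*r^DIM('a)"
 let ?G = "%de. {x. infdist x C <= de}"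
 let ?F = "%de. (\<Union>c\<in>C. cball c de)"
 obtain de where de: "0 < de" "?F de <= Om"
  using compact_subset_open_imp_cball_epsilon_subset[OF C(1) Om] by metis
 define D0 where "D0 = (\<Union>c\<in>C. ball c de)"
 define F where "F = - D0"
 \<comment> \<open>A superlevel set of the distance to \<open>F\<close> has exterior balls: from a
   frontier point z move by r/2 towards a nearest point f of \<open>F\<close>, at distance de/2. The
   ball of radius r/2 around the new point lies in the ball of radius de/2 around f, hence off
   \<open>D\<close>.\<close>
 define D where "D = {x. de/2 < infdist x F}"
 have oD0: "open D0" unfolding D0_def by auto
 have clF: "closed F" unfolding F_def using oD0 by(rule closed_Compl)
 obtain M where M: "!!x. x : C ==> norm x <= M" using compact_imp_bounded[OF C(1)] by(auto simp:bounded_iff)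
 have bD0: "bounded D0"
 proof(rule boundedI)
  fix x assume "x : D0"
  then obtain c where "c : C" "dist c x < de" by(auto simp:D0_def)
  thus "norm x <= M+de"
   using M[of c] norm_triangle_ineq[of "x-c" c] by(simp add:dist_norm norm_minus_commute)
 qed
 have Fne: "F ~= {}"
 proof
  assume "F = {}"
  hence "D0 = UNIV" by(auto simp:F_def)
  thus False using bD0 not_bounded_UNIV by simp
 qed
 have oD: "open D" unfolding D_def by(intro open_Collect_less continuous_intros)
 have CD: "C <= D"
 proof
  fix c assume c: "c : C"
  have "de <= infdist c F"
   unfolding infdist_notempty[OF Fne] using c Fne by(intro cINF_greatest) (auto simp:F_def D0_def not_less)
  thus "c : D" using de by(simp add:D_def)
 qed
 have D_far: "de/2 < dist x y" if "x : D" "y ~: D0" for x y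
  using that infdist_le[of y F x] by(auto simp:D_def F_def)
 have DD0: "D <= D0" using D_far de by force
 have cl: "closure D0 <= ?F de"
 proof -
  have "closed {x. infdist x C <= de}" by(intro closed_Collect_le continuous_intros)
  moreover have "D0 <= ?G de"
  proof
   fix x assume "x : D0"
   then obtain c where "c : C" "dist x c < de" by(auto simp:D0_def dist_commute)
   thus "x : ?G de" using infdist_le[of c C x] by auto
  qed
  ultimately have "closure D0 <= ?G de" by(rule closure_minimal[rotated])
  moreover have "?G de <= ?F de"
  proof
   fix x assume x: "x : ?G de"
   obtain c where "c : C" "infdist x C = dist x c"
    by(rule infdist_attains_inf[OF compact_imp_closed[OF C(1)] C(2), of x]) blast
   thus "x : ?F de" using x by(auto simp:dist_commute)
  qed
  ultimately show ?thesis by blast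
 qed
 have clD: "de/2 <= infdist z F" if "z : closure D" for z
 proof -
  have "closed {x. de/2 <= infdist x F}" by(intro closed_Collect_le continuous_intros)
  hence "closure D <= {x. de/2 <= infdist x F}" by(intro closure_minimal) (auto simp:D_def)
  thus ?thesis using that by auto
 qed
 show ?thesis
 proof(rule that[of D D0 "de/2"])
  show "closure D0 <= Om" using cl de by auto
  show "compact (closure D0)" using bD0 by(simp add:compact_closure)
  show "inside D D0"
   unfolding inside_def
  proof(intro conjI exI[of _ "de/2"] ballI allI impI)
   show "de/2 <= norm (x-y)" if "x : D" "y ~: D0" for x y
    using D_far[OF that] by(simp add:dist_norm)
  qed (use oD oD0 bounded_subset[OF bD0 DD0] de in auto)
  show "closure D <= D0"
  proof
   fix z assume "z : closure D"
   hence "0 < infdist z F" using clD[of z] de by linarith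
   hence "z ~: F" by auto
   thus "z : D0" by(simp add:F_def)
  qed
  fix z r assume z: "z : frontier D" and r: "0 < r" "r <= de/2"
  have "z ~: D" using z oD by(auto simp:frontier_def interior_open)
  hence "infdist z F = de/2" using z clD[of z] by(auto simp:D_def frontier_def)
  moreover obtain f where f1: "f : F" "infdist z F = dist z f"
   by(rule infdist_attains_inf[OF clF Fne, of z]) blast
  ultimately have f: "f : F" "dist z f = de/2" by auto
  define m where "m = z+(r/de) *\<^sub>R (f-z)"
  have fz: "norm (f-z) = de/2" "norm (z-f) = de/2"
   using f(2) by(simp_all add:dist_norm norm_minus_commute)
  have "dist z m = norm ((r/de) *\<^sub>R (f-z))" by(simp add:m_def dist_norm)
  also have "... = r/de*(de/2)" unfolding norm_scaleR fz using r de by simp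
  finally have mz: "dist z m = r/2" using de by simp
  have "m-f = (1-r/de) *\<^sub>R (z-f)" by(simp add:m_def algebra_simps)
  hence "dist m f = abs (1-r/de)*(de/2)" using fz by(simp add:dist_norm)
  also have "abs (1-r/de) = 1-r/de" using r de by(simp add:field_simps)
  finally have mf: "dist m f = de/2-r/2" using de by(simp add:left_diff_distrib)
  have sub: "ball m (r/2) <= ball z r-D"
  proof
   fix y assume y: "y : ball m (r/2)"
   have "dist z y <= dist z m+dist m y" by(rule dist_triangle)
   hence 1: "dist z y < r" using y mz by auto
   have "dist y f <= dist y m+dist m f" by(rule dist_triangle)
   hence "dist y f < de/2" using y mf by(auto simp:dist_commute)
   hence "infdist y F < de/2" using infdist_le[OF f(1), of y] by linarith
   thus "y : ball z r-D" using 1 by(auto simp:D_def)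
  qed
  have "?A r = ms (ball m (r/2))"
   using r by(simp add:measure_def emeasure_ball power_divide)
  also have "... <= ms (ball z r-D)"
  proof(rule measure_mono_fmeasurable[OF sub])
   have "em (ball z r-D) < infy"
    by(rule emeasure_bounded_finite, rule bounded_subset[OF bounded_ball[of z r]]) auto
   thus "ball z r-D : fmeasurable lborel" using oD by(intro fmeasurableI) auto
  qed simp
  finally show "?A r <= ms (ball z r-D)" .
 qed (use oD oD0 bD0 CD de in auto)
qed

lemma open_superlevel:
 assumes "open Om" "lower_semicontinuous_on Om u"
 shows "open {x:Om. c < u x}"
 using assms openin_open_trans unfolding lower_semicontinuous_on_def by blast

lemma lsc_bounded_below:
 fixes u :: "'a::topological_space => ereal"
 assumes "open Om" "lower_semicontinuous_on Om u" "compact S" "S <= Om" "!!x. x : Om ==> - infy < u x"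
 obtains lo :: real where "!!x. x : S ==> ereal lo < u x"
proof -
 let ?A = "%i::nat. {x:Om. ereal (- real i) < u x}"
 have "S <= (\<Union>i. ?A i)"
 proof
  fix x assume "x : S"
  hence x: "x : Om" "- infy < u x" using assms by auto
  obtain i :: nat where "ereal (- real i) < u x"
  proof(cases "u x")
   case (real r)
   obtain i where "- r < real i" using reals_Archimedean2 by blast
   thus ?thesis using that[of i] real by simp
  qed (use x that in auto)
  thus "x : (\<Union>i. ?A i)" using x by auto
 qed
 moreover have "open (?A i)" for i by(rule open_superlevel[OF assms(1,2)])
 ultimately obtain I where I: "finite I" "S <= (\<Union>i\<in>I. ?A i)"
  using compactE_image[OF assms(3), of UNIV ?A] by auto
 show ?thesis
 proof(rule that[of "- real (Max (insert 0 I))"])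
  fix x assume "x : S"
  then obtain i where i: "i : I" "ereal (- real i) < u x" using I by auto
  have "i <= Max (insert 0 I)" using I i by(intro Max_ge) auto
  hence "ereal (- real (Max (insert 0 I))) <= ereal (- real i)" by simp
  thus "ereal (- real (Max (insert 0 I))) < u x" using i(2) by(rule order_le_less_trans)
 qed
qed

definition trunc_at :: "('a => ereal) => real => 'a => real"
 where "trunc_at u ka x = real_of_ereal (min (u x) (ereal ka))"

lemma ereal_trunc_at: "- infy < u x ==> ereal (trunc_at u ka x) = min (u x) (ereal ka)"
 by(cases "u x") (auto simp:trunc_at_def min_def)

lemma trunc_at_le: "- infy < u x ==> trunc_at u ka x <= ka"
 by(cases "u x") (auto simp:trunc_at_def min_def)

lemma trunc_at_measurable [measurable (raw)]:
 assumes [measurable]: "u : borel_measurable M"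
 shows "trunc_at u ka : borel_measurable M"
 unfolding trunc_at_def[abs_def] by measurable

text \<open>The Pasch-Hausdorff envelope: the largest \<open>a\<close>-Lipschitz minorant of
  \<open>f\<close> on \<open>S\<close>, when finite.\<close>

definition inf_conv :: "('a::metric_space => real) => 'a set => real => 'a => real"
 where "inf_conv f S a x = (INF y\<in>S. f y+a*dist x y)"

lemma inf_conv_bdd:
 assumes lo: "!!y. y : S ==> lo <= f y" and a: "0 <= a"
 shows "bdd_below ((%v. f v+a*dist x v) ` S)"
proof(rule bdd_belowI)
 fix z assume "z : (%v. f v+a*dist x v) ` S"
 then obtain v where "v : S" "z = f v+a*dist x v" by auto
 thus "lo <= z" using lo[of v] a by(simp add:add_increasing2)
qed

lemma inf_conv_greatest:
 assumes "S ~= {}" "!!v. v : S ==> c <= f v+a*dist x v"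
 shows "c <= inf_conv f S a x"
 unfolding inf_conv_def using assms by(rule cINF_greatest)

lemma inf_conv_le:
 assumes "!!y. y : S ==> lo <= f y" "0 <= a" "v : S"
 shows "inf_conv f S a x <= f v+a*dist x v"
 unfolding inf_conv_def by(rule cINF_lower[OF inf_conv_bdd[OF assms(1,2)] assms(3)])

lemma inf_conv_lipschitz:
 assumes S: "S ~= {}" and lo: "!!y. y : S ==> lo <= f y" and a: "0 <= a"
 shows "abs (inf_conv f S a x-inf_conv f S a y) <= a*dist x y"
proof -
 have *: "inf_conv f S a x-a*dist x y <= inf_conv f S a y" for x y
 proof(rule inf_conv_greatest[OF S])
  fix v assume v: "v : S"
  have "inf_conv f S a x <= f v+a*dist x v"
   by(rule inf_conv_le[OF lo a v])
  also have "a*dist x v <= a*(dist x y+dist y v)"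
   using a by(intro mult_left_mono dist_triangle)
  finally show "inf_conv f S a x-a*dist x y <= f v+a*dist y v"
   by(simp add:algebra_simps)
 qed
 show ?thesis
  using *[of x y] *[of y x] by(simp add:dist_commute abs_le_iff)
qed

text \<open>The comparison property enters only through \<open>u_comp\<close>, which transfers it to
  continuous solutions of obstacle problems with obstacle below \<open>u\<close>;
  \<open>superharmonic_comparison\<close> verifies it. In this form no test functions and no
  Lebesgue measurable data occur in the arguments below.\<close>

locale comparison = frac_kernel s p La k for s p La and k :: "'a::euclidean_space => 'a => real" +
 fixes Om :: "'a set" and u :: "'a => ereal"
 assumes open_Om: "open Om" and u_meas [measurable]: "u : Bor"
  and u_fin: "AL x. x : Om --> u x < infy" and u_low: "!!x. x : Om ==> - infy < u x"
  and u_lsc: "lower_semicontinuous_on Om u"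
  and u_AE: "AL x. - infy < u x" and u_neg: "tail (%x. real_of_ereal (neg_part u x))"
  and u_comp: "!!D D0 g lo hi A w x. obstacle_sol s p La k D D0 g lo hi A w ==> continuous_on D w ==> (!!z e. z : frontier D ==> 0 < e ==> EX r>0. ALL x:ball z r Int D. w x <= g z+e) ==> closure D <= D0 ==> D0 <= Om ==> (!!x. x : D0 ==> ereal (g x) <= u x) ==> (AL x. ereal (g x) <= u x) ==> x : D ==> ereal (w x) <= u x"
begin

lemma trunc_at_abs: "abs (trunc_at u ka x) <= abs (real_of_ereal (neg_part u x))+abs ka"
 by(cases "u x") (auto simp:trunc_at_def neg_part_def min_def max_def)

lemma tail_trunc_at: "tail (trunc_at u ka)"
proof -
 define m where "m x = real_of_ereal (neg_part u x)" for x
 have t: "tail m" using u_neg by(simp add:m_def[abs_def])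
 have [measurable]: "m : Bor" using t by(rule tail_measurable)
 have "tail (%x. (abs (m x)))" by(rule tail_mono[OF t]) auto
 from tail_add[OF this tail_const[of "abs ka"]] show ?thesis
 proof(rule tail_mono)
  fix x
  have "abs (trunc_at u ka x) <= abs (m x)+abs ka" unfolding m_def by(rule trunc_at_abs)
  thus "\<bar>trunc_at u ka x\<bar> <= \<bar>\<bar>m x\<bar> + \<bar>ka\<bar>\<bar>" by linarith
 qed measurable
qed

lemma trunc_at_le': "0 <= ka ==> trunc_at u ka x <= ka"
 by(cases "u x") (auto simp:trunc_at_def min_def)

text \<open>Solutions of obstacle problems whose obstacles are Lipschitz minorants of \<open>u\<close>;
 they increase to \<open>u\<close> without any compactness argument.\<close>

lemma approximation:
 assumes C: "compact C" "C ~= {}" "C <= Om"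
 obtains D D0 lo g w where "open D" "open D0" "bounded D0" "C <= D" "closure D0 <= Om" "compact (closure D0)" "inside D D0"
  "closure D <= D0" "lo < 0" "!!x. x : closure D0 ==> ereal lo < u x"
  "!!ka j. 0 < ka ==> obstacle_sol s p La k D D0 (g ka j) lo ka (real j+1) (w ka j)"
  "!!ka j. 0 < ka ==> continuous_on D (w ka j)"
  "!!ka j x. 0 < ka ==> x : D0 ==> ereal (w ka j x) <= u x"
  "!!ka j x. x ~: D0 ==> w ka j x = trunc_at u ka x"
  "!!x c. x : D0 ==> ereal c < u x ==> EX r>0. EX J. ALL j>=J. ALL ka>0. c <= ka --> (ALL y:ball x r Int D0. c <= g ka j y)"
proof -
 obtain D D0 and r0 :: real where geo: "open D" "open D0" "bounded D0" "C <= D" "closure D0 <= Om" "compact (closure D0)"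
  "inside D D0" "closure D <= D0" "0 < r0"
  "!!z r. z : frontier D ==> 0 < r ==> r <= r0 ==> unit_ball_vol (real DIM('a))/2^DIM('a)*r^DIM('a) <= ms (ball z r-D)"
  by(rule exterior_ball_neighbourhood[OF C(1,2) open_Om C(3)]) blast
 obtain lo' where lo': "!!x. x : closure D0 ==> ereal lo' < u x"
  using lsc_bounded_below[OF open_Om u_lsc geo(6,5) u_low] by metis
 define lo where "lo = min lo' (- 1)"
 have lo: "lo < 0" "!!x. x : closure D0 ==> ereal lo < u x"
 proof -
  show "lo < 0" by(simp add:lo_def)
  fix x assume "x : closure D0"
  have "ereal lo <= ereal lo'" by(simp add:lo_def)
  thus "ereal lo < u x" using lo'[OF \<open>x : closure D0\<close>] by(rule order_le_less_trans)
 qed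
 define S where "S = closure D0"
 have D0S: "D0 <= S" by(simp add:S_def closure_subset)
 have Sne: "S ~= {}" using C(2) geo(4) geo(8) closure_subset[of D] D0S by blast
 have SOm: "S <= Om" using geo(5) by(simp add:S_def)
 have trS: "ereal (trunc_at u ka x) = min (u x) (ereal ka)" if "x : S" for ka x
  using that SOm u_low by(intro ereal_trunc_at) auto
 have tr_lo: "lo <= trunc_at u ka x" if "0 < ka" "x : S" for ka x
 proof -
  have "ereal lo <= min (u x) (ereal ka)"
   using that lo by(auto simp:S_def intro:less_imp_le)
  thus ?thesis using trS[OF that(2), of ka] by(metis ereal_less_eq(3))
 qed
 \<comment> \<open>The infimum runs over the compact closure of \<open>D0\<close>, where the
   truncation of \<open>u\<close> is at least \<open>lo\<close>, so the envelope is finite.\<close>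
 define ps where "ps ka j x = inf_conv (trunc_at u ka) S (real j) x" for ka and j :: nat and x
 have psi1: "lo <= ps ka j x" if "0 < ka" for ka j x
  unfolding ps_def using tr_lo[OF that] by(intro inf_conv_greatest[OF Sne]) (simp add:add_increasing2)
 have psi2: "ps ka j x <= trunc_at u ka x" if "0 < ka" "x : S" for ka j x
  unfolding ps_def
  using inf_conv_le[where S = S and lo = lo and f = "trunc_at u ka" and a = "real j" and v = x and x = x] tr_lo[OF that(1)] that
  by simp
 have psi3: "abs (ps ka j x-ps ka j y) <= real j*dist x y" if "0 < ka" for ka j x y
  unfolding ps_def by(rule inf_conv_lipschitz[OF Sne, of lo]) (use tr_lo[OF that] in simp_all)
 define g where "g ka j x = (if x : D0 then ps ka j x else trunc_at u ka x)" for ka j x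
 have g_le_tr: "g ka j x <= trunc_at u ka x" if "0 < ka" for ka j x
  using psi2[OF that, of x j] D0S by(auto simp:g_def)
 have psi_cont: "continuous_on UNIV (ps ka j)" if "0 < ka" for ka j
 proof(rule lipschitz_on_continuous_on)
  show "(real j)-lipschitz_on UNIV (ps ka j)"
   using psi3[OF that] by(intro lipschitz_onI) (auto simp:dist_real_def)
 qed
 have g_meas: "g ka j : Bor" if "0 < ka" for ka j
 proof -
  have [measurable]: "ps ka j : Bor"
   by(rule borel_measurable_continuous_onI[OF psi_cont[OF that]])
  have [measurable]: "D0 : sets borel" using geo by auto
  show ?thesis unfolding g_def[abs_def] by measurable
 qed
 have obst: "obstacle s p La k D D0 (g ka j) lo ka (real j+1)" if ka: "0 < ka" for ka j
 proof
  show "tail (g ka j)"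
  proof(rule tail_mono[OF tail_add[OF _ tail_const[of "abs lo+abs ka"]] g_meas[OF ka]])
   show "tail (%x. (abs (trunc_at u ka x)))"
    by(rule tail_mono[OF tail_trunc_at[of ka]]) auto
   fix x
   show "abs (g ka j x) <= abs (abs (trunc_at u ka x)+(abs lo+abs ka))"
   proof(cases "x : D0")
    case True
    hence "lo <= g ka j x" using psi1[OF ka] by(simp add:g_def)
    moreover have "g ka j x <= ka" using g_le_tr[OF ka, of j x] trunc_at_le'[of ka x] ka by simp
    ultimately show ?thesis by linarith
   qed (simp add:g_def)
  qed
  show "g ka j x <= ka" for x using g_le_tr[OF ka, of j x] trunc_at_le'[of ka x] ka by simp
  show "lo <= g ka j x" if "x : D0" for x using that psi1[OF ka] by(simp add:g_def)
  show "abs (g ka j x-g ka j y) <= (real j+1)*norm (x-y)" if "x : D0" "y : D0" for x y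
  proof -
   have "abs (g ka j x-g ka j y) <= real j*dist x y" using that psi3[OF ka] by(simp add:g_def)
   also have "... <= (real j+1)*norm (x-y)" by(simp add:dist_norm mult_right_mono)
   finally show ?thesis .
  qed
 qed (use geo lo ka in auto)
 have "EX w. obstacle_sol s p La k D D0 (g ka j) lo ka (real j+1) w & continuous_on D w & (ALL x:D0. ereal (w x) <= u x)"
  if ka: "0 < ka" for ka j
 proof -
  interpret ob: obstacle s p La k D D0 "g ka j" lo ka "real j+1" by(rule obst[OF ka])
  obtain w0 where w0: "w0 : Bor" "!!x. x ~: D ==> w0 x = g ka j x" "!!x. g ka j x <= w0 x" "!!x. w0 x <= ka"
   "energy D0 w0 < infy"
   "!!eh B t. eh : Bor ==> (!!x. (abs (eh x)) <= B) ==> (!!x. x ~: D ==> eh x = 0) ==> energy D0 eh < infy ==> 0 < t ==> (!!x. x : D ==> g ka j x <= w0 x+t*eh x) ==> 0 <= (BM v. jp p (dl w0 v)*dl eh v)"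
   by(rule ob.obstacle_solution) blast
  have "obstacle_sol s p La k D D0 (g ka j) lo ka (real j+1) w0"
  proof
   show "0 <= (BM v. jp p (dl w0 v)*dl eh v)"
    if "eh : Bor" "!!x. (abs (eh x)) <= B" "!!x. x ~: D ==> eh x = 0" "energy D0 eh < infy"
     "0 < t" "!!x. x : D ==> g ka j x <= w0 x+t*eh x" for eh B t
    by(rule w0(6)[OF that])
  qed (use w0 in auto)
  then interpret os: obstacle_sol s p La k D D0 "g ka j" lo ka "real j+1" w0 .
  note sol = os.wc_sol
  interpret oc: obstacle_sol s p La k D D0 "g ka j" lo ka "real j+1" os.wc by(rule sol)
  have gu: "ereal (g ka j x) <= u x" if "- infy < u x" for x
  proof -
   have "ereal (g ka j x) <= ereal (trunc_at u ka x)" using g_le_tr[OF ka] by simp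
   also have "... <= u x" using ereal_trunc_at[of u x, OF that] by simp
   finally show ?thesis .
  qed
  have gD0: "ereal (g ka j x) <= u x" if "x : D0" for x
   using that D0S SOm u_low by(intro gu) auto
  have wD: "ereal (os.wc x) <= u x" if "x : D" for x
  proof(rule u_comp[OF sol os.continuous_wc])
   fix z :: 'a and e :: real assume e: "0 < e" and z: "z : frontier D"
   have zD0: "z : D0" using z geo(8) by(auto simp:frontier_def)
   have c0: "0 < unit_ball_vol (real DIM('a))/2^DIM('a)" by simp
   obtain r where "0 < r" "!!x. x : ball z r ==> x : D ==> os.wc x <= g ka j z+e"
    using os.wc_boundary[OF zD0 c0 geo(9) geo(10)[OF z] e] by blast
   thus "EX r>0. ALL x:ball z r Int D. os.wc x <= g ka j z+e" by blast
  next
   show "AL x. ereal (g ka j x) <= u x" using u_AE by(rule eventually_mono) (rule gu)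
  qed (use geo D0S SOm gD0 that in auto)
  have "ereal (os.wc x) <= u x" if "x : D0" for x
   using wD gD0[OF that] oc.w_off[of x] by(cases "x : D") auto
  thus ?thesis using sol os.continuous_wc by blast
 qed
 then obtain w where w: "!!ka j. 0 < ka ==> obstacle_sol s p La k D D0 (g ka j) lo ka (real j+1) (w ka j)"
  "!!ka j. 0 < ka ==> continuous_on D (w ka j)" "!!ka j x. 0 < ka ==> x : D0 ==> ereal (w ka j x) <= u x"
  by metis
 define w' where "w' ka j x = (if 0 < ka then w ka j x else trunc_at u ka x)" for ka j x
 have w': "0 < ka ==> w' ka j = w ka j" for ka j by(auto simp:w'_def)
 show ?thesis
 proof(rule that[of D D0 lo g w'])
  show "w' ka j x = trunc_at u ka x" if "x ~: D0" for ka j x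
  proof(cases "0 < ka")
   case True
   interpret oc: obstacle_sol s p La k D D0 "g ka j" lo ka "real j+1" "w ka j" by(rule w(1)[OF True])
   have "x ~: D" using that oc.D_sub by auto
   thus ?thesis using oc.w_off[of x] that True by(simp add:w'_def g_def)
  qed (simp add:w'_def)
  fix x c assume x: "x : D0" and c: "ereal c < u x"
  have "open {y:Om. ereal c < u y}" by(rule open_superlevel[OF open_Om u_lsc])
  moreover have "x : {y:Om. ereal c < u y}" using x c D0S SOm by auto
  ultimately obtain e where e: "0 < e" "ball x e <= {y:Om. ereal c < u y}"
   using open_contains_ball by blast
  \<comment> \<open>From j = J on, the penalty j * e/2 for points outside the ball of radius e
    exceeds c - lo, so these points do not push the infimum below \<open>c\<close>.\<close>
  obtain J :: nat where J: "(c-lo)/(e/2) <= real J" using real_arch_simple by blast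
  show "EX r>0. EX J. ALL j>=J. ALL ka>0. c <= ka --> (ALL y:ball x r Int D0. c <= g ka j y)"
  proof(intro exI[of _ "e/2"] conjI exI[of _ J] allI impI ballI)
   fix j ka y assume j: "J <= j" and ka: "0 < ka" "c <= ka" and y: "y : ball x (e/2) Int D0"
   have "c <= ps ka j y"
    unfolding ps_def
   proof(rule inf_conv_greatest[OF Sne])
    fix v assume v: "v : S"
    show "c <= trunc_at u ka v+real j*dist y v"
    proof(cases "dist x v < e")
     case True
     hence "ereal c <= min (u v) (ereal ka)" using e ka by(auto intro:less_imp_le)
     hence "c <= trunc_at u ka v" using trS[OF v, of ka] by(metis ereal_less_eq(3))
     thus ?thesis by(simp add:add_increasing2)
    next
     case False
     have "e/2 <= dist y v" using False y dist_triangle[of x v y] by auto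
     have "c-lo <= real J*(e/2)" using J e by(simp add:field_simps)
     also have "... <= real j*dist y v" using j e \<open>e / 2 <= dist y v\<close> by(intro mult_mono) auto
     finally show ?thesis using tr_lo[OF ka(1) v] by linarith
    qed
   qed
   thus "c <= g ka j y" using y by(simp add:g_def)
  qed (use e in auto)
 qed (use geo lo w w' in auto)
qed

end

context obstacle_sol
begin

lemma dg_lower_T:
 assumes UV: "inside U V" and V: "V <= D" and T0: "0 <= T"
  and T: "!!x ka. x : U ==> ka0 <= ka ==> (NL y. en (max (- w y-ka) 0 powr (p-1))*ind (- V) y*en (k x y)) <= en T"
 shows "dg (%x. - w x) U V ka0 T"
proof(unfold dg_def, intro conjI allI impI)
 fix ka H l ze
 assume a: "ka0 <= ka" "0 < H" "cutoff_fun U l ze" "AL x. x : V --> - w x <= ka+H"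
 from lower_test[OF UV V a(2,3,4)]
 show "(NM z. en (dl (%x. - w x-(ka+H*ze x)) z |^ (p-1)*abs (dl (trunc_test U (%x. - w x) (%x. ka+H*ze x)) z))*ind (V \<times> V) z) <= en (est_const*(H powr p*l powr-(s*p)+T*H))*em {x:U. ka+H*ze x < - w x}"
  using T T0 a by(intro energy_estimate(1)[OF UV _ a(3,2,4)]) auto
qed (use T0 in auto)

end

context comparison
begin

abbreviation un :: "'a => real" where "un x == real_of_ereal (neg_part u x)"

lemma un_nonneg: "0 <= un x"
 by(cases "u x") (auto simp:neg_part_def max_def)

lemma un_measurable [measurable]: "(%x. un x) : Bor"
 using u_neg by(rule tail_measurable)

lemma trunc_at_ge_un: "0 < ka ==> - un x <= trunc_at u ka x"
 by(cases "u x") (auto simp:trunc_at_def neg_part_def min_def max_def)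

text \<open>What the later arguments use, with the obstacle hidden. The convergence is a squeeze
  between obstacle and \<open>u\<close>, for fixed \<open>ka\<close> and along the diagonal. The
  bound -w <= -lo + \<open>un\<close> is uniform in \<open>ka\<close> and \<open>j\<close>, so the
  far integrals of -w are controlled by the negative tail alone, before anything is known about the
  positive one.\<close>

lemma approximants:
 assumes C: "compact C" "C ~= {}" "C <= Om"
 obtains D D0 lo w where "open D" "open D0" "bounded D0" "C <= D" "closure D0 <= Om" "inside D D0" "closure D <= D0" "lo < 0"
  "!!ka j. 0 < ka ==> EX g. obstacle_sol s p La k D D0 g lo ka (real j+1) (w ka j)"
  "!!ka j. 0 < ka ==> continuous_on D (w ka j)"
  "!!ka j x. 0 < ka ==> x : D0 ==> ereal (w ka j x) <= u x"
  "!!ka j x. x ~: D0 ==> w ka j x = trunc_at u ka x"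
  "!!ka j x. 0 < ka ==> x : D0 ==> lo <= w ka j x" "!!ka j x. 0 < ka ==> w ka j x <= ka"
  "!!ka j x. 0 < ka ==> - w ka j x <= - lo+un x"
  "!!x c. x : D0 ==> ereal c < u x ==> EX r>0. EX J. ALL j>=J. ALL ka>0. c <= ka --> (ALL y:ball x r Int D0. c <= w ka j y)"
  "!!x. - infy < u x ==> (%i. ereal (w (real i+1) i x)) ~> u x"
  "!!ka x. 0 < ka ==> (%j. w ka j x) ~> trunc_at u ka x"
proof -
 let ?F = "%w i x. ereal (w (real i+1) i x)"
 obtain D D0 lo g w where a: "open D" "open D0" "bounded D0" "C <= D" "closure D0 <= Om" "compact (closure D0)" "inside D D0"
  "closure D <= D0" "lo < 0" "!!x. x : closure D0 ==> ereal lo < u x"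
  "!!ka j. 0 < ka ==> obstacle_sol s p La k D D0 (g ka j) lo ka (real j+1) (w ka j)"
  "!!ka j. 0 < ka ==> continuous_on D (w ka j)"
  "!!ka j x. 0 < ka ==> x : D0 ==> ereal (w ka j x) <= u x"
  "!!ka j x. x ~: D0 ==> w ka j x = trunc_at u ka x"
  "!!x c. x : D0 ==> ereal c < u x ==> EX r>0. EX J. ALL j>=J. ALL ka>0. c <= ka --> (ALL y:ball x r Int D0. c <= g ka j y)"
  by(rule approximation[OF C]) blast
 have D0Om: "x : D0 ==> x : Om" for x using a(5) closure_subset by blast
 have w_lo: "lo <= w ka j x" if "0 < ka" "x : D0" for ka j x
  by(rule obstacle_sol.w_lower[OF a(11)[OF that(1)] that(2)])
 have w_hi: "w ka j x <= ka" if "0 < ka" for ka j x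
  by(rule obstacle_sol.w_hi[OF a(11)[OF that]])
 have w_un: "- w ka j x <= - lo+un x" if "0 < ka" for ka j x
  using w_lo[OF that, of x j] a(14)[of x ka j] trunc_at_ge_un[OF that, of x] un_nonneg[of x] a(9)
  by(cases "x : D0") auto
 have loc: "EX r>0. EX J. ALL j>=J. ALL ka>0. c <= ka --> (ALL y:ball x r Int D0. c <= w ka j y)"
  if h: "x : D0" "ereal c < u x" for x c
 proof -
  obtain r J where r: "0 < r" "!!j ka y. J <= j ==> 0 < ka ==> c <= ka ==> y : ball x r Int D0 ==> c <= g ka j y"
   using a(15)[OF h] by blast
  have "c <= w ka j y" if "J <= j" "0 < ka" "c <= ka" "y : ball x r Int D0" for j ka y
   using r(2)[OF that] obstacle_sol.w_ge[OF a(11)[OF that(2)], of j y] by linarith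
  thus ?thesis using r(1) by blast
 qed
 have ev: "\<forall>\<^sub>F j in sequentially. ALL ka>0. c <= ka --> c <= w ka j x" if h: "x : D0" "ereal c < u x" for x c
 proof -
  obtain r J where r: "0 < r" "ALL j>=J. ALL ka>0. c <= ka --> (ALL y:ball x r Int D0. c <= w ka j y)"
   using loc[OF h] by blast
  hence "ALL j>=J. ALL ka>0. c <= ka --> c <= w ka j x" using h by auto
  thus ?thesis by(auto simp:eventually_sequentially)
 qed
 have lim1: "(%i. ?F w i x) ~> u x" if x: "- infy < u x" for x
 proof(cases "x : D0")
  case True
  show ?thesis
  proof(rule order_tendstoI)
   fix y assume y: "u x < y"
   have "?F w i x <= u x" for i by(rule a(13)) (use True in auto)
   thus "\<forall>\<^sub>F i in sequentially. ?F w i x < y"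
    using y by(auto intro!: always_eventually intro:order_le_less_trans)
  next
   fix y assume "y < u x"
   then obtain c where c: "y < ereal c" "ereal c < u x"
    using ereal_dense2 by blast
   obtain n :: nat where n: "c <= real n" using real_arch_simple by blast
   show "\<forall>\<^sub>F i in sequentially. y < ?F w i x"
    using ev[OF True c(2)] eventually_ge_at_top[of n]
   proof eventually_elim
    fix i assume i: "ALL ka>0. c <= ka --> c <= w ka i x" "n <= i"
    have "c <= w (real i+1) i x" using i n by auto
    thus "y < ?F w i x" using c(1) by(meson ereal_less_eq(3) order_less_le_trans)
   qed
  qed
 next
  case False
  have "(%i. min (u x) (ereal (real i+1))) ~> u x"
  proof(cases "u x = infy")
   case True
   have "filterlim (%i. real i+1) at_top sequentially"
    by(rule filterlim_tendsto_add_at_top[OF tendsto_const filterlim_real_sequentially, of 1, unfolded add.commute[of 1]])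
   thus ?thesis using True by(simp add:tendsto_PInfty_eq_at_top)
  next
   case fin: False
   then obtain r where r: "u x = ereal r" using x by(cases "u x") auto
   obtain n :: nat where n: "r <= real n" using real_arch_simple by blast
   have "\<forall>\<^sub>F i in sequentially. min (u x) (ereal (real i+1)) = u x"
    using eventually_ge_at_top[of n] by eventually_elim (use r n in auto)
   thus ?thesis by(rule tendsto_eventually)
  qed
  thus ?thesis using False a(14) ereal_trunc_at[of u x, OF x] by simp
 qed
 have lim2: "(%j. w ka j x) ~> trunc_at u ka x" if ka: "0 < ka" for ka x
 proof(cases "x : D0")
  case False thus ?thesis using a(14) by simp
 next
  case True
  have t: "ereal (trunc_at u ka x) = min (u x) (ereal ka)"
   using True D0Om u_low by(intro ereal_trunc_at) auto
  show ?thesis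
  proof(rule order_tendstoI)
   fix y assume y: "trunc_at u ka x < y"
   have "ereal (w ka j x) <= min (u x) (ereal ka)" for j using a(13)[OF ka True] w_hi[OF ka] by simp
   hence "w ka j x <= trunc_at u ka x" for j unfolding t[symmetric] by simp
   thus "\<forall>\<^sub>F j in sequentially. w ka j x < y"
    using y by(auto intro!: always_eventually intro:order_le_less_trans)
  next
   fix y assume y: "y < trunc_at u ka x"
   define c where "c = (y+trunc_at u ka x)/2"
   have c: "y < c" "c < trunc_at u ka x" using y by(auto simp:c_def)
   have "ereal c < min (u x) (ereal ka)" using c(2) unfolding t[symmetric] by simp
   hence "ereal c < u x" "c <= ka" by auto
   show "\<forall>\<^sub>F j in sequentially. y < w ka j x"
    using ev[OF True \<open>ereal c < u x\<close>] by eventually_elim (use c ka \<open>c <= ka\<close> in force)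
  qed
 qed
 show ?thesis
  by(rule that[of D D0 lo w]; (rule a | rule w_lo | rule w_hi | rule w_un | rule loc | rule lim1 | rule lim2 | (rule exI, rule a(11))); assumption)
qed

section \<open>Finiteness almost everywhere and the positive tail\<close>

lemma lower_far_bound:
 assumes UV: "inside U V" and w: "!!x. - w x <= - lo+un x" and wm [measurable]: "w : Bor"
  and T: "!!x. x : U ==> (NL y. en (max ((- lo+un y)-ka0) 0 powr (p-1))*ind (- V) y*en (k x y)) <= en T"
  and x: "x : U" "ka0 <= ka"
 shows "(NL y. en (max (- w y-ka) 0 powr (p-1))*ind (- V) y*en (k x y)) <= en T"
proof -
 have "(NL y. en (max (- w y-ka) 0 powr (p-1))*ind (- V) y*en (k x y)) <= (NL y. en (max ((- lo+un y)-ka0) 0 powr (p-1))*ind (- V) y*en (k x y))"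
 proof(intro nn_integral_mono mult_right_mono ennreal_leI powr_mono2)
  fix y show "max (- w y-ka) 0 <= max ((- lo+un y)-ka0) 0"
   using w[of y] x(2) by auto
 qed (use p1 in auto)
 also have "... <= en T" by(rule T[OF x(1)])
 finally show ?thesis .
qed

lemma tail_un_shift: "tail (%x. - lo+un x)"
 using tail_add[OF tail_const[of "- lo"] u_neg] .

lemma sublevel_positive_measure:
 assumes "x1 : Om" "0 < r"
 obtains m :: real where "0 < m" "0 < em {x:ball x1 r. u x < ereal m}"
proof -
 let ?F = "%n. {x:ball x1 r. u x < ereal (real n+1)}"
 obtain e where e: "0 < e" "ball x1 e <= Om" using assms open_Om open_contains_ball by blast
 define q where "q = min e r"
 have q: "0 < q" "ball x1 q <= Om" "q <= r" using e assms by(auto simp:q_def)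
 have [measurable]: "ball x1 t : sets borel" for t by simp
 have "EX n::nat. 0 < em {x:ball x1 r. u x < ereal (real n+1)}"
 proof(rule ccontr)
  assume "~ ?thesis"
  hence z: "?F n : null_sets lborel" for n
   by(auto simp:null_sets_def not_gr_zero)
  have "AL x. ALL n. x ~: ?F n"
   unfolding AE_all_countable using AE_not_in[OF z] by blast
  hence "AL x. x : ball x1 q --> False"
   using u_fin
  proof eventually_elim
   fix x assume x: "ALL n. x ~: ?F n" "x : Om --> u x < infy"
   show "x : ball x1 q --> False"
   proof
    assume xq: "x : ball x1 q"
    hence "u x < infy" "x : ball x1 r" using x q by auto
    obtain n :: nat where "u x < ereal (real n+1)"
    proof(cases "u x")
     case (real v)
     obtain n :: nat where "v < real n" using reals_Archimedean2 by blast
     thus ?thesis using that[of n] real by simp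
    next
     case PInf
     thus ?thesis using \<open>u x < infy\<close> by simp
    next
     case MInf
     thus ?thesis using that[of 0] by simp
    qed
    thus False using x(1) \<open>x : ball x1 r\<close> by auto
   qed
  qed
  thus False by(rule AE_open_ex[rotated 2]) (use q in auto)
 qed
 thus ?thesis using that[of "real _+1"] by(metis add_nonneg_pos of_nat_0_le_iff zero_less_one)
qed

text \<open>The far part of the energy estimate for \<open>(2 m - w)\<^sub>+\<close>, taken on a set where \<open>u < m\<close>,
 bounds the tail of \<open>u\<^sub>+\<close>.\<close>

lemma positive_tail_finite:
 assumes "Om ~= {}"
 obtains m M :: real and w where "0 < m" "!!i. (NL y. en (max (w i y-2 * m) 0 powr (p-1)*wt y)) <= en M"
  "!!i. w i : Bor" "!!x. - infy < u x ==> (%i. ereal (w i x)) ~> u x"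
proof -
 let ?A = "%H r T. est_const*(H powr p*(r/2-r/4) powr-(s*p)+T*H)"
 let ?G = "%w i m. NL y. en (max (w (real i+1) i y-2 * m) 0 powr (p-1)*wt y)"
 let ?F = "%G x y. en (G (x, y))*en (k x y)"
 obtain x1 r where x1: "x1 : Om" "0 < r" "cball x1 r <= Om"
  using assms open_Om open_contains_cball by blast
 have C: "compact (cball x1 r)" "cball x1 r ~= {}" using x1 by auto
 obtain D D0 lo w where a: "open D" "open D0" "bounded D0" "cball x1 r <= D" "closure D0 <= Om" "inside D D0" "closure D <= D0" "lo < 0"
  "!!ka j. 0 < ka ==> EX g. obstacle_sol s p La k D D0 g lo ka (real j+1) (w ka j)"
  "!!ka j x. 0 < ka ==> x : D0 ==> ereal (w ka j x) <= u x"
  "!!ka j x. 0 < ka ==> x : D0 ==> lo <= w ka j x"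
  "!!ka j x. 0 < ka ==> - w ka j x <= - lo+un x"
  "!!x. - infy < u x ==> (%i. ereal (w (real i+1) i x)) ~> u x"
  by(rule approximants[OF C x1(3)]) blast
 have D_D0: "D <= D0" using a(6) by(rule insideD)
 obtain m where m: "0 < m" "0 < em {x:ball x1 (r/4). u x < ereal m}"
  using sublevel_positive_measure[OF x1(1), of "r/4"] x1(2) by auto
 define P where "P = {x:ball x1 (r/4). u x < ereal m}"
 have [measurable]: "P : sets borel" unfolding P_def by measurable
 let ?U = "ball x1 (r/2)" and ?V = "ball x1 r"
 have UV: "inside ?U ?V" by(rule inside_balls[OF x1(2)])
 have VD: "?V <= D" using a(4) by auto
 \<comment> \<open>The estimate is applied to -w at the level -2m. Its truncation is (2m - w - H
   ze)_+, which is at least m on \<open>P\<close>, where w <= u < m and the cutoff vanishes.\<close>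
 define ka0 where "ka0 = - (2 * m)"
 define H where "H = 2 * m-lo"
 have H: "0 < H" using m a(8) by(simp add:H_def)
 obtain T where T0: "0 <= T" "!!x ka. x : ?U ==> ka0 <= ka ==> (NL y. en (max ((- lo+un y)-ka) 0 powr (p-1))*ind (- ?V) y*en (k x y)) <= en T"
  by(rule far_integral_bound[OF tail_un_shift[of lo] UV, where ?ka0.0 = ka0]) blast
 note T = T0(1) T0(2)[OF _ order_refl]
 define ze where "ze = radial x1 (r/4) (r/2)"
 have cut: "cutoff_fun ?U (r/2-r/4) ze"
  unfolding ze_def using x1 by(intro cutoff_radial) auto
 have [measurable]: "ze : Bor" using cut by(simp add:cutoff_fun_def)
 obtain Ck where Ck: "0 < Ck" "!!x y. norm x <= norm x1+r ==> x ~= y ==> wt y <= Ck * k x y"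
  by(rule wt_le_k[of "norm x1+r"]) (use x1 in auto)
 define E where "E = en (?A H r T)*em ?U"
 have Efin: "E < infy"
  unfolding E_def using x1 by(simp add:emeasure_ball ennreal_mult_less_top)
 have P_fin: "em P < infy"
  by(rule emeasure_bounded_finite, rule bounded_subset[OF bounded_ball[of x1 "r/4"]]) (auto simp:P_def)
 have key: "en (m/Ck)*em P*(?G w i m) <= E+E"
  and wmeas: "w (real i+1) i : Bor" for i
 proof -
  have ka: "0 < real i+1" by simp
  obtain g where "obstacle_sol s p La k D D0 g lo (real i+1) (real i+1) (w (real i+1) i)"
   using a(9)[OF ka] by blast
  then interpret os: obstacle_sol s p La k D D0 g lo "real i+1" "real i+1" "w (real i+1) i" .
  let ?w = "w (real i+1) i"
  show wm [measurable]: "?w : Bor" by(rule os.w_meas)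
  let ?f = "%x. - ?w x" and ?ph = "%x. ka0+H*ze x"
  define eh where "eh = trunc_test ?U ?f ?ph"
  have [measurable]: "eh : Bor" unfolding eh_def by measurable
  have le: "AL x. x : ?V --> ?f x <= ka0+H"
  proof(rule AE_I2, rule impI)
   fix x assume "x : ?V"
   hence "lo <= ?w x" using VD D_D0 by(intro a(11)) auto
   thus "?f x <= ka0+H" by(simp add:ka0_def H_def)
  qed
  have Tw: "(NL y. en (max (?f y-ka0) 0 powr (p-1))*ind (- ?V) y*en (k x y)) <= en T"
   if "x : ?U" for x
   by(rule lower_far_bound[OF UV _ wm T(2) that order_refl]) (use a(12)[OF ka] in auto)
  have fm: "?f : Bor" by measurable
  note est = energy_estimate[OF UV fm cut H le T(1) Tw os.lower_test(1)[OF UV VD H cut le] os.lower_test(2)[OF UV VD H cut le], folded eh_def]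
  have SE: "en (?A H r T)*em {x:?U. ?ph x < ?f x} <= E"
   unfolding E_def by(intro mult_left_mono emeasure_mono) auto
  \<comment> \<open>The sum of both left sides of the energy estimate. For x in \<open>P\<close> it
    dominates m (w y - 2m)_+^(p-1) for every y, through the near part inside the ball and the far
    part outside; \<open>wt_le_k\<close> then turns the kernel into the tail weight.\<close>
  define G where "G z = dl (%x. ?f x-?ph x) z |^ (p-1)*abs (dl eh z)*ind (?V \<times> ?V) z+eh (fst z) * max (ka0-?f (snd z)) 0 powr (p-1)*ind (- ?V) (snd z)" for z
  have [measurable]: "?V : sets borel" by simp
  have [measurable]: "G : Bor" unfolding G_def[abs_def] by measurable
  have eh0: "0 <= eh x" for x by(simp add:eh_def trunc_test_nonneg)
  have "(NM z. en (G z)) = (NM z. en (dl (%x. ?f x-?ph x) z |^ (p-1)*abs (dl eh z))*ind (?V \<times> ?V) z+en (eh (fst z) * max (ka0-?f (snd z)) 0 powr (p-1))*ind (- ?V) (snd z))"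
   by(intro nn_integral_cong) (auto simp:G_def ennreal_plus eh0 split:split_indicator)
  also have "... = (NM z. en (dl (%x. ?f x-?ph x) z |^ (p-1)*abs (dl eh z))*ind (?V \<times> ?V) z)+(NM z. en (eh (fst z) * max (ka0-?f (snd z)) 0 powr (p-1))*ind (- ?V) (snd z))"
   by(rule nn_integral_add) measurable
  also have "... <= E+E"
   by(rule add_mono[OF order_trans[OF est(1) SE] order_trans[OF est(2) SE]])
  finally have upper: "(NM z. en (G z)) <= E+E" .
  let ?I = "NL y. en (max (?w y-2 * m) 0 powr (p-1)*wt y)"
  have "en (m/Ck)*em P*?I = (NL x. (en (m/Ck)*?I)*ind P x)"
   by(subst nn_integral_cmult_indicator) (auto simp:mult_ac)
  also have "... <= (NL x. NL y. ?F G x y)"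
  proof(rule nn_integral_mono)
   fix x
   show "(en (m/Ck)*?I)*ind P x <= (NL y. ?F G x y)"
   proof(cases "x : P")
    case True
    hence x: "dist x1 x < r/4" "u x < ereal m" by(auto simp:P_def)
    have xU: "x : ?U" "x : ?V" using x x1 by auto
    have "ereal (?w x) <= u x" by(rule a(10)[OF ka]) (use xU VD D_D0 in auto)
    hence wx: "?w x < m" using x(2) by(metis ereal_less_eq(3) order_le_less_trans not_le)
    have z0: "ze x = 0" unfolding ze_def using x x1 by(intro radial_0) auto
    have ehx: "eh x = 2 * m-?w x" using xU wx m z0 by(simp add:eh_def trunc_test_def ka0_def)
    have nx: "norm x <= norm x1+r"
     using x x1 norm_triangle_ineq[of "x-x1" x1] by(simp add:dist_norm norm_minus_commute)
    have "en (m/Ck)*?I = (NL y. en (m/Ck)*en (max (?w y-2 * m) 0 powr (p-1)*wt y))"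
     by(rule nn_integral_cmult[symmetric]) measurable
    also have "... <= (NL y. ?F G x y)"
    proof(rule nn_integral_mono)
     fix y
     let ?b = "max (?w y-2 * m) 0 powr (p-1)"
     show "en (m/Ck)*en (?b*wt y) <= ?F G x y"
     proof(cases "2 * m < ?w y")
      case False
      hence "max (?w y-2 * m) 0 = 0" by simp
      thus ?thesis by simp
     next
      case y: True
      hence "x ~= y" using wx m by auto
      hence k1: "wt y/Ck <= k x y" using Ck(2)[OF nx] Ck(1) by(simp add:divide_le_eq mult.commute)
      have "m*?b <= G (x, y)"
      proof(cases "y : ?V")
       case yV: True
       have "0 <= ze y" using cut by(simp add:cutoff_fun_def)
       hence z1: "0 <= H*ze y" using H by simp
       have ehy: "eh y = 0" using y z1 by(simp add:eh_def trunc_test_def ka0_def)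
       have "?b <= dl (%x. ?f x-?ph x) (x, y) |^ (p-1)"
        using y z1 z0 wx m p1 by(intro powr_mono2) (auto simp:dl_def ka0_def)
       moreover have "m <= abs (dl eh (x, y))" using ehx ehy wx by(simp add:dl_def)
       ultimately have "m*?b <= dl (%x. ?f x-?ph x) (x, y) |^ (p-1)*abs (dl eh (x, y))"
        using m by(subst mult.commute) (intro mult_mono, auto)
       thus ?thesis using xU yV by(simp add:G_def)
      next
       case False
       have "m*?b <= eh x*?b" using ehx wx by(intro mult_right_mono) auto
       thus ?thesis using False by(simp add:G_def ka0_def)
      qed
      hence "(m*?b)*(wt y/Ck) <= G (x, y) * k x y"
       using k1 m Ck(1) by(intro mult_mono) (auto intro:order_trans[of 0 "m*?b"])
      moreover have "en (m/Ck)*en (?b*wt y) = en ((m*?b)*(wt y/Ck))"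
       using m Ck(1) by(subst ennreal_mult[symmetric]) (auto simp:field_simps)
      moreover have "0 <= m*?b" using m by simp
      hence "0 <= G (x, y)" using \<open>m * ?b <= G (x, y)\<close> by(rule order_trans)
      hence "?F G x y = en (G (x, y) * k x y)"
       using k_nonneg by(simp add:ennreal_mult)
      ultimately show ?thesis by(simp only: ennreal_leI)
     qed
    qed
    finally show ?thesis using True by simp
   qed simp
  qed
  also have "... = (NM z. en (G z))" by(rule nn_integral_mu[symmetric]) measurable
  also note upper
  finally show "en (m/Ck)*em P*?I <= E+E" .
 qed
 define c where "c = en (m/Ck)*em P"
 have c: "0 < c" "c < infy"
  using m Ck P_fin by(auto simp:c_def P_def ennreal_zero_less_mult_iff ennreal_mult_less_top)
 show ?thesis
 proof(rule that[of m "%i. w (real i+1) i" "enn2real ((E+E)/c)"])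
  fix i
  let ?I = "?G w i m"
  have "?I <= (E+E)/c"
  proof -
   have "?I = (?I*c)/c" using c by(subst ennreal_mult_divide_eq) auto
   also have "... <= (E+E)/c"
    using key[of i] unfolding c_def[symmetric] by(intro divide_right_mono_ennreal) (simp add:mult.commute)
   finally show ?thesis .
  qed
  also have "... = en (enn2real ((E+E)/c))"
  proof -
   have "(E+E)/c ~= top" using Efin c by(auto simp:ennreal_divide_eq_top_iff)
   thus ?thesis by(simp add:ennreal_enn2real less_top)
  qed
  finally show "?I <= en (enn2real ((E+E)/c))" .
 qed (use m wmeas a(13) in auto)
qed

text \<open>Fatou's lemma along the diagonal approximants. The lower limit of the integrands is
  infinite wherever u is infinite, so this set is null, and elsewhere the limit is the tail density
  of (u - 2m)_+. The conclusion concerns the whole space, not only \<open>Om\<close>.\<close>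

lemma u_finite_AE: 
 assumes "Om ~= {}"
 shows "AL x. (abs (u x)) ~= infy" and "tail (%x. real_of_ereal (u x))"
proof -
 obtain m M :: real and w where w: "0 < m" "!!i. (NL y. en (max (w i y-2 * m) 0 powr (p-1)*wt y)) <= en M"
  "!!i. w i : Bor" "!!x. - infy < u x ==> (%i. ereal (w i x)) ~> u x"
  by(rule positive_tail_finite[OF assms]) blast
 note [measurable] = w(3)
 define L where "L y = liminf (%i. en (max (w i y-2 * m) 0 powr (p-1)*wt y))" for y
 have [measurable]: "L : Bor" unfolding L_def[abs_def] by measurable
 have "(NL y. L y) <= liminf (%i. NL y. en (max (w i y-2 * m) 0 powr (p-1)*wt y))"
  unfolding L_def by(rule nn_integral_liminf) measurable
 also have "... <= en M" by(rule Liminf_le) (use w(2) in auto)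
 finally have LM: "(NL y. L y) < infy" by(simp add:order_le_less_trans)
 have Lfin: "AL y. L y ~= infy"
  by(rule nn_integral_noteq_infinite) (use LM in auto)
 have L_inf: "L y = infy" if "u y = infy" for y
 proof -
  have "(%i. ereal (w i y)) ~> infy" using w(4)[of y] that by simp
  hence "filterlim (%i. w i y) at_top sequentially" by(simp add:tendsto_PInfty_eq_at_top)
  have "en (real B) <= L y" for B :: nat
  proof -
   define b where "b = 2 * m+(real B/wt y) powr (1/(p-1))"
   have "\<forall>\<^sub>F i in sequentially. b <= w i y"
    using \<open>filterlim (%i. w i y) at_top sequentially\<close> by(simp add:filterlim_at_top)
   hence "\<forall>\<^sub>F i in sequentially. en (real B) <= en (max (w i y-2 * m) 0 powr (p-1)*wt y)"
   proof eventually_elim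
    fix i assume i: "b <= w i y"
    have "real B/wt y = ((real B/wt y) powr (1/(p-1))) powr (p-1)"
     using p1 by(simp add:powr_powr)
    also have "... <= max (w i y-2 * m) 0 powr (p-1)"
     using i p1 by(intro powr_mono2) (auto simp:b_def)
    finally show "en (real B) <= en (max (w i y-2 * m) 0 powr (p-1)*wt y)"
     using wt_pos[of y] by(intro ennreal_leI) (simp add:divide_le_eq)
   qed
   thus ?thesis unfolding L_def by(rule Liminf_bounded)
  qed
  thus ?thesis
   by(metis ennreal_of_nat_eq_real_of_nat ennreal_Ex_less_of_nat infinity_ennreal_def not_le top.not_eq_extremum)
 qed
 show fin: "AL x. (abs (u x)) ~= infy"
  using Lfin u_AE by eventually_elim (use L_inf in auto)
 have L_fin: "L y = en (max (real_of_ereal (u y)-2 * m) 0 powr (p-1)*wt y)" if fy: "abs (u y) ~= infy" for y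
 proof -
  obtain r where r: "u y = ereal r" using fy by(cases "u y") auto
  hence "(%i. w i y) ~> r" using w(4)[of y] by simp
  hence "(%i. max (w i y-2 * m) 0 powr (p-1)*wt y) ~> max (r-2 * m) 0 powr (p-1)*wt y"
   using p1 by(intro tendsto_intros tendsto_powr') auto
  hence "(%i. en (max (w i y-2 * m) 0 powr (p-1)*wt y)) ~> en (max (r-2 * m) 0 powr (p-1)*wt y)"
   by(rule tendsto_ennrealI)
  from lim_imp_Liminf[OF _ this] show ?thesis unfolding L_def r by simp
 qed
 define f where "f x = max (real_of_ereal (u x)-2 * m) 0" for x
 have [measurable]: "f : Bor" unfolding f_def by measurable
 have "(NL y. en (f y |^ (p-1)*wt y)) = (NL y. L y)"
  by(rule nn_integral_cong_AE) (use fin in eventually_elim, simp add:L_fin f_def)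
 hence "tail f" using LM by(simp add:tail_def)
 from tail_add[OF tail_add[OF this tail_const[of "2 * m"]] u_neg]
 show "tail (%x. real_of_ereal (u x))"
 proof(rule tail_mono)
  fix x
  have "abs (real_of_ereal (u x)) <= f x+2 * m+un x"
   using w(1) by(cases "u x") (auto simp:f_def neg_part_def max_def)
  thus "abs (real_of_ereal (u x)) <= abs (f x+2 * m+un x)" by linarith
 qed measurable
qed

end

section \<open>Truncations are supersolutions, and pointwise values are essential limits\<close>

definition dist_cutoff :: "'a::euclidean_space set => real => 'a => real"
 where "dist_cutoff C l x = min 1 (max 0 (infdist x C/l))"

lemma cutoff_dist:
 assumes "0 < l"
 shows "cutoff_fun {x. infdist x C < l} l (dist_cutoff C l)"
 unfolding cutoff_fun_def
proof(intro conjI allI impI)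
 show "dist_cutoff C l : Bor"
  unfolding dist_cutoff_def[abs_def]
  by(intro borel_measurable_continuous_onI continuous_intros) (use assms in auto)
 show "abs (dist_cutoff C l x-dist_cutoff C l y) <= norm (x-y)/l" for x y
 proof -
  have "abs (dist_cutoff C l x-dist_cutoff C l y) <= abs (infdist x C/l-infdist y C/l)"
   unfolding dist_cutoff_def by(rule abs_min_max_diff_le)
  also have "... = abs (infdist x C-infdist y C)/l"
   using assms by(simp add:diff_divide_distrib[symmetric])
  also have "abs (infdist x C-infdist y C) <= norm (x-y)"
   using infdist_triangle_abs[of x C y] by(simp add:dist_norm)
  finally show ?thesis using assms by(simp add:divide_right_mono)
 qed
 show "dist_cutoff C l x = 1" if "x ~: {x. infdist x C < l}" for x
  using that assms by(simp add:dist_cutoff_def)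
qed (use assms in \<open>auto simp:dist_cutoff_def\<close>)

lemma dist_cutoff_0: "x : C ==> dist_cutoff C l x = 0"
 by(simp add:dist_cutoff_def)

lemma inside_neighbourhood:
 fixes C :: "'a::euclidean_space set"
 assumes "compact C" "C ~= {}" "inside C V"
 obtains l where "0 < l" "inside {x. infdist x C < l} V" "C <= {x. infdist x C < l}"
proof -
 let ?F = "%x d. infdist x C < d/2"
 obtain d where d: "0 < d" "!!x y. x : C ==> y ~: V ==> d <= norm (x-y)"
  using assms(3) unfolding inside_def by blast
 obtain B where B: "!!x. x : C ==> norm x <= B" using compact_imp_bounded[OF assms(1)] by(auto simp:bounded_iff)
 have near: "EX c:C. infdist x C = dist x c" for x
  by(rule infdist_attains_inf[OF compact_imp_closed[OF assms(1)] assms(2), of x]) blast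
 show ?thesis
 proof(rule that[of "d/2"])
  show "inside {x. ?F x d} V"
   unfolding inside_def
  proof(intro conjI exI[of _ "d/2"] ballI allI impI)
   have "open {x. ?F x d}" by(intro open_Collect_less continuous_intros)
   thus "{x. ?F x d} : sets borel" by simp
   show "bounded {x. ?F x d}"
   proof(rule boundedI)
    fix x assume "x : {x. ?F x d}"
    then obtain c where "c : C" "dist x c < d/2" using near[of x] by auto
    thus "norm x <= B+d/2"
     using B[of c] norm_triangle_ineq[of "x-c" c] by(simp add:dist_norm)
   qed
   fix x y assume "x : {x. ?F x d}" and y: "y ~: V"
   then obtain c where c: "c : C" "dist x c < d/2" using near[of x] by auto
   have "d <= dist c y" using d(2)[OF c(1) y] by(simp add:dist_norm)
   thus "d/2 <= norm (x-y)"
    using c(2) dist_triangle[of c y x] by(simp add:dist_norm[symmetric] dist_commute)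
  qed (use d assms(3) in \<open>auto simp:inside_def\<close>)
  show "C <= {x. ?F x d}" using d by auto
 qed (use d in auto)
qed

context comparison
begin

text \<open>The energy estimate for -w at the level -ka. As w <= ka, nothing is cut off on
  \<open>C\<close>: the truncation is ka - w there, and the left side is the full energy. The bound
  depends on \<open>lo\<close> and \<open>ka\<close> but not on the obstacle, hence not on
  j.\<close>

lemma approximant_energy_bound:
 assumes C: "compact C" "C ~= {}" "C <= D" and D: "open D" "bounded D" and lo: "lo < ka"
 obtains M where "0 <= M" "!!g A w. obstacle_sol s p La k D D0 g lo ka A w ==> (!!x. - w x <= - lo+un x) ==> energy C w <= en M"
proof -
 have CD: "inside C D" by(rule inside_compact_open[OF C(1) D(1) C(3)])
 obtain l where l: "0 < l" "inside {x. infdist x C < l} D" "C <= {x. infdist x C < l}"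
  by(rule inside_neighbourhood[OF C(1,2) CD])
 define U where "U = {x. infdist x C < l}"
 define ze where "ze = dist_cutoff C l"
 have cut: "cutoff_fun U l ze" unfolding U_def ze_def by(rule cutoff_dist[OF l(1)])
 have UD: "inside U D" using l(2) by(simp add:U_def)
 define H where "H = ka-lo"
 have H: "0 < H" using lo by(simp add:H_def)
 obtain T where T0: "0 <= T" "!!x ka'. x : U ==> - ka <= ka' ==> (NL y. en (max ((- lo+un y)-ka') 0 powr (p-1))*ind (- D) y*en (k x y)) <= en T"
  by(rule far_integral_bound[OF tail_un_shift[of lo] UD, where ?ka0.0 = "- ka"]) blast
 define E where "E = en (est_const*(H powr p*l powr-(s*p)+T*H))*em U"
 have E: "E < infy"
  using inside_emeasure_finite[OF UD] by(simp add:E_def ennreal_mult_less_top)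
 show ?thesis
 proof(rule that[of "enn2real E"])
  fix g A w assume sol: "obstacle_sol s p La k D D0 g lo ka A w" and w: "!!x. - w x <= - lo+un x"
  interpret os: obstacle_sol s p La k D D0 g lo ka A w by(rule sol)
  have [measurable]: "C : sets borel" "U : sets borel" using C UD by(auto simp:borel_compact inside_def)
  let ?f = "%x. - w x"
  have wm: "w : Bor" by(rule os.w_meas)
  have fm: "?f : Bor" by measurable
  have le: "AL x. x : D --> ?f x <= - ka+H"
   using os.w_lower os.D_sub by(intro AE_I2) (auto simp:H_def)
  have Tw: "(NL y. en (max (?f y-(- ka)) 0 powr (p-1))*ind (- D) y*en (k x y)) <= en T"
   if "x : U" for x
   by(rule lower_far_bound[OF UD w wm T0(2) that order_refl]) auto
  have "energy C w <= (NM z. en (dl (%x. ?f x-(- ka+H*ze x)) z |^ (p-1)*abs (dl (trunc_test U ?f (%x. - ka+H*ze x)) z))*ind (D \<times> D) z)"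
   unfolding energy_def
  proof(rule nn_integral_mono)
   fix z :: "'a \<times> 'a"
   obtain x y where z: "z = (x, y)" by(cases z)
   show "en (dl w z |^ p)*ind (C \<times> C) z <= en (dl (%x. ?f x-(- ka+H*ze x)) z |^ (p-1)*abs (dl (trunc_test U ?f (%x. - ka+H*ze x)) z))*ind (D \<times> D) z"
   proof(cases "x : C & y : C")
    case True
    have tt: "trunc_test U ?f (%x. - ka+H*ze x) v = ka-w v" if "v : C" for v
     using that l(3) os.w_hi[of v] by(auto simp:trunc_test_def ze_def dist_cutoff_0 U_def)
    have "dl w z |^ p = dl w z |^ (p-1)*abs (dl w z)"
     using jp_mult_self[of p "abs (dl w z)"] by(simp add:jp_nonneg)
    also have "... = dl (%x. ?f x-(- ka+H*ze x)) z |^ (p-1)*abs (dl (trunc_test U ?f (%x. - ka+H*ze x)) z)"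
    proof -
     have "dl (trunc_test U ?f (%x. - ka+H*ze x)) z = - dl w z"
      using tt[of x] tt[of y] True by(simp add:dl_def z)
     moreover have "dl (%x. ?f x-(- ka+H*ze x)) z = - dl w z"
      using True by(simp add:dl_def z ze_def dist_cutoff_0)
     ultimately show ?thesis by simp
    qed
    finally show ?thesis using True C(3) by(auto simp:z split:split_indicator)
   qed (auto simp:z split:split_indicator)
  qed
  also have "... <= en (est_const*(H powr p*l powr-(s*p)+T*H))*em {x:U. - ka+H*ze x < ?f x}"
   by(rule energy_estimate(1)[OF UD fm cut H le T0(1) Tw os.lower_test(1)[OF UD order_refl H cut le] os.lower_test(2)[OF UD order_refl H cut le]])
  also have "... <= E" unfolding E_def by(intro mult_left_mono emeasure_mono) auto
  also have "... = en (enn2real E)" using E by simp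
  finally show "energy C w <= en (enn2real E)" .
 qed simp
qed

text \<open>The approximants with fixed \<open>ka\<close> converge pointwise with bounded energy on
  \<open>C\<close> and a common tail, so the variational inequality for nonnegative directions
  passes to the limit by \<open>jp_dl_tendsto\<close>.\<close>

lemma trunc_supersolution:
 assumes ka: "0 < ka" and C: "compact C" "C ~= {}" "C <= Om"
 shows "energy C (trunc_at u ka) < infy"
  and "inside U C ==> eh : Bor ==> (!!x. 0 <= eh x) ==> (!!x. eh x <= B) ==> (!!x. x ~: U ==> eh x = 0) ==> energy C eh < infy ==> 0 <= (BM v. jp p (dl (trunc_at u ka) v)*dl eh v)"
proof -
 obtain D D0 lo w where a: "open D" "open D0" "bounded D0" "C <= D" "inside D D0" "lo < 0"
  "!!ka j. 0 < ka ==> EX g. obstacle_sol s p La k D D0 g lo ka (real j+1) (w ka j)"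
  "!!ka j x. x ~: D0 ==> w ka j x = trunc_at u ka x"
  "!!ka j x. 0 < ka ==> x : D0 ==> lo <= w ka j x" "!!ka j x. 0 < ka ==> w ka j x <= ka"
  "!!ka j x. 0 < ka ==> - w ka j x <= - lo+un x"
  "!!ka x. 0 < ka ==> (%j. w ka j x) ~> trunc_at u ka x"
  by(rule approximants[OF C]) blast
 have bD: "bounded D" using bounded_subset[OF a(3) insideD[OF a(5)]] .
 have "lo < ka" using a(6) ka by simp
 then obtain M where M: "0 <= M" "!!g A w. obstacle_sol s p La k D D0 g lo ka A w ==> (!!x. - w x <= - lo+un x) ==> energy C w <= en M"
  by(rule approximant_energy_bound[OF C(1,2) a(4,1) bD]) blast
 have ew: "energy C (w ka j) <= en M" for j
  using a(7)[OF ka, of j] M(2) a(11)[OF ka] by blast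
 have wm [measurable]: "w ka j : Bor" for j
  using a(7)[OF ka, of j] obstacle_sol.w_meas by blast
 have Cb [measurable]: "C : sets borel" using C by(simp add:borel_compact)
 have et: "energy C (trunc_at u ka) <= en M"
  by(rule energy_lsc[OF wm Cb a(12)[OF ka] ew])
 thus "energy C (trunc_at u ka) < infy" by(simp add:order_le_less_trans)
 assume U: "inside U C" and eh: "eh : Bor" "!!x. 0 <= eh x" "!!x. eh x <= B" "!!x. x ~: U ==> eh x = 0"
  and eeh: "energy C eh < infy"
 have ehB: "abs (eh x) <= B" for x using eh(2,3)[of x] by simp
 define h where "h x = abs (trunc_at u ka x)+(abs lo+ka)" for x
 have ht: "tail h"
 proof -
  have "tail (%x. (abs (trunc_at u ka x)))" by(rule tail_mono[OF tail_trunc_at[of ka]]) auto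
  thus ?thesis unfolding h_def[abs_def] by(rule tail_add) (rule tail_const)
 qed
 have wh: "abs (w ka j x) <= abs (h x)" for j x
  using a(8)[of x ka j] a(9)[OF ka, of x j] a(10)[OF ka, of j x] ka by(cases "x : D0") (auto simp:h_def)
 have "(%j. BM v. jp p (dl (w ka j) v)*dl eh v) ~> (BM v. jp p (dl (trunc_at u ka) v)*dl eh v)"
  by(rule jp_dl_tendsto[OF U ht wm wh a(12)[OF ka] ew M(1) eh(1) ehB eh(4) eeh])
 moreover have "0 <= (BM v. jp p (dl (w ka j) v)*dl eh v)" for j
 proof -
  obtain g where "obstacle_sol s p La k D D0 g lo ka (real j+1) (w ka j)" using a(7)[OF ka] by blast
  then interpret os: obstacle_sol s p La k D D0 g lo ka "real j+1" "w ka j" .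
  show ?thesis
  proof(rule os.w_var[OF eh(1) ehB])
   show "eh x = 0" if "x ~: D" for x using that a(4) insideD[OF U] by(intro eh(4)) auto
   show "energy D0 eh < infy" by(rule energy_extend[OF U eh(1) ehB eh(4) eeh])
   show "g x <= w ka j x+1*eh x" for x using os.w_ge[of x] eh(2)[of x] by simp
  qed simp
 qed
 ultimately show "0 <= (BM v. jp p (dl (trunc_at u ka) v)*dl eh v)"
  by(intro LIMSEQ_le_const) auto
qed

text \<open>If \<open>u >= c\<close> almost everywhere near \<open>x0\<close> but \<open>u x0 < c\<close>, then for large \<open>j\<close> the approximants from
 below are close to \<open>c\<close> up to a set of small measure, so De Giorgi's lemma lifts them above \<open>u x0\<close> at \<open>x0\<close>.\<close>

lemma lower_bound_AE_imp_pointwise: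
 assumes x0: "x0 : Om" and r: "0 < r" and ae: "AL y. y : ball x0 r --> ereal c <= u y"
 shows "ereal c <= u x0"
proof(rule ccontr)
 assume "~ ereal c <= u x0"
 hence lt: "u x0 < ereal c" by simp
 then obtain b where b: "u x0 = ereal b" "b < c" using u_low[OF x0] by(cases "u x0") auto
 have C: "compact {x0}" "{x0} ~= {}" "{x0} <= Om" using x0 by auto
 obtain D D0 lo w where a: "open D" "open D0" "bounded D0" "{x0} <= D" "inside D D0" "lo < 0"
  "!!ka j. 0 < ka ==> EX g. obstacle_sol s p La k D D0 g lo ka (real j+1) (w ka j)"
  "!!ka j. 0 < ka ==> continuous_on D (w ka j)"
  "!!ka j x. 0 < ka ==> x : D0 ==> ereal (w ka j x) <= u x"
  "!!ka j x. 0 < ka ==> - w ka j x <= - lo+un x"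
  "!!x c. x : D0 ==> ereal c < u x ==> EX r>0. EX J. ALL j>=J. ALL ka>0. c <= ka --> (ALL y:ball x r Int D0. c <= w ka j y)"
  "!!ka x. 0 < ka ==> (%j. w ka j x) ~> trunc_at u ka x" "closure D0 <= Om"
  by(rule approximants[OF C]) blast
 have DD0: "D <= D0" using a(5) by(rule insideD)
 have x0D: "x0 : D" "x0 : D0" using a(4) DD0 by auto
 define de where "de = (c-b)/4"
 have de: "0 < de" using b by(simp add:de_def)
 define ka where "ka = abs c+1"
 have ka: "0 < ka" "c <= ka" "b-de <= ka" using b de by(auto simp:ka_def)
 have "ereal (b-de) < u x0" using b de by simp
 from a(11)[OF x0D(2) this] obtain r1 J where r1: "0 < r1" "!!j y. J <= j ==> y : ball x0 r1 Int D0 ==> b-de <= w ka j y"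
  using ka by blast
 obtain r2 where r2: "0 < r2" "ball x0 r2 <= D" using x0D a(1) open_contains_ball by blast
 define R where "R = min r (min r1 r2)"
 have R: "0 < R" "R <= r" "R <= r1" "R <= r2" using r r1 r2 by(auto simp:R_def)
 let ?U = "ball x0 (R/2)" and ?V = "ball x0 R"
 have UV: "inside ?U ?V" by(rule inside_balls[OF R(1)])
 have VD: "?V <= D" using r2 R by auto
 \<comment> \<open>Near x0 lower semicontinuity gives -w <= -(b - de) = ka' + H for large j, and -w
   <= ka' fails only on a small set. Halving the height leaves w x0 >= c - de - H/2 = b + de, which
   exceeds u x0 = b.\<close>
 define ka' where "ka' = - (c-de)"
 define H where "H = c-b"
 have H: "0 < H" using b by(simp add:H_def)
 obtain T where T0: "0 <= T" "!!x ka. x : ?U ==> ka' <= ka ==> (NL y. en (max ((- lo+un y)-ka) 0 powr (p-1))*ind (- ?V) y*en (k x y)) <= en T"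
  by(rule far_integral_bound[OF tail_un_shift[of lo] UV, where ?ka0.0 = ka']) blast
 obtain vu where vu: "0 < vu" "!!f x0 R r ka0 ka H T. dg f (ball x0 (R/2)) (ball x0 R) ka0 T ==> 0 < r ==> 4*r <= R ==> ka0 <= ka ==> 0 < H ==> T <= H powr (p-1)*r powr-(s*p) ==> AL x. x : ball x0 R --> f x <= ka+H ==> ms {x:ball x0 r. ka < f x} <= vu*r^DIM('a) ==> AL x. x : ball x0 (r/2) --> f x <= ka+H/2"
  by(rule de_giorgi_small_measure) blast
 define a' where "a' = H powr (p-1)"
 have a': "0 < a'" using H by(simp add:a'_def)
 define rh where "rh = min (R/4) ((a'/(T+1)) powr (1/(s*p)))"
 have rh: "0 < rh" "4*rh <= R" using R a' T0(1) by(auto simp:rh_def)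
 have Trh: "T <= H powr (p-1)*rh powr-(s*p)"
 proof -
  have "rh powr (s*p) <= ((a'/(T+1)) powr (1/(s*p))) powr (s*p)"
   using rh sp0 by(intro powr_mono2) (auto simp:rh_def)
  also have "... = a'/(T+1)"
  proof -
   have "1/(s*p)*(s*p) = 1" using sp0 by(metis less_irrefl nonzero_divide_eq_eq)
   thus ?thesis unfolding powr_powr using a' T0(1) by simp
  qed
  finally have "(T+1)*rh powr (s*p) <= a'" using T0(1) by(simp add:field_simps)
  hence "T*rh powr (s*p) <= a'"
   by(smt (verit) mult_right_mono powr_ge_zero)
  thus ?thesis
   using rh by(simp add:powr_minus_divide field_simps a'_def)
 qed
 have wm [measurable]: "w ka j : Bor" for j
  using a(7)[OF ka(1), of j] obstacle_sol.w_meas by blast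
 have [measurable]: "ball x0 t : sets borel" for t by simp
 \<comment> \<open>The sets where the approximants are still below c - de. Almost every point leaves
   them eventually, so their measures tend to 0.\<close>
 define B where "B j = {x:ball x0 rh. ka' < - w ka j x}" for j
 have [measurable]: "B j : sets borel" for j unfolding B_def by measurable
 have "(%j. NL x. ind (B j) x) ~> (\<integral>\<^sup>+x. 0 \<partial>(lborel :: 'a measure))"
 proof(rule nn_integral_dominated_convergence[where w = "ind (ball x0 rh)"])
  show "(NL x. ind (ball x0 rh) x) < infy"
   using rh by(simp add:emeasure_ball)
  show "AL x. ind (B j) x <= (ind (ball x0 rh) x :: ennreal)" for j
   by(rule AE_I2) (auto simp:B_def split:split_indicator)
  show "AL x. (%j. ind (B j) x) ~> (0 :: ennreal)"
   using ae
  proof(rule eventually_mono)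
   fix x assume x: "x : ball x0 r --> ereal c <= u x"
   show "(%j. ind (B j) x) ~> (0 :: ennreal)"
   proof(cases "x : ball x0 rh")
    case True
    hence "x : ball x0 R" using rh by auto
    hence xr: "x : ball x0 r" "x : D0" using R VD DD0 by auto
    have "ereal (trunc_at u ka x) = min (u x) (ereal ka)"
     using xr(2) a(13) closure_subset[of D0] u_low by(intro ereal_trunc_at) auto
    moreover have "ereal c <= min (u x) (ereal ka)" using x xr ka by simp
    ultimately have "c <= trunc_at u ka x" by(metis ereal_less_eq(3))
    hence "c-de < trunc_at u ka x" using de by simp
    hence "\<forall>\<^sub>F j in sequentially. c-de < w ka j x"
     using order_tendstoD(1)[OF a(12)[OF ka(1)]] by blast
    hence "\<forall>\<^sub>F j in sequentially. ind (B j) x = (0 :: ennreal)"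
     by eventually_elim (auto simp:B_def ka'_def)
    thus ?thesis by(rule tendsto_eventually)
   qed (auto simp:B_def)
  qed
 qed measurable
 moreover have "(NL x. ind (B j) x) = em (B j)" for j
  by(rule nn_integral_indicator) measurable
 ultimately have "(%j. em (B j)) ~> 0" by simp
 moreover have "0 < en (vu*rh^DIM('a))" using vu rh by simp
 ultimately have "\<forall>\<^sub>F j in sequentially. em (B j) < en (vu*rh^DIM('a))"
  by(rule order_tendstoD(2))
 hence "\<forall>\<^sub>F j in sequentially. J <= j & em (B j) < en (vu*rh^DIM('a))"
  by(intro eventually_conj eventually_ge_at_top)
 then obtain j where j: "J <= j" "em (B j) < en (vu*rh^DIM('a))"
  using eventually_happens'[OF sequentially_bot] by blast
 have Bm: "ms (B j) <= vu*rh^DIM('a)"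
  unfolding measure_def using j(2) vu rh by(intro enn2real_leI) auto
 obtain g where "obstacle_sol s p La k D D0 g lo ka (real j+1) (w ka j)" using a(7)[OF ka(1)] by blast
 then interpret os: obstacle_sol s p La k D D0 g lo ka "real j+1" "w ka j" .
 have dg: "dg (%x. - w ka j x) ?U ?V ka' T"
 proof(rule os.dg_lower_T[OF UV VD T0(1)])
  fix x ka1 assume x: "x : ?U" "ka' <= ka1"
  show "(NL y. en (max (- w ka j y-ka1) 0 powr (p-1))*ind (- ?V) y*en (k x y)) <= en T"
   by(rule lower_far_bound[OF UV a(10)[OF ka(1)] wm T0(2)[OF _ order_refl] x])
 qed
 have "AL x. x : ball x0 (rh/2) --> - w ka j x <= ka'+H/2"
 proof(rule vu(2)[OF dg rh order_refl H Trh])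
  show "AL x. x : ball x0 R --> - w ka j x <= ka'+H"
  proof(rule AE_I2, rule impI)
   fix x assume "x : ball x0 R"
   hence "x : ball x0 r1 Int D0" using R VD DD0 by auto
   hence "b-de <= w ka j x" by(rule r1(2)[OF j(1)])
   thus "- w ka j x <= ka'+H" by(simp add:ka'_def H_def)
  qed
  show "ms {x:ball x0 rh. ka' < - w ka j x} <= vu*rh^DIM('a)" using Bm by(simp add:B_def)
 qed
 moreover have "continuous_on (ball x0 (rh/2)) (%x. - w ka j x)"
 proof -
  have "ball x0 (rh/2) <= D" using rh VD by auto
  thus ?thesis by(intro continuous_intros continuous_on_subset[OF a(8)[OF ka(1)]])
 qed
 ultimately have "- w ka j x0 <= ka'+H/2"
  using rh by(intro AE_open_continuous_le[of "ball x0 (rh/2)" "%x. - w ka j x"]) auto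
 hence "b < w ka j x0" using b by(simp add:ka'_def H_def de_def field_simps)
 thus False using a(9)[OF ka(1) x0D(2), of j] b(1) by simp
qed

lemma min_supersolution:
 assumes ka: "0 < ka" and C: "compact C" "C ~= {}" "C <= Om"
 shows "energy C (%x. min (real_of_ereal (u x)) ka) < infy"
  and "inside U C ==> eh : Bor ==> (!!x. 0 <= eh x) ==> (!!x. eh x <= B) ==> (!!x. x ~: U ==> eh x = 0) ==> energy C eh < infy ==> 0 <= (BM v. jp p (dl (%x. min (real_of_ereal (u x)) ka) v)*dl eh v)"
proof -
 let ?t = "%x. min (real_of_ereal (u x)) ka"
 have Om: "Om ~= {}" using C by auto
 have teq: "AL x. ?t x = trunc_at u ka x"
  using u_finite_AE(1)[OF Om]
 proof(rule eventually_mono)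
  fix x assume "abs (u x) ~= infy"
  thus "?t x = trunc_at u ka x" by(cases "u x") (auto simp:trunc_at_def min_def)
 qed
 have "energy C ?t = energy C (trunc_at u ka)" by(rule energy_cong_AE) (use teq in auto)
 thus "energy C ?t < infy" using trunc_supersolution(1)[OF ka C] by simp
 assume U: "inside U C" and eh: "eh : Bor" "!!x. 0 <= eh x" "!!x. eh x <= B" "!!x. x ~: U ==> eh x = 0"
  and eeh: "energy C eh < infy"
 have [measurable]: "eh : Bor" by fact
 have "0 <= (BM v. jp p (dl (trunc_at u ka) v)*dl eh v)"
  by(rule trunc_supersolution(2)[OF ka C U eh eeh])
 also have "... = (BM v. jp p (dl ?t v)*dl eh v)"
 proof(rule integral_cong_AE)
  show "AE v in mu. jp p (dl (trunc_at u ka) v)*dl eh v = jp p (dl ?t v)*dl eh v"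
   using AE_muI[OF teq] by eventually_elim (simp add:dl_def)
 qed measurable
 finally show "0 <= (BM v. jp p (dl ?t v)*dl eh v)" .
qed

text \<open>The truncation level tends to infinity. Truncation contracts increments, so the energies
  stay below that of \<open>u\<close> and \<open>jp_dl_tendsto\<close> applies.\<close>

lemma u_supersolution:
 assumes C: "compact C" "C ~= {}" "C <= Om" and e: "energy C (%x. real_of_ereal (u x)) < infy"
  and U: "inside U C" and eh: "eh : Bor" "!!x. 0 <= eh x" "!!x. eh x <= B" "!!x. x ~: U ==> eh x = 0" "energy C eh < infy"
 shows "integrable mu (%v. jp p (dl (%x. real_of_ereal (u x)) v)*dl eh v)"
  and "0 <= (BM v. jp p (dl (%x. real_of_ereal (u x)) v)*dl eh v)"
proof -
 let ?u = "%x. real_of_ereal (u x)"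
 have Om: "Om ~= {}" using C by auto
 note fin = u_finite_AE[OF Om]
 have ehB: "abs (eh x) <= B" for x using eh(2,3)[of x] by simp
 have [measurable]: "?u : Bor" by measurable
 have [measurable]: "eh : Bor" by fact
 show "integrable mu (%v. jp p (dl ?u v)*dl eh v)"
  by(rule integrable_jp_dl[OF fin(2) e U eh(1) ehB eh(4,5)])
 define t where "t i x = min (?u x) (real i+1)" for i :: nat and x
 have tm [measurable]: "t i : Bor" for i unfolding t_def[abs_def] by measurable

 obtain M where M: "0 <= M" "energy C ?u = en M" using e by(cases "energy C ?u") auto
 have "(%i. BM v. jp p (dl (t i) v)*dl eh v) ~> (BM v. jp p (dl ?u v)*dl eh v)"
 proof(rule jp_dl_tendsto[OF U fin(2) tm _ _ _ M(1) eh(1) ehB eh(4,5)])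
  have "abs (min a (real i+1)) <= abs a" for a :: real and i by(auto simp:min_def)
  thus "abs (t i x) <= abs (?u x)" for i x unfolding t_def .
  show "(%i. t i x) ~> ?u x" for x
  proof(rule tendsto_eventually)
   obtain n :: nat where n: "?u x <= real n" using real_arch_simple by blast
   show "\<forall>\<^sub>F i in sequentially. t i x = ?u x"
    using eventually_ge_at_top[of n] by eventually_elim (use n in \<open>auto simp:t_def\<close>)
  qed
  show "energy C (t i) <= en M" for i
   unfolding M(2)[symmetric] by(rule energy_contraction) (auto simp:t_def min_def)
 qed
 moreover have "0 <= (BM v. jp p (dl (t i) v)*dl eh v)" for i
  unfolding t_def[abs_def] by(rule min_supersolution(2)[OF _ C U eh]) auto
 ultimately show "0 <= (BM v. jp p (dl ?u v)*dl eh v)"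
  by(intro LIMSEQ_le_const) auto
qed

end

section \<open>Negative powers as test functions and the weighted energy\<close>

lemma neg_powr_tangent:
 fixes a b e :: real
 assumes "0 < a" "0 < b" "0 <= e"
 shows "b powr-e-e*b powr (- e-1)*(a-b) <= a powr-e"
proof -
 have "1-e*ln (a/b) <= exp (- e*ln (a/b))" using exp_ge_add_one_self[of "- e*ln (a/b)"] by simp
 moreover have "e*ln (a/b) <= e*(a/b-1)" using assms by(intro mult_left_mono ln_le_minus_one) auto
 moreover have "exp (- e*ln (a/b)) = (a/b) powr-e" using assms by(simp add:powr_def)
 ultimately have "1-e*(a/b-1) <= (a/b) powr-e" by linarith
 hence "b powr-e*(1-e*(a/b-1)) <= b powr-e*(a/b) powr-e"
  by(rule mult_left_mono) simp
 also have "b powr-e*(a/b) powr-e = a powr-e"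
  using assms by(simp add:powr_mult[symmetric])
 also have "b powr-e*(1-e*(a/b-1)) = b powr-e-e*(b powr-e*(a/b-1))"
  by(simp add:algebra_simps)
 also have "b powr-e*(a/b-1) = b powr (- e-1)*(a-b)"
  using assms by(simp add:powr_diff field_simps)
 finally show ?thesis by(simp add:mult.assoc)
qed

lemma neg_powr_lipschitz:
 fixes a b e :: real
 assumes "1 <= a" "1 <= b" "0 <= e"
 shows "abs (a powr-e-b powr-e) <= e*abs (a-b)"
proof -
 have *: "b powr-e-a powr-e <= e*(a-b)" if "b <= a" "1 <= b" for a b :: real
 proof -
  have "b powr-e-a powr-e <= e*b powr (- e-1)*(a-b)"
   using neg_powr_tangent[of a b e] that assms(3) by linarith
  also have "... <= e*1*(a-b)"
   using powr_mono[of "- e-1" 0 b] that assms(3) by(intro mult_right_mono mult_left_mono) auto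
  finally show ?thesis by simp
 qed
 have m: "x powr-e <= y powr-e" if "y <= x" "1 <= y" for x y :: real
  using powr_mono2'[of "- e" y x] that assms(3) by simp
 show ?thesis
 proof(cases "b <= a")
  case True
  thus ?thesis using *[of b a] m[of b a] assms by simp
 next
  case False
  thus ?thesis using *[of a b] m[of a b] assms by simp
 qed
qed

text \<open>If the left side is positive, then \<open>q - r\<close> dominates \<open>(ep / p) q (a - b) / a\<close>, so every
 factor \<open>a - b\<close> can be traded for \<open>a (q - r)\<close>.\<close>

lemma neg_powr_test_aux:
 fixes a b q r e p :: real
 assumes p: "1 < p" and e: "0 < e" "e <= p" and ab: "0 < b" "b <= a" "1 <= a" and qr: "0 <= q" "q <= 1" "0 <= r"
 shows "(a-b) powr (p-1)*(a powr-e*q powr p-b powr-e*r powr p) <= p*(p/e) powr (p-1)*a powr (p-1)*(q-r) |^ p"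
proof(cases "a powr-e*q powr p <= b powr-e*r powr p")
 case True
 hence "(a-b) powr (p-1)*(a powr-e*q powr p-b powr-e*r powr p) <= 0"
  by(intro mult_nonneg_nonpos) auto
 also have "0 <= p*(p/e) powr (p-1)*a powr (p-1)*(q-r) |^ p" using p by simp
 finally show ?thesis .
next
 let ?A = "(p/e)*(a*(q-r))"
 let ?G = "q powr p-r powr p"
 let ?F = "a powr-e*q powr p-b powr-e*r powr p"
 case False
 define si where "si = e/p"
 have si: "0 < si" "si <= 1" using p e by(auto simp:si_def)
 have q0: "0 < q"
 proof(rule ccontr)
  assume "~ 0 < q"
  hence "q = 0" using qr by simp
  thus False using False by simp
 qed
 have "b powr-si*r < a powr-si*q"
 proof(rule ccontr)
  assume "~ b powr-si*r < a powr-si*q"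
  hence "(a powr-si*q) powr p <= (b powr-si*r) powr p"
   using p qr by(intro powr_mono2) auto
  thus False using False p qr by(simp add:powr_mult powr_powr si_def)
 qed
 hence "b powr si*(b powr-si*r) < b powr si*(a powr-si*q)"
  using ab by(intro mult_strict_left_mono) auto
 also have "b powr si*(b powr-si*r) = r" using ab by(simp add:powr_minus field_simps)
 also have "b powr si*(a powr-si*q) = (b/a) powr si*q"
  using ab by(simp add:powr_divide powr_minus field_simps)
 finally have r: "r < (b/a) powr si*q" .
 have "(b/a) powr si <= 1-si*(1-b/a)"
 proof(cases "si = 1")
  case True
  thus ?thesis using ab by simp
 next
  case False
  hence "(b/a) powr si*1 <= ((b/a) powr si) powr (1/si)/(1/si)+1 powr (1/(1-si))/(1/(1-si))"
   using si by(intro Youngs_inequality) auto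
  thus ?thesis using si ab by(simp add:powr_powr algebra_simps)
 qed
 hence "(b/a) powr si*q <= (1-si*(1-b/a))*q"
  using q0 by(intro mult_right_mono) auto
 with r have "si*(1-b/a)*q <= q-r" by(simp add:algebra_simps)
 hence "a*(si*(1-b/a)*q) <= a*(q-r)" using ab by(intro mult_left_mono) auto
 moreover have "a*(si*(1-b/a)*q) = si*((a-b)*q)" using ab by(simp add:algebra_simps)
 ultimately have *: "si*((a-b)*q) <= a*(q-r)" by simp
 have rq: "r <= q"
 proof -
  have "0 <= si*((a-b)*q)" using si ab q0 by simp
  hence "0 <= a*(q-r)" using * by simp
  thus ?thesis using ab by(simp add:zero_le_mult_iff)
 qed
 have "((a-b)*q) <= ?A"
  using * p e by(simp add:si_def field_simps)
 hence 1: "((a-b)*q) powr (p-1) <= (?A) powr (p-1)"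
  using p ab q0 by(intro powr_mono2) auto
 have "?G <= p*q powr (p-1)*(q-r)"
  using powr_tangent[OF p, of q r] q0 qr by(simp add:jp_nonneg algebra_simps)
 moreover have "?F <= ?G"
 proof -
  have "a powr-e <= b powr-e" using ab e by(intro powr_mono2') auto
  hence "a powr-e*r powr p <= b powr-e*r powr p" by(intro mult_right_mono) auto
  hence "?F <= a powr-e*(?G)"
   by(simp add:algebra_simps)
  also have "... <= 1*(?G)"
  proof(rule mult_right_mono)
   show "a powr-e <= 1" using powr_mono[of "- e" 0 a] ab e by simp
   show "0 <= ?G" using rq qr p by(simp add:powr_mono2)
  qed
  finally show ?thesis by simp
 qed
 ultimately have "(a-b) powr (p-1)*(?F) <= (a-b) powr (p-1)*(p*q powr (p-1)*(q-r))"
  by(intro mult_left_mono) auto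
 also have "... = p*(((a-b)*q) powr (p-1)*(q-r))"
  using ab q0 by(simp add:powr_mult mult_ac)
 also have "... <= p*((?A) powr (p-1)*(q-r))"
  using 1 rq p by(intro mult_left_mono mult_right_mono) auto
 also have "... = p*(p/e) powr (p-1)*a powr (p-1)*((q-r) powr (p-1)*(q-r))"
 proof -
  have "(?A) powr (p-1) = (p/e) powr (p-1)*(a powr (p-1)*(q-r) powr (p-1))"
   using ab rq e p by(simp only: powr_mult)
  thus ?thesis by(simp only: mult_ac)
 qed
 also have "(q-r) powr (p-1)*(q-r) = (q-r) |^ p"
  using jp_mult_self[of p "q-r"] rq by(simp add:jp_nonneg)
 finally show ?thesis .
qed

lemma neg_powr_test:
 fixes a b q r e p :: real
 assumes p: "1 < p" and e: "0 < e" "e <= p" and ab: "1 <= a" "1 <= b" and qr: "0 <= q" "q <= 1" "0 <= r" "r <= 1"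
 shows "jp p (a-b)*(a powr-e*q powr p-b powr-e*r powr p) <= p*(p/e) powr (p-1)*(a powr (p-1)+b powr (p-1))*(q-r) |^ p"
proof(cases "b <= a")
 case True
 have "p*(p/e) powr (p-1)*a powr (p-1)*(q-r) |^ p <= p*(p/e) powr (p-1)*(a powr (p-1)+b powr (p-1))*(q-r) |^ p"
  using p by(intro mult_right_mono mult_left_mono) auto
 thus ?thesis
  using neg_powr_test_aux[OF p e, of b a q r] True ab qr by(simp add:jp_nonneg)
next
 case False
 have "p*(p/e) powr (p-1)*b powr (p-1)*(r-q) |^ p <= p*(p/e) powr (p-1)*(a powr (p-1)+b powr (p-1))*(r-q) |^ p"
  using p by(intro mult_right_mono mult_left_mono) auto
 moreover have "(b-a) powr (p-1)*(b powr-e*r powr p-a powr-e*q powr p) = jp p (a-b)*(a powr-e*q powr p-b powr-e*r powr p)"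
  using False by(simp add:jp_nonpos algebra_simps)
 ultimately show ?thesis
  using neg_powr_test_aux[OF p e, of a b r q] False ab qr by(simp add:abs_minus_commute)
qed

text \<open>A negative power decreases in its argument, so where the cutoff is constant the
  supersolution inequality, read with the opposite sign, bounds an energy from above. The tangent
  inequality for a^(-e) shows that its weight is the power -(1+e) of the larger value.\<close>

lemma neg_powr_gain:
 fixes a b e p :: real
 assumes e: "0 < e" and ab: "1 <= a" "1 <= b"
 shows "e*((a-b) |^ p * max a b powr-(1+e)) <= - (jp p (a-b)*(a powr-e-b powr-e))"
proof -
 have *: "e*((a-b) |^ p*a powr-(1+e)) <= - (jp p (a-b)*(a powr-e-b powr-e))"
  if "b <= a" "1 <= b" for a b :: real
 proof -
  have "e*a powr (- e-1)*(a-b) <= b powr-e-a powr-e"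
   using neg_powr_tangent[of b a e] that e by(simp add:algebra_simps)
  hence "(a-b) powr (p-1)*(e*a powr (- e-1)*(a-b)) <= (a-b) powr (p-1)*(b powr-e-a powr-e)"
   by(rule mult_left_mono) simp
  also have "(a-b) powr (p-1)*(e*a powr (- e-1)*(a-b)) = e*(((a-b) powr (p-1)*(a-b))*a powr (- e-1))"
   by(simp only: mult_ac)
  also have "(a-b) powr (p-1)*(a-b) = (a-b) |^ p"
   using jp_mult_self[of p "a-b"] that by(simp add:jp_nonneg)
  also have "- e-1 = - (1+e)" by simp
  finally show ?thesis using that by(simp add:jp_nonneg algebra_simps)
 qed
 show ?thesis
 proof(cases "b <= a")
  case True
  thus ?thesis using * ab by(simp add:max_def)
 next
  case False
  have "- (jp p (b-a)*(b powr-e-a powr-e)) = - (jp p (a-b)*(a powr-e-b powr-e))"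
   by(subst jp_minus_commute) (simp add:algebra_simps)
  thus ?thesis using *[of a b] False ab by(simp add:abs_minus_commute max_def)
 qed
qed

lemma nn_integral_Fatou_const:
 assumes [measurable]: "!!i. F i : borel_measurable M"
  and lim: "!!z. \<forall>\<^sub>F i in sequentially. F i z = G z" and le: "!!i. (\<integral>\<^sup>+z. F i z \<partial>M) <= B"
 shows "(\<integral>\<^sup>+z. G z \<partial>M) <= B"
proof -
 have "(\<integral>\<^sup>+z. G z \<partial>M) = (\<integral>\<^sup>+z. liminf (%i. F i z) \<partial>M)"
  by(intro nn_integral_cong lim_imp_Liminf[symmetric] tendsto_eventually lim) simp
 also have "... <= liminf (%i. \<integral>\<^sup>+z. F i z \<partial>M)" by(rule nn_integral_liminf) measurable
 also have "... <= B" by(rule Liminf_le) (use le in auto)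
 finally show ?thesis .
qed

lemma compact_collar:
 fixes C Om :: "'a::euclidean_space set"
 assumes C: "compact C" "C ~= {}" "C <= Om" "open Om"
 obtains V l where "compact V" "V <= Om" "0 < l" "inside {x. infdist x C < l} V" "C <= {x. infdist x C < l}" "V ~= {}"
proof -
 obtain d where d: "0 < d" "inside {x. infdist x C < d} Om" "C <= {x. infdist x C < d}"
  by(rule inside_neighbourhood[OF C(1,2) inside_compact_open[OF C(1,4,3)]])
 define V where "V = {x. infdist x C <= d/2}"
 have sub: "V <= {x. infdist x C < d}" using d(1) by(auto simp:V_def)
 have "closed V" unfolding V_def by(intro closed_Collect_le continuous_intros)
 moreover have "bounded V" by(rule bounded_subset[OF _ sub]) (use d(2) in \<open>simp add:inside_def\<close>)
 ultimately have V: "compact V" by(simp add:compact_eq_bounded_closed)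
 have o: "open {x. infdist x C < d/2}" by(intro open_Collect_less continuous_intros)
 have "C <= {x. infdist x C < d/2}" using d(1) by auto
 hence "inside C {x. infdist x C < d/2}" by(rule inside_compact_open[OF C(1) o])
 hence "inside C V"
  by(rule inside_mono) (use C(1) V in \<open>auto simp:V_def borel_compact\<close>)
 then obtain l where l: "0 < l" "inside {x. infdist x C < l} V" "C <= {x. infdist x C < l}"
  by(rule inside_neighbourhood[OF C(1,2)])
 show ?thesis
  by(rule that[OF V _ l]) (use sub insideD[OF d(2)] C(2) l(3) insideD[OF l(2)] in auto)
qed

context frac_kernel
begin

lemma nn_integral_lip_weight:
 assumes l: "0 < l" and [measurable]: "ze : Bor" "G : Bor"
  and ze: "!!x y. (abs (ze x-ze y)) <= 1" "!!x y. (abs (ze x-ze y)) <= norm (x-y)/l"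
 shows "(NM z. en (dl ze z |^ p)*(G (fst z)+G (snd z))) <= 2*(en (lip_const*l powr-(s*p))*(NL x. G x))"
proof -
 let ?A = "%x. NL y. en ((ze x-ze y) |^ p)*G x*en (k x y)"
 let ?G = "lip_const*l powr-(s*p)"
 let ?F = "NM z. en (dl ze z |^ p)*G (fst z)"
 have *: "(?F) <= en (?G)*(NL x. G x)"
 proof -
  have "(?F) = (NL x. ?A x)"
   by(subst nn_integral_mu) (auto simp:dl_def)
  also have "... <= (NL x. en (?G)*G x)"
  proof(rule nn_integral_mono)
   fix x
   have "(?A x) = (NL y. en ((ze x-ze y) |^ p)*en (k x y)*G x)"
    by(simp only: mult_ac)
   also have "... = (NL y. en ((ze x-ze y) |^ p)*en (k x y))*G x"
    by(rule nn_integral_multc) measurable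
   also have "... <= en (?G)*G x"
    by(intro mult_right_mono nn_integral_lip_kernel l ze) auto
   finally show "(?A x) <= en (?G)*G x" .
  qed
  also have "... = en (?G)*(NL x. G x)"
   by(rule nn_integral_cmult) measurable
  finally show ?thesis .
 qed
 have "(NM z. en (dl ze z |^ p)*G (snd z)) = (?F)"
  by(subst nn_integral_mu_swap[symmetric]) (auto simp:dl_def abs_minus_commute)
 hence "(NM z. en (dl ze z |^ p)*(G (fst z)+G (snd z))) = (?F)+(?F)"
  by(simp add:distrib_left nn_integral_add)
 also have "... = 2*(?F)" by(simp add:mult_2)
 also have "... <= 2*(en (?G)*(NL x. G x))"
  by(rule mult_left_mono[OF *]) simp
 finally show ?thesis .
qed

end

context comparison
begin

abbreviation "ur == %x. real_of_ereal (u x)"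

text \<open>The truncations t = min(u, i+1) are tested with (t + c)^(-e) ze^p, where
  \<open>c\<close> makes u + c >= 1 on the collar. On C x C this yields the weighted energy
  (\<open>neg_powr_gain\<close>); elsewhere on V x V the cutoff costs at most its own increments
  weighted by (t + c)^(p-1) (\<open>neg_powr_test\<close>), and the far part is controlled by the
  tail. Then i tends to infinity by Fatou's lemma.\<close>

lemma weighted_energy:
 assumes C: "compact C" "C ~= {}" "C <= Om" and e: "0 < e" "e <= p"
 obtains c M where "1 <= c" "0 <= M" "!!x. x : C ==> 1 <= ur x+c"
  "(NM z. en (dl ur z |^ p * max (ur (fst z)+c) (ur (snd z)+c) powr-(1+e))*ind (C \<times> C) z) <= en M"
proof -
 have tu: "tail ur" using u_finite_AE(2) C by auto
 obtain V l where V: "compact V" "V <= Om" "0 < l" "inside {x. infdist x C < l} V" "C <= {x. infdist x C < l}" "V ~= {}"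
  by(rule compact_collar[OF C open_Om])
 define U where "U = {x. infdist x C < l}"
 have UV: "inside U V" using V(4) by(simp add:U_def)
 have CU: "C <= U" using V(5) by(simp add:U_def)
 have UVs: "U <= V" by(rule insideD[OF UV])
 obtain lo :: real where lo: "!!x. x : V ==> ereal lo < u x"
  by(rule lsc_bounded_below[OF open_Om u_lsc V(1,2) u_low]) auto
 define c where "c = 1+abs lo"
 have c: "1 <= ur x+c" if "x : V" for x
  using lo[OF that] by(cases "u x") (auto simp:c_def)
 have c1: "1 <= c" by(simp add:c_def)
 have [measurable]: "C : sets borel" "U : sets borel" "V : sets borel"
  using C V UV by(auto simp:borel_compact inside_def)
 have [measurable]: "ur : Bor" by measurable
 define ze where "ze x = 1-dist_cutoff C l x" for x
 have cut: "cutoff_fun U l (dist_cutoff C l)" unfolding U_def by(rule cutoff_dist[OF V(3)])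
 have [measurable]: "dist_cutoff C l : Bor" using cut by(simp add:cutoff_fun_def)
 have [measurable]: "ze : Bor" unfolding ze_def[abs_def] by measurable
 have ze01: "0 <= ze x" "ze x <= 1" for x using cut by(auto simp:cutoff_fun_def ze_def)
 have ze1: "abs (ze x-ze y) <= 1" for x y using ze01[of x] ze01[of y] by(simp add:abs_le_iff)
 have zel: "abs (ze x-ze y) <= norm (x-y)/l" for x y
  using cut by(simp add:cutoff_fun_def ze_def abs_minus_commute)
 have ze0: "ze x = 0" if "x ~: U" for x using cut that by(simp add:cutoff_fun_def ze_def)
 have zeC: "ze x = 1" if "x : C" for x using that by(simp add:ze_def dist_cutoff_0)
 define K1 where "K1 = p*(p/e) powr (p-1)"
 have K1: "0 <= K1" using p1 by(simp add:K1_def)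
 define G where "G x = en ((abs (ur x)+c) powr (p-1))*ind V x" for x
 have [measurable]: "G : Bor" unfolding G_def[abs_def] by measurable
 have GV: "(NL x. G x) < infy"
 proof -
  have "tail (%x. (abs (ur x))+c)"
   by(rule tail_add[OF tail_mono[OF tu] tail_const]) auto
  from tail_bounded_integral[OF this compact_imp_bounded[OF V(1)]]
  have "(NL y. en ((abs (ur y)+c) |^ (p-1))*ind V y) < infy" by simp
  moreover have "abs (abs a+c) = abs a+c" for a :: real using c1 by simp
  ultimately show ?thesis unfolding G_def by(simp only:)
 qed
 \<comment> \<open>The cost is written with |u| + c in place of t + c, which makes it independent of
   i. It is integrable because \<open>u\<close> is locally in L^(p-1) and has a finite tail.\<close>
 define Q where "Q z = K1*(dl ze z |^ p*((abs (ur (fst z))+c) powr (p-1)+(abs (ur (snd z))+c) powr (p-1)))*ind (V \<times> V) z+2 powr (p-1)*1*farfun U V ur z" for z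
 have [measurable]: "Q : Bor" unfolding Q_def[abs_def] by measurable
 have Q0: "0 <= Q z" for z unfolding Q_def using K1 farfun_nonneg[of U V ur z] by simp
 have Qfin: "(NM z. en (Q z)) < infy"
 proof -
  have "(NM z. en (Q z)) <= (NM z. en K1*(en (dl ze z |^ p)*(G (fst z)+G (snd z)))+en (2 powr (p-1))*en (farfun U V ur z))"
  proof(rule nn_integral_mono)
   fix z
   have "en (Q z) = en (K1*(dl ze z |^ p*((abs (ur (fst z))+c) powr (p-1)+(abs (ur (snd z))+c) powr (p-1)))*ind (V \<times> V) z)+en (2 powr (p-1)*farfun U V ur z)"
    unfolding Q_def using K1 farfun_nonneg[of U V ur z] by(subst ennreal_plus) auto
   also have "en (2 powr (p-1)*farfun U V ur z) = en (2 powr (p-1))*en (farfun U V ur z)"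
    by(rule ennreal_mult) (auto simp:farfun_nonneg)
   also have "en (K1*(dl ze z |^ p*((abs (ur (fst z))+c) powr (p-1)+(abs (ur (snd z))+c) powr (p-1)))*ind (V \<times> V) z) <= en K1*(en (dl ze z |^ p)*(G (fst z)+G (snd z)))"
    using K1 by(cases "z : V \<times> V") (auto simp:G_def ennreal_mult ennreal_plus)
   finally show "en (Q z) <= en K1*(en (dl ze z |^ p)*(G (fst z)+G (snd z)))+en (2 powr (p-1))*en (farfun U V ur z)" by(simp add:add_right_mono)
  qed
  also have "... = en K1*(NM z. en (dl ze z |^ p)*(G (fst z)+G (snd z)))+en (2 powr (p-1))*(NM z. en (farfun U V ur z))"
   by(subst nn_integral_add, measurable, subst nn_integral_cmult, measurable, subst nn_integral_cmult, measurable)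
  also have "... < infy"
  proof -
   have "(NM z. en (dl ze z |^ p)*(G (fst z)+G (snd z))) < infy"
    by(rule order_le_less_trans[OF nn_integral_lip_weight[OF V(3) _ _ ze1 zel]])
     (use GV in \<open>auto simp:ennreal_mult_less_top\<close>)
   thus ?thesis using farfun_finite[OF tu UV] by(simp add:ennreal_mult_less_top)
  qed
  finally show ?thesis .
 qed
 define P where "P i z = e*(dl (%x. min (ur x) (real i+1)) z |^ p * max (min (ur (fst z)) (real i+1)+c) (min (ur (snd z)) (real i+1)+c) powr-(1+e))*ind (C \<times> C) z" for i :: nat and z
 have [measurable]: "P i : Bor" for i unfolding P_def[abs_def] by measurable
 have PQ: "(NM z. en (P i z)) <= (NM z. en (Q z))" for i
 proof -
  define t where "t x = min (ur x) (real i+1)" for x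
  have [measurable]: "t : Bor" unfolding t_def[abs_def] by measurable
  have tc: "1 <= t x+c" if "x : V" for x using c[OF that] c1 by(simp add:t_def min_def)
  have "abs (min a (real i+1)) <= abs a" for a by(auto simp:min_def)
  hence tle: "abs (t x) <= abs (ur x)" for x unfolding t_def .
  define eh where "eh x = (if x : U then (t x+c) powr-e*ze x powr p else 0)" for x
  have [measurable]: "eh : Bor" unfolding eh_def[abs_def] by measurable
  have ehV: "eh x = (t x+c) powr-e*ze x powr p" if "x : V" for x
   using ze0[of x] p0 by(simp add:eh_def)
  have ple: "(t x+c) powr-e <= 1" if "x : V" for x
   using powr_mono[of "- e" 0 "t x+c"] tc[OF that] e by simp
  have zep: "ze x powr p <= 1" for x using powr_mono2[of p "ze x" 1] ze01[of x] p0 by simp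
  have eh0: "0 <= eh x" for x by(simp add:eh_def)
  have eh1: "eh x <= 1" for x
   using ple[of x] zep[of x] UVs by(auto simp:eh_def intro!: mult_le_one)
  have eeh: "energy V eh < infy"
  proof -
   have "energy V eh <= en (2 powr p)*(energy V (%x. e*t x)+energy V (%x. 2*p*ze x))"
   proof(rule energy_le_sum)
    fix x y assume xy: "x : V" "y : V"
    let ?a = "(t x+c) powr-e" and ?b = "(t y+c) powr-e" and ?q = "ze x powr p" and ?r = "ze y powr p"
    have "eh x-eh y = (?a-?b)*?q+?b*(?q-?r)" using xy by(simp add:ehV algebra_simps)
    hence "abs (eh x-eh y) <= abs (?a-?b)*?q+?b*abs (?q-?r)"
     using abs_triangle_ineq[of "(?a-?b)*?q" "?b*(?q-?r)"] by(simp add:abs_mult)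
    also have "abs (?a-?b)*?q <= abs (?a-?b)*1" by(intro mult_left_mono zep) auto
    also have "?b*abs (?q-?r) <= 1*abs (?q-?r)" by(intro mult_right_mono ple xy) auto
    also have "abs (?a-?b)*1 <= e*abs (t x-t y)"
     using neg_powr_lipschitz[OF tc[OF xy(1)] tc[OF xy(2)], of e] e by simp
    also have "abs (?q-?r) <= p*(ze x powr (p-1)+ze y powr (p-1))*abs (ze x-ze y)"
     using powr_diff_le[OF p1, of "ze x" "ze y"] ze01 by simp
    also have "... <= p*(1+1)*abs (ze x-ze y)"
     using powr_mono2[of "p-1" "ze x" 1] powr_mono2[of "p-1" "ze y" 1] ze01 p1
     by(intro mult_right_mono mult_left_mono add_mono) auto
    finally show "abs (eh x-eh y) <= abs (e*t x-e*t y)+abs (2*p*ze x-2*p*ze y)"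
     using e p0 by(simp add:abs_mult right_diff_distrib[symmetric])
   qed measurable
   also have "... < infy"
   proof -
    have cm: "energy V (%x. a*f x) = en (a |^ p)*energy V f" if "f : Bor" for a f
    proof -
     have [measurable]: "f : Bor" by fact
     have "energy V (%x. a*f x) = (NM z. en (a |^ p)*(en (dl f z |^ p)*ind (V \<times> V) z))"
      unfolding energy_def
      by(intro nn_integral_cong) (simp add:dl_def right_diff_distrib[symmetric] abs_mult powr_mult ennreal_mult mult.assoc)
     also have "... = en (a |^ p)*energy V f"
      unfolding energy_def by(rule nn_integral_cmult) measurable
     finally show ?thesis .
    qed
    have "energy V t < infy" unfolding t_def[abs_def] by(rule min_supersolution(1)[OF _ V(1,6,2)]) simp
    moreover have "energy V ze < infy"
    proof -
     have "energy V ze <= en (1 powr p*(lip_const*l powr-(s*p)))*em V"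
      by(rule energy_lipschitz) (use V(3) ze1 zel in auto)
     also have "... < infy" using emeasure_bounded_finite[OF compact_imp_bounded[OF V(1)]] by(simp add:ennreal_mult_less_top)
     finally show ?thesis .
    qed
    ultimately show ?thesis by(simp add:cm ennreal_mult_less_top)
   qed
   finally show ?thesis .
  qed
  have t_tail: "tail t" by(rule tail_mono[OF tu _ tle]) measurable
  have "energy V t < infy" unfolding t_def[abs_def] by(rule min_supersolution(1)[OF _ V(1,6,2)]) simp
  hence int: "integrable mu (%z. jp p (dl t z)*dl eh z)"
   by(rule integrable_jp_dl[OF t_tail _ UV, where B = 1]) (use eh0 eh1 eeh in \<open>auto simp:eh_def\<close>)
  have pos: "0 <= (BM z. jp p (dl t z)*dl eh z)"
   unfolding t_def[abs_def] by(rule min_supersolution(2)[OF _ V(1,6,2) UV _ eh0 eh1 _ eeh]) (auto simp:eh_def)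
  show ?thesis
  proof(rule nn_integral_le_of_integral_nonpos[where e = "%z. - (jp p (dl t z)*dl eh z)"])
   show "AE z in mu. P i z-Q z <= - (jp p (dl t z)*dl eh z)"
   proof(rule AE_I2)
    fix z :: "'a \<times> 'a"
    obtain x y where z: "z = (x, y)" by(cases z)
    show "P i z-Q z <= - (jp p (dl t z)*dl eh z)"
    proof(cases "z : V \<times> V")
     case False
     hence "P i z = 0" using CU UVs by(auto simp:P_def split:split_indicator)
     moreover have "Q z = 2 powr (p-1)*1*farfun U V ur z" using False by(simp add:Q_def)
     moreover have "abs (jp p (dl t z)*dl eh z) <= 2 powr (p-1)*1*farfun U V ur z"
      by(rule jp_dl_far_le[OF UVs tle _ _ False]) (use eh0 eh1 in \<open>auto simp:eh_def\<close>)
     ultimately show ?thesis by linarith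
    next
     case True
     hence xy: "x : V" "y : V" by(auto simp:z)
     let ?a = "t x+c" and ?b = "t y+c"
     have ab: "1 <= ?a" "1 <= ?b" using tc xy by auto
     have d: "jp p (dl t z)*dl eh z = jp p (?a-?b)*(?a powr-e*ze x powr p-?b powr-e*ze y powr p)"
      by(simp add:dl_def z ehV xy)
     show ?thesis
     proof(cases "x : C & y : C")
      case inC: True
      have "P i z = e*((?a-?b) |^ p * max ?a ?b powr-(1+e))"
       using inC by(simp add:P_def z dl_def t_def)
      also have "... <= - (jp p (?a-?b)*(?a powr-e-?b powr-e))"
       by(rule neg_powr_gain[OF e(1) ab])
      also have "... = - (jp p (dl t z)*dl eh z)" using inC by(simp add:d zeC)
      finally show ?thesis using Q0[of z] by linarith
     next
      case False
      hence "P i z = 0" by(auto simp:P_def z split:split_indicator)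
      moreover have "jp p (dl t z)*dl eh z <= Q z"
      proof -
       have "jp p (dl t z)*dl eh z <= K1*(?a powr (p-1)+?b powr (p-1))*(ze x-ze y) |^ p"
        unfolding d K1_def by(rule neg_powr_test[OF p1 e ab ze01 ze01])
       also have "... <= K1*((abs (ur x)+c) powr (p-1)+(abs (ur y)+c) powr (p-1))*(ze x-ze y) |^ p"
        using K1 p1 ab tle[of x] tle[of y]
        by(intro mult_right_mono mult_left_mono add_mono powr_mono2) auto
       also have "... <= Q z"
        using True farfun_nonneg[of U V ur z] by(simp add:Q_def z dl_def mult_ac)
       finally show ?thesis .
      qed
      ultimately show ?thesis by linarith
     qed
    qed
   qed
   show "integrable mu (%z. - (jp p (dl t z)*dl eh z))" using int by simp
   show "(BM z. - (jp p (dl t z)*dl eh z)) <= 0" using pos by simp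
   show "0 <= P i z" for z using e by(simp add:P_def)
  qed (use Q0 in auto)
 qed
 obtain M where M: "0 <= M" "(NM z. en (Q z)) = en M"
  using Qfin by(cases "NM z. en (Q z)") auto
 have "(NM z. en (e*(dl ur z |^ p * max (ur (fst z)+c) (ur (snd z)+c) powr-(1+e))*ind (C \<times> C) z)) <= en M"
 proof(rule nn_integral_Fatou_const[where F = "%i z. en (P i z)"])
  fix z
  obtain n :: nat where n: "ur (fst z) <= real n" "ur (snd z) <= real n"
   using real_arch_simple[of "max (ur (fst z)) (ur (snd z))"] by auto
  show "\<forall>\<^sub>F i in sequentially. en (P i z) = en (e*(dl ur z |^ p * max (ur (fst z)+c) (ur (snd z)+c) powr-(1+e))*ind (C \<times> C) z)"
   using eventually_ge_at_top[of n]
  proof eventually_elim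
   case (elim i)
   hence "min (ur (fst z)) (real i+1) = ur (fst z)" "min (ur (snd z)) (real i+1) = ur (snd z)" using n by auto
   thus ?case by(simp add:P_def dl_def)
  qed
 qed (use PQ M in auto)
 moreover have "en (e*(dl ur z |^ p * max (ur (fst z)+c) (ur (snd z)+c) powr-(1+e))*ind (C \<times> C) z) = en e*(en (dl ur z |^ p * max (ur (fst z)+c) (ur (snd z)+c) powr-(1+e))*ind (C \<times> C) z)" for z
  using e by(auto simp:ennreal_mult split:split_indicator)
 ultimately have le: "en e*(NM z. en (dl ur z |^ p * max (ur (fst z)+c) (ur (snd z)+c) powr-(1+e))*ind (C \<times> C) z) <= en M"
  by(simp add:nn_integral_cmult)
 show ?thesis
 proof(rule that[OF c1, of "M/e"])
  have "(NM z. en (dl ur z |^ p * max (ur (fst z)+c) (ur (snd z)+c) powr-(1+e))*ind (C \<times> C) z) = en (1/e)*(en e*(NM z. en (dl ur z |^ p * max (ur (fst z)+c) (ur (snd z)+c) powr-(1+e))*ind (C \<times> C) z))"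
   using e by(simp add:mult.assoc[symmetric] ennreal_mult[symmetric])
  also have "... <= en (1/e)*en M" by(rule mult_left_mono[OF le]) simp
  also have "... = en (M/e)" using e M by(simp add:ennreal_mult[symmetric])
  finally show "(NM z. en (dl ur z |^ p * max (ur (fst z)+c) (ur (snd z)+c) powr-(1+e))*ind (C \<times> C) z) <= en (M/e)" .
  show "1 <= ur x+c" if "x : C" for x using c CU UVs that by auto
 qed (use M e in auto)
qed

end

section \<open>Decay of level sets, integrable powers and fractional seminorms\<close>

declare abs_real_of_ereal [simp del]

text \<open>The truncation between L and 2 L varies only while its argument does. If a <= 4 L, the
  weight is at most (5 L)^r. If a > 4 L and b >= 2 L, the truncations agree. If a > 4 L and b < 2 L,
  then a - b exceeds a/2 while the truncations differ by at most L = L^r L^(1-r).\<close>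

lemma level_truncation_aux:
 fixes a b c L r :: real
 assumes L: "0 < L" "c <= L" and ab: "b <= a" "1 <= a+c" and r: "0 <= r" "r <= 1"
 shows "(max 0 (min (a-L) L)-max 0 (min (b-L) L))*(a+c) powr r <= 5*L powr r*(a-b)"
proof -
 let ?ta = "max 0 (min (a-L) L)-max 0 (min (b-L) L)"
 have ta: "0 <= ?ta" "?ta <= a-b" "?ta <= L" using ab L by auto
 have a1: "a+c <= a+L" using L by simp
 consider "a <= 4*L" | "4*L < a" "2*L <= b" | "4*L < a" "b < 2*L" by linarith
 thus ?thesis
 proof cases
  case 1
  have "(a+c) powr r <= (5*L) powr r" using 1 a1 ab r by(intro powr_mono2) auto
  also have "... = 5 powr r*L powr r" using L by(simp add:powr_mult)
  also have "... <= 5 powr 1*L powr r" using r by(intro mult_right_mono powr_mono) auto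
  finally have "?ta*(a+c) powr r <= (a-b)*(5*L powr r)"
   using ta ab by(intro mult_mono) auto
  thus ?thesis by(simp add:mult_ac)
 next
  case 2
  hence "?ta = 0" using ab L by auto
  thus ?thesis using ab by(simp only:) simp
 next
  case 3
  have "?ta*(a+c) powr r <= L*(2*a) powr r"
   using ta 3 a1 ab L r by(intro mult_mono powr_mono2) auto
  also have "L*(2*a) powr r = (L powr r*L powr (1-r))*(2*a) powr r"
   using L by(simp add:powr_add[symmetric])
  also have "... <= (L powr r*(2*a) powr (1-r))*(2*a) powr r"
   using L 3 r by(intro mult_right_mono mult_left_mono powr_mono2) auto
  also have "... = L powr r*(2*a)" using L 3 by(simp add:powr_add[symmetric] mult.assoc)
  also have "... <= L powr r*(5*(a-b))" using 3 L by(intro mult_left_mono) auto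
  finally show ?thesis by(simp only: mult_ac)
 qed
qed

lemma level_truncation:
 fixes a b c L e p :: real
 assumes p: "1 < p" and e: "0 < e" "1+e <= p" and L: "0 < L" "c <= L" and ab: "1 <= a+c" "1 <= b+c"
 shows "(max 0 (min (a-L) L)-max 0 (min (b-L) L)) |^ p <= 5 powr p*L powr (1+e)*((a-b) |^ p * max (a+c) (b+c) powr-(1+e))"
proof -
 let ?F = "%a b. 5 powr p*L powr (1+e)*(a-b) powr p*(a+c) powr-(1+e)"
 have *: "(max 0 (min (a-L) L)-max 0 (min (b-L) L)) |^ p <= 5 powr p*L powr (1+e)*((a-b) |^ p*(a+c) powr-(1+e))"
  if "b <= a" "1 <= a+c" for a b
 proof -
  let ?ta = "max 0 (min (a-L) L)-max 0 (min (b-L) L)"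
  define r where "r = (1+e)/p"
  have r: "0 <= r" "r <= 1" "r*p = 1+e" using e p by(auto simp:r_def)
  have ta: "0 <= ?ta" using that by auto
  have "(?ta*(a+c) powr r) powr p <= (5*L powr r*(a-b)) powr p"
   using level_truncation_aux[OF L that r(1,2)] ta p by(intro powr_mono2) auto
  hence "?ta powr p*(a+c) powr (1+e) <= 5 powr p*L powr (1+e)*(a-b) powr p"
   using ta that L by(simp add:powr_mult powr_powr r(3))
  hence "?ta powr p*(a+c) powr (1+e)*(a+c) powr-(1+e) <= ?F a b"
   by(rule mult_right_mono) simp
  moreover have "(a+c) powr (1+e)*(a+c) powr-(1+e) = 1"
   using that by(simp add:powr_add[symmetric])
  ultimately have "?ta powr p <= ?F a b"
   by(simp add:mult.assoc)
  thus ?thesis using ta that by(simp only: abs_of_nonneg mult.assoc diff_ge_0_iff_ge)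
 qed
 show ?thesis
 proof(cases "b <= a")
  case True
  thus ?thesis using *[OF True ab(1)] by(simp add:max_def)
 next
  case False
  thus ?thesis using *[of a b] ab by(simp add:max_def abs_minus_commute)
 qed
qed

context comparison
begin

text \<open>A weak L^al bound for u_+ on every compact subset of \<open>Om\<close>.\<close>

definition decay :: "real => bool"
 where "decay al \<longleftrightarrow> (ALL C. compact C --> C <= Om --> (EX M>=0. ALL L>=1. em {x:C. L <= ur x} <= en (M*L powr-al)))"

lemma decay_antimono:
 assumes "decay al" "bt <= al"
 shows "decay bt"
 unfolding decay_def
proof(intro allI impI)
 fix C assume "compact C" "C <= Om"
 then obtain M where M: "0 <= M" "!!L. 1 <= L ==> em {x:C. L <= ur x} <= en (M*L powr-al)"
  using assms(1) unfolding decay_def by blast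
 have "M*L powr-al <= M*L powr-bt" if "1 <= L" for L
  using that assms(2) M(1) by(intro mult_left_mono powr_mono) auto
 thus "EX M>=0. ALL L>=1. em {x:C. L <= ur x} <= en (M*L powr-bt)"
  using M by(meson ennreal_leI order_trans)
qed

text \<open>Chebyshev's inequality, since the finite tail of \<open>u\<close> contains its local
  L^(p-1) integral.\<close>

lemma decay_start: "decay (p-1)"
 unfolding decay_def
proof(intro allI impI)
 let ?F = "%C. NL y. en (ur y |^ (p-1))*ind C y"
 fix C assume C: "compact C" "C <= Om"
 show "EX M>=0. ALL L>=1. em {x:C. L <= ur x} <= en (M*L powr-(p-1))"
 proof(cases "C = {}")
  case False
  have [measurable]: "C : sets borel" using C by(simp add:borel_compact)
  have tu: "tail ur" using u_finite_AE(2) C False by auto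
  have "(?F C) < infy"
   by(rule tail_bounded_integral[OF tu compact_imp_bounded[OF C(1)]]) measurable
  then obtain M where M: "0 <= M" "(?F C) = en M"
   by(cases "?F C") auto
  have "em {x:C. L <= ur x} <= en (M*L powr-(p-1))" if L: "1 <= L" for L
  proof -
   have "em {x:C. L <= ur x} = (NL x. ind {x:C. L <= ur x} x)"
    by(rule nn_integral_indicator[symmetric]) measurable
   also have "... <= (NL x. en (L powr-(p-1))*(en (ur x |^ (p-1))*ind C x))"
   proof(rule nn_integral_mono)
    fix x
    show "(ind {x:C. L <= ur x} x :: ennreal) <= en (L powr-(p-1))*(en (ur x |^ (p-1))*ind C x)"
    proof(cases "x : C & L <= ur x")
     case True
     have "1 = L powr-(p-1)*L powr (p-1)" using L by(simp add:powr_add[symmetric])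
     also have "... <= L powr-(p-1)*ur x |^ (p-1)"
      using True L p1 by(intro mult_left_mono powr_mono2) auto
     finally have "en 1 <= en (L powr-(p-1)*ur x |^ (p-1))" by(rule ennreal_leI)
     thus ?thesis using True by(simp add:ennreal_mult)
    qed auto
   qed
   also have "... = en (L powr-(p-1))*en M"
    by(subst nn_integral_cmult) (simp_all add:M(2))
   also have "... = en (M*L powr-(p-1))" using M by(simp add:ennreal_mult[symmetric] mult.commute)
   finally show ?thesis .
  qed
  thus ?thesis using M(1) by blast
 qed auto
qed

text \<open>Energy of the truncation of \<open>u\<close> between \<open>L\<close> and \<open>2 L\<close> against the kernel mass
 that a point of \<open>{2 L <= u}\<close> sees outside \<open>{L <= u}\<close>.\<close>

lemma decay_step:
 assumes d: "decay al" and al: "0 < al" and e: "0 < e" "1+e <= p"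
 defines "bt == p-1-e+al*(s*p/real DIM('a))"
 shows "decay bt"
 unfolding decay_def
proof(intro allI impI)
 let ?C = "%M1 L. M1*L powr-al"
 let ?B = "%x rh A y. ind (ball x rh-A) y*en (k x y)"
 let ?A = "%L. 5 powr p*L powr (1+e)"
 let ?G = "%L M. 5 powr p*L powr (1+e)*M"
 let ?F = "%z c V. en (dl ur z |^ p * max (ur (fst z)+c) (ur (snd z)+c) powr-(1+e))*ind (V \<times> V) z"
 fix C assume C: "compact C" "C <= Om"
 show "EX M>=0. ALL L>=1. em {x:C. L <= ur x} <= en (M*L powr-bt)"
 proof(cases "C = {}")
  case True
  thus ?thesis by(intro exI[of _ 0]) auto
 next
  case False
  let ?n = "real DIM('a)" and ?om = "unit_ball_vol (real DIM('a))"
  have n0: "0 < ?n" by simp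
  have om: "0 < ?om" by simp
  have bt: "0 < bt"
   unfolding bt_def using e al sp0 by(intro add_nonneg_pos) auto
  obtain V l where V: "compact V" "V <= Om" "0 < l" "inside {x. infdist x C < l} V" "C <= {x. infdist x C < l}" "V ~= {}"
   by(rule compact_collar[OF C(1) False C(2) open_Om])
  have bV: "ball x l <= V" if "x : C" for x
  proof
   fix y assume "y : ball x l"
   hence "infdist y C < l" using infdist_le[OF that, of y] by(simp add:dist_commute)
   thus "y : V" using insideD[OF V(4)] by auto
  qed
  have CV: "C <= V" using V(5) insideD[OF V(4)] by auto
  have [measurable]: "C : sets borel" "V : sets borel" using C V by(auto simp:borel_compact)
  have fV: "em V < infy" by(rule emeasure_bounded_finite[OF compact_imp_bounded[OF V(1)]])
  obtain c M where c: "1 <= c" and M: "0 <= M" and cV: "!!x. x : V ==> 1 <= ur x+c"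
   and we: "(NM z. ?F z c V) <= en M"
   by(rule weighted_energy[OF V(1,6,2) e(1)]) (use e in auto)
  obtain M1 where M1: "0 <= M1" "!!L. 1 <= L ==> em {x:V. L <= ur x} <= en (?C M1 L)"
   using d V(1,2) unfolding decay_def by blast
  have "((%L. ?C M1 L) \<longlongrightarrow> M1*0) at_top"
   by(intro tendsto_intros tendsto_neg_powr filterlim_ident) (use al in auto)
  hence "\<forall>\<^sub>F L in at_top. ?C M1 L < ?om*l^DIM('a)/2"
   using V(3) om by(intro order_tendstoD(2)) auto
  then obtain L0 where L0: "!!L. L0 <= L ==> ?C M1 L < ?om*l^DIM('a)/2"
   by(auto simp:eventually_at_top_linorder)
  \<comment> \<open>Above \<open>L0\<close> the set {u >= L} is so small that the radius
    \<open>rh\<close> chosen below stays within the width of the collar; L >= c is what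
    \<open>level_truncation\<close> asks for.\<close>
  define L1 where "L1 = max (max L0 c) 1"
  define K where "K = (5 powr p*M)*(2*La/?om)*(2*M1/?om) powr (s*p/?n)"
  have K: "0 <= K" using M La0 om by(simp add:K_def)
  have key: "em {x:C. 2*L <= ur x} <= en (K*L powr-bt)" if L: "L1 <= L" for L
  proof -
   have Lx: "1 <= L" "c <= L" "L0 <= L" "0 < L" using L by(auto simp:L1_def)
   define A where "A = {x:V. L <= ur x}"
   define B where "B = {x:C. 2*L <= ur x}"
   have [measurable]: "A : sets borel" "B : sets borel" unfolding A_def B_def by measurable
   have BA: "B <= A" using CV Lx by(auto simp:A_def B_def)
   define a where "a = ms A"
   have fA: "em A < infy"
    by(rule order_le_less_trans[OF emeasure_mono fV]) (auto simp:A_def)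
   have ea: "em A = en a"
    unfolding a_def by(rule emeasure_eq_ennreal_measure) (use fA in auto)
   have a_le: "a <= ?C M1 L"
    using M1(2)[OF Lx(1)] M1(1) unfolding A_def[symmetric] ea by(simp add:ennreal_le_iff)
   show ?thesis
   proof(cases "a = 0")
    case True
    hence "em B <= 0" using emeasure_mono[OF BA, of lborel] ea by simp
    thus ?thesis by(simp add:B_def)
   next
    case False
    hence a0: "0 < a" by(simp add:a_def less_le)
    define rh where "rh = (2*a/?om) powr (1/?n)"
    have rh0: "0 < rh" using a0 om by(simp add:rh_def)
    have rhn: "rh^DIM('a) = 2*a/?om"
     using a0 om rh0 by(simp add:rh_def powr_powr powr_realpow[symmetric])
    have rhl: "rh <= l"
    proof(rule power_le_imp_le_base)
     have "2*a/?om <= l^DIM('a)" using L0[OF Lx(3)] a_le om by(simp add:field_simps)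
     thus "rh^Suc (DIM('a)-1) <= l^Suc (DIM('a)-1)" using rhn by simp
    qed (use V in auto)
    define T where "T x = max 0 (min (ur x-L) L)" for x
    have [measurable]: "T : Bor" unfolding T_def[abs_def] by measurable
    define F where "F z = dl T z |^ p*ind (V \<times> V) z" for z
    have [measurable]: "F : Bor" unfolding F_def[abs_def] by measurable
    define c0 where "c0 = L powr p*(?om/(2*La)*rh powr-(s*p))"
    have c0: "0 < c0" using Lx om La0 rh0 by(simp add:c0_def)
    have "en c0*em B <= (NM z. en (F z))"
    proof(rule nn_integral_mu_lower)
     fix x assume x: "x : B"
     have [measurable]: "ball x rh : sets borel" by simp
     have "em (A Int ball x rh) <= em A" by(rule emeasure_mono) auto
     also have "... = en (?om*rh^DIM('a)/2)" using om by(simp add:ea rhn)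
     finally have "en (?om/(2*La)*rh powr-(s*p)) <= (NL y. ?B x rh A y)"
      by(intro kernel_integral_off_set rh0) auto
     hence "en (L powr p)*en (?om/(2*La)*rh powr-(s*p)) <= en (L powr p)*(NL y. ?B x rh A y)"
      by(rule mult_left_mono) simp
     also have "... = (NL y. en (L powr p)*(?B x rh A y))"
      by(rule nn_integral_cmult[symmetric]) measurable
     also have "... <= (NL y. en (F (x, y))*en (k x y))"
     proof(rule nn_integral_mono)
      fix y
      show "en (L powr p)*(?B x rh A y) <= en (F (x, y))*en (k x y)"
      proof(cases "y : ball x rh-A")
       case True
       have xC: "x : C" "2*L <= ur x" using x by(auto simp:B_def)
       have y: "y : V" using True rhl bV[OF xC(1)] by auto
       hence "ur y < L" using True by(auto simp:A_def)
       hence "T y = 0" by(simp add:T_def)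
       moreover have "T x = L" using xC(2) Lx by(simp add:T_def)
       ultimately have "F (x, y) = L powr p" using y xC(1) CV Lx by(auto simp:F_def dl_def)
       thus ?thesis using True by simp
      qed simp
     qed
     also have "en (L powr p)*en (?om/(2*La)*rh powr-(s*p)) = en c0"
      unfolding c0_def using om La0 by(intro ennreal_mult[symmetric]) auto
     finally show "en c0 <= (NL y. en (F (x, y))*en (k x y))" .
    qed measurable
    also have "... <= (NM z. en (?A L)*(?F z c V))"
    proof(rule nn_integral_mono)
     fix z
     show "en (F z) <= en (?A L)*(?F z c V)"
     proof(cases "z : V \<times> V")
      case True
      have "F z <= 5 powr p*L powr (1+e)*(dl ur z |^ p * max (ur (fst z)+c) (ur (snd z)+c) powr-(1+e))"
       using level_truncation[OF p1 e Lx(4,2) cV cV, of "fst z" "snd z"] True by(auto simp:F_def dl_def T_def)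
      from ennreal_leI[OF this] show ?thesis using True by(simp add:ennreal_mult)
     qed (simp add:F_def)
    qed
    also have "... = en (?A L)*(NM z. ?F z c V)"
     by(rule nn_integral_cmult) measurable
    also have "... <= en (?A L)*en M" by(rule mult_left_mono[OF we]) simp
    also have "... = en (?G L M)" using M by(simp add:ennreal_mult)
    finally have up: "en c0*em B <= en (?G L M)" .
    have "em B = en (1/c0)*(en c0*em B)"
     using c0 by(simp add:mult.assoc[symmetric] ennreal_mult[symmetric])
    also have "... <= en (1/c0)*en (?G L M)" by(rule mult_left_mono[OF up]) simp
    also have "... = en (1/c0*(?G L M))"
     using c0 M by(intro ennreal_mult[symmetric]) auto
    also have "... <= en (K*L powr-bt)"
    proof(rule ennreal_leI)
     have "rh powr (s*p) = (2*a/?om) powr (s*p/?n)"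
      using a0 om by(simp add:rh_def powr_powr)
     also have "... <= (2*(?C M1 L)/?om) powr (s*p/?n)"
      using a0 a_le om sp0 by(intro powr_mono2 divide_right_mono) auto
     also have "... = (2*M1/?om) powr (s*p/?n)*L powr (- (al*(s*p/?n)))"
     proof -
      have "2*(?C M1 L)/?om = (2*M1/?om)*L powr-al" by simp
      thus ?thesis using M1(1) om Lx by(simp only: powr_mult powr_powr) simp
     qed
     finally have "L powr-p*(2*La/?om)*rh powr (s*p) <= L powr-p*(2*La/?om)*((2*M1/?om) powr (s*p/?n)*L powr (- (al*(s*p/?n))))"
      using La0 om by(intro mult_left_mono) auto
     moreover have "1/c0 = L powr-p*(2*La/?om)*rh powr (s*p)"
      using rh0 by(simp add:c0_def powr_minus field_simps)
     ultimately have "1/c0*(?G L M) <= L powr-p*(2*La/?om)*((2*M1/?om) powr (s*p/?n)*L powr (- (al*(s*p/?n))))*(?G L M)"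
      using M by(intro mult_right_mono) auto
     also have "... = K*((L powr-p*L powr (- (al*(s*p/?n))))*L powr (1+e))"
      unfolding K_def by(simp only: mult_ac)
     also have "(L powr-p*L powr (- (al*(s*p/?n))))*L powr (1+e) = L powr-bt"
      unfolding powr_add[symmetric] bt_def by(simp add:algebra_simps)
     finally show "1/c0*(?G L M) <= K*L powr-bt" .
    qed
    finally show ?thesis by(simp add:B_def)
   qed
  qed
  \<comment> \<open>The first summand covers the levels below 2 * L1 by the trivial bound with the
    measure of \<open>V\<close>; the second compensates for passing from 2 L to L.\<close>
  define E where "E = ms V*(2*L1) powr bt+K*2 powr bt"
  show ?thesis
  proof(intro exI[of _ E] conjI allI impI)
   show "0 <= E" using K by(simp add:E_def)
   fix L :: real assume L: "1 <= L"
   show "em {x:C. L <= ur x} <= en (E*L powr-bt)"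
   proof(cases "2*L1 <= L")
    case True
    have "em {x:C. 2*(L/2) <= ur x} <= en (K*(L/2) powr-bt)"
     using True by(intro key) simp
    also have "... <= en (E*L powr-bt)"
    proof(rule ennreal_leI)
     have "K*(L/2) powr-bt = K*2 powr bt*L powr-bt"
      using L by(simp add:powr_divide powr_minus field_simps)
     also have "... <= E*L powr-bt" by(intro mult_right_mono) (auto simp:E_def)
     finally show "K*(L/2) powr-bt <= E*L powr-bt" .
    qed
    finally show ?thesis by simp
   next
    case False
    have "em {x:C. L <= ur x} <= em V" using CV by(intro emeasure_mono) auto
    also have "... = en (ms V)" using fV by(intro emeasure_eq_ennreal_measure) auto
    also have "... <= en (E*L powr-bt)"
    proof(rule ennreal_leI)
     have "1 <= (2*L1) powr bt*L powr-bt"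
     proof -
      have "L powr bt <= (2*L1) powr bt" using False L bt by(intro powr_mono2) auto
      thus ?thesis using L by(simp add:powr_minus field_simps)
     qed
     hence "ms V*1 <= ms V*((2*L1) powr bt*L powr-bt)"
      by(rule mult_left_mono) simp
     also have "... <= E*L powr-bt"
      using K by(simp add:E_def algebra_simps)
     finally show "ms V <= E*L powr-bt" by simp
    qed
    finally show ?thesis .
   qed
  qed
 qed
qed

text \<open>One step sends al to p - 1 - de + al s p/n. As long as al <= t, the choice of
  \<open>de\<close> as half of the gap in the hypothesis makes this at least al + de, so finitely
  many steps from p - 1 reach t.\<close>

lemma decay_below:
 assumes t: "0 < t" "(1-s*p/real DIM('a))*t < p-1"
 shows "decay t"
proof -
 let ?th = "s*p/real DIM('a)"
 define X where "X = max 0 ((1-?th)*t)"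
 have X: "X < p-1" "0 <= X" using t p1 by(auto simp:X_def)
 define de where "de = (p-1-X)/2"
 have de: "0 < de" using X by(simp add:de_def)
 have "2*de <= p-1" using X by(simp add:de_def)
 hence dep: "1+de <= p" using de by simp
 have step: "decay (al+de)" if "decay al" "0 < al" "al <= t" for al
 proof(rule decay_antimono[OF decay_step[OF that(1,2) de dep]])
  have "(1-?th)*al <= X"
  proof(cases "0 <= 1-?th")
   case True
   hence "(1-?th)*al <= (1-?th)*t" using that(3) by(rule mult_left_mono[rotated])
   thus ?thesis by(simp add:X_def)
  next
   case False
   hence "(1-?th)*al <= 0" using that(2) by(intro mult_nonpos_nonneg) auto
   thus ?thesis using X(2) by linarith
  qed
  thus "al+de <= p-1-de+al*?th" by(simp add:de_def algebra_simps) 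
 qed
 have "decay (min t (p-1+real m*de))" for m :: nat
 proof(induction m)
  case 0
  show ?case by(rule decay_antimono[OF decay_start]) auto
 next
  case (Suc m)
  have "0 < p-1+real m*de" using p1 de by(intro add_pos_nonneg) auto
  hence "decay (min t (p-1+real m*de)+de)" using t by(intro step Suc) auto
  thus ?case
   by(rule decay_antimono) (use de in \<open>auto simp:min_def algebra_simps\<close>)
 qed
 moreover obtain m :: nat where "t/de <= real m" using real_arch_simple by blast
 hence "t <= p-1+real m*de" using de p1 by(simp add:field_simps)
 hence "min t (p-1+real m*de) = t" by simp
 ultimately show ?thesis by metis
qed

text \<open>The condition on t is open, so the weak bound is available for some al > t, and the sum
  over the layers 2^j <= u < 2^(j+1) is geometric. Below 1 the function is bounded on
  \<open>C\<close>, as it is bounded below there.\<close>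

lemma powr_integrable:
 assumes t: "0 < t" "(1-s*p/real DIM('a))*t < p-1" and C: "compact C" "C <= Om"
 shows "(NL x. en (ur x |^ t)*ind C x) < infy"
proof -
 let ?th = "s*p/real DIM('a)"
 let ?F = "%M al j. 2 powr t*M*(2 powr (t-al))^j"
 obtain al where al: "t < al" "(1-?th)*al < p-1"
 proof(cases "0 < 1-?th")
  case True
  have "t < (p-1)/(1-?th)" using t True by(simp add:field_simps)
  then obtain al where "t < al" "al < (p-1)/(1-?th)" using dense by blast
  thus ?thesis using that[of al] True by(simp add:field_simps)
 next
  case False
  have "(1-?th)*(t+1) <= 0" using False t by(intro mult_nonpos_nonneg) auto
  thus ?thesis using that[of "t+1"] p1 by simp
 qed
 have "decay al" using al t by(intro decay_below) auto
 then obtain M where M: "0 <= M" "!!L. 1 <= L ==> em {x:C. L <= ur x} <= en (M*L powr-al)"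
  using C unfolding decay_def by blast
 obtain lo :: real where lo: "!!x. x : C ==> ereal lo < u x"
  by(rule lsc_bounded_below[OF open_Om u_lsc C u_low]) auto
 have [measurable]: "C : sets borel" using C by(simp add:borel_compact)
 have fC: "em C < infy" by(rule emeasure_bounded_finite[OF compact_imp_bounded[OF C(1)]])
 define A where "A j = {x:C. 2^j <= ur x}" for j :: nat
 have [measurable]: "A j : sets borel" for j unfolding A_def by measurable
 define c where "c j = (2^Suc j) powr t" for j :: nat
 have "(NL x. en (ur x |^ t)*ind C x) <= (NL x. en ((1+abs lo) powr t)*ind C x+(\<Sum>j. en (c j)*ind (A j) x))"
 proof(rule nn_integral_mono)
  fix x
  show "en (ur x |^ t)*ind C x <= en ((1+abs lo) powr t)*ind C x+(\<Sum>j. en (c j)*ind (A j) x)"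
  proof(cases "x : C")
   case True
   show ?thesis
   proof(cases "1 <= ur x")
    case big: True
    then obtain j where j: "2^j <= ur x" "ur x < 2^Suc j" by(rule dyadic_between)
    have "ur x |^ t <= c j" unfolding c_def using j big t by(intro powr_mono2) auto
    hence "en (ur x |^ t) <= (\<Sum>j. en (c j)*ind (A j) x)"
     using j True by(intro indicator_le_suminf[of x A j]) (auto simp:A_def)
    thus ?thesis using True by(simp add:add_increasing)
   next
    case False
    have "lo <= ur x | ur x = 0" using lo[OF True] by(cases "u x") auto
    hence "abs (ur x) <= 1+abs lo" using False by(auto simp del:abs_real_of_ereal)
    hence "ur x |^ t <= (1+abs lo) powr t" using t by(intro powr_mono2) auto
    thus ?thesis using True by(simp add:add_increasing2 ennreal_leI)
   qed
  qed simp
 qed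
 also have "... = en ((1+abs lo) powr t)*em C+(\<Sum>j. en (c j)*em (A j))"
  by(simp add:nn_integral_add nn_integral_cmult_indicator nn_integral_suminf)
 also have "... < infy"
 proof -
  have "(\<Sum>j. en (c j)*em (A j)) <= (\<Sum>j. en (?F M al j))"
  proof(intro suminf_le allI)
   fix j
   have "en (c j)*em (A j) <= en (c j)*en (M*(2^j) powr-al)"
    unfolding A_def by(intro mult_left_mono M) auto
   also have "... = en (c j*(M*(2^j) powr-al))" using M by(simp add:ennreal_mult c_def)
   also have "c j*(M*(2^j) powr-al) = ?F M al j"
   proof -
    have "c j = 2 powr t*(2 powr t)^j"
     by(simp add:c_def powr_mult powr_power powr_realpow[symmetric] powr_powr mult.commute)
    moreover have "(2^j) powr-al = (2 powr-al)^j"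
     by(simp add:powr_power powr_realpow[symmetric] powr_powr mult.commute)
    moreover have "(2 powr t)^j*(2 powr-al)^j = (2 powr (t-al))^j"
     by(simp add:power_mult_distrib[symmetric] powr_add[symmetric])
    ultimately show ?thesis by(simp add:mult_ac)
   qed
   finally show "en (c j)*em (A j) <= en (?F M al j)" .
  qed auto
  also have "... < infy"
  proof -
   have "2 powr (t-al) < 1" using al powr_less_mono[of "t-al" 0 2] by simp
   hence "summable (%j. ?F M al j)"
    by(intro summable_mult summable_geometric) simp
   thus ?thesis
    using M by(simp add:ennreal_suminf_neq_top less_top[symmetric])
  qed
  finally show ?thesis using fC by(simp add:ennreal_mult_less_top)
 qed
 finally show ?thesis .
qed

text \<open>Pointwise the integrand is P^(q/p) Q^(1-q/p) and so at most P + Q. Here P is the density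
  of the weighted energy, and Q is m^ta |x - y|^(-(n - ka)) with m the larger value of u + c and ta
  = (1+e) q/(p-q). The first is integrable by \<open>weighted_energy\<close>, the second because ka
  > 0 and u^ta is locally integrable.\<close>

lemma fractional_seminorm_finite:
 assumes h: "h < s" and q: "0 < q" "q < p" "(1-s*p/real DIM('a))*(q/(p-q)) < p-1"
  and C: "compact C" "C <= Om"
 shows "(NL z. en (dl ur z |^ q*norm (fst z-snd z) powr-(real DIM('a)+h*q))*ind (C \<times> C) z) < infy"
proof(cases "C = {}")
 let ?C = "%Y g. (NL z. Y z*g (fst z))"
 let ?B = "%z c e. dl ur z |^ p * max (ur (fst z)+c) (ur (snd z)+c) powr-(1+e)"
 let ?A = "%ta x c. en (2 powr ta)*(en (ur x |^ ta)*ind C x)+en (2 powr ta*c powr ta)*ind C x"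
 let ?G = "%ka R. ball_const TYPE('a) ka*R powr ka"
 let ?F = "%z w. en (k (fst z) (snd z))*(en (w z)*ind (C \<times> C) z)"
 case False
 let ?n = "real DIM('a)" and ?th = "s*p/real DIM('a)"
 define ta0 where "ta0 = q/(p-q)"
 have ta0: "0 < ta0" using q by(simp add:ta0_def)
 define X where "X = max 0 ((1-?th)*ta0)"
 have X: "X < p-1" "0 <= X" using q p1 by(auto simp:X_def ta0_def)
 \<comment> \<open>So small that (1 + e) * ta0 still satisfies the strict condition of
   \<open>powr_integrable\<close>.\<close>
 define e where "e = min 1 ((p-1-X)/(2*(X+1)))"
 have e: "0 < e" "e <= 1" using X by(auto simp:e_def)
 have ep: "e <= p" using e p1 by simp
 have "e*X <= (p-1-X)/(2*(X+1))*(X+1)"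
  using X by(intro mult_mono) (auto simp:e_def)
 also have "(p-1-X)/(2*(X+1))*(X+1) = (p-1-X)/2" using X by(simp add:field_simps)
 also have "... < p-1-X" using X by simp
 finally have eX: "(1+e)*X < p-1" by(simp add:algebra_simps)
 define ta where "ta = (1+e)*ta0"
 have ta: "0 < ta" using e ta0 by(simp add:ta_def)
 have "(1-?th)*ta = (1+e)*((1-?th)*ta0)" by(simp add:ta_def)
 also have "... <= (1+e)*X" using e by(intro mult_left_mono) (auto simp:X_def)
 finally have ta2: "(1-?th)*ta < p-1" using eX by linarith
 obtain c M where c: "1 <= c" and M: "0 <= M" and cC: "!!x. x : C ==> 1 <= ur x+c"
  and we: "(NM z. en (?B z c e)*ind (C \<times> C) z) <= en M"
  by(rule weighted_energy[OF C(1) False C(2) e(1) ep]) blast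
 have [measurable]: "C : sets borel" using C by(simp add:borel_compact)
 obtain R0 where R0: "!!x. x : C ==> norm x <= R0" using compact_imp_bounded[OF C(1)] by(auto simp:bounded_iff)
 define R where "R = 2*abs R0+1"
 have R: "0 < R" by(simp add:R_def)
 have xyR: "norm (x-y) <= R" if "x : C" "y : C" for x y
  using R0[OF that(1)] R0[OF that(2)] norm_triangle_ineq4[of x y] by(simp add:R_def)
 \<comment> \<open>The exponent gained from h < s after the powers of |x - y| in P and Q are
   balanced.\<close>
 define ka where "ka = (s-h)*(q*p/(p-q))"
 have ka: "0 < ka" using h q p0 by(simp add:ka_def)
 define g where "g x = en ((ur x+c) powr ta)*ind C x" for x
 have [measurable]: "g : Bor" unfolding g_def[abs_def] by measurable
 have g_fin: "(NL x. g x) < infy"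
 proof -
  have "(NL x. g x) <= (NL x. ?A ta x c)"
  proof(rule nn_integral_mono)
   fix x
   show "g x <= ?A ta x c"
   proof(cases "x : C")
    case True
    have "(ur x+c) powr ta <= 2 powr ta*ur x |^ ta+2 powr ta*c powr ta"
     using abs_powr_add_le(1)[of ta "ur x" c] ta c cC[OF True] by(simp add:algebra_simps del:abs_real_of_ereal)
    from ennreal_leI[OF this] show ?thesis using True by(simp add:g_def ennreal_plus ennreal_mult)
   qed (simp add:g_def)
  qed
  also have "... = en (2 powr ta)*(NL x. en (ur x |^ ta)*ind C x)+en (2 powr ta*c powr ta)*em C"
   by(subst nn_integral_add, measurable, subst nn_integral_cmult, measurable, simp add:nn_integral_cmult_indicator)
  also have "... < infy"
   using powr_integrable[OF ta ta2 C] emeasure_bounded_finite[OF compact_imp_bounded[OF C(1)]]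
   by(simp add:ennreal_mult_less_top)
  finally show ?thesis .
 qed
 define Y where "Y z = en (norm (fst z-snd z) powr-(?n-ka))*ind {z. norm (fst z-snd z) <= R} z" for z :: "'a \<times> 'a"
 have [measurable]: "Y : Bor" unfolding Y_def[abs_def] by measurable
 have Yfin: "?C Y g < infy"
 proof -
  have "?C Y g = (NL x. NL y. Y (x, y)*g x)"
   by(subst nn_integral_lborel_prod) simp_all
  also have "... <= (NL x. en (?G ka R)*g x)"
  proof(rule nn_integral_mono)
   fix x
   have "(NL y. Y (x, y)*g x) = (NL y. Y (x, y))*g x"
    by(rule nn_integral_multc) measurable
   also have "(NL y. Y (x, y)) <= en (?G ka R)"
    using nn_integral_near_power[OF R ka, of x] by(simp add:Y_def indicator_def)
   finally show "(NL y. Y (x, y)*g x) <= en (?G ka R)*g x"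
    by(simp add:mult_right_mono)
  qed
  also have "... = en (?G ka R)*(NL x. g x)"
   by(rule nn_integral_cmult) measurable
  also have "... < infy" using g_fin by(simp add:ennreal_mult_less_top)
  finally show ?thesis .
 qed
 have Yfin': "(NL z. Y z*g (snd z)) < infy"
 proof -
  have "Y (snd z, fst z) = Y z" for z by(simp add:Y_def norm_minus_commute indicator_def)
  thus ?thesis
   using Yfin nn_integral_lborel_swap[of "%z. Y z*g (fst z)"] by simp
 qed
 define w where "w z = ?B z c e" for z
 have [measurable]: "w : Bor" unfolding w_def[abs_def] by measurable
 have pw: "en (dl ur z |^ q*norm (fst z-snd z) powr-(?n+h*q))*ind (C \<times> C) z <= en La*(?F z w)+(Y z*g (fst z)+Y z*g (snd z))" for z
 proof(cases "z : C \<times> C & fst z ~= snd z")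
  case True
  obtain x y where z: "z = (x, y)" by(cases z)
  have xy: "x : C" "y : C" "x ~= y" using True by(auto simp:z)
  define m where "m = max (ur x+c) (ur y+c)"
  define d where "d = norm (x-y)"
  have m: "1 <= m" using cC[OF xy(1)] by(simp add:m_def)
  have d: "0 < d" using xy by(simp add:d_def)
  define P where "P = (ur x-ur y) |^ p * m powr-(1+e)*d powr-(?n+s*p)"
  define Q where "Q = m powr ta*d powr-(?n-ka)"
  define r where "r = q/p"
  have r: "0 < r" "r < 1" using q p0 by(auto simp:r_def)
  have "(ur x-ur y) |^ q*d powr-(?n+h*q) = P powr r*Q powr (1-r)"
  proof -
   have pq: "p-q ~= 0" "p ~= 0" using q p0 by auto
   have 1: "P powr r = (ur x-ur y) |^ (p*r) * m powr (- (1+e)*r)*d powr (- (?n+s*p)*r)"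
    unfolding P_def by(simp only: powr_mult powr_powr)
   have 2: "Q powr (1-r) = m powr (ta*(1-r))*d powr (- (?n-ka)*(1-r))"
    unfolding Q_def by(simp only: powr_mult powr_powr)
   have 3: "p*r = q" "- (1+e)*r+ta*(1-r) = 0"
    using pq by(simp_all add:r_def ta_def ta0_def field_simps)
   have 4: "ka*(1-r) = (s-h)*q" using pq by(simp add:ka_def r_def field_simps)
   have 5: "- (?n+s*p)*r + - (?n-ka)*(1-r) = - (?n+h*q)"
   proof -
    have "- (?n+s*p)*r + - (?n-ka)*(1-r) = - ?n-s*(p*r)+ka*(1-r)" by(simp add:algebra_simps)
    thus ?thesis unfolding 3(1) 4 by(simp add:algebra_simps)
   qed
   have "P powr r*Q powr (1-r) = (ur x-ur y) |^ q*(m powr (- (1+e)*r) * m powr (ta*(1-r)))*(d powr (- (?n+s*p)*r)*d powr (- (?n-ka)*(1-r)))"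
    unfolding 1 2 3(1) by(simp only: mult_ac)
   also have "... = (ur x-ur y) |^ q*d powr-(?n+h*q)"
    unfolding powr_add[symmetric] 3(2) 5 using m by simp
   finally show ?thesis by simp
  qed
  also have "P powr r*Q powr (1-r) <= max P Q powr r * max P Q powr (1-r)"
   using r by(intro mult_mono powr_mono2) (auto simp:P_def Q_def)
  also have "... = max P Q" by(simp add:powr_add[symmetric] P_def le_max_iff_disj)
  also have "... <= P+Q" by(simp add:P_def Q_def)
  finally have le: "(ur x-ur y) |^ q*d powr-(?n+h*q) <= P+Q" .
  have "P <= La*(k x y*w z)"
  proof -
   have "d powr-(?n+s*p) <= La * k x y" unfolding d_def by(rule k_lower)
   hence "((ur x-ur y) |^ p * m powr-(1+e))*d powr-(?n+s*p) <= ((ur x-ur y) |^ p * m powr-(1+e))*(La * k x y)"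
    by(rule mult_left_mono) simp
   thus ?thesis by(simp add:P_def w_def z dl_def m_def mult_ac)
  qed
  moreover have "Q <= d powr-(?n-ka)*((ur x+c) powr ta+(ur y+c) powr ta)"
   unfolding Q_def by(subst mult.commute) (intro mult_left_mono, auto simp:m_def max_def)
  ultimately have "(ur x-ur y) |^ q*d powr-(?n+h*q) <= La*(k x y*w z)+d powr-(?n-ka)*((ur x+c) powr ta+(ur y+c) powr ta)" using le by linarith
  hence "en ((ur x-ur y) |^ q*d powr-(?n+h*q)) <= en (La*(k x y*w z)+d powr-(?n-ka)*((ur x+c) powr ta+(ur y+c) powr ta))" by(rule ennreal_leI)
  also have "... = en La*(en (k x y)*en (w z))+(en (d powr-(?n-ka))*en ((ur x+c) powr ta)+en (d powr-(?n-ka))*en ((ur y+c) powr ta))"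
   using La0 k_nonneg[of x y] by(simp add:ennreal_plus ennreal_mult distrib_left w_def)
  finally show ?thesis
   using xy xyR[OF xy(1,2)] by(simp add:z dl_def d_def Y_def g_def)
 qed (auto simp:dl_def split:split_indicator)
 have "(NL z. en (dl ur z |^ q*norm (fst z-snd z) powr-(?n+h*q))*ind (C \<times> C) z) <= (NL z. en La*(?F z w)+(Y z*g (fst z)+Y z*g (snd z)))"
  by(intro nn_integral_mono pw)
 also have "... = en La*(NL z. ?F z w)+(?C Y g+(NL z. Y z*g (snd z)))"
  by(subst nn_integral_add, measurable, subst nn_integral_cmult, measurable, subst nn_integral_add, measurable)
 also have "(NL z. ?F z w) = (NM z. en (w z)*ind (C \<times> C) z)"
  unfolding mu_def by(rule nn_integral_density[symmetric]) measurable
 also have "en La*(NM z. en (w z)*ind (C \<times> C) z)+(?C Y g+(NL z. Y z*g (snd z))) < infy"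
  using Yfin Yfin' order_le_less_trans[OF we, of infy] by(simp add:w_def ennreal_mult_less_top)
 finally show ?thesis .
qed simp

end

section \<open>Smooth functions, mollifiers, and convolution under the energy\<close>

lemma Ck_SucI:
 assumes "!!x. (f has_derivative f' x) (at x)" "!!b. b : Basis ==> Ck k (%x. f' x b)"
 shows "Ck (Suc k) f"
proof -
 have "f' x = frechet_derivative f (at x)" for x by(rule frechet_derivative_at[OF assms(1)])
 moreover have "f differentiable_on UNIV"
  using assms(1) by(auto simp:differentiable_on_def differentiable_def)
 ultimately show ?thesis using assms(2) by simp
qed

lemma Ck_derivative:
 assumes "Ck (Suc k) f"
 shows "(f has_derivative frechet_derivative f (at x)) (at x)"
 using assms by(simp add:differentiable_on_def frechet_derivative_works)

lemma Ck_continuous: "Ck k f ==> continuous_on UNIV f"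
 by(cases k) (auto intro:differentiable_imp_continuous_on)

lemma Ck_mono: "Ck (Suc k) f ==> Ck k f"
proof(induction k arbitrary: f)
 case 0
 thus ?case using Ck_continuous[of "Suc 0"] by simp
next
 case (Suc k)
 thus ?case by simp
qed

lemma Ck_const: "Ck k (%x. c)"
proof(induction k arbitrary: c)
 case (Suc k)
 show ?case by(rule Ck_SucI[where f' = "%x h. 0"]) (auto intro:Suc)
qed simp

lemma Ck_add: "Ck k f ==> Ck k g ==> Ck k (%x. f x+g x)"
proof(induction k arbitrary: f g)
 case 0
 thus ?case by(simp add:continuous_on_add)
next
 case (Suc k)
 show ?case
  by(rule Ck_SucI[OF has_derivative_add[OF Ck_derivative[OF Suc.prems(1)] Ck_derivative[OF Suc.prems(2)]]])
   (use Suc in auto)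
qed

lemma Ck_mult: "Ck k f ==> Ck k g ==> Ck k (%x. f x*g x)"
proof(induction k arbitrary: f g)
 case 0
 thus ?case by(simp add:continuous_on_mult)
next
 case (Suc k)
 show ?case
 proof(rule Ck_SucI[OF has_derivative_mult[OF Ck_derivative[OF Suc.prems(1)] Ck_derivative[OF Suc.prems(2)]]])
  fix b :: 'a assume "b : Basis"
  thus "Ck k (%x. f x*frechet_derivative g (at x) b+frechet_derivative f (at x) b*g x)"
   using Suc.prems Ck_mono[OF Suc.prems(1)] Ck_mono[OF Suc.prems(2)] by(intro Ck_add Suc.IH) auto
 qed
qed

lemma Ck_prod: "(!!i. i : I ==> Ck k (f i)) ==> Ck k (%x. \<Prod>i\<in>I. f i x)"
 by(induction I rule:infinite_finite_induct) (auto intro:Ck_const Ck_mult)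

text \<open>The functions t^(-m) exp(-1/t), extended by 0: their span is closed under
  differentiation, so the smoothness of exp(-1/t) is an induction with m arbitrary.\<close>

definition flat :: "nat => real => real"
 where "flat m t = (if 0 < t then inverse t^m*exp (- inverse t) else 0)"

lemma flat_quotient_tendsto: "((%t. flat m t/t) \<longlongrightarrow> 0) (at 0)"
proof -
 have "((%t. flat m t/t) \<longlongrightarrow> 0) (at_right (0::real))"
 proof(rule Lim_transform_eventually)
  show "((%t::real. inverse t^Suc m/exp (inverse t)) \<longlongrightarrow> 0) (at_right 0)"
   by(rule filterlim_compose[OF tendsto_power_div_exp_0 filterlim_inverse_at_top_right])
  show "\<forall>\<^sub>F t in at_right (0::real). inverse t^Suc m/exp (inverse t) = flat m t/t"
   unfolding eventually_at_right_field
   by(intro exI[of _ 1]) (auto simp:flat_def exp_minus divide_inverse)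
 qed
 moreover have "((%t. flat m t/t) \<longlongrightarrow> 0) (at_left (0::real))"
 proof(rule tendsto_eventually)
  show "\<forall>\<^sub>F t in at_left (0::real). flat m t/t = 0"
   unfolding eventually_at_left_field by(intro exI[of _ "-1"]) (auto simp:flat_def)
 qed
 ultimately show ?thesis by(simp add:filterlim_at_split)
qed

lemma flat_derivative:
 "(flat m has_real_derivative (flat (m+2) t-real m*flat (m+1) t)) (at t)"
proof -
 let ?F = "%t. real m*inverse t^(m-1)*(- (inverse t)\<^sup>2)*exp (- inverse t)+exp (- inverse t)*(inverse t)\<^sup>2*inverse t^m"
 consider "0 < t" | "t < 0" | "t = 0" by linarith
 thus ?thesis
 proof cases
  case 1
  have "((%t. inverse t^m*exp (- inverse t)) has_real_derivative (flat (m+2) t-real m*flat (m+1) t)) (at t)"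
  proof(rule DERIV_cong)
   show "((%t. inverse t^m*exp (- inverse t)) has_real_derivative (?F t)) (at t)"
    using 1 by(auto intro!: derivative_eq_intros simp:power2_eq_square divide_inverse)
   show "?F t = flat (m+2) t-real m*flat (m+1) t"
    using 1 by(cases m) (auto simp:flat_def power2_eq_square algebra_simps)
  qed
  thus ?thesis
  proof(rule has_field_derivative_transform_within_open)
   show "open {0::real<..}" "t : {0<..}" using 1 by auto
  qed (auto simp:flat_def)
 next
  case 2
  have "((%t. 0) has_real_derivative 0) (at t)" by simp
  hence "(flat m has_real_derivative 0) (at t)"
  proof(rule has_field_derivative_transform_within_open)
   show "open {..<0::real}" "t : {..<0}" using 2 by auto
  qed (auto simp:flat_def)
  thus ?thesis using 2 by(simp add:flat_def)
 next
  case 3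
  have "(flat m has_real_derivative 0) (at 0)"
   using flat_quotient_tendsto[of m] unfolding has_field_derivative_iff by(simp add:flat_def)
  thus ?thesis using 3 by(simp add:flat_def)
 qed
qed

lemma Ck_flat: "Ck k (%x. flat m (c+a \<bullet> x))"
proof(induction k arbitrary: m)
 case 0
 have "continuous_on UNIV (flat m)"
  by(intro continuous_at_imp_continuous_on ballI DERIV_isCont[OF flat_derivative])
 thus ?case
  by(auto intro!: continuous_on_compose2[of UNIV "flat m"] continuous_intros)
next
 case (Suc k)
 show ?case
 proof(rule Ck_SucI[where f' = "%x h. (flat (m+2) (c+a \<bullet> x)-real m*flat (m+1) (c+a \<bullet> x))*(a \<bullet> h)"])
  fix x
  have "((%x. c+a \<bullet> x) has_derivative (%h. a \<bullet> h)) (at x)"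
   by(auto intro!: derivative_eq_intros)
  from has_derivative_compose[OF this flat_derivative[unfolded has_field_derivative_def]]
  show "((%x. flat m (c+a \<bullet> x)) has_derivative (%h. (flat (m+2) (c+a \<bullet> x)-real m*flat (m+1) (c+a \<bullet> x))*(a \<bullet> h))) (at x)" .
 next
  fix b :: 'a assume "b : Basis"
  have "Ck k (%x. (flat (m+2) (c+a \<bullet> x)+(- real m)*flat (m+1) (c+a \<bullet> x))*(a \<bullet> b))"
   by(intro Ck_mult Ck_add Ck_const Suc)
  thus "Ck k (%x. (flat (m+2) (c+a \<bullet> x)-real m*flat (m+1) (c+a \<bullet> x))*(a \<bullet> b))"
   by simp
 qed
qed

text \<open>A product of one-dimensional bumps over the coordinates. The support lies in the cube |z
  . b| <= r/n, and the norm is at most the sum of the n coordinates.\<close>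

lemma mollifier_exists:
 assumes r: "0 < r"
 obtains rh :: "'a::euclidean_space => real" where "!!k. Ck k rh" "!!z. 0 <= rh z" "!!z. rh z ~= 0 ==> norm z <= r"
  "integrable lborel rh" "(\<integral>z. rh z \<partial>lborel) = 1"
proof -
 let ?F = "%bt. \<integral>z. bt z \<partial>lborel"
 define d where "d = r/real DIM('a)"
 have d: "0 < d" using r by(simp add:d_def)
 define bt where "bt z = (\<Prod>b\<in>Basis. flat 0 (1+(b /\<^sub>R d) \<bullet> z)*flat 0 (1+(- b /\<^sub>R d) \<bullet> z))" for z :: 'a
 have C: "Ck k bt" for k unfolding bt_def[abs_def] by(intro Ck_prod Ck_mult Ck_flat)
 have f0: "0 <= flat 0 t" "flat 0 t = 0 \<longleftrightarrow> t <= 0" for t by(auto simp:flat_def)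
 have nn: "0 <= bt z" for z unfolding bt_def by(intro prod_nonneg mult_nonneg_nonneg f0)
 have supp: "norm z <= r" if "bt z ~= 0" for z
 proof -
  have "abs (z \<bullet> b) <= d" if b: "b : Basis" for b
  proof -
   have "flat 0 (1+(b /\<^sub>R d) \<bullet> z) ~= 0" "flat 0 (1+(- b /\<^sub>R d) \<bullet> z) ~= 0"
    using \<open>bt z ~= 0\<close> b by(auto simp:bt_def)
   hence "0 < 1+(z \<bullet> b)/d" "0 < 1-(z \<bullet> b)/d"
    unfolding f0 by(auto simp:inner_commute divide_inverse mult.commute)
   thus ?thesis using d by(auto simp:field_simps abs_le_iff)
  qed
  hence "(\<Sum>b\<in>Basis. (abs (z \<bullet> b))) <= real DIM('a)*d" using sum_bounded_above[of Basis "%b. (abs (z \<bullet> b))" d] by simp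
  thus ?thesis using norm_le_l1[of z] by(simp add:d_def)
 qed
 have cont: "continuous_on UNIV bt" by(rule Ck_continuous[OF C])
 have int: "integrable lborel bt"
 proof -
  have "integrable lborel (%x. ind (cball 0 r) x *\<^sub>R bt x)"
   by(rule borel_integrable_compact) (auto intro:continuous_on_subset[OF cont])
  also have "(%x. ind (cball 0 r) x *\<^sub>R bt x) = bt"
   using supp by(auto simp:fun_eq_iff split:split_indicator)
  finally show ?thesis .
 qed
 have "(?F bt) ~= 0"
 proof
  assume "(?F bt) = 0"
  hence ae: "AL z. bt z = 0"
   using integral_nonneg_eq_0_iff_AE[OF int] nn by simp
  have "open {z. 0 < bt z}" by(intro open_Collect_less cont continuous_on_const)
  moreover have "0 : {z. 0 < bt z}"
   unfolding bt_def by(auto intro!: prod_pos simp:flat_def)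
  moreover have "AL z. z : {z. 0 < bt z} --> bt z = 0" using ae by eventually_elim simp
  ultimately obtain z where "z : {z. 0 < bt z}" "bt z = 0"
   using AE_open_ex[of "{z. 0 < bt z}" "%z. bt z = 0"] by blast
  thus False by simp
 qed
 moreover have "0 <= (?F bt)" using nn by simp
 ultimately have c: "0 < (?F bt)" by simp
 show ?thesis
 proof(rule that[of "%z. bt z*inverse (?F bt)"])
  show "Ck k (%z. bt z*inverse (?F bt))" for k by(intro Ck_mult C Ck_const)
  show "0 <= bt z*inverse (?F bt)" for z using nn c by simp
  show "norm z <= r" if "bt z*inverse (?F bt) ~= 0" for z using that supp[of z] by auto
 qed (use int c in auto)
qed

text \<open>The Leibniz rule puts each derivative on the smooth factor. The integral runs over a
  box, so that the theorems on parametric integrals apply; for a box containing the support of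
  \<open>eh\<close> it is the full convolution.\<close>

lemma Ck_convolution:
 fixes eh :: "'a::euclidean_space => real"
 assumes eh: "continuous_on UNIV eh"
 shows "Ck k ps ==> Ck k (%x. integral (cbox a b) (%y. ps (x-y)*eh y))"
proof(induction k arbitrary: ps)
 case 0
 have c: "continuous_on UNIV ps" using 0 by simp
 have "continuous_on (UNIV \<times> cbox a b) (%(x, t). ps (x-t)*eh t)"
  unfolding case_prod_beta
  by(intro continuous_intros continuous_on_compose2[OF c] continuous_on_compose2[OF eh]) auto
 thus ?case by(simp add:integral_continuous_on_param)
next
 case (Suc k)
 have c: "continuous_on UNIV ps" by(rule Ck_continuous[OF Suc.prems])
 define F where "F x = frechet_derivative ps (at x)" for x
 have F: "(ps has_derivative F x) (at x)" for x unfolding F_def by(rule Ck_derivative[OF Suc.prems])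
 have Fb: "Ck k (%x. F x b)" if "b : Basis" for b using Suc.prems that by(simp add:F_def)
 have Fc: "continuous_on UNIV (%x. F x b)" if "b : Basis" for b by(rule Ck_continuous[OF Fb[OF that]])
 have bl: "bounded_linear (F x)" for x using F has_derivative_bounded_linear by blast
 define fx where "fx x t = eh t *\<^sub>R Blinfun (F (x-t))" for x t
 have fxa: "blinfun_apply (fx x t) h = eh t*F (x-t) h" for x t h
  using bl by(simp add:fx_def bounded_linear_Blinfun_apply scaleR_blinfun.rep_eq)
 have cfx: "continuous_on (UNIV \<times> cbox a b) (%(x, t). fx x t)"
 proof(rule continuous_on_blinfun_componentwise)
  fix i :: 'a assume i: "i : Basis"
  show "continuous_on (UNIV \<times> cbox a b) (%x. blinfun_apply (case x of (x, t) => fx x t) i)"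
   unfolding case_prod_beta fxa
   by(intro continuous_intros continuous_on_compose2[OF Fc[OF i]] continuous_on_compose2[OF eh]) auto
 qed
 have cint: "continuous_on (cbox a b) (fx x)" for x
  by(rule continuous_on_compose2[OF cfx, of _ "%t. (x, t)", simplified]) (auto intro!: continuous_intros)
 show ?case
 proof(rule Ck_SucI)
  fix x0
  show "((%x. integral (cbox a b) (%y. ps (x-y)*eh y)) has_derivative blinfun_apply (integral (cbox a b) (fx x0))) (at x0)"
  proof(rule leibniz_rule[where U = UNIV, simplified])
   fix x t :: 'a
   have "((%x. x-t) has_derivative (%h. h)) (at x)" by(auto intro!: derivative_eq_intros)
   from has_derivative_compose[OF this F[of "x-t"]]
   have "((%x. ps (x-t)) has_derivative F (x-t)) (at x)" .
   hence "((%x. ps (x-t)*eh t) has_derivative (%h. F (x-t) h*eh t)) (at x)"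
    by(rule has_derivative_mult_left)
   also have "(%h. F (x-t) h*eh t) = blinfun_apply (fx x t)" by(auto simp:fxa mult.commute)
   finally show "((%x. ps (x-t)*eh t) has_derivative blinfun_apply (fx x t)) (at x)" .
  next
   show "(%y. ps (x-y)*eh y) integrable_on cbox a b" for x
    by(intro integrable_continuous continuous_intros continuous_on_compose2[OF c] continuous_on_compose2[OF eh]) auto
  qed (use cfx in auto)
  fix i :: 'a assume i: "i : Basis"
  have "Ck k (%x. integral (cbox a b) (%y. F (x-y) i*eh y))" by(rule Suc.IH[OF Fb[OF i]])
  moreover have "blinfun_apply (integral (cbox a b) (fx x)) i = integral (cbox a b) (%y. F (x-y) i*eh y)" for x
   by(subst blinfun_apply_integral) (auto intro:integrable_continuous cint simp:fxa mult.commute)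
  ultimately show "Ck k (%x. blinfun_apply (integral (cbox a b) (fx x)) i)" by simp
 qed
qed

lemma lborel_integral_reflect:
 fixes f :: "'a::euclidean_space => real"
 assumes [measurable]: "f : Bor"
 shows "(\<integral>y. f y \<partial>lborel) = (\<integral>z. f (x-z) \<partial>lborel)"
proof -
 have "(lborel :: 'a measure) = density (distr lborel borel (%z. x+(-1) *\<^sub>R z)) (%_. en (abs (-1)^DIM('a)))"
  by(rule lborel_affine) simp
 hence "(lborel :: 'a measure) = distr lborel borel (%z. x-z)"
  by(simp add:density_1 one_ennreal_def[symmetric])
 hence "(\<integral>y. f y \<partial>lborel) = (\<integral>y. f y \<partial>distr lborel borel (%z. x-z))" by simp
 also have "... = (\<integral>z. f (x-z) \<partial>lborel)" by(rule integral_distr) measurable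
 finally show ?thesis .
qed

lemma nn_integral_translate:
 fixes f :: "'a::euclidean_space => ennreal"
 assumes [measurable]: "f : Bor"
 shows "(NL y. f (y-z)) = (NL y. f y)"
proof -
 have "(lborel :: 'a measure) = density (distr lborel borel (%x. - z+1 *\<^sub>R x)) (%_. en (abs 1^DIM('a)))"
  by(rule lborel_affine) simp
 hence "(lborel :: 'a measure) = distr lborel borel (%x. x-z)"
  by(simp add:density_1 one_ennreal_def[symmetric])
 hence "(NL y. f y) = (\<integral>\<^sup>+y. f y \<partial>distr lborel borel (%x. x-z))" by simp
 also have "... = (NL y. f (y-z))" by(rule nn_integral_distr) measurable
 finally show ?thesis by simp
qed

text \<open>The tangent inequality at the mean m, integrated against the probability density
  \<open>rh\<close>.\<close>

lemma weighted_Jensen_powr: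
 fixes rh h :: "'b => real"
 assumes p: "1 < p" and rh: "integrable M rh" "!!z. 0 <= rh z" "(\<integral>z. rh z \<partial>M) = 1"
  and h [measurable]: "h : borel_measurable M" and B: "!!z. (abs (h z)) <= B"
 shows "(\<integral>z. rh z*h z \<partial>M) |^ p <= (\<integral>z. rh z*h z |^ p \<partial>M)"
proof -
 let ?F = "%m M. (\<integral>z. (m |^ p-p*jp p m * m)*rh z+p*jp p m*(rh z*h z) \<partial>M)"
 have [measurable]: "rh : borel_measurable M" using rh(1) by auto
 have i1: "integrable M (%z. rh z*h z)"
 proof(rule Bochner_Integration.integrable_bound)
  show "integrable M (%z. rh z*B)" using rh(1) by simp
  show "AE z in M. norm (rh z*h z) <= norm (rh z*B)"
  proof(rule AE_I2)
   fix z
   have "abs (h z) <= abs B" using B[of z] by linarith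
   thus "norm (rh z*h z) <= norm (rh z*B)" by(simp add:abs_mult mult_left_mono)
  qed
 qed measurable
 have i2: "integrable M (%z. rh z*h z |^ p)"
 proof(rule Bochner_Integration.integrable_bound)
  show "integrable M (%z. rh z*B |^ p)" using rh(1) by simp
  show "AE z in M. norm (rh z*h z |^ p) <= norm (rh z*B |^ p)"
  proof(rule AE_I2)
   fix z
   have "h z |^ p <= B |^ p" using B[of z] p by(intro powr_mono2) auto
   thus "norm (rh z*h z |^ p) <= norm (rh z*B |^ p)" by(simp add:abs_mult mult_left_mono)
  qed
 qed measurable
 define m where "m = (\<integral>z. rh z*h z \<partial>M)"
 have "?F m M <= (\<integral>z. rh z*h z |^ p \<partial>M)"
 proof(rule integral_mono)
  fix z
  have "rh z*(m |^ p+p*jp p m*(h z-m)) <= rh z*h z |^ p"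
   by(intro mult_left_mono powr_tangent p rh)
  thus "(m |^ p-p*jp p m * m)*rh z+p*jp p m*(rh z*h z) <= rh z*h z |^ p"
   by(simp add:algebra_simps)
 qed (use i1 i2 rh(1) in auto)
 also have "?F m M = m |^ p"
  using i1 rh by(simp add:m_def[symmetric])
 finally show ?thesis by(simp add:m_def)
qed

context frac_kernel
begin

text \<open>By Jensen's inequality the increment of the average costs at most the average of the
  shifted increments, and translation invariance of |x - y|^(-n-s p) removes the shift. The kernel
  itself need not be translation invariant: it is exchanged for this power and back, at the price of
  a factor \<open>La\<close> each time.\<close>

lemma energy_convolution:
 assumes rh: "integrable lborel rh" "!!z. 0 <= rh z" "(\<integral>z. rh z \<partial>lborel) = 1"
  and [measurable]: "eh : Bor" and B: "!!x. (abs (eh x)) <= B"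
  and eh': "!!x. eh' x = (\<integral>z. rh z*eh (x-z) \<partial>lborel)" and [measurable]: "eh' : Bor"
 shows "energy UNIV eh' <= en (La*La)*energy UNIV eh"
proof -
 let ?B = "%x y. (eh' x-eh' y) |^ p"
 let ?A = "%x z y. eh (x-z)-eh (y-z)"
 let ?G = "%z G x y. en (rh z)*G (x-z) (y-z)"
 let ?F = "%x y. La*norm (x-y) powr-(real DIM('a)+s*p)"
 have [measurable]: "rh : Bor" using rh(1) by auto
 have int: "integrable lborel (%z. rh z*eh (x-z))" for x
 proof(rule Bochner_Integration.integrable_bound)
  show "integrable lborel (%z. rh z*B)" using rh(1) by simp
  show "AL z. norm (rh z*eh (x-z)) <= norm (rh z*B)"
  proof(rule AE_I2)
   fix z
   have "abs (eh (x-z)) <= abs B" using B[of "x-z"] by linarith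
   thus "norm (rh z*eh (x-z)) <= norm (rh z*B)" by(simp add:abs_mult mult_left_mono)
  qed
 qed measurable
 have pt: "en (?B x y) <= (NL z. en (rh z)*en ((?A x z y) |^ p))" for x y
 proof -
  have "eh' x-eh' y = (\<integral>z. rh z*(?A x z y) \<partial>lborel)"
   unfolding eh' by(subst Bochner_Integration.integral_diff[symmetric]) (use int in \<open>auto simp:algebra_simps\<close>)
  hence "?B x y = (\<integral>z. rh z*(?A x z y) \<partial>lborel) |^ p" by simp
  also have "... <= (\<integral>z. rh z*(?A x z y) |^ p \<partial>lborel)"
  proof(rule weighted_Jensen_powr[OF p1 rh])
   show "abs (?A x z y) <= B+B" for z using B[of "x-z"] B[of "y-z"] by linarith
  qed measurable
  finally have "en (?B x y) <= en (\<integral>z. rh z*(?A x z y) |^ p \<partial>lborel)"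
   by(rule ennreal_leI)
  also have "... <= (NL z. en (rh z*(?A x z y) |^ p))"
  proof(cases "integrable lborel (%z. rh z*(?A x z y) |^ p)")
   case True
   thus ?thesis by(subst nn_integral_eq_integral) (use rh in auto)
  qed (simp add:not_integrable_integral_eq)
  finally show ?thesis using rh by(simp add:ennreal_mult)
 qed
 define G where "G x y = en ((eh x-eh y) |^ p)*en (?F x y)" for x y
 have [measurable]: "(%z. G (fst z) (snd z)) : Bor" unfolding G_def by measurable
 have [measurable]: "G x : Bor" for x unfolding G_def by measurable
 have "energy UNIV eh' = (NL x. NL y. en (?B x y)*en (k x y))"
  unfolding energy_def by(subst nn_integral_mu) (auto simp:dl_def)
 also have "... <= (NL x. NL y. NL z. ?G z G x y)"
 proof(intro nn_integral_mono)
  fix x y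
  have kl: "k x y <= ?F x y" by(rule k_upper)
  have "en (?B x y)*en (k x y) <= (NL z. en (rh z)*en ((?A x z y) |^ p))*en (?F x y)"
   by(intro mult_mono pt ennreal_leI kl) auto
  also have "... = (NL z. en (rh z)*en ((?A x z y) |^ p)*en (?F x y))"
   by(rule nn_integral_multc[symmetric]) measurable
  also have "... = (NL z. ?G z G x y)"
   by(simp add:G_def mult.assoc)
  finally show "en (?B x y)*en (k x y) <= (NL z. ?G z G x y)" .
 qed
 also have "... = (NL x. NL z. NL y. ?G z G x y)"
 proof(rule nn_integral_cong)
  fix x
  show "(NL y. NL z. ?G z G x y) = (NL z. NL y. ?G z G x y)"
   by(rule lborel_pair.Fubini') (auto simp:lborel_prod case_prod_beta G_def)
 qed
 also have "... = (NL z. NL x. NL y. ?G z G x y)"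
 proof(rule lborel_pair.Fubini')
  show "(%(z, x). NL y. ?G z G x y) : borel_measurable (lborel \<Otimes>\<^sub>M (lborel :: 'a measure))"
   unfolding G_def case_prod_beta by measurable
 qed
 also have "... = (NL z. en (rh z)*(NL x. NL y. G x y))"
 proof(rule nn_integral_cong)
  fix z
  have "(NL x. NL y. ?G z G x y) = (NL x. en (rh z)*(NL y. G (x-z) (y-z)))"
   by(intro nn_integral_cong nn_integral_cmult) measurable
  also have "... = (NL x. en (rh z)*(NL y. G (x-z) y))"
   by(subst nn_integral_translate) simp_all
  also have "... = en (rh z)*(NL x. (NL y. G (x-z) y))"
   unfolding G_def by(rule nn_integral_cmult) measurable
  also have "(NL x. (NL y. G (x-z) y)) = (NL x. (NL y. G x y))"
   unfolding G_def by(rule nn_integral_translate[of "%x. NL y. en ((eh x-eh y) |^ p)*en (?F x y)"]) measurable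
  finally show "(NL x. NL y. ?G z G x y) = en (rh z)*(NL x. NL y. G x y)" .
 qed
 also have "... = (NL z. en (rh z))*(NL x. NL y. G x y)"
  by(rule nn_integral_multc) measurable
 also have "(NL z. en (rh z)) = 1" using rh by(subst nn_integral_eq_integral) auto
 also have "1*(NL x. NL y. G x y) <= (NL x. NL y. en (La*La)*(en ((eh x-eh y) |^ p)*en (k x y)))"
  unfolding mult_1
 proof(intro nn_integral_mono)
  fix x y
  have "?F x y <= La*(La * k x y)"
   using La0 by(intro mult_left_mono k_lower) auto
  hence "en (?F x y) <= en (La*La)*en (k x y)"
   using La0 k_nonneg[of x y] by(simp add:ennreal_mult[symmetric] ennreal_leI mult.assoc)
  thus "G x y <= en (La*La)*(en ((eh x-eh y) |^ p)*en (k x y))"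
   unfolding G_def by(subst mult.left_commute) (intro mult_left_mono, auto)
 qed
 also have "... = (NM z. en (La*La)*en (dl eh z |^ p))"
  by(subst nn_integral_mu) (simp_all add:dl_def mult.assoc)
 also have "... = en (La*La)*energy UNIV eh"
  unfolding energy_def by(subst nn_integral_cmult) simp_all
 finally show ?thesis .
qed

end

lemma test_function_lipschitz:
 fixes eh :: "'a::euclidean_space => real"
 assumes "eh : test_functions E"
 obtains L S B where "0 < L" "!!x y. (abs (eh x-eh y)) <= L*norm (x-y)" "compact S" "S <= E" "!!x. x ~: S ==> eh x = 0"
  "0 < B" "!!x. (abs (eh x)) <= B" "continuous_on UNIV eh"
proof -
 define S where "S = closure {x. eh x ~= 0}"
 have S: "compact S" "S <= E" using assms by(auto simp:test_functions_def compactly_contained_def S_def)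
 have C: "Ck k eh" for k using assms by(auto simp:test_functions_def)
 have zero: "eh x = 0" if "x ~: S" for x using that closure_subset[of "{x. eh x ~= 0}"] by(auto simp:S_def)
 have cont: "continuous_on UNIV eh" by(rule Ck_continuous[OF C])
 define F where "F x = frechet_derivative eh (at x)" for x
 have F: "(eh has_derivative F x) (at x)" for x unfolding F_def by(rule Ck_derivative[OF C])
 have Fc: "continuous_on UNIV (%x. F x b)" if "b : Basis" for b
  using C[of "Suc 0"] that by(simp add:F_def)
 have F0: "F x = (%h. 0)" if "x ~: S" for x
 proof -
  have "((%x. 0) has_derivative (%h. 0 :: real)) (at x)" by simp
  hence "(eh has_derivative (%h. 0)) (at x)"
  proof(rule has_derivative_transform_within_open)
   show "open (- S)" "x : - S" using that by(auto simp:S_def)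
  qed (use zero in auto)
  thus ?thesis using F has_derivative_unique by blast
 qed
 have "EX M. ALL x. (abs (F x b)) <= M" if b: "b : Basis" for b
 proof -
  have "compact ((%x. F x b) ` S)"
   by(rule compact_continuous_image[OF continuous_on_subset[OF Fc[OF b]] S(1)]) auto
  then obtain M where "ALL x:S. (abs (F x b)) <= M" by(auto dest!: compact_imp_bounded simp:bounded_iff)
  hence M: "!!x. x : S ==> abs (F x b) <= M" by blast
  have "abs (F x b) <= max M 0" for x using M[of x] F0[of x] by(cases "x : S") auto
  thus ?thesis by blast
 qed
 then obtain M where M: "!!b x. b : Basis ==> abs (F x b) <= M b" by metis
 define L where "L = (\<Sum>b\<in>Basis. M b)+1"
 have M0: "0 <= M b" if "b : Basis" for b using M[OF that, of undefined] by linarith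
 hence L: "0 < L" by(simp add:L_def sum_nonneg add_nonneg_pos)
 have on: "onorm (F x) <= L" for x
 proof(rule onorm_le)
  fix h :: 'a
  have lin: "linear (F x)" using F has_derivative_linear by blast
  have "F x h = F x (\<Sum>b\<in>Basis. (h \<bullet> b) *\<^sub>R b)" by(simp add:euclidean_representation)
  also have "... = (\<Sum>b\<in>Basis. (h \<bullet> b)*F x b)" using lin by(simp add:linear_sum linear_scale)
  finally have "abs (F x h) <= (\<Sum>b\<in>Basis. (abs ((h \<bullet> b)*F x b)))" by(simp add:sum_abs)
  also have "... <= (\<Sum>b\<in>Basis. norm h*M b)"
   by(intro sum_mono) (auto simp:abs_mult intro!: mult_mono Basis_le_norm M)
  also have "... = norm h*(\<Sum>b\<in>Basis. M b)" by(simp add:sum_distrib_left)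
  also have "... <= norm h*L" by(intro mult_left_mono) (auto simp:L_def)
  finally show "norm (F x h) <= L*norm h" by(simp add:mult.commute)
 qed
 have lip: "abs (eh x-eh y) <= L*norm (x-y)" for x y
  using differentiable_bound[of UNIV eh F L x y] F on by simp
 have "compact (eh ` S)" by(rule compact_continuous_image[OF continuous_on_subset[OF cont] S(1)]) auto
 then obtain B where "ALL x:S. (abs (eh x)) <= B" by(auto dest!: compact_imp_bounded simp:bounded_iff)
 hence B: "!!x. x : S ==> abs (eh x) <= B" by blast
 have "abs (eh x) <= abs B+1" for x using B[of x] zero[of x] by(cases "x : S") auto
 thus ?thesis using that[OF L lip S zero, of "abs B+1"] cont by auto
qed

section \<open>Borel representatives and translation to and from the definitions\<close>

lemma lebesgue_borel_version:
 assumes "(f :: 'a::euclidean_space => real) : borel_measurable lebesgue"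
 obtains g where "g : Bor" "AL x. f x = g x"
proof -
 obtain g where "g : borel_measurable lborel" "AL x. f x = g x"
  using completion_ex_borel_measurable_real[OF assms] by blast
 thus ?thesis by(intro that[of g]) auto
qed

lemma AE_swap_lborel:
 assumes "AE z in (lborel :: ('a::euclidean_space \<times> 'a) measure). P z"
 shows "AL z. P (snd z, fst z)"
proof -
 obtain N where N: "N : null_sets lborel" "{x. ~ P x} <= N"
  using assms by(auto simp:eventually_ae_filter)
 have [measurable]: "N : sets borel" using N by auto
 have "(%z::'a \<times> 'a. (snd z, fst z)) : borel \<rightarrow>\<^sub>M borel"
  by(intro borel_measurable_continuous_onI continuous_intros)
 hence [measurable]: "(%z. ind N (snd z, fst z) :: ennreal) : Bor"
  by(rule measurable_compose) measurable
 have "(NL z. ind N (snd z, fst z)) = (NL z. ind N z)"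
  by(rule nn_integral_lborel_swap) measurable
 also have "... = 0" using N by(simp add:null_setsD1)
 finally have "AL z. ind N (snd z, fst z) = (0 :: ennreal)"
  by(subst (asm) nn_integral_0_iff_AE) auto
 thus ?thesis by(rule eventually_mono) (use N(2) in \<open>auto split:split_indicator_asm\<close>)
qed

text \<open>A Borel version of \<open>K\<close> may fail symmetry and the bounds on a null set,
  whereas \<open>frac_kernel\<close> asks for them everywhere. Averaging over the exchange of
  variables and clamping between the two bounds restores both, and changes nothing almost
  everywhere.\<close>

lemma kernel_borel_version:
 fixes K :: "'a::euclidean_space => 'a => real"
 assumes K: "elliptic_kernel s p La K" and par: "0 < s" "s < 1" "1 < p" "1 <= La"
 obtains k where "frac_kernel s p La k" "AL z. K (fst z) (snd z) = k (fst z) (snd z)"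
proof -
 let ?N = "real DIM('a)+s*p"
 let ?G = "%z. K (fst z) (snd z)"
 let ?F = "%z. K (fst z) (snd z)*norm (fst z-snd z) powr ?N"
 have "(%z. ?G z) = (%(x, y). K x y)" by auto
 hence Km: "(%z. ?G z) : borel_measurable lebesgue"
  using K by(simp only: elliptic_kernel_def)
 obtain g where [measurable]: "g : Bor" and g: "AL z. ?G z = g z"
  by(rule lebesgue_borel_version[OF Km]) auto
 define d where "d z = norm (fst z-snd z) powr-?N" for z :: "'a \<times> 'a"
 define k where "k x y = max (inverse La*d (x, y)) (min (La*d (x, y)) ((g (x, y)+g (y, x))/2))" for x y
 have [measurable]: "(%z. g (snd z, fst z)) : Bor"
  by(rule measurable_compose[of "%z. (snd z, fst z)" _ borel])
   (auto intro!: borel_measurable_continuous_onI continuous_intros)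
 have d0: "0 <= d z" for z by(simp add:d_def)
 have il: "inverse La*d z <= La*d z" for z
  using par d0[of z] by(intro mult_right_mono) (auto simp:field_simps intro:order_trans[OF _ mult_left_mono[of 1 La La]])
 have "frac_kernel s p La k"
 proof
  show "(%z. k (fst z) (snd z)) : Bor"
   unfolding k_def d_def by simp measurable
  show "k x y = k y x" for x y by(simp add:k_def d_def norm_minus_commute add.commute)
  show "norm (x-y) powr-?N <= La * k x y" for x y
  proof -
   have "La*(inverse La*d (x, y)) <= La * k x y" using par by(intro mult_left_mono) (auto simp:k_def)
   thus ?thesis using par by(simp add:d_def mult.assoc[symmetric])
  qed
  show "k x y <= La*norm (x-y) powr-?N" for x y
   using il[of "(x, y)"] by(simp add:k_def d_def)
 qed (use par in auto)
 moreover have "AL z. ?G z = k (fst z) (snd z)"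
 proof -
  have "AE z in lebesgue. inverse La <= ?F z & ?F z <= La"
   using K by(simp add:elliptic_kernel_def case_prod_beta)
  hence "AL z. inverse La <= ?F z & ?F z <= La" by(simp add:AE_completion_iff)
  thus ?thesis using g AE_swap_lborel[OF g]
  proof eventually_elim
   case (elim z)
   have n: "0 < norm (fst z-snd z)"
   proof(rule ccontr)
    assume "~ 0 < norm (fst z-snd z)"
    hence "inverse La <= 0" using elim(1) by simp
    thus False using par by simp
   qed
   hence "norm (fst z-snd z) powr ?N*d z = 1" unfolding d_def powr_minus by simp
   hence "?G z = (?F z)*d z"
    by(simp only: mult.assoc mult_1_right)
   hence "inverse La*d z <= ?G z" "?G z <= La*d z"
    using elim(1) d0[of z] by(metis mult_right_mono)+
   moreover have "K (snd z) (fst z) = ?G z" using K by(simp add:elliptic_kernel_def)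
   ultimately show ?case using elim by(simp add:k_def)
  qed
 qed
 ultimately show ?thesis by(rule that)
qed

context frac_kernel
begin

lemma smooth_approximation:
 assumes eh: "continuous_on UNIV eh" "!!x. 0 <= eh x" "!!x. eh x <= B" and S: "compact S" "S ~= {}" "S <= E" "open E"
  and ehS: "!!x. x ~: S ==> eh x = 0" and e: "energy UNIV eh < infy"
 obtains S' th M where "compact S'" "S' <= E" "S' ~= {}" "!!j. th j : test_functions E" "!!j x. 0 <= th j x" "!!j x. th j x <= B"
  "!!j x. x ~: S' ==> th j x = 0" "!!x. (%j. th j x) ~> eh x" "0 <= M" "!!j. energy UNIV (th j) <= en M"
proof -
 obtain V l where V: "compact V" "V <= E" "0 < l" "inside {x. infdist x S < l} V" "S <= {x. infdist x S < l}" "V ~= {}"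
  by(rule compact_collar[OF S])
 obtain a where a: "S <= cbox (- a) a" using bounded_subset_cbox_symmetric[OF compact_imp_bounded[OF S(1)]] by blast
 define r where "r j = l/(2*(real j+1))" for j :: nat
 have r: "0 < r j" "r j < l" for j using V(3) by(auto simp:r_def field_simps add_pos_nonneg)
 have "EX rh :: 'a => real. (ALL k. Ck k rh) & (ALL z. 0 <= rh z) & (ALL z. rh z ~= 0 --> norm z <= r j) & integrable lborel rh & (\<integral>z. rh z \<partial>lborel) = 1" for j
  by(rule mollifier_exists[OF r(1)[of j]]) blast
 then obtain rh :: "nat => 'a => real" where rh: "!!j k. Ck k (rh j)" "!!j z. 0 <= rh j z" "!!j z. rh j z ~= 0 ==> norm z <= r j"
  "!!j. integrable lborel (rh j)" "!!j. (\<integral>z. rh j z \<partial>lborel) = 1" by metis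
 define th where "th j x = integral (cbox (- a) a) (%y. rh j (x-y)*eh y)" for j x
 have thC: "Ck k (th j)" for k j unfolding th_def[abs_def] by(rule Ck_convolution[OF eh(1) rh(1)])
 have [measurable]: "th j : Bor" for j
  by(rule borel_measurable_continuous_onI[OF Ck_continuous[OF thC]])
 have rhc: "continuous_on UNIV (rh j)" for j by(rule Ck_continuous[OF rh(1)])
 have [measurable]: "rh j : Bor" for j by(rule borel_measurable_continuous_onI[OF rhc])
 have [measurable]: "eh : Bor" by(rule borel_measurable_continuous_onI[OF eh(1)])
 have th: "th j x = (\<integral>z. rh j z*eh (x-z) \<partial>lborel)" for j x
 proof -
  have "continuous_on (cbox (- a) a) (%y. rh j (x-y)*eh y)"
   by(intro continuous_intros continuous_on_compose2[OF rhc] continuous_on_compose2[OF eh(1)]) auto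
  hence "integrable lborel (%y. ind (cbox (- a) a) y *\<^sub>R (rh j (x-y)*eh y))"
   by(intro borel_integrable_compact) auto
  hence "th j x = (\<integral>y. ind (cbox (- a) a) y *\<^sub>R (rh j (x-y)*eh y) \<partial>lborel)"
   unfolding th_def
   by(subst set_borel_integral_eq_integral(2)[symmetric]) (auto simp:set_integrable_def set_lebesgue_integral_def)
  also have "... = (\<integral>y. rh j (x-y)*eh y \<partial>lborel)"
   using a ehS by(intro Bochner_Integration.integral_cong) (auto split:split_indicator)
  also have "... = (\<integral>z. rh j (x-(x-z))*eh (x-z) \<partial>lborel)"
   by(rule lborel_integral_reflect) measurable
  finally show ?thesis by simp
 qed
 have ehB: "abs (eh x) <= B" for x using eh(2,3)[of x] by simp
 have int: "integrable lborel (%z. rh j z*eh (x-z))" for j x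
 proof(rule Bochner_Integration.integrable_bound)
  show "integrable lborel (%z. rh j z*B)" using rh(4) by simp
  show "AL z. norm (rh j z*eh (x-z)) <= norm (rh j z*B)"
  proof(rule AE_I2)
   fix z
   have "abs (eh (x-z)) <= abs B" using ehB[of "x-z"] by linarith
   thus "norm (rh j z*eh (x-z)) <= norm (rh j z*B)" by(simp add:abs_mult mult_left_mono)
  qed
 qed measurable
 have th0: "0 <= th j x" for j x unfolding th using rh(2) eh(2) by(intro integral_nonneg_AE) auto
 have thB: "th j x <= B" for j x
 proof -
  have "th j x <= (\<integral>z. rh j z*B \<partial>lborel)"
   unfolding th by(rule integral_mono[OF int]) (use rh eh(3) in \<open>auto intro:mult_left_mono\<close>)
  thus ?thesis using rh(5) by simp
 qed
 have thV: "th j x = 0" if x: "x ~: V" for j x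
 proof -
  have "rh j z*eh (x-z) = 0" for z
  proof(rule ccontr)
   assume "rh j z*eh (x-z) ~= 0"
   hence z: "norm z <= r j" "x-z : S" using rh(3)[of j z] ehS[of "x-z"] by auto
   have "infdist x S <= dist x (x-z)" by(rule infdist_le[OF z(2)])
   hence "infdist x S < l" using z(1) r(2)[of j] by(simp add:dist_norm)
   thus False using x insideD[OF V(4)] by auto
  qed
  thus ?thesis by(simp only: th Bochner_Integration.integral_zero)
 qed
 have tht: "th j : test_functions E" for j
 proof -
  have "{x. th j x ~= 0} <= V" using thV by auto
  hence "closure {x. th j x ~= 0} <= V" using V(1) by(intro closure_minimal compact_imp_closed)
  moreover from this have "compact (closure {x. th j x ~= 0})"
   by(metis V(1) closed_closure compact_Int_closed inf.absorb_iff2)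
  ultimately show ?thesis using thC V(2) by(auto simp:test_functions_def compactly_contained_def)
 qed
 have r0: "r ~> 0"
 proof -
  have "(%j. l/2*inverse (real (Suc j))) ~> l/2*0"
   by(intro tendsto_intros LIMSEQ_inverse_real_of_nat)
  thus ?thesis by(simp add:r_def[abs_def] field_simps)
 qed
 have lim: "(%j. th j x) ~> eh x" for x
 proof(rule LIMSEQ_I)
  fix e :: real assume e: "0 < e"
  have "isCont eh x" using eh(1) by(simp add:continuous_on_eq_continuous_at)
  then obtain d where d: "0 < d" "!!y. dist y x < d ==> dist (eh y) (eh x) < e/2"
   using e unfolding continuous_at_eps_delta by(metis half_gt_zero)
  have "\<forall>\<^sub>F j in sequentially. r j < d" using order_tendstoD(2)[OF r0 d(1)] .
  then obtain j0 where j0: "!!j. j0 <= j ==> r j < d" by(auto simp:eventually_sequentially)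
  show "EX no. ALL j>=no. norm (th j x-eh x) < e"
  proof(intro exI[of _ j0] allI impI)
   fix j assume j: "j0 <= j"
   have "th j x-eh x = (\<integral>z. rh j z*eh (x-z)-rh j z*eh x \<partial>lborel)"
    by(subst Bochner_Integration.integral_diff) (use int rh(4,5) in \<open>auto simp:th\<close>)
   also have "\<bar>...\<bar> <= (\<integral>z. rh j z*(e/2) \<partial>lborel)"
   proof(rule integral_abs_bound_integral)
    fix z
    show "abs (rh j z*eh (x-z)-rh j z*eh x) <= rh j z*(e/2)"
    proof(cases "rh j z = 0")
     case False
     hence "norm z < d" using rh(3)[of j z] j0[OF j] by simp
     hence "abs (eh (x-z)-eh x) <= e/2" using d(2)[of "x-z"] by(simp add:dist_norm)
     hence "rh j z*abs (eh (x-z)-eh x) <= rh j z*(e/2)" using rh(2) by(rule mult_left_mono)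
     thus ?thesis
      using rh(2)[of j z] by(simp add:right_diff_distrib[symmetric] abs_mult)
    qed simp
   qed (use int rh(4) in auto)
   also have "... = e/2" using rh(5) by simp
   finally show "norm (th j x-eh x) < e" using e by simp
  qed
 qed
 obtain M where M: "0 <= M" "energy UNIV eh = en M" using e by(cases "energy UNIV eh") auto
 have "energy UNIV (th j) <= en (La*La*M)" for j
  using energy_convolution[OF rh(4,2,5) _ ehB th, of j] M La0 by(simp add:ennreal_mult)
 thus ?thesis
  using that[OF V(1,2,6) tht th0 thB thV lim, of "La*La*M"] M La0 by simp
qed

lemma test_function_energy:
 assumes "eh : test_functions E"
 shows "V : sets borel ==> em V < infy ==> energy V eh < infy"
proof -
 obtain L S B where L: "0 < L" "!!x y. (abs (eh x-eh y)) <= L*norm (x-y)" "0 < B" "!!x. (abs (eh x)) <= B" "continuous_on UNIV eh"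
  by(rule test_function_lipschitz[OF assms]) blast
 assume V: "V : sets borel" "em V < infy"
 have [measurable]: "eh : Bor" by(rule borel_measurable_continuous_onI[OF L(5)])
 have "energy V eh <= en ((2*B) powr p*(lip_const*(2*B/L) powr-(s*p)))*em V"
 proof(rule energy_lipschitz)
  show "abs (eh x-eh y) <= 2*B" for x y using L(4)[of x] L(4)[of y] by linarith
  show "abs (eh x-eh y) <= 2*B*(norm (x-y)/(2*B/L))" for x y
   using L(1,3) L(2)[of x y] by(simp add:mult.commute)
 qed (use V L in auto)
 also have "... < infy" using V by(simp add:ennreal_mult_less_top)
 finally show ?thesis .
qed

lemma tail_spaceI:
 assumes F: "F : borel_measurable lebesgue" "AL x. F x = ereal (f x)" and f: "tail f"
 shows "F : tail_space s p"
proof -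
 let ?F = "%lebesgue. (\<integral>\<^sup>+x. abs_powr (F x) (p-1)*en ((1+norm x) powr (- real DIM('a)-s*p)) \<partial>lebesgue)"
 have [measurable]: "f : Bor" using f by(rule tail_measurable)
 have ae: "AE x in lebesgue. abs_powr (F x) (p-1) = en (f x |^ (p-1))"
  using AE_completion[OF F(2)] by eventually_elim (simp add:abs_powr_def)
 have "F : Lq_loc (p-1) UNIV"
  unfolding Lq_loc_def Lq_def mem_Collect_eq
 proof(intro allI impI conjI)
  fix D :: "'a set" assume D: "open D & D \<Subset> UNIV"
  have [measurable]: "D : sets borel" using D by simp
  have bD: "bounded D" using D bounded_subset[OF compact_imp_bounded closure_subset] by(auto simp:compactly_contained_def)
  show "F : borel_measurable (lebesgue_on D)" by(rule measurable_restrict_space1[OF F(1)])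
  have "(\<integral>\<^sup>+x\<in>D. abs_powr (F x) (p-1) \<partial>lebesgue) = (\<integral>\<^sup>+x\<in>D. en (f x |^ (p-1)) \<partial>lebesgue)"
   by(rule nn_integral_cong_AE) (use ae in eventually_elim, simp)
  thus "(\<integral>\<^sup>+x\<in>D. abs_powr (F x) (p-1) \<partial>lebesgue) < infy"
   using tail_bounded_integral[OF f bD] by(simp add:nn_integral_completion)
 qed
 moreover have "?F lebesgue < infy"
 proof -
  have "?F lebesgue = (\<integral>\<^sup>+x. en (f x |^ (p-1)*wt x) \<partial>lebesgue)"
   by(rule nn_integral_cong_AE) (use ae in eventually_elim, simp add:ennreal_mult wt_def)
  thus ?thesis using f by(simp add:nn_integral_completion tail_def)
 qed
 ultimately show ?thesis by(simp add:tail_space_def)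
qed

lemma tail_spaceD:
 assumes "F : tail_space s p" "AL x. F x = ereal (f x)" and [measurable]: "f : Bor"
 shows "tail f"
proof -
 have ae: "AE x in lebesgue. abs_powr (F x) (p-1) = en (f x |^ (p-1))"
  using AE_completion[OF assms(2)] by eventually_elim (simp add:abs_powr_def)
 have "(NL x. en (f x |^ (p-1)*wt x)) = (\<integral>\<^sup>+x. en (f x |^ (p-1)*wt x) \<partial>lebesgue)"
  by(rule nn_integral_completion[symmetric])
 also have "... = (\<integral>\<^sup>+x. abs_powr (F x) (p-1)*en ((1+norm x) powr (- real DIM('a)-s*p)) \<partial>lebesgue)"
  by(rule nn_integral_cong_AE) (use ae in eventually_elim, simp add:ennreal_mult wt_def)
 also have "... < infy" using assms(1) by(simp add:tail_space_def)
 finally show ?thesis by(simp add:tail_def)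
qed

end

lemma Lq_integral:
 fixes F :: "'a::euclidean_space => ereal"
 assumes "AL x. F x = ereal (f x)"
 shows "(\<integral>\<^sup>+x\<in>D. abs_powr (F x) q \<partial>lebesgue) = (\<integral>\<^sup>+x\<in>D. en (f x |^ q) \<partial>lborel)"
proof -
 have "AE x in lebesgue. abs_powr (F x) q*ind D x = en (f x |^ q)*ind D x"
  using AE_completion[OF assms] by eventually_elim (simp add:abs_powr_def)
 hence "(\<integral>\<^sup>+x\<in>D. abs_powr (F x) q \<partial>lebesgue) = (\<integral>\<^sup>+x\<in>D. en (f x |^ q) \<partial>lebesgue)"
  by(rule nn_integral_cong_AE)
 thus ?thesis by(simp add:nn_integral_completion)
qed

lemma W_seminorm_integral:
 fixes F :: "'a::euclidean_space => ereal"
 assumes "AL x. F x = ereal (f x)"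
 shows "(\<integral>\<^sup>+z\<in>U \<times> U. (case z of (x, y) => abs_powr (F x-F y) q/en (norm (x-y) powr N)) \<partial>(lebesgue :: ('a \<times> 'a) measure)) = (NL z. en (dl f z |^ q*norm (fst z-snd z) powr-N)*ind (U \<times> U) z)"
proof -
 have "AE z in (lebesgue :: ('a \<times> 'a) measure). (case z of (x, y) => abs_powr (F x-F y) q/en (norm (x-y) powr N))*ind (U \<times> U) z = en (dl f z |^ q*norm (fst z-snd z) powr-N)*ind (U \<times> U) z"
  using AE_completion[OF AE_prod_lborelI(1)[OF assms]] AE_completion[OF AE_prod_lborelI(2)[OF assms]]
 proof eventually_elim
  case (elim z)
  obtain x y where z: "z = (x, y)" by(cases z)
  have "abs_powr (F x-F y) q = en ((f x-f y) |^ q)" using elim by(simp add:z abs_powr_def)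
  \<comment> \<open>On the diagonal both sides vanish, since 0/0 is 0 in
    \<open>ennreal\<close>.\<close>
  thus ?case
   by(cases "x = y") (auto simp:z dl_def divide_ennreal powr_minus divide_inverse split:split_indicator)
 qed
 hence "(\<integral>\<^sup>+z\<in>U \<times> U. (case z of (x, y) => abs_powr (F x-F y) q/en (norm (x-y) powr N)) \<partial>(lebesgue :: ('a \<times> 'a) measure)) = (\<integral>\<^sup>+z. en (dl f z |^ q*norm (fst z-snd z) powr-N)*ind (U \<times> U) z \<partial>lebesgue)"
  by(rule nn_integral_cong_AE)
 thus ?thesis by(simp add:nn_integral_completion)
qed

locale kernel_version = frac_kernel s p La k for s p La and k :: "'a::euclidean_space => 'a => real" +
 fixes K :: "'a => 'a => real"
 assumes K_eq: "AL z. K (fst z) (snd z) = k (fst z) (snd z)"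
begin

lemma weak_integrand_integral:
 assumes f: "AL x. f x = g x" and [measurable]: "g : Bor" "eh : Bor"
 shows "integrable lebesgue (weak_integrand p K f eh) \<longleftrightarrow> integrable mu (%z. jp p (dl g z)*dl eh z)" (is ?A)
  and "integral\<^sup>L lebesgue (weak_integrand p K f eh) = (BM z. jp p (dl g z)*dl eh z)" (is ?B)
proof -
 let ?F = "weak_integrand p K f eh"
 define h where "h z = k (fst z) (snd z)*(jp p (dl g z)*dl eh z)" for z
 have [measurable]: "h : Bor" unfolding h_def[abs_def] by measurable
 have hm: "h : borel_measurable lebesgue" by(rule measurable_completion) simp
 have ae: "AE z in lebesgue. weak_integrand p K f eh z = h z"
  using AE_completion[OF AE_prod_lborelI(1)[OF f]] AE_completion[OF AE_prod_lborelI(2)[OF f]] AE_completion[OF K_eq]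
 proof eventually_elim
  case (elim z)
  obtain x y where z: "z = (x, y)" by(cases z)
  show ?case using elim by(simp add:z weak_integrand_def h_def dl_def jp_eq)
 qed
 have wm: "?F : borel_measurable lebesgue"
  by(rule borel_measurable_AE[OF hm]) (use ae in eventually_elim, simp)
 have "integrable lebesgue (?F) \<longleftrightarrow> integrable lebesgue h"
  by(rule integrable_cong_AE[OF wm hm ae])
 also have "... \<longleftrightarrow> integrable lborel h" by(rule integrable_completion) simp
 also have "... \<longleftrightarrow> integrable mu (%z. jp p (dl g z)*dl eh z)"
  unfolding mu_def h_def by(subst integrable_density) (auto simp:k_nonneg)
 finally show ?A .
 have "integral\<^sup>L lebesgue (?F) = integral\<^sup>L lebesgue h"
  by(rule integral_cong_AE[OF wm hm ae])
 also have "... = integral\<^sup>L lborel h" by(rule integral_completion) simp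
 also have "... = (BM z. jp p (dl g z)*dl eh z)"
  unfolding mu_def h_def by(subst integral_density) (auto simp:k_nonneg)
 finally show ?B .
qed

lemma energy_le_seminorm:
 assumes [measurable]: "f : Bor" "U : sets borel"
 shows "energy U f <= en La*(NL z. en (dl f z |^ p*norm (fst z-snd z) powr-(real DIM('a)+s*p))*ind (U \<times> U) z)"
  and "(NL z. en (dl f z |^ p*norm (fst z-snd z) powr-(real DIM('a)+s*p))*ind (U \<times> U) z) <= en La*energy U f"
proof -
 let ?A = "%z. dl f z |^ p*norm (fst z-snd z) powr-(real DIM('a)+s*p)"
 let ?G = "%z. en (k (fst z) (snd z))*(en (dl f z |^ p)*ind (U \<times> U) z)"
 let ?F = "%z. en (?A z)*ind (U \<times> U) z"
 have e: "energy U f = (NL z. ?G z)"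
  unfolding energy_def mu_def by(rule nn_integral_density) measurable
 have "energy U f <= (NL z. en La*(?F z))"
  unfolding e
 proof(rule nn_integral_mono)
  fix z
  have "en (k (fst z) (snd z))*en (dl f z |^ p) <= en (La*norm (fst z-snd z) powr-(real DIM('a)+s*p))*en (dl f z |^ p)"
   by(intro mult_right_mono ennreal_leI k_upper) auto
  also have "... = en La*en (?A z)"
   using La0 by(simp add:ennreal_mult mult_ac)
  finally show "?G z <= en La*(?F z)"
   by(auto split:split_indicator)
 qed
 also have "... = en La*(NL z. ?F z)"
  by(rule nn_integral_cmult) measurable
 finally show "energy U f <= en La*(NL z. ?F z)" .
 have "(NL z. ?F z) <= (NL z. en La*(?G z))"
 proof(rule nn_integral_mono)
  fix z
  have "en (?A z) <= en (dl f z |^ p*(La * k (fst z) (snd z)))"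
   by(intro ennreal_leI mult_left_mono k_lower) auto
  also have "... = en La*(en (k (fst z) (snd z))*en (dl f z |^ p))"
   using La0 k_nonneg by(simp add:ennreal_mult mult_ac)
  finally show "?F z <= en La*(?G z)"
   by(auto split:split_indicator)
 qed
 also have "... = en La*energy U f" unfolding e by(rule nn_integral_cmult) measurable
 finally show "(NL z. ?F z) <= en La*energy U f" .
qed

lemma weak_supersolutionI:
 assumes F: "F : borel_measurable lebesgue" "AL x. F x = ereal (f x)" and f: "tail f" and E: "open E"
  and loc: "!!C. compact C ==> C <= E ==> energy C f < infy" "!!C. compact C ==> C <= E ==> (\<integral>\<^sup>+x\<in>C. en (f x |^ p) \<partial>lborel) < infy"
  and pos: "!!eh S. eh : test_functions E ==> (!!x. 0 <= eh x) ==> 0 <= (BM z. jp p (dl f z)*dl eh z)"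
 shows "weak_supersolution s p K E F"
proof -
 have [measurable]: "f : Bor" using f by(rule tail_measurable)
 have ae: "AE x in lebesgue. (abs (F x)) ~= infy" using AE_completion[OF F(2)] by eventually_elim simp
 have W: "F : W_loc s p E"
  unfolding W_loc_def W_def Lq_def mem_Collect_eq
 proof(intro allI impI conjI)
  fix D assume D: "open D & D \<Subset> E"
  have C: "compact (closure D)" "closure D <= E" using D by(auto simp:compactly_contained_def)
  have [measurable]: "D : sets borel" using D by simp
  show "F : borel_measurable (lebesgue_on D)" by(rule measurable_restrict_space1[OF F(1)])
  have "(\<integral>\<^sup>+x\<in>D. en (f x |^ p) \<partial>lborel) <= (\<integral>\<^sup>+x\<in>closure D. en (f x |^ p) \<partial>lborel)"
   using closure_subset[of D] by(intro nn_integral_mono) (auto split:split_indicator)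
  thus "(\<integral>\<^sup>+x\<in>D. abs_powr (F x) p \<partial>lebesgue) < infy"
   unfolding Lq_integral[OF F(2)] using loc(2)[OF C] by(rule order_le_less_trans)
  have "(NL z. en (dl f z |^ p*norm (fst z-snd z) powr-(real DIM('a)+s*p))*ind (D \<times> D) z) <= en La*energy D f"
   by(rule energy_le_seminorm(2)) measurable
  also have "... <= en La*energy (closure D) f" by(intro mult_left_mono energy_mono closure_subset) auto
  also have "... < infy" using loc(1)[OF C] by(simp add:ennreal_mult_less_top)
  finally show "(\<integral>\<^sup>+z\<in>D \<times> D. (case z of (x, y) => abs_powr (F x-F y) p/en (norm (x-y) powr (real DIM('a)+s*p))) \<partial>(lebesgue :: ('a \<times> 'a) measure)) < infy"
   unfolding W_seminorm_integral[OF F(2)] .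
 qed
 have neg: "neg_part F : tail_space s p"
 proof(rule tail_spaceI)
  show "neg_part F : borel_measurable lebesgue" unfolding neg_part_def[abs_def] using F(1) by measurable
  show "AL x. neg_part F x = ereal (max (- f x) 0)"
   using F(2) by eventually_elim (simp add:neg_part_def ereal_max[symmetric] zero_ereal_def del:ereal_max)
  show "tail (%x. max (- f x) 0)" by(rule tail_mono[OF f]) auto
 qed
 have "integrable lebesgue (weak_integrand p K (%x. real_of_ereal (F x)) eh) & 0 <= integral\<^sup>L lebesgue (weak_integrand p K (%x. real_of_ereal (F x)) eh)"
  if eh: "eh : test_functions E" "!!x. 0 <= eh x" for eh
 proof -
  obtain L S B where L: "compact S" "S <= E" "!!x. x ~: S ==> eh x = 0" "!!x. (abs (eh x)) <= B" "continuous_on UNIV eh"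
   by(rule test_function_lipschitz[OF eh(1)]) blast
  have m [measurable]: "eh : Bor" by(rule borel_measurable_continuous_onI[OF L(5)])
  have Fr: "AL x. real_of_ereal (F x) = f x" using F(2) by eventually_elim simp
  have "integrable mu (%z. jp p (dl f z)*dl eh z)"
  proof(cases "S = {}")
   case True
   hence "dl eh z = 0" for z using L(3) by(simp add:dl_def)
   thus ?thesis by simp
  next
   case False
   obtain V l where V: "compact V" "V <= E" "0 < l" "inside {x. infdist x S < l} V" "S <= {x. infdist x S < l}" "V ~= {}"
    by(rule compact_collar[OF L(1) False L(2) E])
   show ?thesis
   proof(rule integrable_jp_dl[OF f loc(1)[OF V(1,2)] V(4) m L(4)])
    show "eh x = 0" if "x ~: {x. infdist x S < l}" for x using that V(5) by(intro L(3)) auto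
    show "energy V eh < infy"
     using V(1) by(intro test_function_energy[OF eh(1)] emeasure_bounded_finite compact_imp_bounded) (simp_all add:borel_compact)
   qed
  qed
  thus ?thesis
   using weak_integrand_integral[OF Fr, of eh] pos[OF eh] by simp
 qed
 thus ?thesis using F(1) ae W neg by(auto simp:weak_supersolution_def)
qed

lemma weak_solution_borel:
 assumes v: "weak_solution s p K E v" and E: "open E"
  and [measurable]: "f : Bor" and vfe: "AL x. v x = ereal (f x)"
 shows "tail f" and "compact C ==> C <= E ==> energy C f < infy"
  and "eh : test_functions E ==> (!!x. 0 <= eh x) ==> (BM z. jp p (dl f z)*dl eh z) = 0"
proof -
 let ?G = "%z. jp p (dl (%x. - f x) z)*dl eh z"
 let ?F = "%z. jp p (dl f z)*dl eh z"
 have sup: "weak_supersolution s p K E v" "weak_supersolution s p K E (%x. - v x)"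
  using v by(auto simp:weak_solution_def weak_subsolution_def)
 have f: "AL x. real_of_ereal (v x) = f x" using vfe by eventually_elim simp
 have "AL x. neg_part v x = ereal (max (- f x) 0)"
  using vfe by eventually_elim (simp add:neg_part_def ereal_max[symmetric] zero_ereal_def del:ereal_max)
 moreover have "neg_part v : tail_space s p" using sup(1) by(simp add:weak_supersolution_def)
 ultimately have t1: "tail (%x. max (- f x) 0)" by(intro tail_spaceD) auto
 have "AL x. neg_part (%x. - v x) x = ereal (max (f x) 0)"
  using vfe by eventually_elim (simp add:neg_part_def ereal_max[symmetric] zero_ereal_def del:ereal_max)
 moreover have "neg_part (%x. - v x) : tail_space s p" using sup(2) by(simp add:weak_supersolution_def)
 ultimately have t2: "tail (%x. max (f x) 0)" by(intro tail_spaceD) auto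
 show "tail f" by(rule tail_mono[OF tail_add[OF t1 t2]]) auto
 show "energy C f < infy" if C: "compact C" "C <= E"
  proof(cases "C = {}")
   case False
   obtain V l where V: "compact V" "V <= E" "0 < l" "inside {x. infdist x C < l} V" "C <= {x. infdist x C < l}" "V ~= {}"
    by(rule compact_collar[OF C(1) False C(2) E])
   define D where "D = {x. infdist x C < l}"
   have D: "open D" unfolding D_def by(intro open_Collect_less continuous_intros)
   have "closure D <= V" using insideD[OF V(4)] V(1) by(intro closure_minimal compact_imp_closed) (auto simp:D_def)
   hence "D \<Subset> E"
    unfolding compactly_contained_def by(metis V(1,2) closed_closure compact_Int_closed inf.absorb_iff2 order_trans)
   hence "v : W s p D" using sup(1) D by(auto simp:weak_supersolution_def W_loc_def)
   hence "(\<integral>\<^sup>+z\<in>D \<times> D. (case z of (x, y) => abs_powr (v x-v y) p/en (norm (x-y) powr (real DIM('a)+s*p))) \<partial>(lebesgue :: ('a \<times> 'a) measure)) < infy"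
    by(simp add:W_def)
   hence "(NL z. en (dl f z |^ p*norm (fst z-snd z) powr-(real DIM('a)+s*p))*ind (D \<times> D) z) < infy"
    unfolding W_seminorm_integral[OF vfe] .
   hence "energy D f < infy"
    using D by(intro order_le_less_trans[OF energy_le_seminorm(1)]) (auto simp:ennreal_mult_less_top)
   thus ?thesis using energy_mono[of C D f] V(5) by(auto simp:D_def intro:order_le_less_trans)
  qed (simp add:energy_def)
 show "(BM z. ?F z) = 0" if eh: "eh : test_functions E" "!!x. 0 <= eh x"
 proof -
  obtain L S B where L: "continuous_on UNIV eh"
   by(rule test_function_lipschitz[OF eh(1)]) blast
  have m [measurable]: "eh : Bor" by(rule borel_measurable_continuous_onI[OF L])
  have "0 <= integral\<^sup>L lebesgue (weak_integrand p K (%x. real_of_ereal (v x)) eh)"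
   using sup(1) eh by(auto simp:weak_supersolution_def)
  hence 1: "0 <= (BM z. ?F z)"
   unfolding weak_integrand_integral(2)[OF f \<open>f : borel_measurable borel\<close> m] .
  have f': "AL x. real_of_ereal (- v x) = - f x" using f by eventually_elim simp
  have fm: "(%x. - f x) : Bor" by measurable
  have "0 <= integral\<^sup>L lebesgue (weak_integrand p K (%x. real_of_ereal (- v x)) eh)"
   using sup(2) eh by(auto simp:weak_supersolution_def)
  hence "0 <= (BM z. ?G z)"
   unfolding weak_integrand_integral(2)[OF f' fm m] .
  also have "(%z. ?G z) = (%z. - (?F z))"
  proof
   fix z
   have "dl (%x. - f x) z = - dl f z" by(simp add:dl_def)
   thus "?G z = - (?F z)" by simp
  qed
  finally show "(BM z. ?F z) = 0" using 1 by simp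
 qed
qed

end

text \<open>On \<open>Om\<close> pointwise values matter, and there \<open>u\<close> is kept as it
  is, Borel by lower semicontinuity. Elsewhere only its class up to null sets matters; infinite
  values are tracked by a separate Borel indicator.\<close>

lemma ereal_borel_version:
 fixes u :: "'a::euclidean_space => ereal"
 assumes u: "u : borel_measurable lebesgue" and Om: "open Om" "lower_semicontinuous_on Om u" and low: "AL x. - infy < u x"
 obtains ub where "ub : Bor" "AL x. u x = ub x" "!!x. x : Om ==> ub x = u x"
proof -
 have "(%x. real_of_ereal (u x)) : borel_measurable lebesgue" using u by measurable
 then obtain g where [measurable]: "g : Bor" and g: "AL x. real_of_ereal (u x) = g x"
  by(rule lebesgue_borel_version)
 have "(%x. if u x = infy then 1 else 0 :: real) : borel_measurable lebesgue" using u by measurable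
 then obtain i :: "'a => real" where [measurable]: "i : Bor" and i: "AL x. (if u x = infy then 1 else 0) = i x"
  by(rule lebesgue_borel_version)
 define v where "v x = (if x : Om then u x else-infy)" for x
 have [measurable]: "Om : sets borel" using Om by simp
 have [measurable]: "v : Bor"
 proof(rule borel_measurableI_greater)
  fix c
  have "{x : space borel. c < v x} = {x:Om. c < u x}" by(auto simp:v_def)
  thus "{x : space borel. c < v x} : sets borel" using open_superlevel[OF Om, of c] by simp
 qed
 define ub where "ub x = (if x : Om then v x else if i x = 1 then infy else ereal (g x))" for x
 have "ub : Bor" unfolding ub_def[abs_def] by measurable
 moreover have "AL x. u x = ub x"
  using g i low
 proof eventually_elim
  case (elim x)
  thus ?case by(cases "u x") (auto simp:ub_def v_def)
 qed
 ultimately show ?thesis by(rule that) (auto simp:ub_def v_def)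
qed

context kernel_version
begin

text \<open>Supplies \<open>u_comp\<close>. On the open set E where w > g + e the solution can be
  varied in both directions, so w - e solves the equation in E; off E it lies below g <= u. The
  comparison clause, used with E as its domain, gives w - e <= u, and e tends to 0.\<close>

lemma superharmonic_comparison:
 assumes sh: "superharmonic s p K Om u" and Om: "open Om"
 obtains ub where "comparison s p La k Om ub" "AL x. u x = ub x" "!!x. x : Om ==> ub x = u x"
proof -
 let ?A = "%C h. (\<integral>\<^sup>+y\<in>C. en (h y |^ p) \<partial>lborel)"
 let ?G = "%lebesgue. borel_measurable lebesgue"
 let ?F = "%x. (1+norm x) powr (- real DIM('a)-s*p)"
 let ?B = "%x. abs_powr (neg_part u x) (p-1)*en (?F x) ~= infy"
 have um: "u : ?G lebesgue" and ufin: "AL x. x : Om --> u x < infy" and ulow: "!!x. x : Om ==> - infy < u x"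
  and lsc: "lower_semicontinuous_on Om u" and neg: "neg_part u : tail_space s p"
  using sh by(auto simp:superharmonic_def AE_completion_iff)
 have all: "ALL x:D. v x <= u x" if "open D & D \<Subset> Om & continuous_weak_solution s p K D v & pos_part v : Linf & (ALL x:frontier D. v x <= u x) & (AE x in lebesgue. x ~: D --> v x <= u x)" for D v
  using sh that unfolding superharmonic_def by(elim conjE allE[of _ D] allE[of _ v]) blast
 have comp: "v x <= u x" if "open D" "D \<Subset> Om" "continuous_weak_solution s p K D v" "pos_part v : Linf"
  "!!x. x : frontier D ==> v x <= u x" "AL x. x ~: D --> v x <= u x" "x : D" for D v x
  using all[of D v] that AE_completion[OF that(6)] by blast
 have low: "AL x. - infy < u x"
 proof -
  have [measurable]: "neg_part u : ?G lebesgue" unfolding neg_part_def[abs_def] using um by measurable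
  have [measurable]: "(%x::'a. norm x) : ?G lebesgue" by(rule measurable_completion) simp
  have "(\<integral>\<^sup>+x. abs_powr (neg_part u x) (p-1)*en (?F x) \<partial>lebesgue) ~= infy"
   using neg by(simp add:tail_space_def less_top)
  hence "AE x in lebesgue. ?B x"
   by(rule nn_integral_PInf_AE[rotated]) (unfold abs_powr_def, measurable)
  hence "AL x. ?B x"
   by(simp only: AE_completion_iff)
  thus ?thesis
  proof eventually_elim
   case (elim x)
   have "0 < 1+norm x" by(simp add:add_pos_nonneg)
   hence "0 < ?F x" by simp
   hence "abs_powr (neg_part u x) (p-1) ~= infy" using elim by(auto simp:ennreal_mult_eq_top_iff)
   thus ?case by(cases "u x") (auto simp:abs_powr_def neg_part_def)
  qed
 qed
 obtain ub where ubm [measurable]: "ub : Bor" and ub: "AL x. u x = ub x" "!!x. x : Om ==> ub x = u x"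
  by(rule ereal_borel_version[OF um Om lsc low]) blast
 have "comparison s p La k Om ub"
 proof
  show "open Om" "ub : Bor" by fact+
  show "AL x. x : Om --> ub x < infy" using ufin by eventually_elim (simp add:ub(2))
  show "- infy < ub x" if "x : Om" for x using ulow[OF that] ub(2)[OF that] by simp
  have "{x:Om. c < ub x} = {x:Om. c < u x}" for c using ub(2) by auto
  thus "lower_semicontinuous_on Om ub" using lsc by(simp add:lower_semicontinuous_on_def)
  show ubl: "AL x. - infy < ub x" using low ub(1) by eventually_elim simp
  show "tail (%x. real_of_ereal (neg_part ub x))"
  proof(rule tail_spaceD[OF neg])
   show "AL x. neg_part u x = ereal (real_of_ereal (neg_part ub x))"
    using ub(1) ubl
   proof eventually_elim
    case (elim x)
    thus ?case
     by(cases "ub x") (simp_all add:neg_part_def ereal_max[symmetric] zero_ereal_def del:ereal_max)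
   qed
   show "(%x. real_of_ereal (neg_part ub x)) : Bor" unfolding neg_part_def by measurable
  qed
 next
  fix D D0 g lo hi A w x
  assume os: "obstacle_sol s p La k D D0 g lo hi A w" and wc: "continuous_on D w"
   and bd: "!!z e. z : frontier D ==> 0 < e ==> EX r>0. ALL x:ball z r Int D. w x <= g z+e"
   and DD: "closure D <= D0" "D0 <= Om" and gu: "!!x. x : D0 ==> ereal (g x) <= ub x" and gu': "AL x. ereal (g x) <= ub x"
   and x: "x : D"
  interpret os: obstacle_sol s p La k D D0 g lo hi A w by(rule os)
  have g_cont: "continuous_on D0 g" by(rule os.continuous_g)
  have D0: "D <= D0" using DD closure_subset by auto
  have gc: "continuous_on D g" by(rule continuous_on_subset[OF g_cont D0])
  have bD: "bounded (closure D)" by(rule bounded_subset[OF os.bounded_D0 DD(1)])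
  have eps: "ereal (w x) <= ub x+ereal e" if e: "0 < e" for e
  proof -
   define E where "E = {y:D. g y+e < w y}"
   have "open (D Int (%y. w y-g y) -` {e<..})"
    by(intro continuous_open_preimage continuous_intros gc wc os.open_D open_greaterThan)
   also have "D Int (%y. w y-g y) -` {e<..} = E" by(auto simp:E_def)
   finally have E: "open E" .
   have ED: "E <= D" by(auto simp:E_def)
   \<comment> \<open>At frontier points of \<open>D\<close> the hypothesis \<open>bd\<close> and the
     continuity of \<open>g\<close> give w <= g + e nearby, so E stays away from them. This makes w
     continuous on the closure of E.\<close>
   have cE: "closure E <= D"
   proof
    fix z assume z: "z : closure E"
    hence zD: "z : closure D" using closure_mono[OF ED] by auto
    show "z : D"
    proof(rule ccontr)
     assume "z ~: D"
     hence zf: "z : frontier D" using zD os.open_D by(simp add:frontier_def interior_open)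
     obtain r where r: "0 < r" "!!x. x : ball z r Int D ==> w x <= g z+e/2"
      using bd[OF zf, of "e/2"] e by auto
     have "z : D0" using zD DD(1) by auto
     then obtain d where d: "0 < d" "!!y. y : D0 ==> dist y z < d ==> dist (g y) (g z) < e/2"
      using g_cont e unfolding continuous_on_iff by(metis half_gt_zero)
     have "open (ball z (min r d))" "z : ball z (min r d)" using r(1) d(1) by auto
     hence "E Int ball z (min r d) ~= {}"
      using z by(metis disjoint_iff open_Int_closure_eq_empty Int_commute)
     then obtain y where y: "y : E" "dist z y < r" "dist z y < d" by auto
     have yD: "y : D" using y ED by auto
     have "w y <= g z+e/2" using r(2)[of y] y yD by auto
     moreover have "dist (g y) (g z) < e/2" using d(2)[of y] y yD D0 by(auto simp:dist_commute)
     hence "g z < g y+e/2" unfolding dist_real_def by linarith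
     ultimately show False using y by(simp add:E_def)
    qed
   qed
   have ccE: "compact (closure E)" by(simp add:compact_closure bounded_subset[OF bD] ED order_trans[OF ED closure_subset])
   define F where "F y = ereal (w y-e)" for y
   have [measurable]: "w : Bor" by(rule os.w_meas)
   have wD0: "abs (w y) <= abs lo+abs hi" if "y : D0" for y using os.w_lower[OF that] os.w_hi[of y] by linarith
   have Fm: "F : ?G lebesgue" unfolding F_def[abs_def] by(rule measurable_completion) simp
   have CD0: "C <= D0" if "C <= E" for C using that ED D0 by auto
   have fint: "?A C h < infy"
    if C: "compact C" "C <= E" and h: "!!y. y : D0 ==> abs (h y) <= abs lo+abs hi+e" for C h
   proof -
    have [measurable]: "C : sets borel" using C by(simp add:borel_compact)
    have "?A C h <= (NL y. en ((abs lo+abs hi+e) powr p)*ind C y)"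
     using CD0[OF C(2)] h p0 by(intro nn_integral_mono) (auto split:split_indicator intro!: ennreal_leI powr_mono2)
    also have "... < infy"
     using emeasure_bounded_finite[OF compact_imp_bounded[OF C(1)]] by(simp add:nn_integral_cmult_indicator ennreal_mult_less_top)
    finally show ?thesis .
   qed
   \<comment> \<open>On the support of \<open>eh\<close> one has w > g + e, so a step e/B with
     either sign stays above the obstacle, and the variational inequality holds for both
     signs.\<close>
   have test: "0 <= (BM z. jp p (dl w z)*dl (%x. c*eh x) z)" if eh: "eh : test_functions E" "!!x. 0 <= eh x" and c: "c = 1 | c = - 1" for eh c
   proof -
    obtain L S B where L: "compact S" "S <= E" "!!x. x ~: S ==> eh x = 0" "0 < B" "!!x. (abs (eh x)) <= B" "continuous_on UNIV eh"
     by(rule test_function_lipschitz[OF eh(1)]) blast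
    have [measurable]: "eh : Bor" by(rule borel_measurable_continuous_onI[OF L(6)])
    show ?thesis
    proof(rule os.w_var[where B = B and t = "e/B"])
     show "(%x. c*eh x) : Bor" by measurable
     show "abs (c*eh x) <= B" for x using c L(5)[of x] by(auto simp:abs_mult)
     show "c*eh x = 0" if "x ~: D" for x using L(2,3) ED that by auto
     have "energy D0 eh < infy"
      using os.open_D0 by(intro test_function_energy[OF eh(1)] emeasure_bounded_finite os.bounded_D0) simp
     moreover have "energy D0 (%x. c*eh x) <= energy D0 eh"
      by(rule energy_contraction) (use c in \<open>auto simp:abs_minus_commute\<close>)
     ultimately show "energy D0 (%x. c*eh x) < infy" by(rule order_le_less_trans[rotated])
     show "0 < e/B" using e L by simp
     show "g x <= w x+e/B*(c*eh x)" if "x : D" for x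
     proof(cases "x : S")
      case True
      have "abs (c*eh x) <= B" using c L(5)[of x] by(auto simp:abs_mult)
      hence "e/B * - B <= e/B*(c*eh x)" using e L(4) by(intro mult_left_mono) auto
      also have "e/B * - B = - e" using L(4) by simp
      finally have "- e <= e/B*(c*eh x)" .
      moreover have "g x+e < w x" using True L(2) by(auto simp:E_def)
      ultimately show ?thesis by linarith
     qed (use os.w_ge[of x] L(3) in simp)
    qed
   qed
   have "weak_supersolution s p K E F"
   proof(rule weak_supersolutionI[OF Fm _ tail_diff_const[OF os.w_tail] E])
    show "AL x. F x = ereal (w x-e)" by(simp add:F_def)
    show "energy C (%x. w x-e) < infy" if "compact C" "C <= E" for C
     using os.energy_sub[OF CD0[OF that(2)]] energy_contraction[of C "%x. w x-e" w] by(auto intro:order_le_less_trans)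
    show "(\<integral>\<^sup>+x\<in>C. en ((w x-e) |^ p) \<partial>lborel) < infy" if "compact C" "C <= E" for C
     by(rule fint[OF that]) (use wD0 e in \<open>force simp:abs_le_iff\<close>)
    show "0 <= (BM z. jp p (dl (%x. w x-e) z)*dl eh z)" if "eh : test_functions E" "!!x. 0 <= eh x" for eh
     using test[OF that, of 1] by(simp add:dl_def)
   qed
   moreover have "weak_supersolution s p K E (%x. - F x)"
   proof(rule weak_supersolutionI[OF _ _ tail_minus[OF tail_diff_const[OF os.w_tail]] E])
    show "(%x. - F x) : ?G lebesgue" using Fm by measurable
    show "AL x. - F x = ereal (- (w x-e))" by(simp add:F_def)
    show "energy C (%x. - (w x-e)) < infy" if "compact C" "C <= E" for C
     using os.energy_sub[OF CD0[OF that(2)]] energy_contraction[of C "%x. - (w x-e)" w] by(auto simp:abs_minus_commute intro:order_le_less_trans)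
    show "(\<integral>\<^sup>+x\<in>C. en ((- (w x-e)) |^ p) \<partial>lborel) < infy" if "compact C" "C <= E" for C
     by(rule fint[OF that]) (use wD0 e in \<open>force simp:abs_le_iff\<close>)
    show "0 <= (BM z. jp p (dl (%x. - (w x-e)) z)*dl eh z)" if "eh : test_functions E" "!!x. 0 <= eh x" for eh
    proof -
     have "jp p (dl (%x. - (w x-e)) z)*dl eh z = jp p (dl w z)*dl (%x. - 1*eh x) z" for z
     proof -
      have "dl (%x. - (w x-e)) z = - dl w z" by(simp add:dl_def)
      moreover have "dl (%x. - 1*eh x) z = - dl eh z" by(simp add:dl_def)
      ultimately show ?thesis by simp
     qed
     thus ?thesis using test[OF that, of "- 1"] by simp
    qed
   qed
   moreover have "continuous_on (closure E) F"
    unfolding F_def by(intro continuous_intros continuous_on_subset[OF wc cE])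
   ultimately have cws: "continuous_weak_solution s p K E F"
    by(simp add:continuous_weak_solution_def weak_solution_def weak_subsolution_def F_def)
   have "pos_part F : Linf"
    unfolding Linf_def mem_Collect_eq
   proof(intro conjI exI[of _ "abs hi"] AE_I2)
    show "pos_part F : ?G lebesgue" unfolding pos_part_def[abs_def] using Fm by measurable
    show "abs (pos_part F y) <= ereal (abs hi)" for y
     using os.w_hi[of y] e by(auto simp:pos_part_def F_def zero_ereal_def max_def)
   qed
   note c = comp[OF E _ cws this]
   have off: "w y-e <= g y" if "y ~: E" for y
    using that os.w_off[of y] e by(cases "y : D") (auto simp:E_def)
   have inE: "F y <= u y" if "y : E" for y
   proof(rule c[OF _ _ _ that])
    show "E \<Subset> Om" using ccE cE D0 DD by(auto simp:compactly_contained_def)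
    show "F y <= u y" if "y : frontier E" for y
    proof -
     have y: "y ~: E" "y : D" using that E cE by(auto simp:frontier_def interior_open)
     have "F y <= ereal (g y)" using off[OF y(1)] by(simp add:F_def)
     also have "... <= ub y" using gu y D0 by auto
     also have "ub y = u y" using y D0 DD ub(2) by auto
     finally show ?thesis .
    qed
    show "AL y. y ~: E --> F y <= u y"
     using gu' ub(1)
    proof eventually_elim
     case (elim y)
     show ?case
     proof
      assume "y ~: E"
      hence "F y <= ereal (g y)" using off by(simp add:F_def)
      thus "F y <= u y" using elim by simp
     qed
    qed
   qed
   have "F x <= ub x"
   proof(cases "x : E")
    case True
    thus ?thesis using inE[OF True] ub(2) x D0 DD by auto
   next
    case False
    have "F x <= ereal (g x)" using off[OF False] by(simp add:F_def)
    also have "... <= ub x" using gu x D0 by auto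
    finally show ?thesis .
   qed
   thus ?thesis by(cases "ub x") (auto simp:F_def)
  qed
  show "ereal (w x) <= ub x" by(rule ereal_le_epsilon2) (use eps in auto)
 qed
 thus ?thesis using ub by(rule that)
qed

text \<open>Enlarges the tests from smooth functions to continuous ones with compact support and
  finite energy: mollifications converge pointwise, with bounded energy and a common compact
  support, so \<open>jp_dl_tendsto_right\<close> applies.\<close>

lemma weak_solution_test:
 assumes f: "tail f" "!!C. compact C ==> C <= E ==> energy C f < infy"
   "!!eh. eh : test_functions E ==> (!!x. 0 <= eh x) ==> (BM z. jp p (dl f z)*dl eh z) = 0"
  and eh: "continuous_on UNIV eh" "!!x. 0 <= eh x" "!!x. eh x <= B" and S: "compact S" "S ~= {}" "S <= E" "open E"
  and ehS: "!!x. x ~: S ==> eh x = 0" and e: "energy UNIV eh < infy"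
 shows "(BM z. jp p (dl f z)*dl eh z) = 0"
proof -
 obtain S' th M where th: "compact S'" "S' <= E" "S' ~= {}" "!!j. th j : test_functions E" "!!j x. 0 <= th j x" "!!j x. th j x <= B"
  "!!j x. x ~: S' ==> th j x = 0" "!!x. (%j. th j x) ~> eh x" "0 <= M" "!!j. energy UNIV (th j) <= en M"
 proof(rule smooth_approximation[OF eh S ehS e])
  fix S' :: "'a set" and th :: "nat => 'a => real" and M :: real
  assume a: "compact S'" "S' <= E" "S' ~= {}" "!!j. th j : test_functions E" "!!j x. 0 <= th j x" "!!j x. th j x <= B"
   "!!j x. x ~: S' ==> th j x = 0" "!!x. (%j. th j x) ~> eh x" "0 <= M" "!!j. energy UNIV (th j) <= en M"
  show thesis by(rule that[OF a])
 qed
 obtain V l where V: "compact V" "V <= E" "0 < l" "inside {x. infdist x S' < l} V" "S' <= {x. infdist x S' < l}" "V ~= {}"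
  by(rule compact_collar[OF th(1,3,2) S(4)])
 have "th j : Bor" for j
  by(rule test_function_lipschitz[OF th(4)[of j]]) (rule borel_measurable_continuous_onI)
 moreover have "abs (th j x) <= B" for j x using th(5)[of j x] th(6)[of j x] by simp
 moreover have "th j x = 0" if "x ~: {x. infdist x S' < l}" for j x using that V(5) by(intro th(7)) auto
 moreover have "energy V (th j) <= en M" for j using energy_mono[of V UNIV "th j"] th(10)[of j] by simp
 ultimately have "(%j. BM z. jp p (dl f z)*dl (th j) z) ~> (BM z. jp p (dl f z)*dl eh z)"
  by(rule jp_dl_tendsto_right[OF V(4) f(1) f(2)[OF V(1,2)] _ _ _ th(8) _ th(9)])
 moreover have "(BM z. jp p (dl f z)*dl (th j) z) = 0" for j by(rule f(3)[OF th(4,5)])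
 ultimately show ?thesis by(simp add:LIMSEQ_const_iff)
qed

end

section \<open>Comparison with solutions that need not be bounded above\<close>

locale super = kernel_version s p La k K + comparison s p La k Om u
 for s p La and k K :: "'a::euclidean_space => 'a => real" and Om u
begin

text \<open>Without an upper bound for \<open>f\<close> the comparison clause is out of reach, so
  \<open>f\<close> is compared with the approximants. For large j the positive part of f - e - W1 on
  \<open>D\<close> is a test for both. The difference of the two weak forms has a nonpositive
  integral, while its integrand is nonnegative up to a fixed integrable far part. Fatou's lemma
  leaves in the limit a nonnegative integrand of integral 0, and strict monotonicity of
  \<open>jp\<close> excludes that f - e > u on a set of positive measure.\<close>

lemma unbounded_comparison_AE:
 assumes D: "open D" "D ~= {}" "compact (closure D)" "closure D <= Om"
  and f: "tail f" "!!C. compact C ==> C <= D ==> energy C f < infy"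
   "!!eh. eh : test_functions D ==> (!!x. 0 <= eh x) ==> (BM z. jp p (dl f z)*dl eh z) = 0"
  and fc: "continuous_on (closure D) f"
  and fD: "!!x. x : frontier D ==> ereal (f x) <= u x" and off: "AL x. x ~: D --> ereal (f x) <= u x"
  and e: "0 < e"
 shows "AL x. x : D --> f x-e <= ur x"
proof -
 let ?C = "closure D"
 let ?H = "%H. (NM z. en (H z))"
 let ?E = "real DIM('a)+s*p"
 let ?D = "%z eh j. jp p (dl f z)*dl (eh j) z"
 let ?B = "%B S h z. 2 powr (p-1)*B*farfun S D h z"
 let ?A = "%A x y. en (ind (A \<times> (- D)) (x, y))*en (k x y)"
 let ?G = "%Z r. (\<Union>z\<in>Z. ball z (r z))"
 let ?F = "%W2 j z eh. jp p (dl (W2 j) z)*dl (eh j) z"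
 have Om: "Om ~= {}" using D(2,4) closure_subset by auto
 have C: "compact ?C" "?C ~= {}" "?C <= Om" using D by auto
 have DC: "D <= ?C" by(rule closure_subset)
 note ufin = u_finite_AE(1)[OF Om] and utail = u_finite_AE(2)[OF Om]
 have [measurable]: "f : Bor" by(rule tail_measurable[OF f(1)])
 have [measurable]: "D : sets borel" using D by simp
 obtain Da D0 lo w where a: "open Da" "open D0" "bounded D0" "?C <= Da" "inside Da D0" "lo < 0" "closure D0 <= Om"
  "!!ka j. 0 < ka ==> EX g. obstacle_sol s p La k Da D0 g lo ka (real j+1) (w ka j)"
  "!!ka j. 0 < ka ==> continuous_on Da (w ka j)"
  "!!ka j x. 0 < ka ==> x : D0 ==> ereal (w ka j x) <= u x"
  "!!ka j x. x ~: D0 ==> w ka j x = trunc_at u ka x"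
  "!!ka j x. 0 < ka ==> x : D0 ==> lo <= w ka j x" 
  "!!x c. x : D0 ==> ereal c < u x ==> EX r>0. EX J. ALL j>=J. ALL ka>0. c <= ka --> (ALL y:ball x r Int D0. c <= w ka j y)"
  "!!x. - infy < u x ==> (%i. ereal (w (real i+1) i x)) ~> u x"
  by(rule approximants[OF C]) blast
 define W1 where "W1 j = w (real j+1) j" for j :: nat
 have k0: "0 < real j+1" for j :: nat by(simp add:add_nonneg_pos)
 have DaD0: "Da <= D0" by(rule insideD[OF a(5)])
 have CD0: "?C <= D0" using a(4) DaD0 by auto
 have os: "EX g. obstacle_sol s p La k Da D0 g lo (real j+1) (real j+1) (W1 j)" for j
  unfolding W1_def by(rule a(8)[OF k0])
 have Wm [measurable]: "W1 j : Bor" for j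
  using os[of j] obstacle_sol.w_meas by blast
 have Wc: "continuous_on ?C (W1 j)" for j
  unfolding W1_def by(rule continuous_on_subset[OF a(9)[OF k0] a(4)])
 have Wlo: "lo <= W1 j x" if "x : D0" for j x unfolding W1_def by(rule a(12)[OF k0 that])
 have Wlim: "(%j. ereal (W1 j x)) ~> u x" if "- infy < u x" for x unfolding W1_def by(rule a(14)[OF that])
 have "compact (f ` ?C)" by(rule compact_continuous_image[OF fc C(1)])
 then obtain B0 where "ALL x:?C. (abs (f x)) <= B0" by(auto dest!: compact_imp_bounded simp:bounded_iff)
 hence B0: "!!x. x : ?C ==> abs (f x) <= B0" by blast
 define B where "B = abs B0+abs lo"
 have loc: "EX r>0. EX J. ALL j>=J. ALL y:ball z r Int ?C. f y-e <= W1 j y" if z: "z : frontier D" for z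
 proof -
  have zC: "z : ?C" using z by(simp add:frontier_def)
  have "ereal (f z-e/2) < ereal (f z)" using e by simp
  also have "ereal (f z) <= u z" by(rule fD[OF z])
  finally obtain r J where r: "0 < r" and J: "!!j ka y. J <= j ==> 0 < ka ==> f z-e/2 <= ka ==> y : ball z r Int D0 ==> f z-e/2 <= w ka j y"
   using a(13)[of z "f z-e/2"] zC CD0 by blast
  obtain d where d: "0 < d" "!!y. y : ?C ==> dist y z < d ==> dist (f y) (f z) < e/2"
   using fc zC e unfolding continuous_on_iff by(metis half_gt_zero)
  obtain J' :: nat where J': "f z-e/2 <= real J'" using real_arch_simple by blast
  show ?thesis
  proof(intro exI[of _ "min r d"] conjI exI[of _ "max J J'"] allI impI ballI)
   fix j y assume j: "max J J' <= j" and y: "y : ball z (min r d) Int ?C"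
   have "f z-e/2 <= real j+1" using J' j by linarith
   hence "f z-e/2 <= W1 j y" unfolding W1_def using y j CD0 k0[of j] by(intro J) auto
   moreover have "abs (f y-f z) < e/2" using d(2)[of y] y by(auto simp:dist_real_def dist_commute)
   ultimately show "f y-e <= W1 j y" by linarith
  qed (use r d in auto)
 qed
 \<comment> \<open>Compactness of the frontier makes the local bounds uniform: for all j >= J the
   positive set of f - e - W1 lies in one compact subset of \<open>D\<close>.\<close>
 obtain S J where S: "compact S" "S <= D" "S ~= {}" "!!j y. J <= j ==> y : D ==> y ~: S ==> f y-e <= W1 j y"
 proof -
  from loc obtain r J where rJ: "!!z. z : frontier D ==> 0 < r z" "!!z j y. z : frontier D ==> J z <= j ==> y : ball z (r z) ==> y : ?C ==> f y-e <= W1 j y"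
   by(metis IntI)
  have "compact (frontier D)" using C(1) by(metis compact_frontier_bounded compact_imp_bounded bounded_subset DC)
  moreover have "frontier D <= (\<Union>z\<in>frontier D. ball z (r z))" using rJ(1) by auto
  ultimately obtain Z where Z: "Z <= frontier D" "finite Z" "frontier D <= ?G Z r"
   using compactE_image[of "frontier D" "frontier D" "%z. ball z (r z)"] open_ball by blast
  obtain x1 where x1: "x1 : D" using D by auto
  define S where "S = insert x1 (?C-?G Z r)"
  have "compact (?C-?G Z r)" by(intro compact_diff C(1)) auto
  hence "compact S" unfolding S_def by(rule compact_insert)
  moreover have "?C-?G Z r <= D" using Z(3) D(1) by(auto simp:frontier_def interior_open)
  hence "S <= D" using x1 by(simp add:S_def)
  moreover have "f y-e <= W1 j y" if h: "Max (insert 0 (J ` Z)) <= j" "y : D" "y ~: S" for j y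
  proof -
   obtain z where z: "z : Z" "y : ball z (r z)" using h(2,3) DC by(auto simp:S_def)
   have "J z <= Max (insert 0 (J ` Z))" using Z(2) z(1) by(intro Max_ge) auto
   thus ?thesis using rJ(2)[of z j y] z Z(1) h DC by auto
  qed
  moreover have "S ~= {}" by(simp add:S_def)
  ultimately show thesis using that by blast
 qed
 obtain V l where V: "compact V" "V <= D" "0 < l" "inside {x. infdist x S < l} V" "S <= {x. infdist x S < l}" "V ~= {}"
  by(rule compact_collar[OF S(1,3,2) D(1)])
 have SD: "inside S D" by(rule inside_compact_open[OF S(1) D(1) S(2)])
 have [measurable]: "S : sets borel" "V : sets borel" using S V by(auto simp:borel_compact)
 define eh where "eh j x = (if x : D then max (f x-e-W1 j x) 0 else 0)" for j x
 have [measurable]: "eh j : Bor" for j unfolding eh_def[abs_def] by measurable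
 have eh0: "0 <= eh j x" for j x by(simp add:eh_def)
 have B0': "0 <= B" by(simp add:B_def)
 have ehB: "eh j x <= B" for j x
 proof(cases "x : D")
  case True
  hence "abs (f x) <= B0" "lo <= W1 j x" using B0 Wlo DC CD0 by auto
  thus ?thesis using e True by(auto simp:eh_def B_def)
 qed (use B0' in \<open>simp add:eh_def\<close>)
 have ehS: "eh j x = 0" if "J <= j" "x ~: S" for j x using S(4)[OF that(1), of x] that(2) by(auto simp:eh_def)
 have ehc: "continuous_on UNIV (eh j)" if j: "J <= j" for j
 proof -
  have "continuous_on D (%x. max (f x-e-W1 j x) 0)"
   by(intro continuous_intros continuous_on_subset[OF fc DC] continuous_on_subset[OF Wc DC])
  hence 1: "continuous_on D (eh j)" by(rule continuous_on_eq) (simp add:eh_def)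
  have 2: "continuous_on (- S) (eh j)"
   by(rule continuous_on_eq[OF continuous_on_const[of _ 0]]) (use ehS[OF j] in auto)
  have "continuous_on (D Un-S) (eh j)"
   using S(1) by(intro continuous_on_open_Un D(1) 1 2) (simp add:compact_imp_closed open_Compl)
  moreover have "D Un-S = UNIV" using S(2) by auto
  ultimately show ?thesis by simp
 qed
 have ehe: "energy X (eh j) < infy" if j: "J <= j" for j X
 proof(rule energy_extend[OF V(4)])
  obtain g where "obstacle_sol s p La k Da D0 g lo (real j+1) (real j+1) (W1 j)" using os by blast
  then interpret os: obstacle_sol s p La k Da D0 g lo "real j+1" "real j+1" "W1 j" .
  have "energy V (eh j) <= en (2 powr p)*(energy V f+energy V (W1 j))"
   by(rule energy_le_sum) (use V(2) in \<open>auto simp:eh_def max_def\<close>)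
  also have "... < infy"
   using f(2)[OF V(1,2)] os.energy_sub[of V] V(2) DC CD0 by(auto simp:ennreal_mult_less_top)
  finally show "energy V (eh j) < infy" .
  show "eh j x = 0" if "x ~: {x. infdist x S < l}" for x using that V(5) by(intro ehS[OF j]) auto
  show "abs (eh j x) <= B" for x using eh0[of j x] ehB[of j x] by simp
 qed measurable
 \<comment> \<open>Changed on a null set so that |W2| <= |h| holds at every point, as
   \<open>jp_dl_far_le\<close> requires, although \<open>ur\<close> is 0 where \<open>u\<close> is
   infinite.\<close>
 define W2 where "W2 j x = (if abs (u x) = infy then 0 else W1 j x)" for j x
 have [measurable]: "W2 j : Bor" for j unfolding W2_def[abs_def] by measurable
 have W21: "AL x. W2 j x = W1 j x" for j using ufin by eventually_elim (simp add:W2_def)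
 define h where "h x = abs (f x)+(abs (ur x)+abs lo)" for x
 have h_tail: "tail h"
 proof -
  have "tail (%x. (abs (f x)))" by(rule tail_mono[OF f(1)]) auto
  moreover have "tail (%x. (abs (ur x)))" by(rule tail_mono[OF utail]) auto
  ultimately show ?thesis unfolding h_def[abs_def] by(intro tail_add tail_const)
 qed
 have fh: "abs (f x) <= abs (h x)" for x by(simp add:h_def del:abs_real_of_ereal)
 have Wh: "abs (W2 j x) <= abs (h x)" for j x
 proof(cases "abs (u x) = infy")
  case False
  have "abs (W1 j x) <= abs (ur x)+abs lo"
  proof(cases "x : D0")
   case True
   have "ereal (W1 j x) <= u x" unfolding W1_def by(rule a(10)[OF k0 True])
   hence "W1 j x <= ur x" using False by(cases "u x") auto
   thus ?thesis using Wlo[OF True, of j] by linarith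
  next
   case xD: False
   have "W1 j x = trunc_at u (real j+1) x" unfolding W1_def by(rule a(11)[OF xD])
   also have "... = min (ur x) (real j+1)" using False by(cases "u x") (auto simp:trunc_at_def min_def)
   finally have "W1 j x = min (ur x) (real j+1)" .
   moreover have "abs (min t (real j+1)) <= abs t+abs lo" for t by(auto simp:min_def)
   ultimately show ?thesis by(simp only:)
  qed
  thus ?thesis using False by(simp add:W2_def h_def del:abs_real_of_ereal)
 qed (simp add:W2_def)
 \<comment> \<open>Compensates the negative part of \<open>G j\<close> off D x D, uniformly in j. On
   D x D monotonicity of \<open>jp\<close> makes \<open>G j\<close> nonnegative almost
   everywhere.\<close>
 define H where "H z = 2*(?B B S h z)*ind (- (D \<times> D)) z" for z
 have [measurable]: "h : Bor" using h_tail by(rule tail_measurable)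
 have [measurable]: "H : Bor" unfolding H_def[abs_def] by measurable
 have H0: "0 <= H z" for z using B0' farfun_nonneg[of S D h z] by(simp add:H_def)
 have Hint: "integrable mu H"
 proof(rule integrableI_nonneg)
  have "?H H <= (NM z. en (2*(2 powr (p-1)*B))*en (farfun S D h z))"
   using B0' farfun_nonneg[of S D h] by(intro nn_integral_mono) (auto simp:H_def ennreal_mult[symmetric] mult.assoc split:split_indicator)
  also have "... = en (2*(2 powr (p-1)*B))*(NM z. en (farfun S D h z))"
   by(rule nn_integral_cmult) measurable
  also have "... < infy" using farfun_finite[OF h_tail SD] by(simp add:ennreal_mult_less_top)
  finally show "?H H < infy" .
 qed (use H0 in auto)
 define G where "G j z = (jp p (dl f z)-jp p (dl (W2 j) z))*dl (eh j) z" for j z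
 have [measurable]: "G j : Bor" for j unfolding G_def[abs_def] by measurable
 have Gint: "integrable mu (G j)" "(BM z. G j z) <= 0" if j: "J <= j" for j
 proof -
  obtain g where "obstacle_sol s p La k Da D0 g lo (real j+1) (real j+1) (W1 j)" using os by blast
  then interpret os: obstacle_sol s p La k Da D0 g lo "real j+1" "real j+1" "W1 j" .
  have ehab: "abs (eh j x) <= B" for x using eh0[of j x] ehB[of j x] by simp
  have ehU: "eh j x = 0" if "x ~: {x. infdist x S < l}" for x using that V(5) by(intro ehS[OF j]) auto
  have i1: "integrable mu (%z. ?D z eh j)"
   by(rule integrable_jp_dl[OF f(1) f(2)[OF V(1,2)] V(4) _ ehab ehU ehe[OF j]]) measurable
  have "V <= D0" using V(2) DC CD0 by auto
  hence i2: "integrable mu (%z. jp p (dl (W1 j) z)*dl (eh j) z)"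
   by(intro integrable_jp_dl[OF os.w_tail os.energy_sub V(4) _ ehab ehU ehe[OF j]]) measurable
  have ae: "AE z in mu. jp p (dl (W1 j) z)*dl (eh j) z = ?F W2 j z eh"
   using AE_muI[OF W21[of j]] by eventually_elim (simp add:dl_def)
  have i3: "integrable mu (%z. ?F W2 j z eh)"
   using i2 by(subst integrable_cong_AE[OF _ _ ae, symmetric]) measurable
  have Geq: "G j = (%z. ?D z eh j-?F W2 j z eh)"
   by(auto simp:G_def algebra_simps)
  show "integrable mu (G j)" unfolding Geq by(intro Bochner_Integration.integrable_diff i1 i3)
  have z1: "(BM z. ?D z eh j) = 0"
   by(rule weak_solution_test[OF f ehc[OF j] eh0 ehB S(1,3,2) D(1) ehS[OF j] ehe[OF j]])
  have "0 <= (BM z. jp p (dl (W1 j) z)*dl (eh j) z)"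
  proof(rule os.w_var[where B = B and t = 1])
   show "eh j x = 0" if "x ~: Da" for x using that a(4) DC by(auto simp:eh_def)
   show "g x <= W1 j x+1*eh j x" for x using os.w_ge[of x] eh0[of j x] by simp
  qed (use ehab ehe[OF j] in auto)
  also have "... = (BM z. ?F W2 j z eh)"
   by(rule integral_cong_AE[OF _ _ ae]) measurable
  finally show "(BM z. G j z) <= 0"
   unfolding Geq by(subst Bochner_Integration.integral_diff[OF i1 i3]) (simp add:z1)
 qed
 have Glow: "AE z in mu. 0 <= G j z+H z" if j: "J <= j" for j
  using AE_muI[OF W21[of j]]
 proof eventually_elim
  case (elim z)
  obtain x y where z: "z = (x, y)" by(cases z)
  show "0 <= G j z+H z"
  proof(cases "z : D \<times> D")
   case True
   hence xy: "x : D" "y : D" by(auto simp:z)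
   have "0 <= G j z"
   proof(cases "f y-W1 j y <= f x-W1 j x")
    case le: True
    have "jp p (W2 j x-W2 j y) <= jp p (f x-f y)" using le elim by(intro jp_mono p1) (simp add:z)
    moreover have "eh j y <= eh j x" using le xy by(auto simp:eh_def)
    ultimately show ?thesis by(simp add:G_def z dl_def)
   next
    case False
    have "jp p (f x-f y) <= jp p (W2 j x-W2 j y)" using False elim by(intro jp_mono p1) (simp add:z)
    moreover have "eh j x <= eh j y" using False xy by(auto simp:eh_def)
    ultimately show ?thesis by(simp add:G_def z dl_def mult_nonpos_nonpos)
   qed
   thus ?thesis using H0[of z] by simp
  next
   case False
   have ehab: "abs (eh j x) <= B" for x using eh0[of j x] ehB[of j x] by simp
   have "abs (?D z eh j) <= ?B B S h z"
    by(rule jp_dl_far_le[OF S(2) fh ehab ehS[OF j] False])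
   moreover have "abs (?F W2 j z eh) <= ?B B S h z"
    by(rule jp_dl_far_le[OF S(2) Wh ehab ehS[OF j] False])
   moreover have "G j z = ?D z eh j-?F W2 j z eh" by(simp add:G_def algebra_simps)
   moreover have "H z = 2*(?B B S h z)" using False by(simp add:H_def)
   ultimately show ?thesis by linarith
  qed
 qed
 define ze where "ze x = (if x : D then max (f x-e-ur x) 0 else 0)" for x
 have [measurable]: "ze : Bor" unfolding ze_def[abs_def] by measurable
 define G0 where "G0 z = (jp p (dl f z)-jp p (dl ur z))*dl ze z" for z
 have [measurable]: "G0 : Bor" unfolding G0_def[abs_def] by measurable
 have W2lim: "AL x. (%j. W2 j x) ~> ur x & (%j. eh j x) ~> ze x"
  using ufin
 proof eventually_elim
  case (elim x)
  hence "(%j. ereal (W1 j x)) ~> ereal (ur x)" using Wlim[of x] by(cases "u x") auto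
  hence l1: "(%j. W1 j x) ~> ur x" by simp
  moreover have "(%j. eh j x) ~> ze x"
   unfolding eh_def ze_def by(cases "x : D") (auto intro!: tendsto_intros l1)
  ultimately show ?case using elim by(simp add:W2_def)
 qed
 have Glim: "AE z in mu. (%j. G j z+H z) ~> G0 z+H z"
  using AE_muI[OF W2lim]
 proof eventually_elim
  case (elim z)
  thus ?case unfolding G_def G0_def dl_def by(intro tendsto_intros tendsto_jp p1) auto
 qed
 have G0pos: "AE z in mu. 0 <= G0 z"
  using AE_muI[OF off] AE_muI[OF ufin]
 proof eventually_elim
  case (elim z)
  obtain x y where z: "z = (x, y)" by(cases z)
  have xy: "f x <= ur x | x : D" "f y <= ur y | y : D" using elim by(auto simp:z intro:ereal_le_real_iff[THEN iffD1])
  show ?case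
  proof(cases "f y-ur y <= f x-ur x")
   case le: True
   have "jp p (ur x-ur y) <= jp p (f x-f y)" using le by(intro jp_mono p1) simp
   moreover have "ze y <= ze x" using le xy e by(auto simp:ze_def)
   ultimately show ?thesis by(simp add:G0_def z dl_def)
  next
   case False
   have "jp p (f x-f y) <= jp p (ur x-ur y)" using False by(intro jp_mono p1) simp
   moreover have "ze x <= ze y" using False xy e by(auto simp:ze_def)
   ultimately show ?thesis by(simp add:G0_def z dl_def mult_nonpos_nonpos)
  qed
 qed
 have "(NM z. en (G0 z)) = 0"
 proof -
  have "(NM z. en (G0 z))+?H H = (NM z. en (G0 z+H z))"
  proof(subst nn_integral_add[symmetric])
   show "(NM z. en (G0 z)+en (H z)) = (NM z. en (G0 z+H z))"
    by(rule nn_integral_cong_AE) (use G0pos in eventually_elim, use H0 in \<open>simp add:ennreal_plus\<close>)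
  qed measurable
  also have "... = (NM z. liminf (%j. en (G (j+J) z+H z)))"
  proof(rule nn_integral_cong_AE)
   show "AE z in mu. en (G0 z+H z) = liminf (%j. en (G (j+J) z+H z))"
    using Glim
   proof eventually_elim
    case (elim z)
    have "(%j. en (G (j+J) z+H z)) ~> en (G0 z+H z)"
     by(rule tendsto_ennrealI[OF LIMSEQ_ignore_initial_segment[OF elim]])
    thus ?case by(rule lim_imp_Liminf[symmetric, rotated]) simp
   qed
  qed
  also have "... <= liminf (%j. NM z. en (G (j+J) z+H z))"
   by(rule nn_integral_liminf) measurable
  also have "... <= en (BM z. H z)"
  proof(rule Liminf_le)
   show "\<forall>\<^sub>F j in sequentially. (NM z. en (G (j+J) z+H z)) <= en (BM z. H z)"
   proof(rule always_eventually, rule allI)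
    fix j
    have J: "J <= j+J" by simp
    have "(NM z. en (G (j+J) z+H z)) = en (BM z. G (j+J) z+H z)"
     by(rule nn_integral_eq_integral[OF Bochner_Integration.integrable_add[OF Gint(1)[OF J] Hint] Glow[OF J]])
    also have "(BM z. G (j+J) z+H z) = (BM z. G (j+J) z)+(BM z. H z)"
     by(rule Bochner_Integration.integral_add[OF Gint(1)[OF J] Hint])
    also have "en ... <= en (BM z. H z)" using Gint(2)[OF J] by(intro ennreal_leI) simp
    finally show "(NM z. en (G (j+J) z+H z)) <= en (BM z. H z)" .
   qed
  qed simp
  finally have le: "(NM z. en (G0 z))+?H H <= en (BM z. H z)" .
  have "?H H = en (BM z. H z)" using H0 by(intro nn_integral_eq_integral Hint) auto
  with le have "en (BM z. H z)+(NM z. en (G0 z)) <= en (BM z. H z)+0" by(simp add:add.commute)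
  thus ?thesis unfolding ennreal_add_left_cancel_le by simp
 qed
 hence G00: "AE z in mu. G0 z <= 0"
  by(subst (asm) nn_integral_0_iff_AE) (auto simp:ennreal_eq_0_iff)
 \<comment> \<open>At a pair of a point of \<open>A\<close> and a point off \<open>D\<close> the
   limit integrand is almost surely positive, so such pairs are null. Yet each point of
   \<open>A\<close> sees a definite kernel mass in a fixed ball outside the closure of
   \<open>D\<close>; hence \<open>A\<close> is null.\<close>
 define A where "A = {x:D. 0 < ze x}"
 have [measurable]: "A : sets borel" unfolding A_def by measurable
 have strict: "AE z in mu. z ~: A \<times> (- D)"
  using G00 AE_muI(2)[OF off] AE_muI(2)[OF ufin]
 proof eventually_elim
  case (elim z)
  obtain x y where z: "z = (x, y)" by(cases z)
  show ?case
  proof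
   assume "z : A \<times> (- D)"
   hence xy: "x : D" "0 < ze x" "y ~: D" by(auto simp:z A_def)
   have fy: "f y <= ur y" using elim xy by(auto simp:z intro:ereal_le_real_iff[THEN iffD1])
   have "ur x < f x" using xy e by(auto simp:ze_def split:if_splits)
   hence "jp p (ur x-ur y) < jp p (f x-f y)" using fy by(intro jp_strict_mono p1) simp
   moreover have "dl ze z = ze x" using xy by(simp add:dl_def z ze_def)
   ultimately have "0 < G0 z" using xy by(simp add:G0_def dl_def z)
   thus False using elim by simp
  qed
 qed
 have "bounded ?C" by(rule compact_imp_bounded[OF C(1)])
 then obtain R where R: "0 < R" "!!x. x : ?C ==> norm x <= R" by(auto simp:bounded_pos)
 obtain b :: 'a where b: "b : Basis" using nonempty_Basis by blast
 define y0 where "y0 = (2*R+1) *\<^sub>R b"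
 have ny: "norm y0 = 2*R+1" using b R by(simp add:y0_def)
 have ball: "R < norm y" "norm y <= 3*R+1" if "y : ball y0 R" for y
  using that norm_triangle_ineq2[of y0 y] norm_triangle_ineq2[of y y0] ny by(auto simp:dist_norm norm_minus_commute)
 define c where "c = inverse La*(4*R+1) powr-(?E)"
 have c: "0 < c" using La0 R by(simp add:c_def)
 have [measurable]: "ball y0 R : sets borel" by simp
 define m where "m = c * ms (ball y0 R)"
 have m: "0 < m" using c R content_ball_pos[of R y0] by(simp add:m_def)
 have "en m*em A <= (NM z. en (ind (A \<times> (- D)) z))"
 proof(rule nn_integral_mu_lower)
  fix x assume x: "x : A"
  have "em (ball y0 R) = en (ms (ball y0 R))"
   by(rule emeasure_eq_ennreal_measure) (use emeasure_lborel_ball_finite[of y0 R] in auto)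
  hence "en m = (NL y. en c*ind (ball y0 R) y)"
   using c by(simp add:m_def nn_integral_cmult_indicator ennreal_mult)
  also have "... <= (NL y. ?A A x y)"
  proof(rule nn_integral_mono)
   fix y
   show "en c*ind (ball y0 R) y <= ?A A x y"
   proof(cases "y : ball y0 R")
    case True
    have xR: "norm x <= R" using x R(2) DC by(auto simp:A_def)
    have yD: "y ~: D" using ball(1)[OF True] R(2)[of y] DC by auto
    have "0 < norm (x-y)" using xR ball(1)[OF True] by auto
    moreover have "norm (x-y) <= 4*R+1" using xR ball(2)[OF True] norm_triangle_ineq4[of x y] by linarith
    ultimately have "(4*R+1) powr-(?E) <= norm (x-y) powr-(?E)"
     using sp0 by(intro powr_mono2') auto
    also have "... <= La * k x y" by(rule k_lower)
    finally have "inverse La*(4*R+1) powr-(?E) <= inverse La*(La * k x y)"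
     using La0 by(intro mult_left_mono) auto
    hence "c <= k x y" using La0 by(simp add:c_def mult.assoc[symmetric])
    thus ?thesis using True x yD by(simp add:ennreal_leI)
   qed simp
  qed
  finally show "en m <= (NL y. ?A A x y)" .
 qed measurable
 also have "... = (NM z. 0)" by(rule nn_integral_cong_AE) (use strict in eventually_elim, simp)
 finally have "em A = 0" using m by simp
 hence "AL x. x ~: A" by(intro AE_not_in) (simp add:null_sets_def)
 thus ?thesis by eventually_elim (auto simp:A_def ze_def max_def split:if_splits)
qed

end

section \<open>The four properties\<close>

lemma collar_open:
 fixes C Om :: "'a::euclidean_space set"
 assumes C: "compact C" "C <= Om" "open Om"
 obtains D where "open D" "D \<Subset> Om" "C <= D"
proof(cases "C = {}")
 case True
 thus ?thesis by(intro that[of "{}"]) (auto simp:compactly_contained_def)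
next
 case False
 obtain V l where V: "compact V" "V <= Om" "0 < l" "inside {x. infdist x C < l} V" "C <= {x. infdist x C < l}" "V ~= {}"
  by(rule compact_collar[OF C(1) False C(2,3)])
 have D: "open {x. infdist x C < l}" by(intro open_Collect_less continuous_intros)
 have "closure {x. infdist x C < l} <= V"
  using insideD[OF V(4)] V(1) by(intro closure_minimal compact_imp_closed) auto
 moreover have "bounded {x. infdist x C < l}"
  by(rule bounded_subset[OF compact_imp_bounded[OF V(1)] insideD[OF V(4)]])
 ultimately have "{x. infdist x C < l} \<Subset> Om"
  unfolding compactly_contained_def compact_closure using V(2) by blast
 thus ?thesis using that D V(5) by blast
qed

text \<open>A squeeze: lower semicontinuity bounds the lower limit from below by u x; the essential
  infimum over a ball is at least the infimum over the punctured ball; and \<open>lb\<close> bounds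
  the essential infimum by u x.\<close>

lemma liminf_eq_essliminf:
 fixes u :: "'a::euclidean_space => ereal"
 assumes Om: "open Om" "lower_semicontinuous_on Om u" and x: "x : Om"
  and lb: "!!c r. 0 < r ==> AL y. y : ball x r --> ereal c <= u y ==> ereal c <= u x"
 shows "u x = Liminf (at x) u & Liminf (at x) u = ess_lim_inf u x"
proof -
 define I where "I r = ess_inf_on (ball x r) u" for r
 have I_ge: "c <= I r" if "!!y. y : ball x r ==> y ~= x ==> c <= u y" for c r
 proof -
  have "AE y in lebesgue. y ~= x" by(simp add:AE_completion AE_lborel_singleton)
  hence "AE y in lebesgue. y : ball x r --> c <= u y" by eventually_elim (use that in auto)
  hence "AE y in lebesgue_on (ball x r). c <= u y" by(simp add:AE_restrict_space_iff)
  thus ?thesis unfolding I_def ess_inf_on_def by(rule Liminf_bounded)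
 qed
 have I_le: "I r <= u x" if r: "0 < r" for r
 proof(rule dense_le)
  fix c assume c: "c < I r"
  hence "AE y in lebesgue_on (ball x r). c < u y"
   unfolding I_def ess_inf_on_def by(rule less_LiminfD)
  hence "AE y in lebesgue. y : ball x r --> c < u y" by(simp add:AE_restrict_space_iff)
  hence "AL y. y : ball x r --> c < u y" by(simp only: AE_completion_iff)
  hence "AL y. y : ball x r --> c <= u y" by eventually_elim auto
  thus "c <= u x" using lb[OF r] c by(cases c) auto
 qed
 have near: "EX r>0. ALL y:ball x r. c < u y" if "c < u x" for c
 proof -
  have "open {y:Om. c < u y}" by(rule open_superlevel[OF Om])
  moreover have "x : {y:Om. c < u y}" using that x by simp
  ultimately obtain r where "0 < r" "ball x r <= {y:Om. c < u y}" unfolding open_contains_ball by blast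
  thus ?thesis by auto
 qed
 have 1: "u x <= Liminf (at x) u"
  unfolding le_Liminf_iff
 proof(intro allI impI)
  fix c assume "c < u x"
  then obtain r where "0 < r" "ALL y:ball x r. c < u y" using near by blast
  thus "\<forall>\<^sub>F y in at x. c < u y"
   unfolding eventually_at by(intro exI[of _ r]) (auto simp:dist_commute)
 qed
 have 2: "Liminf (at x) u <= u x"
 proof(rule dense_le)
  fix c assume "c < Liminf (at x) u"
  hence "\<forall>\<^sub>F y in at x. c < u y" by(rule less_LiminfD)
  then obtain r where r: "0 < r" "!!y. y ~= x ==> dist y x < r ==> c < u y" by(auto simp:eventually_at)
  have "c <= I r" by(rule I_ge) (use r(2) in \<open>auto simp:dist_commute less_imp_le\<close>)
  also have "I r <= u x" by(rule I_le[OF r(1)])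
  finally show "c <= u x" .
 qed
 have "(I \<longlongrightarrow> u x) (at_right 0)"
 proof(rule order_tendstoI)
  fix c assume "c < u x"
  then obtain c' where c': "c < c'" "c' < u x" using dense by blast
  then obtain r where r: "0 < r" "ALL y:ball x r. c' < u y" using near by blast
  have "c < I t" if "0 < t" "t < r" for t
  proof -
   have "c' <= I t" by(rule I_ge) (use r that in \<open>auto intro!: less_imp_le\<close>)
   thus ?thesis using c' by simp
  qed
  thus "\<forall>\<^sub>F t in at_right 0. c < I t" using r(1) unfolding eventually_at_right_field by blast
 next
  fix c assume c: "u x < c"
  have "I t < c" if "0 < t" for t using I_le[OF that] c by simp
  thus "\<forall>\<^sub>F t in at_right 0. I t < c" unfolding eventually_at_right_field by(intro exI[of _ 1]) auto
 qed
 hence "ess_lim_inf u x = u x"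
  unfolding ess_lim_inf_def I_def by(intro tendsto_Lim trivial_limit_at_right_real)
 with 1 2 show ?thesis by simp
qed

locale super_version = super s p La k K Om ub for s p La and k K :: "'a::euclidean_space => 'a => real" and Om ub +
 fixes u :: "'a => ereal"
 assumes u_lebesgue: "u : borel_measurable lebesgue" and u_ae: "AL x. u x = ub x"
  and u_eq: "!!x. x : Om ==> ub x = u x" and ne: "Om ~= {}"
begin

abbreviation "f == %x. real_of_ereal (ub x)"

lemma u_real: "AL x. u x = ereal (f x)"
 using u_finite_AE(1)[OF ne] u_ae
proof eventually_elim
 case (elim x)
 thus ?case by(cases "ub x") auto
qed

lemma f_tail: "tail f"
 by(rule u_finite_AE(2)[OF ne])

lemma f_borel [measurable]: "f : Bor"
 by measurable

lemma pointwise_behaviour: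
 assumes "x : Om"
 shows "u x = Liminf (at x) u & Liminf (at x) u = ess_lim_inf u x"
proof(rule liminf_eq_essliminf[OF open_Om _ assms])
 have "{y:Om. c < ub y} = {y:Om. c < u y}" for c using u_eq by auto
 thus "lower_semicontinuous_on Om u" using u_lsc by(simp add:lower_semicontinuous_on_def)
 fix c r :: real assume r: "0 < r" and ae: "AL y. y : ball x r --> ereal c <= u y"
 have "AL y. y : ball x r --> ereal c <= ub y" using ae u_ae by eventually_elim simp
 thus "ereal c <= u x" using lower_bound_AE_imp_pointwise[OF assms r] u_eq[OF assms] by simp
qed

lemma Lq_locI:
 assumes "0 < t" "(1-s*p/real DIM('a))*t < p-1"
 shows "u : Lq_loc t Om"
 unfolding Lq_loc_def Lq_def mem_Collect_eq
proof(intro allI impI conjI)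
 fix D assume D: "open D & D \<Subset> Om"
 show "u : borel_measurable (lebesgue_on D)" by(rule measurable_restrict_space1[OF u_lebesgue])
 have "(\<integral>\<^sup>+x\<in>D. en (f x |^ t) \<partial>lborel) <= (\<integral>\<^sup>+x\<in>closure D. en (f x |^ t) \<partial>lborel)"
  using closure_subset[of D] by(intro nn_integral_mono) (auto split:split_indicator)
 also have "... < infy" using D by(intro powr_integrable assms) (auto simp:compactly_contained_def)
 finally show "(\<integral>\<^sup>+x\<in>D. abs_powr (u x) t \<partial>lebesgue) < infy" unfolding Lq_integral[OF u_real] .
qed

lemma W_locI:
 assumes h: "h < s" and q: "0 < q" "q < p" "(1-s*p/real DIM('a))*q < p-1"
  "(1-s*p/real DIM('a))*(q/(p-q)) < p-1"
 shows "u : W_loc h q Om"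
 unfolding W_loc_def W_def mem_Collect_eq
proof(intro allI impI conjI)
 let ?F = "%z. dl f z |^ q*norm (fst z-snd z) powr-(real DIM('a)+h*q)"
 fix D assume D: "open D & D \<Subset> Om"
 show "u : Lq q D" using Lq_locI[OF q(1,3)] D by(simp add:Lq_loc_def)
 have "(NL z. en (?F z)*ind (D \<times> D) z) <= (NL z. en (?F z)*ind (closure D \<times> closure D) z)"
  using closure_subset[of D] by(intro nn_integral_mono) (auto split:split_indicator)
 also have "... < infy" using D by(intro fractional_seminorm_finite h q) (auto simp:compactly_contained_def)
 finally show "(\<integral>\<^sup>+z\<in>D \<times> D. (case z of (x, y) => abs_powr (u x-u y) q/en (norm (x-y) powr (real DIM('a)+h*q))) \<partial>(lebesgue :: ('a \<times> 'a) measure)) < infy"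
  unfolding W_seminorm_integral[OF u_real] .
qed

text \<open>Half of e is spent on the almost everywhere comparison and half on the continuity of the
  solution at x0. Then u >= v x0 - e almost everywhere near x0, and
  \<open>lower_bound_AE_imp_pointwise\<close> makes this hold at x0.\<close>

lemma unbounded_comparison:
 assumes D: "open D" "D \<Subset> Om" and v: "continuous_weak_solution s p K D v"
  and bd: "!!x. x : frontier D ==> v x <= u x" and off: "AL x. x ~: D --> v x <= u x" and x0: "x0 : D"
 shows "v x0 <= u x0"
proof -
 let ?C = "closure D"
 have C: "compact ?C" "?C <= Om" using D by(auto simp:compactly_contained_def)
 have DC: "D <= ?C" by(rule closure_subset)
 have [measurable]: "?C : sets borel" by simp
 have ws: "weak_solution s p K D v" and vc: "continuous_on ?C v" and vf: "!!x. x : ?C ==> abs (v x) ~= infy"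
  using v by(auto simp:continuous_weak_solution_def)
 have vm: "v : borel_measurable lebesgue" and vfin: "AL x. (abs (v x)) ~= infy"
  using ws by(auto simp:weak_solution_def weak_supersolution_def AE_completion_iff)
 have "(%x. real_of_ereal (v x)) : borel_measurable lebesgue" using vm by measurable
 then obtain g0 where [measurable]: "g0 : Bor" and g0: "AL x. real_of_ereal (v x) = g0 x"
  by(rule lebesgue_borel_version)
 have rc: "continuous_on ?C (%x. real_of_ereal (v x))"
  using vc vf by(simp add:continuous_on_iff_real comp_def)
 define g1 where "g1 x = ind ?C x *\<^sub>R real_of_ereal (v x)" for x
 have [measurable]: "g1 : Bor"
  unfolding g1_def[abs_def] by(rule borel_measurable_continuous_on_indicator[OF _ rc]) simp
 \<comment> \<open>A Borel representative that agrees with \<open>v\<close> at every point of the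
   closure of \<open>D\<close>, where values at points are compared.\<close>
 define g where "g x = (if x : ?C then g1 x else g0 x)" for x
 have gm [measurable]: "g : Bor" unfolding g_def[abs_def] by measurable
 have gv: "v x = ereal (g x)" if "x : ?C" for x
  using vf[OF that] that by(simp add:g_def g1_def ereal_real')
 have vg: "AL x. v x = ereal (g x)"
  using vfin g0
 proof eventually_elim
  case (elim x)
  thus ?case using gv[of x] by(cases "x : ?C") (auto simp:g_def ereal_real')
 qed
 have gc: "continuous_on ?C g"
  by(rule continuous_on_eq[OF rc]) (auto simp:g_def g1_def)
 note sol = weak_solution_borel[OF ws D(1) gm vg]
 have eps: "ereal (g x0) <= ub x0+ereal e" if e: "0 < e" for e
 proof -
  have ae: "AL x. x : D --> g x-e/2 <= f x"
  proof(rule unbounded_comparison_AE[OF D(1) _ C sol gc])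
   show "D ~= {}" using x0 by auto
   show "ereal (g x) <= ub x" if "x : frontier D" for x
   proof -
    have "x : ?C" using that by(simp add:frontier_def)
    thus ?thesis using bd[OF that] gv[of x] u_eq[of x] C(2) by auto
   qed
   show "AL x. x ~: D --> ereal (g x) <= ub x" using off vg u_ae by eventually_elim simp
  qed (use e in auto)
  obtain d where d: "0 < d" "!!y. y : ?C ==> dist y x0 < d ==> dist (g y) (g x0) < e/2"
   using gc x0 DC e unfolding continuous_on_iff by(metis half_gt_zero subsetD)
  obtain r where r: "0 < r" "ball x0 r <= D" using D(1) x0 open_contains_ball by blast
  have "ereal (g x0-e) <= ub x0"
  proof(rule lower_bound_AE_imp_pointwise)
   show "x0 : Om" using x0 DC C by auto
   show "0 < min r d" using r d by simp
   show "AL y. y : ball x0 (min r d) --> ereal (g x0-e) <= ub y"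
    using ae u_finite_AE(1)[OF ne]
   proof eventually_elim
    case (elim y)
    show ?case
    proof
     assume y: "y : ball x0 (min r d)"
     hence yD: "y : D" using r by auto
     have "abs (g y-g x0) < e/2" using d(2)[of y] y yD DC by(auto simp:dist_real_def dist_commute)
     moreover have "g y-e/2 <= f y" using elim yD by simp
     ultimately have "g x0-e <= f y" by linarith
     thus "ereal (g x0-e) <= ub y" using elim by(cases "ub y") auto
    qed
   qed
  qed
  thus ?thesis by(cases "ub x0") auto
 qed
 have "ereal (g x0) <= ub x0" by(rule ereal_le_epsilon2) (use eps in auto)
 moreover have "x0 : ?C" "x0 : Om" using x0 DC C by auto
 ultimately show ?thesis using gv[of x0] u_eq[of x0] by simp
qed

lemma weak_supersolution_of_local:
 assumes loc: "!!C. compact C ==> C ~= {} ==> C <= Om ==> energy C f < infy" "!!C. compact C ==> C <= Om ==> (\<integral>\<^sup>+x\<in>C. en (f x |^ p) \<partial>lborel) < infy"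
 shows "weak_supersolution s p K Om u"
proof(rule weak_supersolutionI[OF u_lebesgue u_real f_tail open_Om _ loc(2)])
 show "energy C f < infy" if "compact C" "C <= Om" for C
  using loc(1)[OF that(1) _ that(2)] by(cases "C = {}") (auto simp:energy_def)
 fix eh assume eh: "eh : test_functions Om" "!!x. 0 <= eh x"
 obtain L S B where L: "compact S" "S <= Om" "!!x. x ~: S ==> eh x = 0" "!!x. (abs (eh x)) <= B" "continuous_on UNIV eh"
  by(rule test_function_lipschitz[OF eh(1)]) blast
 have m: "eh : Bor" by(rule borel_measurable_continuous_onI[OF L(5)])
 show "0 <= (BM z. jp p (dl f z)*dl eh z)"
 proof(cases "S = {}")
  case True
  hence "dl eh z = 0" for z using L(3) by(simp add:dl_def)
  thus ?thesis by simp
 next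
  case False
  obtain V l where V: "compact V" "V <= Om" "0 < l" "inside {x. infdist x S < l} V" "S <= {x. infdist x S < l}" "V ~= {}"
   by(rule compact_collar[OF L(1) False L(2) open_Om])
  show ?thesis
  proof(rule u_supersolution(2)[OF V(1,6,2) loc(1)[OF V(1,6,2)] V(4) m eh(2)])
   show "eh x <= B" for x using L(4)[of x] by simp
   show "eh x = 0" if "x ~: {x. infdist x S < l}" for x using that V(5) by(intro L(3)) auto
   show "energy V eh < infy"
    using V(1) by(intro test_function_energy[OF eh(1)] emeasure_bounded_finite compact_imp_bounded) (simp_all add:borel_compact)
  qed
 qed
qed

text \<open>On a compact set where |u| <= M the function agrees with its truncation at M, whose
  energy is finite by \<open>min_supersolution\<close>.\<close>

lemma weak_supersolution_bounded:
 assumes "locally_bounded Om u"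
 shows "weak_supersolution s p K Om u"
proof(rule weak_supersolution_of_local)
 let ?F = "%C. (\<integral>\<^sup>+x\<in>C. en (f x |^ p) \<partial>lborel)"
 have bnd: "EX M>0. ALL x:C. (abs (f x)) <= M" if C: "compact C" "C <= Om" for C
 proof -
  obtain D where D: "open D" "D \<Subset> Om" "C <= D" by(rule collar_open[OF C open_Om])
  obtain M :: real where M: "ALL x:D. (abs (u x)) <= ereal M" using assms D unfolding locally_bounded_def by blast
  have "abs (f x) <= abs M+1" if "x : C" for x
  proof -
   have "x : D" "x : Om" using that D(3) C(2) by auto
   hence "abs (ub x) <= ereal M" using M u_eq[of x] by simp
   thus ?thesis by(cases "ub x") auto
  qed
  thus ?thesis by(intro exI[of _ "abs M+1"]) auto
 qed
 fix C assume C: "compact C" "C <= Om"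
 obtain M where M: "0 < M" "!!x. x : C ==> abs (f x) <= M" using bnd[OF C] by blast
 have [measurable]: "C : sets borel" using C by(simp add:borel_compact)
 show "energy C f < infy" if "C ~= {}"
 proof -
  have "energy C f <= energy C (%x. min (f x) M)"
  proof(rule energy_contraction)
   fix x y assume xy: "x : C" "y : C"
   have "f x <= M" "f y <= M" using M(2)[OF xy(1)] M(2)[OF xy(2)] by linarith+
   thus "abs (f x-f y) <= abs (min (f x) M-min (f y) M)" by simp
  qed
  also have "... < infy" by(rule min_supersolution(1)[OF M(1) C(1) that C(2)])
  finally show ?thesis .
 qed
 have "?F C <= (NL x. en (M powr p)*ind C x)"
  using M p0 by(intro nn_integral_mono) (auto split:split_indicator intro!: ennreal_leI powr_mono2)
 also have "... < infy"
  using emeasure_bounded_finite[OF compact_imp_bounded[OF C(1)]] by(simp add:nn_integral_cmult_indicator ennreal_mult_less_top)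
 finally show "?F C < infy" .
qed

lemma weak_supersolution_W:
 assumes "u : W_loc s p Om"
 shows "weak_supersolution s p K Om u"
proof(rule weak_supersolution_of_local)
 let ?G = "%C. (\<integral>\<^sup>+x\<in>C. en (f x |^ p) \<partial>lborel)"
 let ?F = "%D. (\<integral>\<^sup>+x\<in>D. en (f x |^ p) \<partial>lborel)"
 fix C assume C: "compact C" "C <= Om"
 obtain D where D: "open D" "D \<Subset> Om" "C <= D" by(rule collar_open[OF C open_Om])
 have W: "u : W s p D" using assms D by(simp add:W_loc_def)
 hence "(\<integral>\<^sup>+x\<in>D. abs_powr (u x) p \<partial>lebesgue) < infy" by(simp add:W_def Lq_def)
 hence "?F D < infy" unfolding Lq_integral[OF u_real] .
 moreover have "?G C <= ?F D"
  using D(3) by(intro nn_integral_mono) (auto split:split_indicator)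
 ultimately show "?G C < infy" by(rule order_le_less_trans[rotated])
 have "(\<integral>\<^sup>+z\<in>D \<times> D. (case z of (x, y) => abs_powr (u x-u y) p/en (norm (x-y) powr (real DIM('a)+s*p))) \<partial>(lebesgue :: ('a \<times> 'a) measure)) < infy"
  using W by(simp add:W_def)
 hence "(NL z. en (dl f z |^ p*norm (fst z-snd z) powr-(real DIM('a)+s*p))*ind (D \<times> D) z) < infy"
  unfolding W_seminorm_integral[OF u_real] .
 hence "energy D f < infy"
  using D by(intro order_le_less_trans[OF energy_le_seminorm(1)]) (auto simp:ennreal_mult_less_top)
 thus "energy C f < infy" using energy_mono[OF D(3), of f] by(rule order_le_less_trans[rotated])
qed

end

text \<open>Integrability is governed by (1 - s p/n) t < p - 1, the fixed point condition of the
  decay iteration; it holds automatically for s p >= n and so covers both cases of the critical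
  exponent. For q < p, the same condition on q/(p-q) amounts to q < n (p-1)/(n-s).\<close>

lemma critical_exponents:
 fixes n s p q t :: real
 assumes par: "0 < s" "s < 1" "1 < p" "1 <= n"
 shows "0 < t ==> ereal t < (if p < n/s then ereal ((p-1)*n/(n-s*p)) else infy) ==> (1-s*p/n)*t < p-1"
  and "0 < q ==> q < min (n*(p-1)/(n-s)) p ==> (1-s*p/n)*q < p-1"
  and "0 < q ==> q < min (n*(p-1)/(n-s)) p ==> (1-s*p/n)*(q/(p-q)) < p-1"
proof -
 have npos: "(1-s*p/n)*r < p-1" if "~ p < n/s" "0 < r" for r
 proof -
  have "n <= s*p" using that par by(simp add:field_simps)
  hence "1-s*p/n <= 0" using par by(simp add:field_simps)
  hence "(1-s*p/n)*r <= 0" using that by(intro mult_nonpos_nonneg) auto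
  thus ?thesis using par by simp
 qed
 show "(1-s*p/n)*t < p-1"
  if t: "0 < t" "ereal t < (if p < n/s then ereal ((p-1)*n/(n-s*p)) else infy)"
 proof(cases "p < n/s")
  case True
  hence "s*p < n" using par by(simp add:field_simps)
  moreover have "t < (p-1)*n/(n-s*p)" using t True by simp
  ultimately have "t*(n-s*p) < (p-1)*n" by(simp add:field_simps)
  thus ?thesis using par by(simp add:field_simps)
 qed (use npos t in auto)
 assume q: "0 < q" "q < min (n*(p-1)/(n-s)) p"
 hence q1: "q*(n-s) < n*(p-1)" and qp: "q < p" using par by(simp_all add:field_simps)
 have "s*q*1 <= s*q*p" using par q by(intro mult_left_mono) auto
 hence "(n-s*p)*q < n*(p-1)" using q1 by(simp add:algebra_simps)
 thus "(1-s*p/n)*q < p-1" using par by(simp add:field_simps)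
 have "p*(q*(n-s)) < p*(n*(p-1))" using q1 par by simp
 hence "(n-s*p)*q < n*(p-1)*(p-q)" by(simp add:algebra_simps)
 thus "(1-s*p/n)*(q/(p-q)) < p-1" using par qp by(simp add:field_simps)
qed


theorem theorem1:
  fixes s p \<Lambda> :: real
    and K :: "'a::euclidean_space \<Rightarrow> 'a \<Rightarrow> real"
    and \<Omega> :: "'a set"
    and u :: "'a \<Rightarrow> ereal"
  assumes "0 < s" and "s < 1" and "1 < p" and "1 \<le> \<Lambda>"
    and "elliptic_kernel s p \<Lambda> K"
    and "open \<Omega>" and "\<Omega> \<noteq> {}"
    and "superharmonic s p K \<Omega> u"
  shows "(\<forall>x\<in>\<Omega>. u x = Liminf (at x) u \<and> Liminf (at x) u = ess_lim_inf u x)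
    \<and> (let n = real DIM('a);
           t_bar = (if p < n / s then ereal ((p - 1) * n / (n - s * p)) else \<infinity>);
           q_bar = min (n * (p - 1) / (n - s)) p
       in \<forall>h t q. 0 < h \<and> h < s \<and> 0 < t \<and> ereal t < t_bar \<and> 0 < q \<and> q < q_bar \<longrightarrow>
            u \<in> W_loc h q \<Omega> \<inter> Lq_loc t \<Omega> \<inter> tail_space s p)
    \<and> (\<forall>D v. open D \<and> D \<Subset> \<Omega> \<and> continuous_weak_solution s p K D v \<and>
          (\<forall>x\<in>frontier D. v x \<le> u x) \<and> (AE x in lebesgue. x \<notin> D \<longrightarrow> v x \<le> u x) \<longrightarrow>
          (\<forall>x\<in>D. v x \<le> u x))
    \<and> (locally_bounded \<Omega> u \<or> u \<in> W_loc s p \<Omega> \<longrightarrow> weak_supersolution s p K \<Omega> u)"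
proof -
 note par = assms(1-4)
 obtain k where k: "frac_kernel s p \<Lambda> k" "AL z. K (fst z) (snd z) = k (fst z) (snd z)"
  by (rule kernel_borel_version[OF assms(5) par])
 have kv: "kernel_version s p \<Lambda> k K"
  unfolding kernel_version_def kernel_version_axioms_def using k by blast
 obtain ub where ub: "comparison s p \<Lambda> k \<Omega> ub" "AL x. u x = ub x" "!!x. x : \<Omega> ==> ub x = u x"
  by (rule kernel_version.superharmonic_comparison[OF kv assms(8,6)]) blast
 have "u : borel_measurable lebesgue" using assms(8) by (simp add: superharmonic_def)
 hence "super_version s p \<Lambda> k K \<Omega> ub u"
  unfolding super_version_def super_version_axioms_def super_def using kv ub assms(7) by blast
 then interpret super_version s p \<Lambda> k K \<Omega> ub u .
 have n: "1 <= real DIM('a)" using DIM_positive[where 'a = 'a] by linarith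
 note ce = critical_exponents[OF par(1-3) n]
 show ?thesis
  unfolding Let_def
 proof (intro conjI ballI allI impI)
  show "u x = Liminf (at x) u" "Liminf (at x) u = ess_lim_inf u x" if "x : \<Omega>" for x
   using pointwise_behaviour[OF that] by auto
  show "u : W_loc h q \<Omega> Int Lq_loc t \<Omega> Int tail_space s p"
   if a: "0 < h & h < s & 0 < t & ereal t < (if p < real DIM('a) / s then ereal ((p - 1) * real DIM('a) / (real DIM('a) - s * p)) else \<infinity>)
    & 0 < q & q < min (real DIM('a) * (p - 1) / (real DIM('a) - s)) p" for h t q
  proof -
   have "u : W_loc h q \<Omega>" using a by (intro W_locI ce) auto
   moreover have "u : Lq_loc t \<Omega>" using a by (intro Lq_locI ce) auto
   moreover have "u : tail_space s p" by (rule tail_spaceI[OF u_lebesgue u_real f_tail])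
   ultimately show ?thesis by simp
  qed
  show "v x <= u x"
   if a: "open D & D \<Subset> \<Omega> & continuous_weak_solution s p K D v & (ALL x:frontier D. v x <= u x) &
    (AE x in lebesgue. x ~: D --> v x <= u x)" and x: "x : D" for D v x
  proof -
   have "AL x. x ~: D --> v x <= u x" using a by (simp only: AE_completion_iff)
   thus ?thesis using a x by (intro unbounded_comparison[of D v x]) auto
  qed
  show "weak_supersolution s p K \<Omega> u" if "locally_bounded \<Omega> u | u : W_loc s p \<Omega>"
   using that weak_supersolution_bounded weak_supersolution_W by blast
 qed
qed

end
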